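(* Let $T\ge2$, data $\tilde y_1,\dots,\tilde y_T\in\mathsf Y$, and a parametric state-space model for $T$ observations with likelihood $\tilde L_T$ be as in the context, and suppose that the MLE Smoothness Assumption of the context holds. Assume that $\tilde L_T$ has a unique maximizer $\tilde\theta_T=\mathrm{argmax}_{\theta\in\Theta}\tilde L_T(\theta)$ and that $\tilde\theta_T$ lies in the interior of $\Theta$. Let $(Y_t)_{t\ge1}$ be the infinite periodic repetition of the data and consider the associated $T$-periodic model and self-organizing model defined in the context, with Markov kernels $(K_t)_{t\ge2}$ that are either the "fast" kernels, or the "slow" kernels with $(t_p)_{p\ge1}$ a sequence in $\{mT+1:m\in\mathbb N\}$. Let $p_{t,\Theta}(d\theta_t|Y_{1:t})$ be the filtering distribution of $\theta_t$ under the self-organizing model. Then $$\lim_{t\to\infty}\int_\Theta\theta_t\,p_{t,\Theta}(d\theta_t|Y_{1:t})=\tilde\theta_T.$$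
   Context: **Setting.** $\mathsf X$ is a Polish space with its Borel $\sigma$-algebra, $\mathsf Y$ a measurable space with reference measure $dy$. $\Theta\subset\mathbb R^d$ is a regular compact set: it is compact and there is a continuous $f:[0,\infty)\to[0,\infty)$ with $f(\epsilon)>0$ for $\epsilon>0$ and $\lim_{x\downarrow0}f(x)=0$ such that for all $\epsilon>0$, $x\in\Theta$ there is $x'\in\Theta$ with $\{u:\|u-x'\|<f(\epsilon)\}\subseteq\{u:\|u-x\|<\epsilon\}\cap\Theta$. **Model for $T$ observations.** For $\theta\in\Theta$: $\tilde X_1\sim\tilde\chi_\theta(dx)=\tilde p_\theta(x)\lambda(dx)$; $\tilde X_s|\tilde X_{s-1}\sim\tilde M_{s,\theta}(\tilde X_{s-1},dx_s)=\tilde m_{s,\theta}(x_s|\tilde X_{s-1})\lambda(dx_s)$ for $s=2,\dots,T$; $\tilde Y_s|\tilde X_s\sim\tilde f_{s,\theta}(y|\tilde X_s)dy$ for $s=1,\dots,T$; here $\lambda$ is a $\sigma$-finite measure on $\mathsf X$. Likelihood: $\tilde L_T(\theta)=\int\tilde\chi_\theta(dx_1)\tilde f_{1,\theta}(\tilde y_1|x_1)\prod_{s=2}^T\tilde f_{s,\theta}(\tilde y_s|x_s)\tilde M_{s,\theta}(x_{s-1},dx_s)$. **MLE Smoothness Assumption.** $\tilde L_T(\theta)>0$ for all $\theta\in\Theta$; $\sup_{\Theta\times\mathsf X}\tilde f_{s,\theta}(\tilde y_s|x)<\infty$ for $s\le T$; and there are a continuous strictly increasing $g':[0,\infty)\to[0,\infty)$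 with $g'(0)=0$ and measurable functions $\varphi'_1,\dots,\varphi'_T$ on $\mathsf X^2$ with $\varphi'_1(x',x)=\varphi'_1(x,x)$ such that: (1) for all $x,x'\in\mathsf X$, $\theta,\theta'\in\Theta$, $s\in\{2,\dots,T\}$, $|\log(\tilde f_{s,\theta}(\tilde y_s|x)\tilde m_{s,\theta}(x|x'))-\log(\tilde f_{s,\theta'}(\tilde y_s|x)\tilde m_{s,\theta'}(x|x'))|\le g'(\|\theta-\theta'\|)\varphi'_s(x',x)$; (2) for all $x,\theta,\theta'$, $|\log(\tilde f_{1,\theta}(\tilde y_1|x)\tilde p_\theta(x))-\log(\tilde f_{1,\theta'}(\tilde y_1|x)\tilde p_{\theta'}(x))|\le g'(\|\theta-\theta'\|)\varphi'_1(x,x)$; (3) there is $\delta>0$ such that for all $\theta\in\Theta$, with the convention $x_{s-1}=x_s$ when $s=1$, $\int_{\mathsf X^T}\exp(\delta\sum_{s=1}^T\varphi'_s(x_{s-1},x_s))\tilde\chi_\theta(dx_1)\tilde f_{1,\theta}(\tilde y_1|x_1)\prod_{s=2}^T\tilde f_{s,\theta}(\tilde y_s|x_s)\tilde M_{s,\theta}(x_{s-1},dx_s)<\infty$. **Cloned data and periodic model.** $Y_{(t-1)T+s}=\tilde y_s$ for $t\ge1$, $s\in\{1,\dots,T\}$; $f_{(t-1)T+s,\theta}=\tilde f_{s,\theta}$; $M_{(t-1)T+s,\theta}(x,\cdot)=\tilde M_{s,\theta}(x,\cdot)$ if $s\ne1$ and $=\tilde\chi_\theta(\cdot)$ if $s=1$;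 $\chi_\theta=\tilde\chi_\theta$. **Self-organizing model.** $\theta_1\sim\pi_1$ (strictly positive Lebesgue density on $\Theta$), $X_1\sim\chi_{\theta_1}$, and for $t\ge1$: $Y_t|(\theta_t,X_t)\sim f_{t,\theta_t}(y|X_t)dy$, $\theta_{t+1}\sim K_{t+1}(\theta_t,\cdot)$, $X_{t+1}|(\theta_{t+1},X_t)\sim M_{t+1,\theta_{t+1}}(X_t,\cdot)$. $p_{t,\Theta}(\cdot|Y_{1:t})$ is the conditional law of $\theta_t$ given that the first $t$ observations equal $Y_{1:t}$. **Kernels.** $\mathrm{TN}_\Theta(m,S)$: Gaussian with mean $m$, covariance $S$ truncated to $\Theta$; $\mathrm{TS}_\Theta(m,S,\nu)$: Student-t with location $m$, scale matrix $S$, $\nu$ degrees of freedom truncated to $\Theta$; both mean $\delta_{\{m\}}$ if $S=0$. $\Sigma$ symmetric positive definite, $(h_t)_{t\ge2}\subset[0,\infty)$. Fast: $K_t(\theta,\cdot)=\mathrm{TN}_\Theta(\theta,h_t^2\Sigma)$ with $h_t=o(t^{-1})$. Slow: $\alpha,\nu>0$, $\Delta,t_1\in\mathbb N$, $t_p=t_{p-1}+\Delta\lceil(\log t_{p-1})^2\rceil$ for $p\ge2$ (with $t_1$, $\Delta$ such that all $t_p\in\{mT+1:m\in\mathbb N\}$); $h_t=\mathcal O(t^{-\alpha})$, $\liminf_pt_p^\alpha h_{t_p}>0$; $K_t(\theta,\cdot)=\mathrm{TS}_\Theta(\theta,h_t^2\Sigma,\nu)$ if $t\in\{t_p\}_{p\ge1}$,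 and $\mathrm{TN}_\Theta(\theta,h_t^2\Sigma)$ otherwise. *)

theory Defs
  imports "HOL-Probability.Probability"
begin

section \<open>State-space models\<close>

text \<open>Law of \<open>(Z\<^sub>1, \<dots>, Z\<^sub>n)\<close> for a Markov chain on the measurable space \<open>S\<close> with initial
  distribution \<open>I\<close> and transition kernels \<open>P s\<close> from time \<open>s - 1\<close> to time \<open>s \<ge> 2\<close>.\<close>

primrec markov_law ::
  "'a measure \<Rightarrow> 'a measure \<Rightarrow> (nat \<Rightarrow> 'a \<Rightarrow> 'a measure) \<Rightarrow> nat \<Rightarrow> (nat \<Rightarrow> 'a) measure" where
  "markov_law S I P 0 = return (\<Pi>\<^sub>M i\<in>{1..0}. S) (\<lambda>_. undefined)"
| "markov_law S I P (Suc n) =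
    markov_law S I P n \<bind>
      (\<lambda>z. distr (if n = 0 then I else P (Suc n) (z n)) (\<Pi>\<^sub>M i\<in>{1..Suc n}. S) (\<lambda>u. z(Suc n := u)))"

text \<open>\<open>g s z\<close> is the density of \<open>Y\<^sub>s\<close> given \<open>Z\<^sub>s = z\<close>.\<close>

definition obs_weight ::
  "(nat \<Rightarrow> 'a \<Rightarrow> 'y \<Rightarrow> real) \<Rightarrow> (nat \<Rightarrow> 'y) \<Rightarrow> nat \<Rightarrow> (nat \<Rightarrow> 'a) \<Rightarrow> ennreal" where
  "obs_weight g y n z = (\<Prod>s\<in>{1..n}. ennreal (g s (z s) (y s)))"

definition ssm_likelihood ::
  "'a measure \<Rightarrow> 'a measure \<Rightarrow> (nat \<Rightarrow> 'a \<Rightarrow> 'a measure) \<Rightarrow> (nat \<Rightarrow> 'a \<Rightarrow> 'y \<Rightarrow> real) \<Rightarrow>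
    (nat \<Rightarrow> 'y) \<Rightarrow> nat \<Rightarrow> ennreal" where
  "ssm_likelihood S I P g y n = (\<integral>\<^sup>+ z. obs_weight g y n z \<partial>markov_law S I P n)"

text \<open>Conditional law of \<open>(Z\<^sub>1, \<dots>, Z\<^sub>n)\<close> given \<open>Y\<^sub>1 = y 1, \<dots>, Y\<^sub>n = y n\<close>. Since the conditioning
  event is usually a null set, this is the version of the conditional law determined by the
  observation densities; see \<open>ssm_posterior_is_conditional_law\<close> below.\<close>

definition ssm_posterior ::
  "'a measure \<Rightarrow> 'a measure \<Rightarrow> (nat \<Rightarrow> 'a \<Rightarrow> 'a measure) \<Rightarrow> (nat \<Rightarrow> 'a \<Rightarrow> 'y \<Rightarrow> real) \<Rightarrow>
    (nat \<Rightarrow> 'y) \<Rightarrow> nat \<Rightarrow> (nat \<Rightarrow> 'a) measure" where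
  "ssm_posterior S I P g y n =
    density (markov_law S I P n) (\<lambda>z. obs_weight g y n z / ssm_likelihood S I P g y n)"

text \<open>Joint law of \<open>(Z\<^sub>1, \<dots>, Z\<^sub>n)\<close> and \<open>(Y\<^sub>1, \<dots>, Y\<^sub>n)\<close>, where \<open>\<mu>\<close> is the reference measure on the
  observation space.\<close>

definition ssm_joint ::
  "'a measure \<Rightarrow> 'a measure \<Rightarrow> (nat \<Rightarrow> 'a \<Rightarrow> 'a measure) \<Rightarrow> 'y measure \<Rightarrow>
    (nat \<Rightarrow> 'a \<Rightarrow> 'y \<Rightarrow> real) \<Rightarrow> nat \<Rightarrow> ((nat \<Rightarrow> 'a) \<times> (nat \<Rightarrow> 'y)) measure" where
  "ssm_joint S I P \<mu> g n =
    markov_law S I P n \<bind>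
      (\<lambda>z. distr (\<Pi>\<^sub>M s\<in>{1..n}. density \<mu> (\<lambda>v. ennreal (g s (z s) v)))
              ((\<Pi>\<^sub>M s\<in>{1..n}. S) \<Otimes>\<^sub>M (\<Pi>\<^sub>M s\<in>{1..n}. \<mu>)) (\<lambda>y. (z, y)))"

lemma markov_law_step_measurable:
  assumes I: "I \<in> space (prob_algebra S)"
    and P: "n \<noteq> 0 \<Longrightarrow> P (Suc n) \<in> S \<rightarrow>\<^sub>M prob_algebra S"
  shows "(\<lambda>z. distr (if n = 0 then I else P (Suc n) (z n)) (\<Pi>\<^sub>M i\<in>{1..Suc n}. S) (\<lambda>u. z(Suc n := u)))
     \<in> (\<Pi>\<^sub>M i\<in>{1..n}. S) \<rightarrow>\<^sub>M prob_algebra (\<Pi>\<^sub>M i\<in>{1..Suc n}. S)"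
proof (rule measurable_distr_prob_space2[where M = S])
  show "(\<lambda>z. if n = 0 then I else P (Suc n) (z n)) \<in> (\<Pi>\<^sub>M i\<in>{1..n}. S) \<rightarrow>\<^sub>M prob_algebra S"
  proof (cases "n = 0")
    case False
    have "(\<lambda>z. z n) \<in> (\<Pi>\<^sub>M i\<in>{1..n}. S) \<rightarrow>\<^sub>M S"
      using False by (intro measurable_component_singleton) auto
    from measurable_compose[OF this P[OF False]] show ?thesis using False by simp
  qed (use I in simp)
  have *: "{1..Suc n} = insert (Suc n) {1..n}" by auto
  show "(\<lambda>(z, u). z(Suc n := u)) \<in> (\<Pi>\<^sub>M i\<in>{1..n}. S) \<Otimes>\<^sub>M S \<rightarrow>\<^sub>M (\<Pi>\<^sub>M i\<in>{1..Suc n}. S)"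
    unfolding * by (rule measurable_add_dim)
qed

lemma markov_law_prob:
  assumes I: "I \<in> space (prob_algebra S)"
    and P: "\<And>s. s \<in> {2..n} \<Longrightarrow> P s \<in> S \<rightarrow>\<^sub>M prob_algebra S"
  shows "markov_law S I P n \<in> space (prob_algebra (\<Pi>\<^sub>M i\<in>{1..n}. S))"
  using P
proof (induction n)
  case 0
  show ?case by (auto simp: space_prob_algebra space_PiM intro!: prob_space_return)
next
  case (Suc n)
  let ?k = "\<lambda>z. distr (if n = 0 then I else P (Suc n) (z n)) (\<Pi>\<^sub>M i\<in>{1..Suc n}. S) (\<lambda>u. z(Suc n := u))"
  have IH: "markov_law S I P n \<in> space (prob_algebra (\<Pi>\<^sub>M i\<in>{1..n}. S))"
    using Suc by auto
  have k: "?k \<in> (\<Pi>\<^sub>M i\<in>{1..n}. S) \<rightarrow>\<^sub>M prob_algebra (\<Pi>\<^sub>M i\<in>{1..Suc n}. S)"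
    by (intro markov_law_step_measurable I Suc.prems) auto
  show ?case
    using prob_space_bind'[OF IH k] sets_bind'[OF IH k] by (simp add: space_prob_algebra)
qed

lemma PiM_density:
  assumes "sigma_finite_measure \<mu>" and J: "finite J"
    and d: "\<And>s. s \<in> J \<Longrightarrow> d s \<in> borel_measurable \<mu>"
    and p: "\<And>s. s \<in> J \<Longrightarrow> prob_space (density \<mu> (d s))"
  shows "(\<Pi>\<^sub>M s\<in>J. density \<mu> (d s)) = density (\<Pi>\<^sub>M s\<in>J. \<mu>) (\<lambda>y. \<Prod>s\<in>J. d s (y s))"
proof -
  interpret sigma_finite_measure \<mu> by fact
  interpret m: product_sigma_finite "\<lambda>_. \<mu>" by standard
  let ?D = "\<lambda>s. if s \<in> J then density \<mu> (d s) else \<mu>"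
  interpret D: product_sigma_finite ?D
    using p by (auto simp: product_sigma_finite_def sigma_finite_measure_axioms
        intro!: prob_space_imp_sigma_finite)
  have eq: "(\<Pi>\<^sub>M s\<in>J. density \<mu> (d s)) = (\<Pi>\<^sub>M s\<in>J. ?D s)"
    by (intro PiM_cong) auto
  have meas: "(\<lambda>y. \<Prod>s\<in>J. d s (y s)) \<in> borel_measurable (\<Pi>\<^sub>M s\<in>J. \<mu>)"
    by (intro borel_measurable_prod_ennreal measurable_compose[OF measurable_component_singleton]) (auto intro: d)
  have "density (\<Pi>\<^sub>M s\<in>J. \<mu>) (\<lambda>y. \<Prod>s\<in>J. d s (y s)) = (\<Pi>\<^sub>M s\<in>J. ?D s)"
  proof (rule D.PiM_eqI[OF J])
    show "sets (density (\<Pi>\<^sub>M s\<in>J. \<mu>) (\<lambda>y. \<Prod>s\<in>J. d s (y s))) = sets (\<Pi>\<^sub>M s\<in>J. ?D s)"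
      by (simp, intro sets_PiM_cong) auto
    fix A assume A: "\<And>i. i \<in> J \<Longrightarrow> A i \<in> sets (?D i)"
    then have A': "\<And>i. i \<in> J \<Longrightarrow> A i \<in> sets \<mu>" by simp
    have "emeasure (density (\<Pi>\<^sub>M s\<in>J. \<mu>) (\<lambda>y. \<Prod>s\<in>J. d s (y s))) (Pi\<^sub>E J A) =
        (\<integral>\<^sup>+ y. (\<Prod>s\<in>J. d s (y s)) * indicator (Pi\<^sub>E J A) y \<partial>(\<Pi>\<^sub>M s\<in>J. \<mu>))"
      using A' J by (intro emeasure_density meas sets_PiM_I_finite) auto
    also have "\<dots> = (\<integral>\<^sup>+ y. (\<Prod>s\<in>J. d s (y s) * indicator (A s) (y s)) \<partial>(\<Pi>\<^sub>M s\<in>J. \<mu>))"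
    proof (intro nn_integral_cong)
      fix y assume "y \<in> space (\<Pi>\<^sub>M s\<in>J. \<mu>)"
      then have "indicator (Pi\<^sub>E J A) y = (\<Prod>s\<in>J. indicator (A s) (y s) :: ennreal)"
        using J by (auto simp: space_PiM PiE_iff indicator_def prod_zero_iff)
      then show "(\<Prod>s\<in>J. d s (y s)) * indicator (Pi\<^sub>E J A) y = (\<Prod>s\<in>J. d s (y s) * indicator (A s) (y s))"
        by (simp add: prod.distrib)
    qed
    also have "\<dots> = (\<Prod>s\<in>J. \<integral>\<^sup>+ v. d s v * indicator (A s) v \<partial>\<mu>)"
      using d A' J by (intro m.product_nn_integral_prod) auto
    also have "\<dots> = (\<Prod>s\<in>J. emeasure (?D s) (A s))"
      using d A' by (intro prod.cong) (auto simp: emeasure_density)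
    finally show "emeasure (density (\<Pi>\<^sub>M s\<in>J. \<mu>) (\<lambda>y. \<Prod>s\<in>J. d s (y s))) (Pi\<^sub>E J A) =
      (\<Prod>s\<in>J. emeasure (?D s) (A s))" .
  qed
  with eq show ?thesis by simp
qed

text \<open>The posterior disintegrates the joint law with respect to the observations. The second claim says
  that \<open>ssm_likelihood\<close> is the density of the observations.\<close>

lemma ssm_posterior_is_conditional_law:
  assumes \<mu>: "sigma_finite_measure \<mu>"
    and I: "I \<in> space (prob_algebra S)"
    and P: "\<And>s. s \<in> {2..n} \<Longrightarrow> P s \<in> S \<rightarrow>\<^sub>M prob_algebra S"
    and g: "\<And>s. s \<in> {1..n} \<Longrightarrow> (\<lambda>(z, y). g s z y) \<in> borel_measurable (S \<Otimes>\<^sub>M \<mu>)"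
    and gp: "\<And>s z. s \<in> {1..n} \<Longrightarrow> z \<in> space S \<Longrightarrow> prob_space (density \<mu> (\<lambda>y. ennreal (g s z y)))"
    and A: "A \<in> sets (\<Pi>\<^sub>M s\<in>{1..n}. S)" and B: "B \<in> sets (\<Pi>\<^sub>M s\<in>{1..n}. \<mu>)"
  shows "emeasure (ssm_joint S I P \<mu> g n) (A \<times> B) =
    (\<integral>\<^sup>+ y\<in>B. emeasure (ssm_posterior S I P g y n) A * ssm_likelihood S I P g y n \<partial>(\<Pi>\<^sub>M s\<in>{1..n}. \<mu>))"
    and "emeasure (ssm_joint S I P \<mu> g n) (space (\<Pi>\<^sub>M s\<in>{1..n}. S) \<times> B) =
    (\<integral>\<^sup>+ y\<in>B. ssm_likelihood S I P g y n \<partial>(\<Pi>\<^sub>M s\<in>{1..n}. \<mu>))"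
proof -
  note One_nat_def [simp del]
  let ?J = "{1..n}"
  let ?Z = "\<Pi>\<^sub>M s\<in>?J. S" and ?Y = "\<Pi>\<^sub>M s\<in>?J. \<mu>"
  let ?L = "markov_law S I P n"
  let ?w = "\<lambda>z y. obs_weight g y n z"
  interpret sigma_finite_measure \<mu> by fact
  interpret m: product_sigma_finite "\<lambda>_. \<mu>" by standard
  interpret Y: sigma_finite_measure ?Y by (rule m.sigma_finite) simp
  have L: "?L \<in> space (prob_algebra ?Z)" by (rule markov_law_prob[OF I P])
  then have setsL[measurable_cong]: "sets ?L = sets ?Z" and pL: "prob_space ?L"
    by (auto simp: space_prob_algebra)
  interpret L: prob_space ?L by fact
  interpret LY: pair_sigma_finite ?L ?Y ..
  have w1: "(\<lambda>x. ennreal (g s (fst x s) (snd x s))) \<in> borel_measurable (?Z \<Otimes>\<^sub>M ?Y)" if "s \<in> ?J" for s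
  proof -
    have "(\<lambda>x. (fst x s, snd x s)) \<in> ?Z \<Otimes>\<^sub>M ?Y \<rightarrow>\<^sub>M S \<Otimes>\<^sub>M \<mu>"
      using that by (intro measurable_Pair measurable_compose[OF measurable_fst]
          measurable_compose[OF measurable_snd] measurable_component_singleton) auto
    from measurable_compose[OF this g[OF that]] show ?thesis by simp
  qed
  have w[measurable]: "(\<lambda>x. ?w (fst x) (snd x)) \<in> borel_measurable (?Z \<Otimes>\<^sub>M ?Y)"
    unfolding obs_weight_def by (intro borel_measurable_prod_ennreal w1)
  have w'[measurable]: "(\<lambda>(z, y). ?w z y) \<in> borel_measurable (?Z \<Otimes>\<^sub>M ?Y)"
    using w by (simp add: case_prod_beta')
  have wy: "(\<lambda>z. ?w z y) \<in> borel_measurable ?Z" if "y \<in> space ?Y" for y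
    using measurable_compose[OF measurable_Pair2'[OF that] w] by simp
  have wz: "?w z \<in> borel_measurable ?Y" if "z \<in> space ?Z" for z
    using measurable_compose[OF measurable_Pair1'[OF that] w] by simp
  have gs: "(\<lambda>v. ennreal (g s u v)) \<in> borel_measurable \<mu>" if "s \<in> ?J" "u \<in> space S" for s u
    using measurable_compose[OF measurable_Pair1'[OF that(2)] g[OF that(1)]] by simp
  have dens: "(\<Pi>\<^sub>M s\<in>?J. density \<mu> (\<lambda>v. ennreal (g s (z s) v))) = density ?Y (?w z)"
    if "z \<in> space ?Z" for z
    unfolding obs_weight_def
    using that by (intro PiM_density \<mu> gs gp) (auto simp: space_PiM)
  have pdens: "prob_space (density ?Y (?w z))" if "z \<in> space ?Z" for z
    unfolding dens[OF that, symmetric]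
    using that by (intro prob_space_PiM gp) (auto simp: space_PiM)
  have kern: "(\<lambda>z. density ?Y (?w z)) \<in> ?Z \<rightarrow>\<^sub>M prob_algebra ?Y"
  proof (rule measurable_prob_algebraI[OF pdens], assumption, rule measurable_subprob_algebra)
    fix z assume z: "z \<in> space ?Z"
    show "subprob_space (density ?Y (?w z))" by (intro prob_space_imp_subprob_space pdens z)
    show "sets (density ?Y (?w z)) = sets ?Y" by simp
  next
    fix C assume [measurable]: "C \<in> sets ?Y"
    have "(\<lambda>z. \<integral>\<^sup>+ y. ?w z y * indicator C y \<partial>?Y) \<in> borel_measurable ?Z"
      by measurable
    then show "(\<lambda>z. emeasure (density ?Y (?w z)) C) \<in> borel_measurable ?Z"
      by (subst measurable_cong[where g = "\<lambda>z. \<integral>\<^sup>+ y. ?w z y * indicator C y \<partial>?Y"])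
         (auto intro!: emeasure_density wz)
  qed
  let ?k = "\<lambda>z. distr (density ?Y (?w z)) (?Z \<Otimes>\<^sub>M ?Y) (\<lambda>y. (z, y))"
  have k: "?k \<in> ?Z \<rightarrow>\<^sub>M prob_algebra (?Z \<Otimes>\<^sub>M ?Y)"
    by (rule measurable_distr_prob_space2[OF kern]) simp
  have joint: "ssm_joint S I P \<mu> g n = ?L \<bind> ?k"
    unfolding ssm_joint_def
    by (intro bind_cong refl)
       (simp add: dens sets_eq_imp_space_eq[OF setsL])
  have rect: "emeasure (ssm_joint S I P \<mu> g n) (C \<times> B) =
      (\<integral>\<^sup>+ y\<in>B. (\<integral>\<^sup>+ z. ?w z y * indicator C z \<partial>?L) \<partial>?Y)" if [measurable]: "C \<in> sets ?Z" for C
  proof -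
    note [measurable] = B
    have "emeasure (ssm_joint S I P \<mu> g n) (C \<times> B) = (\<integral>\<^sup>+ z. emeasure (?k z) (C \<times> B) \<partial>?L)"
      unfolding joint by (rule emeasure_bind_prob_algebra[OF L k]) (intro pair_measureI that B)
    also have "\<dots> = (\<integral>\<^sup>+ z. \<integral>\<^sup>+ y. ?w z y * indicator C z * indicator B y \<partial>?Y \<partial>?L)"
    proof (intro nn_integral_cong)
      fix z assume "z \<in> space ?L"
      then have z: "z \<in> space ?Z" using sets_eq_imp_space_eq[OF setsL] by simp
      have "emeasure (?k z) (C \<times> B) = emeasure (density ?Y (?w z)) ((\<lambda>y. (z, y)) -` (C \<times> B) \<inter> space ?Y)"
        using z by (subst emeasure_distr) (auto intro: pair_measureI[OF that B])
      also have "(\<lambda>y. (z, y)) -` (C \<times> B) \<inter> space ?Y = (if z \<in> C then B else {})"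
        using sets.sets_into_space[OF B] by auto
      also have "emeasure (density ?Y (?w z)) \<dots> = (\<integral>\<^sup>+ y. ?w z y * indicator C z * indicator B y \<partial>?Y)"
        using wz[OF z] B by (auto simp: emeasure_density)
      finally show "emeasure (?k z) (C \<times> B) = \<dots>" .
    qed
    also have "\<dots> = (\<integral>\<^sup>+ y. \<integral>\<^sup>+ z. ?w z y * indicator C z * indicator B y \<partial>?L \<partial>?Y)"
      by (intro LY.Fubini'[symmetric]) measurable
    also have "\<dots> = (\<integral>\<^sup>+ y\<in>B. (\<integral>\<^sup>+ z. ?w z y * indicator C z \<partial>?L) \<partial>?Y)"
    proof (intro nn_integral_cong)
      fix y assume y: "y \<in> space ?Y"
      have [measurable]: "(\<lambda>z. ?w z y) \<in> borel_measurable ?L"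
        using wy[OF y] setsL by (simp cong: measurable_cong_sets)
      show "(\<integral>\<^sup>+ z. ?w z y * indicator C z * indicator B y \<partial>?L) =
          (\<integral>\<^sup>+ z. ?w z y * indicator C z \<partial>?L) * indicator B y"
        by (rule nn_integral_multc) measurable
    qed
    finally show ?thesis .
  qed
  have lik: "ssm_likelihood S I P g y n = (\<integral>\<^sup>+ z. ?w z y * indicator (space ?Z) z \<partial>?L)" for y
    unfolding ssm_likelihood_def
    by (intro nn_integral_cong) (simp add: sets_eq_imp_space_eq[OF setsL])
  show marg: "emeasure (ssm_joint S I P \<mu> g n) (space ?Z \<times> B) =
    (\<integral>\<^sup>+ y\<in>B. ssm_likelihood S I P g y n \<partial>?Y)"
    unfolding lik by (rule rect) simp
  have lm[measurable]: "(\<lambda>y. ssm_likelihood S I P g y n) \<in> borel_measurable ?Y"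
  proof -
    have "(\<lambda>(y, z). ?w z y) \<in> borel_measurable (?Y \<Otimes>\<^sub>M ?L)"
      using w by measurable
    then show ?thesis unfolding ssm_likelihood_def
      by (rule L.borel_measurable_nn_integral)
  qed
  have total: "(\<integral>\<^sup>+ y. ssm_likelihood S I P g y n \<partial>?Y) = 1"
  proof -
    have "(\<integral>\<^sup>+ y. ssm_likelihood S I P g y n \<partial>?Y) = (\<integral>\<^sup>+ z. \<integral>\<^sup>+ y. ?w z y \<partial>?Y \<partial>?L)"
      unfolding ssm_likelihood_def by (intro LY.Fubini') measurable
    also have "\<dots> = (\<integral>\<^sup>+ z. 1 \<partial>?L)"
    proof (intro nn_integral_cong)
      fix z assume "z \<in> space ?L"
      then have z: "z \<in> space ?Z" using sets_eq_imp_space_eq[OF setsL] by simp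
      have "(\<integral>\<^sup>+ y. ?w z y \<partial>?Y) = emeasure (density ?Y (?w z)) (space ?Y)"
        using wz[OF z] by (subst emeasure_density) (auto intro!: nn_integral_cong)
      then show "(\<integral>\<^sup>+ y. ?w z y \<partial>?Y) = 1"
        using prob_space.emeasure_space_1[OF pdens[OF z]] by simp
    qed
    finally show ?thesis by (simp add: L.emeasure_space_1)
  qed
  have fin: "AE y in ?Y. y \<in> space ?Y \<and> ssm_likelihood S I P g y n \<noteq> \<infinity>"
    using nn_integral_noteq_infinite[OF lm] by (auto simp: total intro: AE_space)
  have "emeasure (ssm_joint S I P \<mu> g n) (A \<times> B) =
      (\<integral>\<^sup>+ y\<in>B. (\<integral>\<^sup>+ z. ?w z y * indicator A z \<partial>?L) \<partial>?Y)"
    by (rule rect[OF A])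
  also have "\<dots> = (\<integral>\<^sup>+ y\<in>B. emeasure (ssm_posterior S I P g y n) A * ssm_likelihood S I P g y n \<partial>?Y)"
  proof (rule nn_integral_cong_AE, use fin in eventually_elim)
    fix y assume "y \<in> space ?Y \<and> ssm_likelihood S I P g y n \<noteq> \<infinity>"
    then have ae: "y \<in> space ?Y" "ssm_likelihood S I P g y n \<noteq> \<infinity>" by auto
    let ?c = "ssm_likelihood S I P g y n"
    have [measurable]: "(\<lambda>z. ?w z y) \<in> borel_measurable ?L"
      using wy[OF ae(1)] setsL by (simp cong: measurable_cong_sets)
    have [measurable]: "A \<in> sets ?L" using A setsL by simp
    have post: "emeasure (ssm_posterior S I P g y n) A = (\<integral>\<^sup>+ z. ?w z y / ?c * indicator A z \<partial>?L)"
      unfolding ssm_posterior_def by (intro emeasure_density) measurable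
    have "emeasure (ssm_posterior S I P g y n) A * ?c = (\<integral>\<^sup>+ z. ?w z y * indicator A z \<partial>?L)"
    proof (cases "?c = 0")
      case True
      have "(\<integral>\<^sup>+ z. ?w z y * indicator A z \<partial>?L) \<le> ?c"
        unfolding ssm_likelihood_def by (intro nn_integral_mono) (auto simp: indicator_def)
      then show ?thesis using True by simp
    next
      case False
      have "emeasure (ssm_posterior S I P g y n) A * ?c =
          (\<integral>\<^sup>+ z. ?w z y / ?c * indicator A z * ?c \<partial>?L)"
        unfolding post by (intro nn_integral_multc[symmetric]) measurable
      also have "\<dots> = (\<integral>\<^sup>+ z. ?w z y * indicator A z \<partial>?L)"
      proof (intro nn_integral_cong)
        fix z
        have "?w z y / ?c * ?c = ?w z y"
          using False ae(2) by (simp add: ennreal_divide_times less_top ennreal_divide_self mult_divide_eq_ennreal)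
        then show "?w z y / ?c * indicator A z * ?c = ?w z y * indicator A z"
          by (simp add: indicator_def)
      qed
      finally show ?thesis .
    qed
    then show "(\<integral>\<^sup>+ z. ?w z y * indicator A z \<partial>?L) * indicator B y =
        emeasure (ssm_posterior S I P g y n) A * ?c * indicator B y" by simp
  qed
  finally show "emeasure (ssm_joint S I P \<mu> g n) (A \<times> B) =
      (\<integral>\<^sup>+ y\<in>B. emeasure (ssm_posterior S I P g y n) A * ssm_likelihood S I P g y n \<partial>?Y)" .
qed

section \<open>Truncated Gaussian and Student distributions\<close>

definition spd_matrix :: "real ^ 'd ^ 'd \<Rightarrow> bool" where
  "spd_matrix S \<longleftrightarrow> transpose S = S \<and> (\<forall>v. v \<noteq> 0 \<longrightarrow> v \<bullet> (S *v v) > 0)"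

definition mvn_density :: "real ^ 'd \<Rightarrow> real ^ 'd ^ 'd \<Rightarrow> real ^ 'd \<Rightarrow> real" where
  "mvn_density m S u =
    exp (- ((u - m) \<bullet> (matrix_inv S *v (u - m))) / 2) / sqrt ((2 * pi) ^ CARD('d) * det S)"

definition mvt_density :: "real ^ 'd \<Rightarrow> real ^ 'd ^ 'd \<Rightarrow> real \<Rightarrow> real ^ 'd \<Rightarrow> real" where
  "mvt_density m S \<nu> u =
    Gamma ((\<nu> + CARD('d)) / 2) / (Gamma (\<nu> / 2) * sqrt ((\<nu> * pi) ^ CARD('d) * det S)) *
    (1 + ((u - m) \<bullet> (matrix_inv S *v (u - m))) / \<nu>) powr (- (\<nu> + CARD('d)) / 2)"

definition truncate_to :: "'a set \<Rightarrow> 'a measure \<Rightarrow> 'a measure" where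
  "truncate_to A D = restrict_space (uniform_measure D A) A"

definition TN :: "(real ^ 'd) set \<Rightarrow> real ^ 'd \<Rightarrow> real ^ 'd ^ 'd \<Rightarrow> (real ^ 'd) measure" where
  "TN \<Theta> m S =
    (if S = 0 then return (restrict_space borel \<Theta>) m
     else truncate_to \<Theta> (density lborel (\<lambda>u. ennreal (mvn_density m S u))))"

definition TS :: "(real ^ 'd) set \<Rightarrow> real ^ 'd \<Rightarrow> real ^ 'd ^ 'd \<Rightarrow> real \<Rightarrow> (real ^ 'd) measure" where
  "TS \<Theta> m S \<nu> =
    (if S = 0 then return (restrict_space borel \<Theta>) m
     else truncate_to \<Theta> (density lborel (\<lambda>u. ennreal (mvt_density m S \<nu> u))))"

section \<open>The model for \<open>T\<close> observations\<close>

definition regular_compact :: "(real ^ 'd) set \<Rightarrow> bool" where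
  "regular_compact \<Theta> \<longleftrightarrow> compact \<Theta> \<and>
    (\<exists>f :: real \<Rightarrow> real. continuous_on {0..} f \<and> (\<forall>\<epsilon>\<ge>0. f \<epsilon> \<ge> 0) \<and> (\<forall>\<epsilon>>0. f \<epsilon> > 0) \<and>
      (f \<longlongrightarrow> 0) (at_right 0) \<and>
      (\<forall>\<epsilon>>0. \<forall>x\<in>\<Theta>. \<exists>x'\<in>\<Theta>. {u. norm (u - x') < f \<epsilon>} \<subseteq> {u. norm (u - x) < \<epsilon>} \<inter> \<Theta>))"

text \<open>Argument order: \<open>m s \<theta> x' x\<close> stands for \<open>m\<^sub>s\<^sub>,\<^sub>\<theta>(x | x')\<close> and \<open>f s \<theta> x y\<close> for \<open>f\<^sub>s\<^sub>,\<^sub>\<theta>(y | x)\<close>.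
  The densities matter only for \<open>\<theta> \<in> \<Theta>\<close>, hence the use of \<open>restrict_space borel \<Theta>\<close>; joint
  measurability in the parameter is what makes \<open>\<theta>\<close> usable as a random variable later on.\<close>

definition init_law :: "'x measure \<Rightarrow> ('t \<Rightarrow> 'x \<Rightarrow> real) \<Rightarrow> 't \<Rightarrow> 'x measure" where
  "init_law L p \<theta> = density L (\<lambda>x. ennreal (p \<theta> x))"

definition trans_kernel ::
  "'x measure \<Rightarrow> (nat \<Rightarrow> 't \<Rightarrow> 'x \<Rightarrow> 'x \<Rightarrow> real) \<Rightarrow> nat \<Rightarrow> 't \<Rightarrow> 'x \<Rightarrow> 'x measure" where
  "trans_kernel L m s \<theta> x' = density L (\<lambda>x. ennreal (m s \<theta> x' x))"

definition state_space_model ::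
  "nat \<Rightarrow> (real ^ 'd) set \<Rightarrow> 'x::polish_space measure \<Rightarrow> 'y measure \<Rightarrow>
    (real ^ 'd \<Rightarrow> 'x \<Rightarrow> real) \<Rightarrow> (nat \<Rightarrow> real ^ 'd \<Rightarrow> 'x \<Rightarrow> 'x \<Rightarrow> real) \<Rightarrow>
    (nat \<Rightarrow> real ^ 'd \<Rightarrow> 'x \<Rightarrow> 'y \<Rightarrow> real) \<Rightarrow> bool" where
  "state_space_model T \<Theta> L \<mu> p m f \<longleftrightarrow>
    sets L = sets borel \<and> sigma_finite_measure L \<and>
    (\<lambda>(\<theta>, x). p \<theta> x) \<in> borel_measurable (restrict_space borel \<Theta> \<Otimes>\<^sub>M borel) \<and>
    (\<forall>\<theta>\<in>\<Theta>. (\<forall>x. p \<theta> x \<ge> 0) \<and> prob_space (init_law L p \<theta>)) \<and>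
    (\<forall>s\<in>{2..T}.
      (\<lambda>(\<theta>, x', x). m s \<theta> x' x) \<in> borel_measurable (restrict_space borel \<Theta> \<Otimes>\<^sub>M borel \<Otimes>\<^sub>M borel) \<and>
      (\<forall>\<theta>\<in>\<Theta>. \<forall>x'. (\<forall>x. m s \<theta> x' x \<ge> 0) \<and> prob_space (trans_kernel L m s \<theta> x'))) \<and>
    (\<forall>s\<in>{1..T}.
      (\<lambda>(\<theta>, x, y). f s \<theta> x y) \<in> borel_measurable (restrict_space borel \<Theta> \<Otimes>\<^sub>M borel \<Otimes>\<^sub>M \<mu>) \<and>
      (\<forall>\<theta>\<in>\<Theta>. \<forall>x. (\<forall>y\<in>space \<mu>. f s \<theta> x y \<ge> 0) \<and>
        prob_space (density \<mu> (\<lambda>y. ennreal (f s \<theta> x y)))))"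

definition likelihood ::
  "nat \<Rightarrow> 'x::polish_space measure \<Rightarrow> ('t \<Rightarrow> 'x \<Rightarrow> real) \<Rightarrow> (nat \<Rightarrow> 't \<Rightarrow> 'x \<Rightarrow> 'x \<Rightarrow> real) \<Rightarrow>
    (nat \<Rightarrow> 't \<Rightarrow> 'x \<Rightarrow> 'y \<Rightarrow> real) \<Rightarrow> (nat \<Rightarrow> 'y) \<Rightarrow> 't \<Rightarrow> ennreal" where
  "likelihood T L p m f yt \<theta> =
    ssm_likelihood borel (init_law L p \<theta>) (\<lambda>s. trans_kernel L m s \<theta>) (\<lambda>s. f s \<theta>) yt T"

section \<open>Smoothness of the likelihood\<close>

text \<open>\<open>\<bar>log a - log b\<bar>\<close> for \<open>a, b \<ge> 0\<close>, with \<open>log 0 = -\<infinity>\<close> and the convention that it is \<open>0\<close> if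
  \<open>a = b = 0\<close>. (Using \<open>ln\<close> directly would be wrong: \<open>ln 0 = 0\<close> in HOL.)\<close>

definition log_dist :: "real \<Rightarrow> real \<Rightarrow> ereal" where
  "log_dist a b =
    (if a = 0 \<and> b = 0 then 0 else if a = 0 \<or> b = 0 then \<infinity> else ereal \<bar>ln a - ln b\<bar>)"

definition mle_smooth ::
  "nat \<Rightarrow> (real ^ 'd) set \<Rightarrow> 'x::polish_space measure \<Rightarrow> (real ^ 'd \<Rightarrow> 'x \<Rightarrow> real) \<Rightarrow>
    (nat \<Rightarrow> real ^ 'd \<Rightarrow> 'x \<Rightarrow> 'x \<Rightarrow> real) \<Rightarrow> (nat \<Rightarrow> real ^ 'd \<Rightarrow> 'x \<Rightarrow> 'y \<Rightarrow> real) \<Rightarrow>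
    (nat \<Rightarrow> 'y) \<Rightarrow> bool" where
  "mle_smooth T \<Theta> L p m f yt \<longleftrightarrow>
    (\<forall>\<theta>\<in>\<Theta>. likelihood T L p m f yt \<theta> > 0) \<and>
    (\<forall>s\<in>{1..T}. bdd_above ((\<lambda>(\<theta>, x). f s \<theta> x (yt s)) ` (\<Theta> \<times> UNIV))) \<and>
    (\<exists>(g :: real \<Rightarrow> real) (\<phi> :: nat \<Rightarrow> 'x \<times> 'x \<Rightarrow> real).
      continuous_on {0..} g \<and> strict_mono_on {0..} g \<and> g 0 = 0 \<and>
      (\<forall>s\<in>{1..T}. \<phi> s \<in> borel_measurable (borel \<Otimes>\<^sub>M borel)) \<and>
      (\<forall>x' x. \<phi> 1 (x', x) = \<phi> 1 (x, x)) \<and>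
      (\<forall>x x'. \<forall>\<theta>\<in>\<Theta>. \<forall>\<theta>'\<in>\<Theta>. \<forall>s\<in>{2..T}.
        log_dist (f s \<theta> x (yt s) * m s \<theta> x' x) (f s \<theta>' x (yt s) * m s \<theta>' x' x)
          \<le> ereal (g (norm (\<theta> - \<theta>')) * \<phi> s (x', x))) \<and>
      (\<forall>x. \<forall>\<theta>\<in>\<Theta>. \<forall>\<theta>'\<in>\<Theta>.
        log_dist (f 1 \<theta> x (yt 1) * p \<theta> x) (f 1 \<theta>' x (yt 1) * p \<theta>' x)
          \<le> ereal (g (norm (\<theta> - \<theta>')) * \<phi> 1 (x, x))) \<and>
      (\<exists>\<delta>>0. \<forall>\<theta>\<in>\<Theta>.
        (\<integral>\<^sup>+ x. ennreal (exp (\<delta> * (\<Sum>s\<in>{1..T}. \<phi> s (if s = 1 then x s else x (s - 1), x s)))) *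
                obs_weight (\<lambda>s. f s \<theta>) yt T x
           \<partial>markov_law borel (init_law L p \<theta>) (\<lambda>s. trans_kernel L m s \<theta>) T) < \<infinity>))"

section \<open>Cloned data, periodic model and self-organizing model\<close>

definition phase :: "nat \<Rightarrow> nat \<Rightarrow> nat" where
  "phase T t = (t - 1) mod T + 1"

definition cloned :: "nat \<Rightarrow> (nat \<Rightarrow> 'a) \<Rightarrow> nat \<Rightarrow> 'a" where
  "cloned T a t = a (phase T t)"

definition periodic_kernel ::
  "nat \<Rightarrow> 'x measure \<Rightarrow> ('t \<Rightarrow> 'x \<Rightarrow> real) \<Rightarrow> (nat \<Rightarrow> 't \<Rightarrow> 'x \<Rightarrow> 'x \<Rightarrow> real) \<Rightarrow>
    nat \<Rightarrow> 't \<Rightarrow> 'x \<Rightarrow> 'x measure" where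
  "periodic_kernel T L p m t \<theta> x =
    (if phase T t = 1 then init_law L p \<theta> else trans_kernel L m (phase T t) \<theta> x)"

definition positive_density_on :: "(real ^ 'd) set \<Rightarrow> (real ^ 'd) measure \<Rightarrow> bool" where
  "positive_density_on \<Theta> \<pi> \<longleftrightarrow>
    (\<exists>q \<in> borel_measurable (restrict_space borel \<Theta>).
      (\<forall>\<theta>\<in>\<Theta>. q \<theta> > (0::real)) \<and> \<pi> = density (restrict_space lborel \<Theta>) (\<lambda>\<theta>. ennreal (q \<theta>)))"

text \<open>The self-organizing model is the state-space model with state \<open>(\<theta>\<^sub>t, X\<^sub>t)\<close>.\<close>

definition so_space :: "(real ^ 'd) set \<Rightarrow> ((real ^ 'd) \<times> 'x::polish_space) measure" where
  "so_space \<Theta> = restrict_space borel \<Theta> \<Otimes>\<^sub>M borel"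

definition so_init ::
  "(real ^ 'd) set \<Rightarrow> (real ^ 'd) measure \<Rightarrow> (real ^ 'd \<Rightarrow> 'x::polish_space measure) \<Rightarrow>
    ((real ^ 'd) \<times> 'x) measure" where
  "so_init \<Theta> \<pi> init = \<pi> \<bind> (\<lambda>\<theta>. distr (init \<theta>) (so_space \<Theta>) (\<lambda>x. (\<theta>, x)))"

definition so_kernel ::
  "(real ^ 'd) set \<Rightarrow> (nat \<Rightarrow> real ^ 'd \<Rightarrow> (real ^ 'd) measure) \<Rightarrow>
    (nat \<Rightarrow> real ^ 'd \<Rightarrow> 'x::polish_space \<Rightarrow> 'x measure) \<Rightarrow>
    nat \<Rightarrow> (real ^ 'd) \<times> 'x \<Rightarrow> ((real ^ 'd) \<times> 'x) measure" where
  "so_kernel \<Theta> K M t = (\<lambda>(\<theta>, x).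
    K t \<theta> \<bind> (\<lambda>\<theta>'. distr (M t \<theta>' x) (so_space \<Theta>) (\<lambda>x'. (\<theta>', x'))))"

definition param_filter ::
  "(real ^ 'd) set \<Rightarrow> (real ^ 'd) measure \<Rightarrow> (nat \<Rightarrow> real ^ 'd \<Rightarrow> (real ^ 'd) measure) \<Rightarrow>
    (real ^ 'd \<Rightarrow> 'x::polish_space measure) \<Rightarrow> (nat \<Rightarrow> real ^ 'd \<Rightarrow> 'x \<Rightarrow> 'x measure) \<Rightarrow>
    (nat \<Rightarrow> real ^ 'd \<Rightarrow> 'x \<Rightarrow> 'y \<Rightarrow> real) \<Rightarrow> (nat \<Rightarrow> 'y) \<Rightarrow> nat \<Rightarrow> (real ^ 'd) measure" where
  "param_filter \<Theta> \<pi> K init M f Y t =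
    distr (ssm_posterior (so_space \<Theta>) (so_init \<Theta> \<pi> init) (so_kernel \<Theta> K M)
             (\<lambda>s (\<theta>, x). f s \<theta> x) Y t)
          (restrict_space borel \<Theta>) (\<lambda>z. fst (z t))"

definition fast_kernels ::
  "(real ^ 'd) set \<Rightarrow> real ^ 'd ^ 'd \<Rightarrow> (nat \<Rightarrow> real) \<Rightarrow>
    (nat \<Rightarrow> real ^ 'd \<Rightarrow> (real ^ 'd) measure) \<Rightarrow> bool" where
  "fast_kernels \<Theta> V h K \<longleftrightarrow>
    h \<in> o(\<lambda>t. 1 / real t) \<and>
    (\<forall>t\<ge>2. \<forall>\<theta>\<in>\<Theta>. K t \<theta> = TN \<Theta> \<theta> ((h t)\<^sup>2 *\<^sub>R V))"

text \<open>Here the natural numbers start at 1: \<open>\<Delta> \<ge> 1\<close> and \<open>\<tau> 1 \<ge> T + 1\<close>. Otherwise \<open>\<tau>\<close> could be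
  constant. Only \<open>\<tau> p\<close> with \<open>p \<ge> 1\<close> is constrained.\<close>

definition slow_kernels ::
  "nat \<Rightarrow> (real ^ 'd) set \<Rightarrow> real ^ 'd ^ 'd \<Rightarrow> (nat \<Rightarrow> real) \<Rightarrow>
    (nat \<Rightarrow> real ^ 'd \<Rightarrow> (real ^ 'd) measure) \<Rightarrow> bool" where
  "slow_kernels T \<Theta> V h K \<longleftrightarrow>
    (\<exists>(\<alpha>::real) (\<nu>::real) (\<Delta>::nat) (\<tau> :: nat \<Rightarrow> nat).
      \<alpha> > 0 \<and> \<nu> > 0 \<and> \<Delta> \<ge> 1 \<and>
      (\<forall>p\<ge>2. \<tau> p = \<tau> (p - 1) + \<Delta> * nat \<lceil>(ln (real (\<tau> (p - 1))))\<^sup>2\<rceil>) \<and>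
      (\<forall>p\<ge>1. \<tau> p \<in> {k * T + 1 | k. k \<ge> 1}) \<and>
      h \<in> O(\<lambda>t. real t powr (- \<alpha>)) \<and>
      liminf (\<lambda>p. ereal (real (\<tau> p) powr \<alpha> * h (\<tau> p))) > 0 \<and>
      (\<forall>t\<ge>2. \<forall>\<theta>\<in>\<Theta>. K t \<theta> =
        (if t \<in> \<tau> ` {1..} then TS \<Theta> \<theta> ((h t)\<^sup>2 *\<^sub>R V) \<nu> else TN \<Theta> \<theta> ((h t)\<^sup>2 *\<^sub>R V))))"

end

theory Submission
  imports Defs "HOL-Real_Asymp.Real_Asymp"
begin

text \<open>
  The unnormalised filter is evaluated by backward operators, one per observation, and a frozen
  parameter turns a block of T of them into multiplication by the likelihood, because the state is
  drawn afresh at the start of every block.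

  Upper bound: away from the maximiser, a finite cover by small balls, on each of which the
  likelihood, tilted to absorb small changes of the parameter, is below its maximum by a fixed
  factor, makes a weight decaying exponentially towards the far region a supersolution that loses
  that factor in every block.  Lower bound: a tent function at the maximiser, whose peak is a
  fixed mass, loses an arbitrarily small fraction per block.  Comparing both over a long enough
  window shows that the far mass is negligible.

  For the fast kernels the noise is negligible over the whole window from \<open>\<delta> t\<close> to \<open>t\<close>.  For the
  slow kernels a heavy-tailed step at the beginning of a window reaches the maximiser at only a
  polynomial cost in t, which the subsequent gain, exponential in \<open>(log t)\<^sup>2\<close>, outweighs; inside
  a window the concentration is then propagated by the Gaussian steps.
\<close>

section \<open>Backward evaluation of path functionals\<close>

text \<open>Two obstacles shape the estimates. The smoothness condition compares densities at two
  parameters only up to a factor \<open>exp (c * \<phi>)\<close>, which is known to be integrable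
  only for small \<open>c\<close>. So a frozen parameter may replace the true one within a block
  only while the latter moves little; a larger move is charged to a crude factor \<open>C\<close>
  per observation and to the small probability of such a jump. Moreover, near the maximiser no
  factor is gained. There the upper bound only has an additive error
  \<open>D * exp (- lam * \<epsilon>)\<close> per block, which grows by up to \<open>D\<close> in
  every further block. Hence the exponent \<open>lam\<close> must be at least a large multiple of
  the number of blocks in the window, whereas \<open>lam * h t\<close> must stay small, so that a
  Gaussian step hardly changes the weight. For h = o(1/t) both hold with \<open>lam\<close>
  proportional to t. For h = O(t^(-\<alpha>)) and windows of length of order (log \<tau>)^2 they
  hold with \<open>lam\<close> = \<tau>^(\<alpha>/2). The upper and the lower bound are multiples of
  one reference mass at the start of the window, which cancels, so nothing sharp has to be known
  about the filter before the window.\<close>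

primrec chain :: "(nat \<Rightarrow> 'f \<Rightarrow> 'f) \<Rightarrow> nat \<Rightarrow> nat \<Rightarrow> 'f \<Rightarrow> 'f" where
  "chain A a 0 F = F"
| "chain A a (Suc n) F = chain A a n (A (a + Suc n) F)"

lemma chain_add: "chain A a (m + n) F = chain A a m (chain A (a + m) n F)"
  by (induction n arbitrary: F) (simp_all add: add.assoc)

text \<open>The recursion of \<open>chain\<close> peels off the innermost operator, which belongs to
  the last time. The inductions inside a block run over the number of remaining observations and
  need the outermost one.\<close>

lemma chain_Suc_left: "chain A a (Suc n) F = A (Suc a) (chain A (Suc a) n F)"
  using chain_add[of A a 1 n F] by simp

text \<open>Integrating out the last coordinate turns the terminal function \<open>F\<close> into
  its image under the last operator, so the induction keeps \<open>F\<close> arbitrary. Time 1 is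
  treated like any other time: \<open>P 1\<close> is constant and \<open>q 1\<close> ignores its
  first argument, so the starting point \<open>z0\<close> may be any point of the space.\<close>

lemma nn_integral_markov_law:
  fixes q :: "nat \<Rightarrow> 'a \<Rightarrow> 'a \<Rightarrow> ennreal"
  assumes I: "P 1 = (\<lambda>_. I)" "I \<in> space (prob_algebra S)"
    and P: "\<And>s. s \<in> {1..n} \<Longrightarrow> P s \<in> S \<rightarrow>\<^sub>M prob_algebra S"
    and q: "\<And>s. s \<in> {1..n} \<Longrightarrow> case_prod (q s) \<in> borel_measurable (S \<Otimes>\<^sub>M S)"
    and q1: "\<And>u v w. q 1 u w = q 1 v w"
    and F: "F \<in> borel_measurable S" and n: "n \<ge> 1" and z0: "z0 \<in> space S"
  shows "(\<integral>\<^sup>+ z. (\<Prod>s\<in>{1..n}. q s (if s = 1 then z s else z (s - 1)) (z s)) * F (z n) \<partial>markov_law S I P n) =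
    chain (\<lambda>s H z. \<integral>\<^sup>+ u. q s z u * H u \<partial>P s z) 0 n F z0"
  using P q F n
proof (induction n arbitrary: F)
  case (Suc n)
  note One_nat_def [simp del]
  let ?w = "\<lambda>n z. (\<Prod>s\<in>{1..n}. q s (if s = 1 then z s else z (s - 1)) (z s))"
  let ?A = "\<lambda>s H z. \<integral>\<^sup>+ u. q s z u * H u \<partial>P s z"
  let ?k = "\<lambda>z. distr (if n = 0 then I else P (Suc n) (z n)) (\<Pi>\<^sub>M i\<in>{1..Suc n}. S) (\<lambda>u. z(Suc n := u))"
  have mk: "?k \<in> (\<Pi>\<^sub>M i\<in>{1..n}. S) \<rightarrow>\<^sub>M prob_algebra (\<Pi>\<^sub>M i\<in>{1..Suc n}. S)"
    by (intro markov_law_step_measurable I(2) Suc.prems(1)) auto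
  have Ps: "sets (P (Suc n) z) = sets S" if "z \<in> space S" for z
    using measurable_space[OF Suc.prems(1) that] by (auto simp: space_prob_algebra)
  have law: "markov_law S I P n \<in> space (prob_algebra (\<Pi>\<^sub>M i\<in>{1..n}. S))"
    by (intro markov_law_prob I(2) Suc.prems(1)) auto
  then have slaw: "sets (markov_law S I P n) = sets (\<Pi>\<^sub>M i\<in>{1..n}. S)"
    by (auto simp: space_prob_algebra)
  have mc: "(\<lambda>z. z i) \<in> (\<Pi>\<^sub>M i\<in>{1..m}. S) \<rightarrow>\<^sub>M S" if "i \<in> {1..m}" for i m
    using that by (intro measurable_component_singleton)
  have mq: "(\<lambda>z. q s (if s = 1 then z s else z (s - 1)) (z s)) \<in> borel_measurable (\<Pi>\<^sub>M i\<in>{1..Suc n}. S)"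
    if "s \<in> {1..Suc n}" for s
  proof -
    have "(\<lambda>z. (if s = 1 then z s else z (s - 1), z s)) \<in> (\<Pi>\<^sub>M i\<in>{1..Suc n}. S) \<rightarrow>\<^sub>M S \<Otimes>\<^sub>M S"
      using that by (cases "s = 1") (auto intro!: measurable_Pair mc)
    from measurable_compose[OF this Suc.prems(2)[OF that]] show ?thesis by simp
  qed
  have mF: "(\<lambda>z. F (z (Suc n))) \<in> borel_measurable (\<Pi>\<^sub>M i\<in>{1..Suc n}. S)"
    using measurable_compose[OF mc[of "Suc n" "Suc n"] Suc.prems(3)] by simp
  have mw: "(\<lambda>z. ?w (Suc n) z * F (z (Suc n))) \<in> borel_measurable (\<Pi>\<^sub>M i\<in>{1..Suc n}. S)"
    by (intro borel_measurable_times_ennreal borel_measurable_prod_ennreal mq mF)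
  have "(\<integral>\<^sup>+ z. ?w (Suc n) z * F (z (Suc n)) \<partial>markov_law S I P (Suc n)) =
    (\<integral>\<^sup>+ z. \<integral>\<^sup>+ z'. ?w (Suc n) z' * F (z' (Suc n)) \<partial>?k z \<partial>markov_law S I P n)"
    unfolding markov_law.simps
    by (rule nn_integral_bind[OF mw]) (use measurable_prob_algebraD[OF mk] slaw in \<open>simp cong: measurable_cong_sets\<close>)
  \<comment> \<open>The last coordinate is gone and the integrand has the old form for
    \<open>n\<close>. For \<open>n = 0\<close> there is no previous coordinate, and
    \<open>z0\<close> takes its place.\<close>
  also have "\<dots> = (\<integral>\<^sup>+ z. ?w n z * ?A (Suc n) F (if n = 0 then z0 else z n) \<partial>markov_law S I P n)"
  proof (rule nn_integral_cong)
    fix z assume "z \<in> space (markov_law S I P n)"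
    then have z: "z \<in> space (\<Pi>\<^sub>M i\<in>{1..n}. S)" using sets_eq_imp_space_eq[OF slaw] by simp
    let ?z = "if n = 0 then z0 else z n"
    have zn: "?z \<in> space S" using z z0 by (auto simp: space_PiM)
    have IP: "(if n = 0 then I else P (Suc n) (z n)) = P (Suc n) ?z" using I(1) by (auto simp: One_nat_def)
    have upd: "(\<lambda>u. z(Suc n := u)) \<in> P (Suc n) ?z \<rightarrow>\<^sub>M (\<Pi>\<^sub>M i\<in>{1..Suc n}. S)"
    proof -
      have *: "{1..Suc n} = insert (Suc n) {1..n}" by auto
      have "(\<lambda>(z, u). z(Suc n := u)) \<in> (\<Pi>\<^sub>M i\<in>{1..n}. S) \<Otimes>\<^sub>M S \<rightarrow>\<^sub>M (\<Pi>\<^sub>M i\<in>{1..Suc n}. S)"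
        unfolding * by (rule measurable_add_dim)
      from measurable_compose[OF measurable_Pair1'[OF z] this] Ps[OF zn] show ?thesis
        by (simp cong: measurable_cong_sets)
    qed
    have "(\<integral>\<^sup>+ z'. ?w (Suc n) z' * F (z' (Suc n)) \<partial>?k z) =
      (\<integral>\<^sup>+ u. ?w (Suc n) (z(Suc n := u)) * F u \<partial>P (Suc n) ?z)"
      unfolding IP by (subst nn_integral_distr[OF upd]) (use mw in simp_all)
    also have "\<dots> = (\<integral>\<^sup>+ u. ?w n z * (q (Suc n) ?z u * F u) \<partial>P (Suc n) ?z)"
    proof (rule nn_integral_cong)
      fix u
      have "?w n (z(Suc n := u)) = ?w n z"
        by (intro prod.cong) (auto)
      moreover have "q (Suc n) (if Suc n = 1 then u else (z(Suc n := u)) n) u = q (Suc n) ?z u"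
        using q1[where u = u and v = z0 and w = u] by (cases "n = 0") (simp_all add: One_nat_def)
      ultimately show "?w (Suc n) (z(Suc n := u)) * F u = ?w n z * (q (Suc n) ?z u * F u)"
        by (cases "n = 0") (simp_all add: mult.assoc)
    qed
    also have "\<dots> = ?w n z * ?A (Suc n) F ?z"
    proof (rule nn_integral_cmult)
      have "(\<lambda>u. q (Suc n) ?z u) \<in> borel_measurable S"
        using measurable_compose[OF measurable_Pair1'[OF zn] Suc.prems(2)] by simp
      then show "(\<lambda>u. q (Suc n) ?z u * F u) \<in> borel_measurable (P (Suc n) ?z)"
        using Suc.prems(3) Ps[OF zn] by (simp cong: measurable_cong_sets)
    qed
    finally show "(\<integral>\<^sup>+ z'. ?w (Suc n) z' * F (z' (Suc n)) \<partial>?k z) = ?w n z * ?A (Suc n) F ?z" .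
  qed
  also have "\<dots> = chain ?A 0 (Suc n) F z0"
  proof (cases "n = 0")
    case True
    have "emeasure (markov_law S I P 0) (space (markov_law S I P 0)) = 1"
      using law True by (auto simp: space_prob_algebra intro: prob_space.emeasure_space_1)
    then show ?thesis using True by simp
  next
    case False
    have mA: "?A (Suc n) F \<in> borel_measurable S"
    proof -
      have "(\<lambda>z. \<integral>\<^sup>+ u. q (Suc n) z u * F u \<partial>P (Suc n) z) \<in> borel_measurable S"
        using Suc.prems(1)[of "Suc n"] Suc.prems(2)[of "Suc n"] Suc.prems(3)
        by (intro nn_integral_measurable_subprob_algebra2[where N = S] measurable_prob_algebraD)
           (auto simp: split_beta')
      then show ?thesis .
    qed
    show ?thesis using False Suc.IH[OF _ _ mA] Suc.prems by simp
  qed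
  finally show ?case .
qed simp

section \<open>Comparison with a frozen parameter over blocks\<close>

definition frozen_step ::
  "'x measure \<Rightarrow> (nat \<Rightarrow> 't \<Rightarrow> 'x \<Rightarrow> 'x \<Rightarrow> real) \<Rightarrow> (nat \<Rightarrow> 'x \<times> 'x \<Rightarrow> real) \<Rightarrow> 't \<Rightarrow> real \<Rightarrow>
    nat \<Rightarrow> ('x \<Rightarrow> ennreal) \<Rightarrow> 'x \<Rightarrow> ennreal" where
  "frozen_step L G \<phi> \<theta> c s H x = (\<integral>\<^sup>+ x'. ennreal (G s \<theta> x x' * exp (c * \<phi> s (x, x'))) * H x' \<partial>L)"

text \<open>For the densities of the model this is the path integral of the likelihood with the
  extra weight \<open>exp (c * path_weight \<phi> x)\<close>, and the likelihood itself for
  \<open>c = 0\<close>. The dependence on the starting state is then only formal, as the first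
  density of a block does not look at it.\<close>

definition tilted_lik ::
  "'x measure \<Rightarrow> (nat \<Rightarrow> 't \<Rightarrow> 'x \<Rightarrow> 'x \<Rightarrow> real) \<Rightarrow> (nat \<Rightarrow> 'x \<times> 'x \<Rightarrow> real) \<Rightarrow> nat \<Rightarrow> 't \<Rightarrow> real \<Rightarrow>
    'x \<Rightarrow> ennreal" where
  "tilted_lik L G \<phi> T \<theta> c = chain (frozen_step L G \<phi> \<theta> c) 0 T (\<lambda>_. 1)"

lemma phase_block: "1 \<le> s \<Longrightarrow> s \<le> T \<Longrightarrow> phase T (k * T + s) = s"
  by (simp add: phase_def Suc_le_eq)
    (metis Suc_pred add.commute less_le_trans diff_Suc_less mod_less mod_mult_self1 Suc_leI Nat.add_diff_assoc One_nat_def)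

lemma phase_mem: "1 \<le> T \<Longrightarrow> phase T t \<in> {1..T}"
  by (auto simp: phase_def Suc_le_eq)

text \<open>\<open>G s \<theta> x x'\<close> stands for the transition density from \<open>x\<close>
  to \<open>x'\<close> times the observation density at \<open>x'\<close>. The prior is included as
  the kernel \<open>K 1\<close>. The last three assumptions express, uniformly in the starting
  state, that \<theta>h is the strict maximiser and that the likelihood is stable under a small
  tilt; the uniformity in \<open>x\<close> encodes that each block starts afresh.\<close>

locale so_model =
  fixes T :: nat and \<Theta> :: "(real ^ 'd) set" and L :: "'x::polish_space measure"
    and K :: "nat \<Rightarrow> real ^ 'd \<Rightarrow> (real ^ 'd) measure"
    and G :: "nat \<Rightarrow> real ^ 'd \<Rightarrow> 'x \<Rightarrow> 'x \<Rightarrow> real"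
    and \<phi> :: "nat \<Rightarrow> 'x \<times> 'x \<Rightarrow> real" and g :: "real \<Rightarrow> real" and C :: real
    and \<theta>h :: "real ^ 'd" and ell :: real
  assumes T: "1 \<le> T"
    and sets_L: "sets L = sets borel" and sf_L: "sigma_finite_measure L"
    and K: "\<And>t. 1 \<le> t \<Longrightarrow> K t \<in> restrict_space borel \<Theta> \<rightarrow>\<^sub>M prob_algebra (restrict_space borel \<Theta>)"
    and G_meas: "\<And>s. s \<in> {1..T} \<Longrightarrow>
      (\<lambda>(\<theta>, x, x'). G s \<theta> x x') \<in> borel_measurable (restrict_space borel \<Theta> \<Otimes>\<^sub>M borel \<Otimes>\<^sub>M borel)"
    and G_nonneg: "\<And>s \<theta> x x'. s \<in> {1..T} \<Longrightarrow> \<theta> \<in> \<Theta> \<Longrightarrow> 0 \<le> G s \<theta> x x'"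
    and G_bound: "\<And>s \<theta> x. s \<in> {1..T} \<Longrightarrow> \<theta> \<in> \<Theta> \<Longrightarrow> (\<integral>\<^sup>+ x'. ennreal (G s \<theta> x x') \<partial>L) \<le> ennreal C"
    and C: "1 \<le> C"
    and \<phi>_meas: "\<And>s. s \<in> {1..T} \<Longrightarrow> \<phi> s \<in> borel_measurable (borel \<Otimes>\<^sub>M borel)"
    and \<phi>_nonneg: "\<And>s z. s \<in> {1..T} \<Longrightarrow> 0 \<le> \<phi> s z"
    and G_cmp: "\<And>s \<theta> \<theta>' x x'. s \<in> {1..T} \<Longrightarrow> \<theta> \<in> \<Theta> \<Longrightarrow> \<theta>' \<in> \<Theta> \<Longrightarrow>
      G s \<theta>' x x' \<le> G s \<theta> x x' * exp (g (norm (\<theta> - \<theta>')) * \<phi> s (x, x'))"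
    and g_cont: "continuous_on {0..} g" and g_mono: "strict_mono_on {0..} g" and g_0: "g 0 = 0"
    and cpt: "compact \<Theta>" and \<theta>h: "\<theta>h \<in> interior \<Theta>"
    and ell: "0 < ell" "\<And>x. tilted_lik L G \<phi> T \<theta>h 0 x = ennreal ell"
    and lik_less: "\<And>\<theta>. \<theta> \<in> \<Theta> \<Longrightarrow> \<theta> \<noteq> \<theta>h \<Longrightarrow> \<exists>c>0. \<exists>q<ell. \<forall>x. tilted_lik L G \<phi> T \<theta> c x \<le> ennreal q"
    and lik_hat: "\<And>a. a < ell \<Longrightarrow> \<exists>c>0. \<forall>x. ennreal a \<le> tilted_lik L G \<phi> T \<theta>h (- c) x"
    and lik_pos: "\<And>c. 0 \<le> c \<Longrightarrow> \<exists>q>0. \<forall>x. ennreal q \<le> tilted_lik L G \<phi> T \<theta>h (- c) x"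
begin

section \<open>Measurability, monotonicity and linearity of the one-step operators\<close>

abbreviation "P\<Theta> \<equiv> restrict_space borel \<Theta> :: (real ^ 'd) measure"

text \<open>The parameter moves first, then the state moves under the new parameter, and the
  observation is weighted on arrival. Thus \<open>run 0 t F\<close> is the unnormalised filter
  expectation of \<open>F\<close> at time \<open>t\<close>, provided that the first step ignores the
  starting point.\<close>

definition stp :: "nat \<Rightarrow> ((real ^ 'd) \<times> 'x \<Rightarrow> ennreal) \<Rightarrow> (real ^ 'd) \<times> 'x \<Rightarrow> ennreal" where
  "stp t F = (\<lambda>(\<theta>, x). \<integral>\<^sup>+ \<theta>'. \<integral>\<^sup>+ x'. ennreal (G (phase T t) \<theta>' x x') * F (\<theta>', x') \<partial>L \<partial>K t \<theta>)"

abbreviation "run \<equiv> chain stp"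

lemma \<theta>h_mem: "\<theta>h \<in> \<Theta>" using \<theta>h interior_subset by auto

lemma space_L [simp]: "space L = UNIV"
  using sets_eq_imp_space_eq[OF sets_L] by simp

lemma meas_L [simp]: "borel_measurable L = borel_measurable borel"
  by (rule measurable_cong_sets) (simp_all add: sets_L)

lemma sets_K: "1 \<le> t \<Longrightarrow> \<theta> \<in> \<Theta> \<Longrightarrow> sets (K t \<theta>) = sets P\<Theta>"
  using measurable_space[OF K, of t \<theta>] by (auto simp: space_prob_algebra space_restrict_space)

lemma space_K: "1 \<le> t \<Longrightarrow> \<theta> \<in> \<Theta> \<Longrightarrow> space (K t \<theta>) = \<Theta>"
  using sets_eq_imp_space_eq[OF sets_K] by (auto simp: space_restrict_space)

lemma prob_K: "1 \<le> t \<Longrightarrow> \<theta> \<in> \<Theta> \<Longrightarrow> prob_space (K t \<theta>)"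
  using measurable_space[OF K, of t \<theta>] by (auto simp: space_prob_algebra space_restrict_space)

lemma meas_K: "1 \<le> t \<Longrightarrow> \<theta> \<in> \<Theta> \<Longrightarrow> borel_measurable (K t \<theta>) = borel_measurable P\<Theta>"
  by (rule measurable_cong_sets) (simp_all add: sets_K)

lemma meas_KI: "F \<in> borel_measurable borel \<Longrightarrow> 1 \<le> t \<Longrightarrow> \<theta> \<in> \<Theta> \<Longrightarrow> F \<in> borel_measurable (K t \<theta>)"
  by (simp add: meas_K measurable_restrict_space1)

lemma G_meas_x:
  assumes "s \<in> {1..T}" "\<theta> \<in> \<Theta>"
  shows "(\<lambda>(x, x'). G s \<theta> x x') \<in> borel_measurable (borel \<Otimes>\<^sub>M borel)"
proof -
  have "\<theta> \<in> space P\<Theta>" using assms by (simp add: space_restrict_space)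
  from measurable_compose[OF measurable_Pair1'[OF this] G_meas[OF assms(1)]]
  show ?thesis by (simp add: split_beta')
qed

lemma G_meas_x1:
  assumes "s \<in> {1..T}" "\<theta> \<in> \<Theta>"
  shows "(\<lambda>x'. G s \<theta> x x') \<in> borel_measurable borel"
  using measurable_compose[OF measurable_Pair1'[of x borel borel] G_meas_x[OF assms]] by simp

lemma \<phi>_meas1: "s \<in> {1..T} \<Longrightarrow> (\<lambda>x'. \<phi> s (x, x')) \<in> borel_measurable borel"
  using measurable_compose[OF measurable_Pair1'[of x borel borel] \<phi>_meas] by simp

lemma frozen_meas:
  assumes "s \<in> {1..T}" "\<theta> \<in> \<Theta>" "H \<in> borel_measurable borel"
  shows "frozen_step L G \<phi> \<theta> c s H \<in> borel_measurable borel"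
proof -
  interpret sigma_finite_measure L by (rule sf_L)
  note [measurable] = G_meas_x[OF assms(1,2)] \<phi>_meas[OF assms(1)] assms(3)
  have "(\<lambda>(x, x'). ennreal (G s \<theta> x x' * exp (c * \<phi> s (x, x'))) * H x') \<in> borel_measurable (borel \<Otimes>\<^sub>M borel)"
    by measurable
  then have "(\<lambda>(x, x'). ennreal (G s \<theta> x x' * exp (c * \<phi> s (x, x'))) * H x') \<in> borel_measurable (borel \<Otimes>\<^sub>M L)"
    using sets_L by (simp cong: measurable_cong_sets sets_pair_measure_cong)
  from borel_measurable_nn_integral[OF this] show ?thesis
    unfolding frozen_step_def by simp
qed

lemma chain_frozen_meas:
  assumes "\<theta> \<in> \<Theta>"
  shows "a + n \<le> T \<Longrightarrow> H \<in> borel_measurable borel \<Longrightarrow> chain (frozen_step L G \<phi> \<theta> c) a n H \<in> borel_measurable borel"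
proof (induction n arbitrary: H)
  case (Suc n)
  have "frozen_step L G \<phi> \<theta> c (a + Suc n) H \<in> borel_measurable borel"
    using Suc.prems by (intro frozen_meas assms) auto
  then show ?case using Suc by simp
qed simp

lemma stp_mono:
  assumes "1 \<le> t" "\<theta> \<in> \<Theta>" "\<And>\<theta>' x'. \<theta>' \<in> \<Theta> \<Longrightarrow> F (\<theta>', x') \<le> H (\<theta>', x')"
  shows "stp t F (\<theta>, x) \<le> stp t H (\<theta>, x)"
  unfolding stp_def using assms
  by (auto intro!: nn_integral_mono mult_left_mono simp: space_K)

lemma run_mono:
  assumes "\<theta> \<in> \<Theta>" "\<And>\<theta>' x'. \<theta>' \<in> \<Theta> \<Longrightarrow> F (\<theta>', x') \<le> H (\<theta>', x')"
  shows "run a n F (\<theta>, x) \<le> run a n H (\<theta>, x)"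
  using assms(2)
proof (induction n arbitrary: F H)
  case (Suc n)
  show ?case unfolding chain.simps
    by (rule Suc.IH) (auto intro!: stp_mono Suc.prems)
qed (use assms(1) in auto)

text \<open>Joint measurability in the old pair and the new parameter is what integration against a
  kernel requires. The product is rearranged over \<open>borel\<close>, where \<open>G_meas\<close>
  lives, and transferred to \<open>L\<close>, which has the same measurable sets.\<close>

lemma stp_inner_meas:
  assumes t: "1 \<le> t" and F: "F \<in> borel_measurable (so_space \<Theta>)"
  shows "(\<lambda>((\<theta>, x), \<theta>'). \<integral>\<^sup>+ x'. ennreal (G (phase T t) \<theta>' x x') * F (\<theta>', x') \<partial>L)
    \<in> borel_measurable (so_space \<Theta> \<Otimes>\<^sub>M P\<Theta>)"
proof -
  interpret sigma_finite_measure L by (rule sf_L)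
  note [measurable] = F[unfolded so_space_def]
  let ?N = "((P\<Theta> \<Otimes>\<^sub>M borel) \<Otimes>\<^sub>M P\<Theta>) \<Otimes>\<^sub>M borel :: ((((real ^ 'd) \<times> 'x) \<times> (real ^ 'd)) \<times> 'x) measure"
  have "(\<lambda>z. (snd (fst z), snd (fst (fst z)), snd z)) \<in> ?N \<rightarrow>\<^sub>M P\<Theta> \<Otimes>\<^sub>M borel \<Otimes>\<^sub>M borel"
    by measurable
  from measurable_compose[OF this G_meas[OF phase_mem[OF T]]]
  have [measurable]: "(\<lambda>z. G (phase T t) (snd (fst z)) (snd (fst (fst z))) (snd z)) \<in> borel_measurable ?N"
    by simp
  have "(\<lambda>z. ennreal (G (phase T t) (snd (fst z)) (snd (fst (fst z))) (snd z)) * F (snd (fst z), snd z)) \<in>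
    borel_measurable ?N"
    by measurable
  then have "(\<lambda>(((\<theta>, x), \<theta>'), x'). ennreal (G (phase T t) \<theta>' x x') * F (\<theta>', x')) \<in> borel_measurable ?N"
    by (simp add: split_beta')
  then have "(\<lambda>(((\<theta>, x), \<theta>'), x'). ennreal (G (phase T t) \<theta>' x x') * F (\<theta>', x')) \<in>
    borel_measurable (((P\<Theta> \<Otimes>\<^sub>M borel) \<Otimes>\<^sub>M P\<Theta>) \<Otimes>\<^sub>M L)"
    using sets_L by (simp cong: measurable_cong_sets sets_pair_measure_cong)
  then have "case_prod (\<lambda>y x'. ennreal (G (phase T t) (snd y) (snd (fst y)) x') * F (snd y, x')) \<in>
    borel_measurable (((P\<Theta> \<Otimes>\<^sub>M borel) \<Otimes>\<^sub>M P\<Theta>) \<Otimes>\<^sub>M L)"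
    by (simp add: split_beta')
  from borel_measurable_nn_integral[OF this] show ?thesis
    by (simp add: split_beta' so_space_def)
qed

lemma stp_meas:
  assumes t: "1 \<le> t" and F: "F \<in> borel_measurable (so_space \<Theta>)"
  shows "stp t F \<in> borel_measurable (so_space \<Theta>)"
proof -
  have k: "(\<lambda>z. K t (fst z)) \<in> so_space \<Theta> \<rightarrow>\<^sub>M subprob_algebra P\<Theta>"
    unfolding so_space_def
    by (rule measurable_compose[OF measurable_fst]) (rule measurable_prob_algebraD[OF K[OF t]])
  have "(\<lambda>z. \<integral>\<^sup>+ \<theta>'. \<integral>\<^sup>+ x'. ennreal (G (phase T t) \<theta>' (snd z) x') * F (\<theta>', x') \<partial>L \<partial>K t (fst z))
    \<in> borel_measurable (so_space \<Theta>)"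
    using stp_inner_meas[OF assms]
    by (intro nn_integral_measurable_subprob_algebra2[OF _ k]) (simp add: split_beta')
  then show ?thesis unfolding stp_def by (simp add: split_beta')
qed

lemma stp_add:
  assumes t: "1 \<le> t" and \<theta>: "\<theta> \<in> \<Theta>"
    and F: "F \<in> borel_measurable (so_space \<Theta>)" and H: "H \<in> borel_measurable (so_space \<Theta>)"
  shows "stp t (\<lambda>z. F z + H z) (\<theta>, x) = stp t F (\<theta>, x) + stp t H (\<theta>, x)"
proof -
  have z: "(\<theta>, x) \<in> space (so_space \<Theta>)" using \<theta> by (simp add: so_space_def space_pair_measure space_restrict_space)
  have outer: "(\<lambda>\<theta>'. \<integral>\<^sup>+ x'. ennreal (G (phase T t) \<theta>' x x') * F (\<theta>', x') \<partial>L) \<in> borel_measurable (K t \<theta>)"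
    if "F \<in> borel_measurable (so_space \<Theta>)" for F
    using measurable_compose[OF measurable_Pair1'[OF z] stp_inner_meas[OF t that]] by (simp add: meas_K[OF t \<theta>])
  have inner: "(\<lambda>x'. ennreal (G (phase T t) \<theta>' x x') * F (\<theta>', x')) \<in> borel_measurable L"
    if "F \<in> borel_measurable (so_space \<Theta>)" "\<theta>' \<in> \<Theta>" for F \<theta>'
  proof -
    have "(\<lambda>x'. F (\<theta>', x')) \<in> borel_measurable borel"
      using measurable_compose[OF measurable_Pair1'[of \<theta>' P\<Theta> borel] that(1)[unfolded so_space_def]] that(2)
      by (simp add: space_restrict_space)
    then show ?thesis using G_meas_x1[OF phase_mem[OF T] that(2)] by simp
  qed
  have "stp t (\<lambda>z. F z + H z) (\<theta>, x) = (\<integral>\<^sup>+ \<theta>'. (\<integral>\<^sup>+ x'. ennreal (G (phase T t) \<theta>' x x') * F (\<theta>', x') \<partial>L) +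
    (\<integral>\<^sup>+ x'. ennreal (G (phase T t) \<theta>' x x') * H (\<theta>', x') \<partial>L) \<partial>K t \<theta>)"
    unfolding stp_def prod.case
    by (intro nn_integral_cong, subst nn_integral_add[symmetric])
       (auto simp: space_K[OF t \<theta>] distrib_left intro!: inner F H simp del: meas_L)
  also have "\<dots> = stp t F (\<theta>, x) + stp t H (\<theta>, x)"
    unfolding stp_def prod.case by (intro nn_integral_add outer F H)
  finally show ?thesis .
qed

lemma stp_cmult:
  assumes t: "1 \<le> t" and \<theta>: "\<theta> \<in> \<Theta>" and F: "F \<in> borel_measurable (so_space \<Theta>)"
  shows "stp t (\<lambda>z. c * F z) (\<theta>, x) = c * stp t F (\<theta>, x)"
proof -
  have z: "(\<theta>, x) \<in> space (so_space \<Theta>)" using \<theta> by (simp add: so_space_def space_pair_measure space_restrict_space)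
  have outer: "(\<lambda>\<theta>'. \<integral>\<^sup>+ x'. ennreal (G (phase T t) \<theta>' x x') * F (\<theta>', x') \<partial>L) \<in> borel_measurable (K t \<theta>)"
    using measurable_compose[OF measurable_Pair1'[OF z] stp_inner_meas[OF t F]] by (simp add: meas_K[OF t \<theta>])
  have inner: "(\<lambda>x'. ennreal (G (phase T t) \<theta>' x x') * F (\<theta>', x')) \<in> borel_measurable L"
    if "\<theta>' \<in> \<Theta>" for \<theta>'
  proof -
    have "(\<lambda>x'. F (\<theta>', x')) \<in> borel_measurable borel"
      using measurable_compose[OF measurable_Pair1'[of \<theta>' P\<Theta> borel] F[unfolded so_space_def]] that
      by (simp add: space_restrict_space)
    then show ?thesis using G_meas_x1[OF phase_mem[OF T] that] by simp
  qed
  have "stp t (\<lambda>z. c * F z) (\<theta>, x) = (\<integral>\<^sup>+ \<theta>'. c * (\<integral>\<^sup>+ x'. ennreal (G (phase T t) \<theta>' x x') * F (\<theta>', x') \<partial>L) \<partial>K t \<theta>)"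
    unfolding stp_def prod.case
    by (intro nn_integral_cong, subst nn_integral_cmult[symmetric])
       (auto simp: space_K[OF t \<theta>] mult.left_commute intro!: inner simp del: meas_L)
  also have "\<dots> = c * stp t F (\<theta>, x)"
    unfolding stp_def prod.case by (intro nn_integral_cmult outer)
  finally show ?thesis .
qed

lemma run_cong:
  assumes "\<theta> \<in> \<Theta>" "\<And>\<theta>' x'. \<theta>' \<in> \<Theta> \<Longrightarrow> F (\<theta>', x') = H (\<theta>', x')"
  shows "run a n F (\<theta>, x) = run a n H (\<theta>, x)"
  by (intro antisym run_mono) (auto simp: assms)

lemma run_lin:
  assumes \<theta>: "\<theta> \<in> \<Theta>"
    and F: "F \<in> borel_measurable (so_space \<Theta>)" and H: "H \<in> borel_measurable (so_space \<Theta>)"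
  shows "run a n (\<lambda>z. c * F z + d * H z) (\<theta>, x) = c * run a n F (\<theta>, x) + d * run a n H (\<theta>, x)"
  using F H
proof (induction n arbitrary: F H)
  case (Suc n)
  have "run a (Suc n) (\<lambda>z. c * F z + d * H z) (\<theta>, x) =
    run a n (\<lambda>z. c * stp (a + Suc n) F z + d * stp (a + Suc n) H z) (\<theta>, x)"
    unfolding chain.simps using Suc.prems
    by (intro run_cong \<theta>) (simp add: stp_add stp_cmult)
  also have "\<dots> = c * run a (Suc n) F (\<theta>, x) + d * run a (Suc n) H (\<theta>, x)"
    using Suc.prems by (simp add: Suc.IH stp_meas)
  finally show ?case .
qed simp

lemma fst_meas: "V \<in> borel_measurable borel \<Longrightarrow> (\<lambda>z. V (fst z)) \<in> borel_measurable (so_space \<Theta>)"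
  unfolding so_space_def
  by (rule measurable_compose[OF measurable_fst]) (rule measurable_restrict_space1)

text \<open>If the terminal function depends on the parameter only, the new state can be integrated
  out, at the price of the factor \<open>C\<close>.\<close>

lemma stp_fst_le:
  assumes t: "1 \<le> t" and \<theta>: "\<theta> \<in> \<Theta>" and V: "V \<in> borel_measurable borel"
  shows "stp t (\<lambda>z. V (fst z)) (\<theta>, x) \<le> ennreal C * (\<integral>\<^sup>+ \<theta>'. V \<theta>' \<partial>K t \<theta>)"
proof -
  have "stp t (\<lambda>z. V (fst z)) (\<theta>, x) \<le> (\<integral>\<^sup>+ \<theta>'. ennreal C * V \<theta>' \<partial>K t \<theta>)"
    unfolding stp_def prod.case fst_conv
  proof (intro nn_integral_mono)
    fix \<theta>' assume "\<theta>' \<in> space (K t \<theta>)"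
    then have \<theta>': "\<theta>' \<in> \<Theta>" by (simp add: space_K[OF t \<theta>])
    show "(\<integral>\<^sup>+ x'. ennreal (G (phase T t) \<theta>' x x') * V \<theta>' \<partial>L) \<le> ennreal C * V \<theta>'"
      using G_bound[OF phase_mem[OF T] \<theta>'] G_meas_x1[OF phase_mem[OF T] \<theta>']
      by (subst nn_integral_multc) (auto intro: mult_right_mono)
  qed
  also have "\<dots> = ennreal C * (\<integral>\<^sup>+ \<theta>'. V \<theta>' \<partial>K t \<theta>)"
    by (intro nn_integral_cmult meas_KI V t \<theta>)
  finally show ?thesis .
qed

text \<open>This bound uses nothing about the likelihood: each step costs \<open>C\<close> for the
  observation and \<open>Z\<close> for the parameter move. It serves after an exit from a small
  neighbourhood and for incomplete blocks.\<close>

lemma run_crude: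
  assumes V: "V \<in> borel_measurable borel"
    and sup: "\<And>i \<theta>. i \<in> {1..n} \<Longrightarrow> \<theta> \<in> \<Theta> \<Longrightarrow> (\<integral>\<^sup>+ \<theta>'. V \<theta>' \<partial>K (a + i) \<theta>) \<le> Z * V \<theta>"
    and \<theta>: "\<theta> \<in> \<Theta>"
  shows "run a n (\<lambda>z. V (fst z)) (\<theta>, x) \<le> (ennreal C * Z) ^ n * V \<theta>"
  using sup
proof (induction n)
  case (Suc n)
  have "run a (Suc n) (\<lambda>z. V (fst z)) (\<theta>, x) \<le> run a n (\<lambda>z. (ennreal C * Z) * V (fst z) + 0 * 0) (\<theta>, x)"
    unfolding chain.simps
  proof (intro run_mono \<theta>)
    fix \<theta>' x' assume \<theta>': "\<theta>' \<in> \<Theta>"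
    have "stp (a + Suc n) (\<lambda>z. V (fst z)) (\<theta>', x') \<le> ennreal C * (\<integral>\<^sup>+ \<theta>. V \<theta> \<partial>K (a + Suc n) \<theta>')"
      by (intro stp_fst_le V \<theta>') simp
    also have "\<dots> \<le> ennreal C * (Z * V \<theta>')"
      by (intro mult_left_mono Suc.prems \<theta>') auto
    finally show "stp (a + Suc n) (\<lambda>z. V (fst z)) (\<theta>', x') \<le> (ennreal C * Z) * V (fst (\<theta>', x')) + 0 * 0"
      by (simp add: mult.assoc)
  qed
  also have "\<dots> = (ennreal C * Z) * run a n (\<lambda>z. V (fst z)) (\<theta>, x)"
    by (subst run_lin[OF \<theta>]) (auto intro!: fst_meas V)
  also have "\<dots> \<le> (ennreal C * Z) * ((ennreal C * Z) ^ n * V \<theta>)"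
    by (intro mult_left_mono Suc.IH Suc.prems) auto
  finally show ?case by (simp add: mult_ac)
qed simp

text \<open>An exit from the \<open>w\<close>-neighbourhood is paid for by the weight \<open>R\<close>: as \<open>1 \<le> R * e\<close>, the crude
  bound \<open>C ^ j\<close> valid after an exit is absorbed by the error term \<open>C ^ j * e\<close>.\<close>

lemma upper_block:
  assumes a: "a = k * T" and \<theta>0: "\<theta>0 \<in> \<Theta>" and \<theta>i: "\<theta>i \<in> \<Theta>" and V: "V \<in> borel_measurable borel"
    and w: "0 \<le> (w :: real)"
    and cmp: "\<And>s \<theta>' x x'. s \<in> {1..T} \<Longrightarrow> \<theta>' \<in> \<Theta> \<Longrightarrow> norm (\<theta>' - \<theta>0) \<le> real T * w \<Longrightarrow>
      G s \<theta>' x x' \<le> G s \<theta>i x x' * exp (c * \<phi> s (x, x'))"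
    and sup: "\<And>s \<theta>. s \<in> {1..T} \<Longrightarrow> \<theta> \<in> \<Theta> \<Longrightarrow>
      (\<integral>\<^sup>+ \<theta>'. V \<theta>' * (1 + R * indicator {\<theta>'. norm (\<theta>' - \<theta>) > w} \<theta>') \<partial>K (a + s) \<theta>) \<le> Z * V \<theta>"
    and e: "1 \<le> R * e"
  shows "run a T (\<lambda>z. V (fst z)) (\<theta>0, x) \<le> Z ^ T * V \<theta>0 * (tilted_lik L G \<phi> T \<theta>i c x + ennreal C ^ T * e)"
proof -
  let ?\<psi> = "\<lambda>j. chain (frozen_step L G \<phi> \<theta>i c) (T - j) j (\<lambda>_. 1)"
  \<comment> \<open>With \<open>j\<close> steps to go, \<open>T - j\<close> steps of length at most
    \<open>w\<close> have been made, which is the distance allowed from \<theta>0. For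
    \<open>j = T\<close> the parameter is \<theta>0 itself.\<close>
  have claim: "run (a + (T - j)) j (\<lambda>z. V (fst z)) (\<theta>, x) \<le> Z ^ j * V \<theta> * (?\<psi> j x + ennreal C ^ j * e)"
    if "j \<le> T" "\<theta> \<in> \<Theta>" "norm (\<theta> - \<theta>0) \<le> real (T - j) * w" for j \<theta> x
    using that
  proof (induction j arbitrary: \<theta> x)
    case 0
    then show ?case by (auto simp: distrib_left intro: order_trans[OF _ add_increasing2])
  next
    case (Suc j)
    define s where "s = T - j"
    have s: "s \<in> {1..T}" "Suc (T - Suc j) = s" "real s = real (T - Suc j) + 1" "T - j = s"
      using Suc.prems by (auto simp: s_def)
    have t: "1 \<le> a + s" and as: "Suc (a + (T - Suc j)) = a + s" using s by auto
    have ph: "phase T (a + s) = s" unfolding a using s by (intro phase_block) auto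
    have m\<psi>: "?\<psi> j \<in> borel_measurable borel"
      using Suc.prems by (intro chain_frozen_meas \<theta>i) auto
    have \<psi>Suc: "?\<psi> (Suc j) x = frozen_step L G \<phi> \<theta>i c s (?\<psi> j) x"
      unfolding chain_Suc_left s(2) s(4) ..
    let ?B = "?\<psi> (Suc j) x + ennreal C ^ Suc j * e"
    have inner: "(\<integral>\<^sup>+ x'. ennreal (G s \<theta>' x x') * run (a + s) j (\<lambda>z. V (fst z)) (\<theta>', x') \<partial>L) \<le>
        Z ^ j * ?B * (V \<theta>' * (1 + R * indicator {\<theta>'. norm (\<theta>' - \<theta>) > w} \<theta>'))"
      if \<theta>': "\<theta>' \<in> \<Theta>" for \<theta>'
    \<comment> \<open>The old parameter lies within \<open>(s - 1) * w\<close> of \<theta>0. A new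
      one beyond \<open>s * w\<close> therefore comes from a jump longer than \<open>w\<close>,
      which is what the penalty \<open>R\<close> charges.\<close>
    proof (cases "norm (\<theta>' - \<theta>0) \<le> real s * w")
      case True
      have mG: "(\<lambda>x'. ennreal (G s \<theta>' x x')) \<in> borel_measurable borel"
        using G_meas_x1[OF s(1) \<theta>'] by simp
      have sT: "real s * w \<le> real T * w" using s w by (intro mult_right_mono) auto
      have "(\<integral>\<^sup>+ x'. ennreal (G s \<theta>' x x') * run (a + s) j (\<lambda>z. V (fst z)) (\<theta>', x') \<partial>L) \<le>
        (\<integral>\<^sup>+ x'. Z ^ j * V \<theta>' * (ennreal (G s \<theta>' x x') * ?\<psi> j x' + ennreal (G s \<theta>' x x') * (ennreal C ^ j * e)) \<partial>L)"
      proof (intro nn_integral_mono)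
        fix x'
        have "run (a + s) j (\<lambda>z. V (fst z)) (\<theta>', x') \<le> Z ^ j * V \<theta>' * (?\<psi> j x' + ennreal C ^ j * e)"
          using Suc.IH[of \<theta>' x'] Suc.prems \<theta>' True unfolding s(4) by simp
        from mult_left_mono[OF this, of "ennreal (G s \<theta>' x x')"]
        show "ennreal (G s \<theta>' x x') * run (a + s) j (\<lambda>z. V (fst z)) (\<theta>', x') \<le>
          Z ^ j * V \<theta>' * (ennreal (G s \<theta>' x x') * ?\<psi> j x' + ennreal (G s \<theta>' x x') * (ennreal C ^ j * e))"
          by (simp add: distrib_left mult_ac)
      qed
      also have "\<dots> = Z ^ j * V \<theta>' * ((\<integral>\<^sup>+ x'. ennreal (G s \<theta>' x x') * ?\<psi> j x' \<partial>L) +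
          (\<integral>\<^sup>+ x'. ennreal (G s \<theta>' x x') \<partial>L) * (ennreal C ^ j * e))"
        using mG m\<psi> by (simp add: nn_integral_cmult nn_integral_add nn_integral_multc)
      also have "\<dots> \<le> Z ^ j * V \<theta>' * (?\<psi> (Suc j) x + ennreal C * (ennreal C ^ j * e))"
      proof (intro mult_left_mono add_mono mult_right_mono G_bound s \<theta>')
        show "(\<integral>\<^sup>+ x'. ennreal (G s \<theta>' x x') * ?\<psi> j x' \<partial>L) \<le> ?\<psi> (Suc j) x"
          unfolding \<psi>Suc frozen_step_def[where H = "?\<psi> j" and x = x and s = s] using cmp[OF s(1) \<theta>'] True sT
          by (intro nn_integral_mono mult_right_mono ennreal_leI) auto
      qed auto
      also have "\<dots> = Z ^ j * ?B * (V \<theta>' * 1)" by (simp add: mult_ac)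
      also have "\<dots> \<le> Z ^ j * ?B * (V \<theta>' * (1 + R * indicator {\<theta>'. norm (\<theta>' - \<theta>) > w} \<theta>'))"
        by (intro mult_left_mono) (auto intro: add_increasing2)
      finally show ?thesis .
    next
      case False
      have far: "norm (\<theta>' - \<theta>) > w"
        using False Suc.prems(3) s(3) norm_triangle_ineq[of "\<theta>' - \<theta>" "\<theta> - \<theta>0"] by (auto simp: algebra_simps)
      have "(\<integral>\<^sup>+ x'. ennreal (G s \<theta>' x x') * run (a + s) j (\<lambda>z. V (fst z)) (\<theta>', x') \<partial>L) \<le>
        (\<integral>\<^sup>+ x'. ennreal (G s \<theta>' x x') * ((ennreal C * Z) ^ j * V \<theta>') \<partial>L)"
      proof (intro nn_integral_mono mult_left_mono run_crude V \<theta>')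
        fix i \<theta>'' assume i: "i \<in> {1..j}" and \<theta>'': "\<theta>'' \<in> \<Theta>"
        have si: "s + i \<in> {1..T}" using i Suc.prems by (auto simp: s_def)
        have "(\<integral>\<^sup>+ \<theta>'. V \<theta>' \<partial>K (a + s + i) \<theta>'') \<le>
          (\<integral>\<^sup>+ \<theta>'. V \<theta>' * (1 + R * indicator {\<theta>'. norm (\<theta>' - \<theta>'') > w} \<theta>') \<partial>K (a + (s + i)) \<theta>'')"
          unfolding add.assoc
          by (intro nn_integral_mono) (simp add: distrib_left)
        also have "\<dots> \<le> Z * V \<theta>''" by (rule sup[OF si \<theta>''])
        finally show "(\<integral>\<^sup>+ \<theta>'. V \<theta>' \<partial>K (a + s + i) \<theta>'') \<le> Z * V \<theta>''" .
      qed auto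
      also have "\<dots> = (\<integral>\<^sup>+ x'. ennreal (G s \<theta>' x x') \<partial>L) * ((ennreal C * Z) ^ j * V \<theta>')"
        using G_meas_x1[OF s(1) \<theta>'] by (simp add: nn_integral_multc)
      also have "\<dots> \<le> ennreal C * ((ennreal C * Z) ^ j * V \<theta>')"
        by (intro mult_right_mono G_bound s \<theta>') auto
      also have "\<dots> = Z ^ j * V \<theta>' * (ennreal C ^ Suc j * 1)"
        by (simp add: mult_ac power_mult_distrib)
      also have "\<dots> \<le> Z ^ j * V \<theta>' * (ennreal C ^ Suc j * (R * e))"
        by (intro mult_left_mono e) auto
      also have "\<dots> = Z ^ j * (ennreal C ^ Suc j * e) * (V \<theta>' * (R * indicator {\<theta>'. norm (\<theta>' - \<theta>) > w} \<theta>'))"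
        using far by (simp add: mult_ac)
      also have "\<dots> \<le> Z ^ j * ?B * (V \<theta>' * (1 + R * indicator {\<theta>'. norm (\<theta>' - \<theta>) > w} \<theta>'))"
        by (intro mult_mono) (auto intro: add_increasing)
      finally show ?thesis .
    qed
    have "run (a + (T - Suc j)) (Suc j) (\<lambda>z. V (fst z)) (\<theta>, x) =
      (\<integral>\<^sup>+ \<theta>'. \<integral>\<^sup>+ x'. ennreal (G s \<theta>' x x') * run (a + s) j (\<lambda>z. V (fst z)) (\<theta>', x') \<partial>L \<partial>K (a + s) \<theta>)"
      unfolding chain_Suc_left as by (simp add: stp_def ph)
    also have "\<dots> \<le> (\<integral>\<^sup>+ \<theta>'. Z ^ j * ?B * (V \<theta>' * (1 + R * indicator {\<theta>'. norm (\<theta>' - \<theta>) > w} \<theta>')) \<partial>K (a + s) \<theta>)"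
      by (intro nn_integral_mono inner) (simp add: space_K[OF t Suc.prems(2)])
    also have "\<dots> = Z ^ j * ?B * (\<integral>\<^sup>+ \<theta>'. V \<theta>' * (1 + R * indicator {\<theta>'. norm (\<theta>' - \<theta>) > w} \<theta>') \<partial>K (a + s) \<theta>)"
    proof (intro nn_integral_cmult meas_KI t Suc.prems)
      note [measurable] = V
      show "(\<lambda>\<theta>'. V \<theta>' * (1 + R * indicator {\<theta>'. norm (\<theta>' - \<theta>) > w} \<theta>')) \<in> borel_measurable borel"
        by measurable
    qed
    also have "\<dots> \<le> Z ^ j * ?B * (Z * V \<theta>)"
      by (intro mult_left_mono sup s Suc.prems) auto
    finally show ?case by (simp add: mult_ac)
  qed
  from claim[of T \<theta>0 x] \<theta>0 show ?thesis by (simp add: tilted_lik_def)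
qed

lemma lower_block:
  assumes a: "a = k * T" and \<theta>: "\<theta> \<in> \<Theta>"
    and u: "\<And>t. t \<in> {a + 1..a + T} \<Longrightarrow> u t \<in> borel_measurable borel"
    and r: "0 \<le> r"
    and supp: "\<And>t \<theta>. t \<in> {a + 1..a + T} \<Longrightarrow> \<theta> \<in> \<Theta> \<Longrightarrow> u t \<theta> \<noteq> 0 \<Longrightarrow> norm (\<theta> - \<theta>h) \<le> r"
    and sub: "\<And>t \<theta>. t \<in> {a + 1..a + T} \<Longrightarrow> \<theta> \<in> \<Theta> \<Longrightarrow> u (t - 1) \<theta> \<le> (\<integral>\<^sup>+ \<theta>'. u t \<theta>' \<partial>K t \<theta>)"
  shows "tilted_lik L G \<phi> T \<theta>h (- g r) x * u a \<theta> \<le> run a T (\<lambda>z. u (a + T) (fst z)) (\<theta>, x)"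
proof -
  let ?\<psi> = "\<lambda>j. chain (frozen_step L G \<phi> \<theta>h (- g r)) (T - j) j (\<lambda>_. 1)"
  have claim: "?\<psi> j x * u (a + (T - j)) \<theta> \<le> run (a + (T - j)) j (\<lambda>z. u (a + T) (fst z)) (\<theta>, x)"
    if "j \<le> T" "\<theta> \<in> \<Theta>" for j \<theta> x
    using that
  proof (induction j arbitrary: \<theta> x)
    case (Suc j)
    define s where "s = T - j"
    have s: "s \<in> {1..T}" "Suc (T - Suc j) = s" "T - j = s" "a + (T - Suc j) = a + s - 1"
      using Suc.prems by (auto simp: s_def)
    have t: "1 \<le> a + s" and as: "Suc (a + (T - Suc j)) = a + s" using s by auto
    have ph: "phase T (a + s) = s" unfolding a using s by (intro phase_block) auto
    have m\<psi>: "?\<psi> j \<in> borel_measurable borel"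
      using Suc.prems by (intro chain_frozen_meas \<theta>h_mem) auto
    have \<psi>Suc: "?\<psi> (Suc j) x = frozen_step L G \<phi> \<theta>h (- g r) s (?\<psi> j) x"
      unfolding chain_Suc_left s(2) s(3) ..
    have inner: "?\<psi> (Suc j) x * u (a + s) \<theta>' \<le>
        (\<integral>\<^sup>+ x'. ennreal (G s \<theta>' x x') * run (a + s) j (\<lambda>z. u (a + T) (fst z)) (\<theta>', x') \<partial>L)"
      if \<theta>': "\<theta>' \<in> \<Theta>" for \<theta>'
    proof (cases "u (a + s) \<theta>' = 0")
      case False
      then have near: "norm (\<theta>' - \<theta>h) \<le> r" using supp[of "a + s" \<theta>'] s \<theta>' by auto
      have cmp: "G s \<theta>h x x' * exp (- g r * \<phi> s (x, x')) \<le> G s \<theta>' x x'" for x'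
      proof -
        have "g (norm (\<theta>' - \<theta>h)) \<le> g r"
          using near r by (intro strict_mono_on_leD[OF g_mono]) auto
        then have "g (norm (\<theta>' - \<theta>h)) * \<phi> s (x, x') \<le> g r * \<phi> s (x, x')"
          by (intro mult_right_mono \<phi>_nonneg s)
        \<comment> \<open>The comparison is used with the roles of the two parameters exchanged:
          \<theta>h is bounded by the true parameter, and the exponential is moved to the other side
          below.\<close>
        then have "G s \<theta>h x x' \<le> G s \<theta>' x x' * exp (g r * \<phi> s (x, x'))"
          using G_cmp[OF s(1) \<theta>' \<theta>h_mem, of x x'] G_nonneg[OF s(1) \<theta>', of x x']
          by (meson order_trans mult_left_mono exp_le_cancel_iff)
        then show ?thesis by (simp add: exp_minus field_simps)
      qed
      have "?\<psi> (Suc j) x * u (a + s) \<theta>' =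
        (\<integral>\<^sup>+ x'. ennreal (G s \<theta>h x x' * exp (- g r * \<phi> s (x, x'))) * ?\<psi> j x' * u (a + s) \<theta>' \<partial>L)"
        unfolding \<psi>Suc frozen_step_def[where H = "?\<psi> j" and x = x and s = s]
        using G_meas_x1[OF s(1) \<theta>h_mem] \<phi>_meas1[OF s(1)] m\<psi> by (subst nn_integral_multc) auto
      also have "\<dots> \<le> (\<integral>\<^sup>+ x'. ennreal (G s \<theta>' x x') * run (a + s) j (\<lambda>z. u (a + T) (fst z)) (\<theta>', x') \<partial>L)"
        unfolding mult.assoc using Suc.IH[of \<theta>'] \<theta>' Suc.prems unfolding s(3)
        by (intro nn_integral_mono mult_mono ennreal_leI cmp) auto
      finally show ?thesis .
    qed simp
    have "?\<psi> (Suc j) x * u (a + s - 1) \<theta> \<le> ?\<psi> (Suc j) x * (\<integral>\<^sup>+ \<theta>'. u (a + s) \<theta>' \<partial>K (a + s) \<theta>)"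
      using s Suc.prems by (intro mult_left_mono sub) auto
    also have "\<dots> = (\<integral>\<^sup>+ \<theta>'. ?\<psi> (Suc j) x * u (a + s) \<theta>' \<partial>K (a + s) \<theta>)"
      using s by (intro nn_integral_cmult[symmetric] meas_KI t Suc.prems u) auto
    also have "\<dots> \<le> (\<integral>\<^sup>+ \<theta>'. \<integral>\<^sup>+ x'. ennreal (G s \<theta>' x x') * run (a + s) j (\<lambda>z. u (a + T) (fst z)) (\<theta>', x') \<partial>L \<partial>K (a + s) \<theta>)"
      by (intro nn_integral_mono inner) (simp add: space_K[OF t Suc.prems(2)])
    also have "\<dots> = run (a + (T - Suc j)) (Suc j) (\<lambda>z. u (a + T) (fst z)) (\<theta>, x)"
      unfolding chain_Suc_left as by (simp add: stp_def ph)
    finally show ?case unfolding s(4) .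
  qed simp
  from claim[of T \<theta> x] \<theta> show ?thesis by (simp add: tilted_lik_def)
qed

text \<open>The factors of the blocks multiply because \<open>q\<close> bounds the tilted likelihood
  from below for every starting state.\<close>

lemma lower_blocks:
  assumes u: "\<And>t. t \<in> {k * T + 1..(k + N) * T} \<Longrightarrow> u t \<in> borel_measurable borel" and r: "0 \<le> r" and q: "\<And>x. q \<le> tilted_lik L G \<phi> T \<theta>h (- g r) x"
    and supp: "\<And>t \<theta>. t \<in> {k * T + 1..(k + N) * T} \<Longrightarrow> \<theta> \<in> \<Theta> \<Longrightarrow> u t \<theta> \<noteq> 0 \<Longrightarrow> norm (\<theta> - \<theta>h) \<le> r"
    and sub: "\<And>t \<theta>. t \<in> {k * T + 1..(k + N) * T} \<Longrightarrow> \<theta> \<in> \<Theta> \<Longrightarrow> u (t - 1) \<theta> \<le> (\<integral>\<^sup>+ \<theta>'. u t \<theta>' \<partial>K t \<theta>)"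
    and \<theta>: "\<theta> \<in> \<Theta>"
  shows "q ^ N * u (k * T) \<theta> \<le> run (k * T) (N * T) (\<lambda>z. u ((k + N) * T) (fst z)) (\<theta>, x)"
  using u supp sub \<theta>
proof (induction N arbitrary: k \<theta> x)
  case (Suc N)
  have le: "(Suc k + N) * T = (k + Suc N) * T" by simp
  have sub1: "{k * T + 1..k * T + T} \<subseteq> {k * T + 1..(k + Suc N) * T}" by (auto simp: algebra_simps intro: trans_le_add1)
  have sub2: "{Suc k * T + 1..(Suc k + N) * T} \<subseteq> {k * T + 1..(k + Suc N) * T}" by auto
  have "q ^ Suc N * u (k * T) \<theta> = q ^ N * (q * u (k * T) \<theta>)" by (simp add: mult_ac)
  also have "\<dots> \<le> q ^ N * (tilted_lik L G \<phi> T \<theta>h (- g r) x * u (k * T) \<theta>)"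
    by (intro mult_left_mono mult_right_mono q) auto
  also have "\<dots> \<le> q ^ N * run (k * T) T (\<lambda>z. u (k * T + T) (fst z)) (\<theta>, x)"
    using Suc.prems(1)[OF subsetD[OF sub1]] Suc.prems(2)[OF subsetD[OF sub1]] Suc.prems(3)[OF subsetD[OF sub1]] Suc.prems(4)
    by (intro mult_left_mono lower_block[OF refl] r) auto
  also have "\<dots> = run (k * T) T (\<lambda>z. q ^ N * u (Suc k * T) (fst z) + 0 * 0) (\<theta>, x)"
    using T by (subst run_lin) (auto intro!: Suc.prems(4) fst_meas Suc.prems(1)[OF subsetD[OF sub1]] simp: add.commute)
  also have "\<dots> \<le> run (k * T) T (run (Suc k * T) (N * T) (\<lambda>z. u ((Suc k + N) * T) (fst z))) (\<theta>, x)"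
    using Suc.prems(1)[OF subsetD[OF sub2]] Suc.prems(2)[OF subsetD[OF sub2]] Suc.prems(3)[OF subsetD[OF sub2]] Suc.prems(4) Suc.IH[of "Suc k"]
    by (intro run_mono) auto
  also have "\<dots> = run (k * T) (Suc N * T) (\<lambda>z. u ((k + Suc N) * T) (fst z)) (\<theta>, x)"
    unfolding le using chain_add[of stp "k * T" T "N * T"] by (simp add: add.commute)
  finally show ?case .
qed simp

end

section \<open>Truncated Gaussian and Student kernels\<close>

lemma ennreal_divide_cmult:
  fixes A B :: ennreal
  assumes c: "0 < c" and B: "B \<noteq> 0" "B \<noteq> top"
  shows "(ennreal c * A) / (ennreal c * B) = A / B"
proof -
  have AB: "A = (A / B) * B" using B by (simp add: ennreal_divide_times less_top ennreal_divide_self mult_divide_eq_ennreal)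
  have "(ennreal c * A) / (ennreal c * B) = ((A / B) * (ennreal c * B)) / (ennreal c * B)"
    by (subst (1) AB) (simp add: mult_ac)
  also have "\<dots> = A / B"
    using B c by (intro mult_divide_eq_ennreal) (auto simp: ennreal_mult_eq_top_iff)
  finally show ?thesis .
qed

lemma le_divide_ennrealI:
  fixes A B m :: ennreal
  assumes "B * m \<le> A" "m \<noteq> 0" "m \<noteq> top" shows "B \<le> A / m"
  using divide_right_mono_ennreal[OF assms(1), of m] assms(2,3) by (simp add: mult_divide_eq_ennreal)

section \<open>Rescaling and Gaussian integrals\<close>

lemma nn_integral_scaled:
  fixes \<theta> :: "real ^ 'd"
  assumes [measurable]: "H \<in> borel_measurable borel" and h: "0 < h"
  shows "(\<integral>\<^sup>+ u. H ((1 / h) *\<^sub>R (u - \<theta>)) \<partial>lborel) = ennreal (h ^ CARD('d)) * (\<integral>\<^sup>+ v. H v \<partial>lborel)"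
proof -
  have "(\<integral>\<^sup>+ u. H ((1 / h) *\<^sub>R (u - \<theta>)) \<partial>lborel) =
    (\<integral>\<^sup>+ u. H ((1 / h) *\<^sub>R (u - \<theta>)) \<partial>density (distr lborel borel (\<lambda>x. \<theta> + h *\<^sub>R x)) (\<lambda>_. ennreal (\<bar>h\<bar> ^ CARD('d))))"
    using lborel_affine[of h \<theta>] h by simp
  also have "\<dots> = (\<integral>\<^sup>+ v. ennreal (\<bar>h\<bar> ^ CARD('d)) * H v \<partial>lborel)"
    using h by (simp add: nn_integral_density nn_integral_distr)
  also have "\<dots> = ennreal (h ^ CARD('d)) * (\<integral>\<^sup>+ v. H v \<partial>lborel)"
    using h by (simp add: nn_integral_cmult)
  finally show ?thesis .
qed

lemma nn_integral_gaussian_finite: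
  assumes c: "0 < c"
  shows "(\<integral>\<^sup>+ v. ennreal (exp (- c * (norm (v :: real ^ 'd))\<^sup>2)) \<partial>lborel) < \<infinity>"
proof -
  define \<sigma> where "\<sigma> = sqrt (1 / (2 * c))"
  have \<sigma>: "0 < \<sigma>" "\<sigma>\<^sup>2 = 1 / (2 * c)" using c by (auto simp: \<sigma>_def)
  define k where "k = sqrt (2 * pi * \<sigma>\<^sup>2)"
  have k: "0 < k" using \<sigma> c by (simp add: k_def)
  have one: "(\<integral>\<^sup>+ x. ennreal (exp (- c * x\<^sup>2)) \<partial>lborel) = ennreal k"
  proof -
    have "(\<integral>\<^sup>+ x. ennreal (exp (- c * x\<^sup>2)) \<partial>lborel) = (\<integral>\<^sup>+ x. ennreal k * ennreal (normal_density 0 \<sigma> x) \<partial>lborel)"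
    proof (rule nn_integral_cong)
      fix x :: real
      have e: "- (x - 0)\<^sup>2 / (2 * \<sigma>\<^sup>2) = - c * x\<^sup>2" using \<sigma>(2) c by simp
      have "exp (- c * x\<^sup>2) = k * normal_density 0 \<sigma> x"
        unfolding normal_density_def k_def[symmetric] e using k by simp
      then show "ennreal (exp (- c * x\<^sup>2)) = ennreal k * ennreal (normal_density 0 \<sigma> x)"
        using k by (simp add: ennreal_mult'')
    qed
    also have "\<dots> = ennreal k * (\<integral>\<^sup>+ x. ennreal (normal_density 0 \<sigma> x) \<partial>lborel)"
      by (rule nn_integral_cmult) simp
    also have "(\<integral>\<^sup>+ x. ennreal (normal_density 0 \<sigma> x) \<partial>lborel) = 1"
      using prob_space.emeasure_space_1[OF prob_space_normal_density[OF \<sigma>(1), of 0]]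
      by (simp add: emeasure_density)
    finally show ?thesis by simp
  qed
  have "(\<integral>\<^sup>+ v. ennreal (exp (- c * (norm (v :: real ^ 'd))\<^sup>2)) \<partial>lborel) =
    (\<integral>\<^sup>+ v. (\<Prod>b\<in>Basis. ennreal (exp (- c * ((v :: real ^ 'd) \<bullet> b)\<^sup>2))) \<partial>lborel)"
  proof (rule nn_integral_cong)
    fix v :: "real ^ 'd"
    have "(norm v)\<^sup>2 = (\<Sum>b\<in>Basis. (v \<bullet> b)\<^sup>2)"
      by (simp add: norm_eq_sqrt_inner euclidean_inner[of v v] power2_eq_square[symmetric] sum_nonneg)
    then show "ennreal (exp (- c * (norm v)\<^sup>2)) = (\<Prod>b\<in>Basis. ennreal (exp (- c * (v \<bullet> b)\<^sup>2)))"
      by (simp add: prod_ennreal exp_sum[symmetric] sum_distrib_left sum_negf)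
  qed
  also have "\<dots> = (\<Prod>b\<in>(Basis :: (real ^ 'd) set). ennreal k)"
    by (subst nn_integral_lborel_prod) (simp_all add: one[simplified])
  also have "\<dots> < \<infinity>" by (simp add: ennreal_power power_less_top_ennreal)
  finally show ?thesis .
qed

text \<open>The function \<open>norm v * exp (norm v)\<close> is the common envelope for the errors
  of a Gaussian step, both for exponential weights and for the mean displacement. Half of the
  Gaussian decay suffices to absorb it.\<close>

lemma nn_integral_gaussian_tilt_finite:
  assumes a: "0 < a"
  shows "(\<integral>\<^sup>+ v. ennreal (norm (v :: real ^ 'd) * exp (norm v) * exp (- a * (norm v)\<^sup>2)) \<partial>lborel) < \<infinity>"
proof -
  have pw: "x * exp x * exp (- a * x\<^sup>2) \<le> exp (2 / a) * exp (- (a / 2) * x\<^sup>2)" if "0 \<le> x" for x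
  proof -
    have "x \<le> exp x" using exp_ge_add_one_self[of x] by linarith
    then have "x * exp x * exp (- a * x\<^sup>2) \<le> exp x * exp x * exp (- a * x\<^sup>2)"
      by (intro mult_right_mono) auto
    also have "\<dots> = exp (2 * x - a * x\<^sup>2)" by (simp add: exp_add[symmetric] mult_exp_exp)
    also have "\<dots> \<le> exp (2 / a - (a / 2) * x\<^sup>2)"
    proof -
      \<comment> \<open>Completing the square; this is where the constant \<open>2 / a\<close> comes
        from.\<close>
      have "0 \<le> (a * x - 2)\<^sup>2 / (2 * a)" using a by simp
      also have "\<dots> = 2 / a - (a / 2) * x\<^sup>2 - (2 * x - a * x\<^sup>2)"
        using a by (simp add: power2_eq_square field_simps)
      finally show ?thesis by simp
    qed
    finally show ?thesis by (simp add: mult_exp_exp)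
  qed
  have "(\<integral>\<^sup>+ v. ennreal (norm (v :: real ^ 'd) * exp (norm v) * exp (- a * (norm v)\<^sup>2)) \<partial>lborel) \<le>
    (\<integral>\<^sup>+ v. ennreal (exp (2 / a)) * ennreal (exp (- (a / 2) * (norm (v :: real ^ 'd))\<^sup>2)) \<partial>lborel)"
    using pw by (intro nn_integral_mono) (simp add: ennreal_mult''[symmetric] ennreal_leI)
  also have "\<dots> = ennreal (exp (2 / a)) * (\<integral>\<^sup>+ v. ennreal (exp (- (a / 2) * (norm (v :: real ^ 'd))\<^sup>2)) \<partial>lborel)"
    by (rule nn_integral_cmult) simp
  also have "\<dots> < \<infinity>"
    using nn_integral_gaussian_finite[of "a / 2", where 'd = 'd] a by (simp add: ennreal_mult_less_top)
  finally show ?thesis .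
qed

section \<open>Positive definite matrices and their quadratic forms\<close>

lemma spd_matrix_mult_neq_0: "spd_matrix S \<Longrightarrow> v \<noteq> 0 \<Longrightarrow> S *v v \<noteq> 0"
  by (auto simp: spd_matrix_def)

lemma spd_matrix_det_neq_0:
  assumes "\<And>v :: real ^ 'd. v \<noteq> 0 \<Longrightarrow> S *v v \<noteq> 0"
  shows "det S \<noteq> 0"
  using assms by (metis det_nz_iff_inj matrix_vector_mul_linear matrix_vector_mult_0_right
      matrix_of_matrix_vector_mul linear_injective_0)

text \<open>The segment from the identity to \<open>S\<close> consists of positive definite, hence
  invertible, matrices. Along it the determinant is continuous, starts at 1 and never vanishes, so
  it cannot change sign.\<close>

lemma spd_matrix_det_pos:
  fixes S :: "real ^ 'd ^ 'd"
  assumes S: "spd_matrix S"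
  shows "0 < det S"
proof (rule ccontr)
  assume "\<not> 0 < det S"
  define M where "M = (\<lambda>t::real. (\<chi> i j. t * (S $ i $ j) + (1 - t) * (if i = j then 1 else 0)) :: real ^ 'd ^ 'd)"
  have M: "M t = t *\<^sub>R S + (1 - t) *\<^sub>R mat 1" for t
    by (simp add: M_def vec_eq_iff mat_def)
  have cont: "continuous_on {0..1} (\<lambda>t. det (M t))"
    unfolding det_def M_def by (intro continuous_intros)
  have "\<exists>t\<ge>0. t \<le> 1 \<and> det (M t) = 0"
    using \<open>\<not> 0 < det S\<close> by (intro IVT2' cont) (auto simp: M)
  then obtain t where t: "0 \<le> t" "t \<le> 1" "det (M t) = 0" by auto
  have "M t *v v \<noteq> 0" if "v \<noteq> 0" for v
  proof -
    have "v \<bullet> (M t *v v) = t * (v \<bullet> (S *v v)) + (1 - t) * (v \<bullet> v)"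
      unfolding M by (simp add: matrix_vector_mult_add_rdistrib scaleR_matrix_vector_assoc[symmetric] inner_add_right)
    moreover have "0 < v \<bullet> (S *v v)" "0 < v \<bullet> v" using S that by (auto simp: spd_matrix_def)
    ultimately have "0 < v \<bullet> (M t *v v)"
      using t by (cases "t = 0") (auto intro!: add_pos_nonneg)
    then show ?thesis by auto
  qed
  from spd_matrix_det_neq_0[OF this] t show False by simp
qed

lemma spd_matrix_scaleR: "spd_matrix S \<Longrightarrow> 0 < c \<Longrightarrow> spd_matrix (c *\<^sub>R S)"
  by (auto simp: spd_matrix_def scaleR_matrix_vector_assoc[symmetric] transpose_scalar)

lemma matrix_inv_right_left:
  fixes S :: "real ^ 'd ^ 'd"
  assumes "det S \<noteq> 0"
  shows "S ** matrix_inv S = mat 1" "matrix_inv S ** S = mat 1"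
proof -
  have "\<exists>B. S ** B = mat 1 \<and> B ** S = mat 1"
    using assms invertible_det_nz[of S] unfolding invertible_def by blast
  from someI_ex[OF this] show "S ** matrix_inv S = mat 1" "matrix_inv S ** S = mat 1"
    unfolding matrix_inv_def by auto
qed

lemma matrix_inv_scaleR:
  fixes S :: "real ^ 'd ^ 'd"
  assumes S: "spd_matrix S" and c: "0 < c"
  shows "matrix_inv (c *\<^sub>R S) = (1 / c) *\<^sub>R matrix_inv S"
proof -
  have d: "det S \<noteq> 0" "det (c *\<^sub>R S) \<noteq> 0"
    using spd_matrix_det_pos[OF S] spd_matrix_det_pos[OF spd_matrix_scaleR[OF S c]] by auto
  have "(c *\<^sub>R S) ** ((1 / c) *\<^sub>R matrix_inv S) = mat 1"
    using matrix_inv_right_left(1)[OF d(1)] c by (simp add: matrix_scalar_ac scalar_matrix_assoc[symmetric])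
  then have "matrix_inv (c *\<^sub>R S) ** ((c *\<^sub>R S) ** ((1 / c) *\<^sub>R matrix_inv S)) = matrix_inv (c *\<^sub>R S)"
    by simp
  then show ?thesis
    unfolding matrix_mul_assoc matrix_inv_right_left(2)[OF d(2)] by simp
qed

text \<open>The squared Mahalanobis norm belonging to \<open>S\<close>; both the Gaussian and the
  Student density are functions of it.\<close>

definition qform :: "real ^ 'd ^ 'd \<Rightarrow> real ^ 'd \<Rightarrow> real" where
  "qform S v = v \<bullet> (matrix_inv S *v v)"

text \<open>With \<open>w = matrix_inv S *v v\<close>, so that \<open>v = S *v w\<close>, the form
  at \<open>v\<close> equals the form of \<open>S\<close> itself at \<open>w\<close>.\<close>

lemma qform_pos:
  assumes S: "spd_matrix S" and v: "v \<noteq> 0"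
  shows "0 < qform S v"
proof -
  let ?w = "matrix_inv S *v v"
  have d: "det S \<noteq> 0" using spd_matrix_det_pos[OF S] by auto
  have Sw: "S *v ?w = v"
    using matrix_inv_right_left(1)[OF d] by (simp add: matrix_vector_mul_assoc)
  then have "?w \<noteq> 0" using v by auto
  then have "0 < ?w \<bullet> (S *v ?w)" using S by (auto simp: spd_matrix_def)
  then show ?thesis unfolding Sw qform_def by (simp add: inner_commute)
qed

lemma qform_scaleR: "qform S (c *\<^sub>R v) = c\<^sup>2 * qform S v"
  by (simp add: qform_def matrix_vector_mult_scaleR power2_eq_square)

lemma continuous_on_qform: "continuous_on A (qform S)"
  unfolding qform_def
  by (intro continuous_intros linear_continuous_on_compose[OF continuous_on_id matrix_vector_mul_linear])

text \<open>The form is homogeneous of degree two, so its extreme values on the compact unit sphere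
  serve as constants.\<close>

lemma qform_bounds:
  fixes S :: "real ^ 'd ^ 'd"
  assumes S: "spd_matrix S"
  obtains a b where "0 < a" "0 < b" "\<And>v. a * (norm v)\<^sup>2 \<le> qform S v" "\<And>v. qform S v \<le> b * (norm v)\<^sup>2"
proof -
  let ?S = "sphere 0 1 :: (real ^ 'd) set"
  have ne: "?S \<noteq> {}" by (metis norm_axis_1 mem_sphere_0 empty_iff)
  obtain x where x: "x \<in> ?S" "\<And>y. y \<in> ?S \<Longrightarrow> qform S x \<le> qform S y"
    using continuous_attains_inf[OF compact_sphere ne continuous_on_qform] by blast
  obtain z where z: "z \<in> ?S" "\<And>y. y \<in> ?S \<Longrightarrow> qform S y \<le> qform S z"
    using continuous_attains_sup[OF compact_sphere ne continuous_on_qform] by blast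
  have sc: "qform S v = (norm v)\<^sup>2 * qform S ((1 / norm v) *\<^sub>R v)" "(1 / norm v) *\<^sub>R v \<in> ?S" if "v \<noteq> 0" for v
    using that by (auto simp: qform_scaleR field_simps)
  show thesis
  proof
    show "0 < qform S x" "0 < qform S z" using x z qform_pos[OF S] by (metis mem_sphere_0 norm_zero zero_neq_one)+
    fix v :: "real ^ 'd"
    show "qform S x * (norm v)\<^sup>2 \<le> qform S v"
    proof (cases "v = 0")
      case False
      show ?thesis unfolding sc(1)[OF False] mult.commute[of _ "(norm v)\<^sup>2"]
        by (intro mult_left_mono x sc False) simp
    qed (simp add: qform_def)
    show "qform S v \<le> qform S z * (norm v)\<^sup>2"
    proof (cases "v = 0")
      case False
      show ?thesis unfolding sc(1)[OF False] mult.commute[of _ "(norm v)\<^sup>2"]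
        by (intro mult_left_mono z sc False) simp
    qed (simp add: qform_def)
  qed
qed

text \<open>The radius \<open>f\<close> does not depend on the point, not even at the boundary of
  \<Theta>. This bounds the normalising mass of a truncated kernel from below where no ball around
  its centre fits into \<Theta>.\<close>

lemma regular_compactD:
  assumes "regular_compact \<Theta>" "0 < e"
  obtains f where "0 < f" "\<And>x. x \<in> \<Theta> \<Longrightarrow> \<exists>x'. ball x' f \<subseteq> ball x e \<inter> \<Theta>"
proof -
  from assms obtain F where F: "\<forall>\<epsilon>>0. F \<epsilon> > (0::real)"
    "\<forall>\<epsilon>>0. \<forall>x\<in>\<Theta>. \<exists>x'\<in>\<Theta>. {u. norm (u - x') < F \<epsilon>} \<subseteq> {u. norm (u - x) < \<epsilon>} \<inter> \<Theta>"
    unfolding regular_compact_def by blast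
  have *: "{u. norm (u - x) < r} = ball x r" for x :: "real ^ 'a" and r
    by (auto simp: dist_norm norm_minus_commute)
  from F assms(2) that[of "F e"] show thesis unfolding * by blast
qed

section \<open>Truncated kernels obtained by rescaling a fixed profile\<close>

text \<open>Densities are only needed up to a constant, which the truncation removes.\<close>

locale scaled_kernel =
  fixes \<Theta> :: "(real ^ 'd) set" and \<kappa> :: "real ^ 'd \<Rightarrow> real"
  assumes cpt: "compact \<Theta>" and int: "interior \<Theta> \<noteq> {}"
    and \<kappa>_meas [measurable]: "\<kappa> \<in> borel_measurable borel" and \<kappa>_pos: "\<And>v. 0 < \<kappa> v" and \<kappa>_le: "\<And>v. \<kappa> v \<le> 1"
begin

definition mass :: "real ^ 'd \<Rightarrow> real \<Rightarrow> (real ^ 'd \<Rightarrow> ennreal) \<Rightarrow> ennreal" where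
  "mass \<theta> h F = (\<integral>\<^sup>+ u. F u * ennreal (\<kappa> ((1 / h) *\<^sub>R (u - \<theta>))) * indicator \<Theta> u \<partial>lborel)"

lemma sets_\<Theta> [measurable, simp]: "\<Theta> \<in> sets borel"
  using cpt by (simp add: borel_compact)

lemma vol_fin: "emeasure lborel \<Theta> < \<infinity>"
  using emeasure_compact_finite[OF cpt] by (simp add: less_top)

lemma vol_pos: "0 < emeasure lborel \<Theta>"
proof -
  obtain x where "x \<in> interior \<Theta>" using int by auto
  then obtain e where e: "0 < e" "ball x e \<subseteq> \<Theta>" by (auto simp: mem_interior)
  have "0 < emeasure lborel (ball x e)" using e by (simp add: emeasure_ball)
  also have "\<dots> \<le> emeasure lborel \<Theta>" by (intro emeasure_mono e) simp
  finally show ?thesis .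
qed

lemma mass_mono: "(\<And>u. u \<in> \<Theta> \<Longrightarrow> F u \<le> H u) \<Longrightarrow> mass \<theta> h F \<le> mass \<theta> h H"
  unfolding mass_def by (intro nn_integral_mono) (auto simp: indicator_def intro: mult_right_mono)

lemma mass_1_fin: "mass \<theta> h (\<lambda>_. 1) \<noteq> top"
proof -
  have "mass \<theta> h (\<lambda>_. 1) \<le> (\<integral>\<^sup>+ u. indicator \<Theta> u \<partial>lborel)"
    unfolding mass_def using \<kappa>_le by (intro nn_integral_mono) (auto simp: indicator_def ennreal_le_1)
  also have "\<dots> < top" using vol_fin by simp
  finally show ?thesis by simp
qed

lemma mass_1_pos: "mass \<theta> h (\<lambda>_. 1) \<noteq> 0"
proof
  have k: "ennreal (\<kappa> v) \<noteq> 0" for v using \<kappa>_pos[of v] by (simp add: ennreal_eq_0_iff not_le)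
  assume "mass \<theta> h (\<lambda>_. 1) = 0"
  then have "AE u in lborel. indicator \<Theta> u = (0::ennreal)"
    unfolding mass_def by (subst (asm) nn_integral_0_iff_AE) (auto simp: k)
  then have "(\<integral>\<^sup>+ u. indicator \<Theta> u \<partial>lborel) = (0::ennreal)"
    by (subst nn_integral_0_iff_AE) auto
  then show False using vol_pos by simp
qed

lemma nn_integral_truncate:
  assumes c: "0 < c" and d: "\<And>u. d u = c * \<kappa> ((1 / h) *\<^sub>R (u - \<theta>))" and [measurable]: "F \<in> borel_measurable borel"
  shows "(\<integral>\<^sup>+ u. F u \<partial>truncate_to \<Theta> (density lborel (\<lambda>u. ennreal (d u)))) = mass \<theta> h F / mass \<theta> h (\<lambda>_. 1)"
proof -
  have [measurable]: "d \<in> borel_measurable borel" unfolding d[abs_def] by measurable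
  let ?D = "density lborel (\<lambda>u. ennreal (d u))"
  have eq: "(\<integral>\<^sup>+ u. F u * indicator \<Theta> u \<partial>?D) = ennreal c * mass \<theta> h F" if [measurable]: "F \<in> borel_measurable borel" for F
    unfolding mass_def using c
    by (subst nn_integral_density, simp, simp, subst nn_integral_cmult[symmetric])
       (auto intro!: nn_integral_cong simp: d ennreal_mult' less_imp_le[OF \<kappa>_pos] mult_ac)
  have "emeasure ?D \<Theta> = (\<integral>\<^sup>+ u. 1 * indicator \<Theta> u \<partial>?D)" by simp
  also have "\<dots> = ennreal c * mass \<theta> h (\<lambda>_. 1)" by (rule eq) simp
  finally have em: "emeasure ?D \<Theta> = ennreal c * mass \<theta> h (\<lambda>_. 1)" .
  have "(\<integral>\<^sup>+ u. F u \<partial>truncate_to \<Theta> ?D) = (\<integral>\<^sup>+ u. F u * indicator \<Theta> u \<partial>uniform_measure ?D \<Theta>)"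
    unfolding truncate_to_def by (subst nn_integral_restrict_space) auto
  also have "\<dots> = (\<integral>\<^sup>+ u. F u * indicator \<Theta> u * indicator \<Theta> u \<partial>?D) / emeasure ?D \<Theta>"
    by (rule nn_integral_uniform_measure) auto
  also have "(\<integral>\<^sup>+ u. F u * indicator \<Theta> u * indicator \<Theta> u \<partial>?D) = (\<integral>\<^sup>+ u. F u * indicator \<Theta> u \<partial>?D)"
    by (intro nn_integral_cong) (auto simp: indicator_def)
  finally show ?thesis
    unfolding em eq[OF assms(3)] using c mass_1_pos mass_1_fin by (simp add: ennreal_divide_cmult)
qed

lemma mass_ball_ge:
  assumes "ball x r \<subseteq> \<Theta>" "0 \<le> r" "\<And>u. u \<in> ball x r \<Longrightarrow> k \<le> \<kappa> ((1 / h) *\<^sub>R (u - \<theta>))" "\<And>u. u \<in> ball x r \<Longrightarrow> F u = 1" "0 \<le> k"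
  shows "ennreal (k * (unit_ball_vol (CARD('d)) * r ^ CARD('d))) \<le> mass \<theta> h F"
proof -
  have "ennreal (k * (unit_ball_vol (CARD('d)) * r ^ CARD('d))) = (\<integral>\<^sup>+ u. ennreal k * indicator (ball x r) u \<partial>lborel)"
    using assms(2,5) emeasure_ball[OF assms(2), of x] by (simp add: nn_integral_cmult_indicator ennreal_mult'')
  also have "\<dots> \<le> mass \<theta> h F"
    unfolding mass_def using assms by (intro nn_integral_mono) (auto simp: indicator_def intro!: ennreal_leI)
  finally show ?thesis .
qed

end

lemma powr_divide_square:
  fixes B h p :: real
  assumes "0 < B" "0 < h"
  shows "(B / h\<^sup>2) powr (- p) = B powr (- p) * h powr (2 * p)"
proof -
  have "h\<^sup>2 = h powr 2" using assms by (simp add: powr_numeral)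
  then have "h\<^sup>2 powr (- p) = h powr (- (2 * p))" by (simp add: powr_powr)
  moreover have "(B / h\<^sup>2) powr (- p) = B powr (- p) / h\<^sup>2 powr (- p)" using assms by (simp add: powr_divide)
  ultimately show ?thesis by (simp add: powr_minus[of h "2 * p"] divide_inverse)
qed

section \<open>Gaussian steps: moments, long jumps, staying in a ball\<close>

locale gauss_kernel =
  fixes \<Theta> :: "(real ^ 'd) set" and V :: "real ^ 'd ^ 'd" and a b :: real
  assumes cpt_\<Theta>: "compact \<Theta>" and int_\<Theta>: "interior \<Theta> \<noteq> {}" and spd: "spd_matrix V"
    and ab: "0 < a" "0 < b"
    and q_lower: "\<And>v. a * (norm v)\<^sup>2 \<le> qform V v / 2" and q_upper: "\<And>v. qform V v / 2 \<le> b * (norm v)\<^sup>2"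
begin

lemma q_nonneg: "0 \<le> qform V v"
  using q_lower[of v] ab by (smt (verit, best) mult_nonneg_nonneg zero_le_power2 field_sum_of_halves)

lemma q_meas [measurable]: "qform V \<in> borel_measurable borel"
  by (intro borel_measurable_continuous_onI continuous_on_qform)

lemma V_neq_0: "V \<noteq> 0"
proof
  assume "V = 0"
  then have "det V = 0" using spd_matrix_mult_neq_0[OF spd, of "axis undefined 1"] by (simp add: axis_eq_0_iff)
  then show False using spd_matrix_det_pos[OF spd] by simp
qed

sublocale scaled_kernel \<Theta> "\<lambda>v. exp (- qform V v / 2)"
  by standard (use cpt_\<Theta> int_\<Theta> q_nonneg in auto)

lemma qform_scaled:
  assumes h: "0 < h"
  shows "(u - \<theta>) \<bullet> (matrix_inv (h\<^sup>2 *\<^sub>R V) *v (u - \<theta>)) = qform V ((1 / h) *\<^sub>R (u - \<theta>))"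
  using h matrix_inv_scaleR[OF spd, of "h\<^sup>2"]
  by (simp add: qform_scaleR) (simp add: qform_def scaleR_matrix_vector_assoc[symmetric] power_divide)

lemma det_scaled_pos: "0 < h \<Longrightarrow> 0 < det (h\<^sup>2 *\<^sub>R V)"
  by (intro spd_matrix_det_pos spd_matrix_scaleR spd) simp

lemma nn_integral_TN:
  assumes h: "0 < h" and F: "F \<in> borel_measurable borel"
  shows "(\<integral>\<^sup>+ u. F u \<partial>TN \<Theta> \<theta> (h\<^sup>2 *\<^sub>R V)) = mass \<theta> h F / mass \<theta> h (\<lambda>_. 1)"
proof -
  have "(\<integral>\<^sup>+ u. F u \<partial>truncate_to \<Theta> (density lborel (\<lambda>u. ennreal (mvn_density \<theta> (h\<^sup>2 *\<^sub>R V) u)))) =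
    mass \<theta> h F / mass \<theta> h (\<lambda>_. 1)"
    by (rule nn_integral_truncate[where c = "1 / sqrt ((2 * pi) ^ CARD('d) * det (h\<^sup>2 *\<^sub>R V))", OF _ _ F])
       (simp_all add: mvn_density_def qform_scaled h det_scaled_pos)
  then show ?thesis using h V_neq_0 by (simp add: TN_def)
qed

lemma nn_integral_TN_0:
  assumes "\<theta> \<in> \<Theta>" "F \<in> borel_measurable borel"
  shows "(\<integral>\<^sup>+ u. F u \<partial>TN \<Theta> \<theta> (0\<^sup>2 *\<^sub>R V)) = F \<theta>"
  using assms by (simp add: TN_def nn_integral_return space_restrict_space measurable_restrict_space1)

text \<open>\<open>m0 * h ^ CARD('d)\<close> is a lower bound for the normalising mass when the ball
  of radius \<open>h\<close> around the centre fits into \<Theta>. \<open>J\<close> is the integral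
  of the envelope relative to it, so it bounds the mean of the envelope under a step from such a
  point, for every \<open>h\<close>.\<close>

definition "m0 = exp (- b) * unit_ball_vol (CARD('d))"
definition "J = enn2real (\<integral>\<^sup>+ v. ennreal (norm (v :: real ^ 'd) * exp (norm v) * exp (- a * (norm v)\<^sup>2)) \<partial>lborel) / m0"

lemma m0_pos: "0 < m0" by (simp add: m0_def)

lemma J_nonneg: "0 \<le> J" using m0_pos by (simp add: J_def)

lemma mass_1_ge:
  assumes "0 < h" "ball \<theta> h \<subseteq> \<Theta>"
  shows "ennreal (m0 * h ^ CARD('d)) \<le> mass \<theta> h (\<lambda>_. 1)"
proof -
  have "ennreal (exp (- b) * (unit_ball_vol (CARD('d)) * h ^ CARD('d))) \<le> mass \<theta> h (\<lambda>_. 1)"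
  proof (rule mass_ball_ge[OF assms(2)])
    fix u assume "u \<in> ball \<theta> h"
    then have "norm ((1 / h) *\<^sub>R (u - \<theta>)) \<le> 1" using assms(1) by (simp add: dist_norm norm_minus_commute)
    then have "b * (norm ((1 / h) *\<^sub>R (u - \<theta>)))\<^sup>2 \<le> b * 1"
      using ab by (intro mult_left_mono power_le_one) auto
    then show "exp (- b) \<le> exp (- qform V ((1 / h) *\<^sub>R (u - \<theta>)) / 2)"
      using q_upper[of "(1 / h) *\<^sub>R (u - \<theta>)"] by simp
  qed (use assms in auto)
  then show ?thesis by (simp add: m0_def mult.assoc)
qed

text \<open>The Jacobian of the rescaling and the lower bound of the normalising mass are both of
  order h to the dimension and cancel. Hence the error is \<open>e * J\<close> with \<open>J\<close>
  independent of the step size.\<close>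

lemma TN_near:
  assumes h: "0 < h" and near: "ball \<theta> h \<subseteq> \<Theta>" and A: "0 \<le> A" and e: "0 \<le> e"
    and [measurable]: "F \<in> borel_measurable borel"
    and le: "\<And>u. F u \<le> A + e * (norm (u - \<theta>) / h * exp (norm (u - \<theta>) / h))"
  shows "(\<integral>\<^sup>+ u. ennreal (F u) \<partial>TN \<Theta> \<theta> (h\<^sup>2 *\<^sub>R V)) \<le> ennreal (A + e * J)"
proof -
  let ?W = "\<lambda>v :: real ^ 'd. norm v * exp (norm v) * exp (- a * (norm v)\<^sup>2)"
  let ?v = "\<lambda>u. (1 / h) *\<^sub>R (u - \<theta>)"
  have W: "(\<integral>\<^sup>+ v. ennreal (?W v) \<partial>lborel) = ennreal (J * m0)"
    using nn_integral_gaussian_tilt_finite[OF ab(1), where 'd = 'd] m0_pos by (simp add: J_def)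
  have "mass \<theta> h (\<lambda>u. ennreal (F u)) \<le>
    (\<integral>\<^sup>+ u. ennreal A * (1 * ennreal (exp (- qform V (?v u) / 2)) * indicator \<Theta> u) + ennreal e * ennreal (?W (?v u)) \<partial>lborel)"
    unfolding mass_def
  proof (intro nn_integral_mono)
    fix u
    let ?k = "exp (- qform V (?v u) / 2)"
    have "F u * ?k \<le> (A + e * (norm (?v u) * exp (norm (?v u)))) * ?k"
      using le[of u] h by (intro mult_right_mono) auto
    also have "\<dots> = A * ?k + e * (norm (?v u) * exp (norm (?v u)) * ?k)"
      by (simp add: algebra_simps)
    also have "\<dots> \<le> A * ?k + e * ?W (?v u)"
      using q_lower[of "?v u"] e by (intro add_left_mono mult_left_mono) auto
    finally have "ennreal (F u) * ennreal ?k \<le> ennreal A * ennreal ?k + ennreal e * ennreal (?W (?v u))"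
      using A e by (simp add: ennreal_mult''[symmetric] ennreal_mult'[symmetric] ennreal_plus[symmetric] ennreal_leI del: ennreal_plus)
    then show "ennreal (F u) * ennreal ?k * indicator \<Theta> u \<le>
      ennreal A * (1 * ennreal ?k * indicator \<Theta> u) + ennreal e * ennreal (?W (?v u))"
      by (auto simp: indicator_def)
  qed
  also have "\<dots> = ennreal A * mass \<theta> h (\<lambda>_. 1) + ennreal e * (\<integral>\<^sup>+ u. ennreal (?W (?v u)) \<partial>lborel)"
    unfolding mass_def by (subst nn_integral_add) (auto simp: nn_integral_cmult)
  also have "(\<integral>\<^sup>+ u. ennreal (?W (?v u)) \<partial>lborel) = ennreal (h ^ CARD('d)) * ennreal (J * m0)"
    unfolding W[symmetric] by (rule nn_integral_scaled[where H = "\<lambda>v. ennreal (?W v)", OF _ h]) measurable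
  also have "ennreal e * (ennreal (h ^ CARD('d)) * ennreal (J * m0)) = ennreal (e * J) * ennreal (m0 * h ^ CARD('d))"
    using e J_nonneg m0_pos h by (simp add: ennreal_mult''[symmetric] ennreal_mult'[symmetric] mult_ac)
  also have "ennreal A * mass \<theta> h (\<lambda>_. 1) + \<dots> \<le> ennreal A * mass \<theta> h (\<lambda>_. 1) + ennreal (e * J) * mass \<theta> h (\<lambda>_. 1)"
    by (intro add_left_mono mult_left_mono mass_1_ge h near) auto
  also have "\<dots> = mass \<theta> h (\<lambda>_. 1) * ennreal (A + e * J)"
    using A e J_nonneg by (subst mult.commute) (simp add: distrib_right)
  finally have "mass \<theta> h (\<lambda>u. ennreal (F u)) / mass \<theta> h (\<lambda>_. 1) \<le> ennreal (A + e * J)"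
    using mass_1_pos by (intro divide_le_posI_ennreal) (auto simp: zero_less_iff_neq_zero)
  then show ?thesis by (subst nn_integral_TN[OF h]) simp_all
qed

text \<open>In terms of \<open>x = norm (u - \<theta>) / h\<close> both corrections to 1 are of
  first order in \<eta> times the envelope \<open>x * exp x\<close>: the exponential because
  \<open>lam * norm (u - \<theta>)\<close> is at most \<open>\<eta> * x\<close>, and the jump
  penalty because a jump beyond \<open>w\<close> forces
  \<open>1 \<le> \<eta> * x / w\<close>.\<close>

lemma TN_exp_moment:
  assumes h: "0 \<le> h" "h \<le> \<eta>" and \<eta>: "0 < \<eta>" "\<eta> \<le> 1" and lam: "0 \<le> lam" "lam * h \<le> \<eta>"
    and R: "0 \<le> R" and w: "0 < w" and near: "ball \<theta> \<eta> \<subseteq> \<Theta>"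
  shows "(\<integral>\<^sup>+ u. ennreal (exp (lam * norm (u - \<theta>)) * (1 + R * indicator {u. norm (u - \<theta>) > w} u)) \<partial>TN \<Theta> \<theta> (h\<^sup>2 *\<^sub>R V))
    \<le> ennreal (1 + \<eta> * (1 + R / w) * J)"
proof (cases "h = 0")
  case True
  have "\<theta> \<in> \<Theta>" using near \<eta> by auto
  moreover have "1 \<le> 1 + \<eta> * (1 + R / w) * J" using \<eta> R w J_nonneg by simp
  ultimately show ?thesis using w unfolding True by (subst nn_integral_TN_0) (auto simp: ennreal_leI simp flip: ennreal_1)
next
  case False
  then have h0: "0 < h" using h by simp
  have nh: "ball \<theta> h \<subseteq> \<Theta>" using near h subset_ball[of h \<eta> \<theta>] by auto
  show ?thesis
  proof (rule TN_near[OF h0 nh])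
    fix u
    define x where "x = norm (u - \<theta>) / h"
    have x: "0 \<le> x" "norm (u - \<theta>) = h * x" using h0 by (auto simp: x_def)
    have lx: "lam * norm (u - \<theta>) \<le> \<eta> * x" using mult_right_mono[OF lam(2) x(1)] by (simp add: x(2) mult.assoc)
    have \<eta>x: "\<eta> * x \<le> x" using \<eta> x mult_right_mono[of \<eta> 1 x] by simp
    have "exp (\<eta> * x) \<le> 1 + \<eta> * x * exp (\<eta> * x)"
    proof -
      \<comment> \<open>This is \<open>1 - y \<le> exp (- y)\<close> multiplied by
        \<open>exp y\<close>, which rearranges to \<open>exp y \<le> 1 + y * exp y\<close>.\<close>
      have "exp (\<eta> * x) * (1 - \<eta> * x) \<le> exp (\<eta> * x) * exp (- (\<eta> * x))"
        using exp_ge_add_one_self[of "- (\<eta> * x)"] by (intro mult_left_mono) auto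
      then show ?thesis by (simp add: exp_minus algebra_simps)
    qed
    also have "\<dots> \<le> 1 + \<eta> * x * exp x"
      using \<eta> x \<eta>x by (intro add_left_mono mult_left_mono) auto
    finally have e1: "exp (lam * norm (u - \<theta>)) \<le> 1 + \<eta> * (x * exp x)"
      using lx by (simp add: mult.assoc order_trans[OF exp_le_cancel_iff[THEN iffD2]])
    have e2: "exp (lam * norm (u - \<theta>)) * (R * indicator {u. norm (u - \<theta>) > w} u) \<le> \<eta> * (R / w) * (x * exp x)"
    proof (cases "norm (u - \<theta>) > w")
      case True
      then have "w \<le> \<eta> * x" using h \<eta> x mult_right_mono[OF h(2) x(1)] by simp
      then have "1 \<le> \<eta> * x / w" using w by simp
      moreover have "exp (lam * norm (u - \<theta>)) \<le> exp x" using lx \<eta>x by simp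
      ultimately have "exp (lam * norm (u - \<theta>)) * 1 \<le> exp x * (\<eta> * x / w)" by (intro mult_mono) auto
      then have "exp (lam * norm (u - \<theta>)) * R \<le> exp x * (\<eta> * x / w) * R" using R by (intro mult_right_mono) auto
      then show ?thesis using True by (simp add: mult_ac)
    qed (use \<eta> R w x in auto)
    show "exp (lam * norm (u - \<theta>)) * (1 + R * indicator {u. norm (u - \<theta>) > w} u) \<le>
      1 + \<eta> * (1 + R / w) * (norm (u - \<theta>) / h * exp (norm (u - \<theta>) / h))"
      using e1 e2 unfolding x_def[symmetric] by (simp add: algebra_simps)
  qed (use \<eta> R w in auto)
qed

lemma TN_mean_step:
  assumes h: "0 \<le> h" and near: "ball \<theta> h \<subseteq> \<Theta>" and \<theta>: "\<theta> \<in> \<Theta>"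
  shows "(\<integral>\<^sup>+ u. ennreal (norm (u - \<theta>)) \<partial>TN \<Theta> \<theta> (h\<^sup>2 *\<^sub>R V)) \<le> ennreal (h * J)"
proof (cases "h = 0")
  case True
  show ?thesis unfolding True using \<theta> by (subst nn_integral_TN_0) auto
next
  case False
  then have h0: "0 < h" using h by simp
  have "(\<integral>\<^sup>+ u. ennreal (norm (u - \<theta>)) \<partial>TN \<Theta> \<theta> (h\<^sup>2 *\<^sub>R V)) \<le> ennreal (0 + h * J)"
  proof (rule TN_near[OF h0 near])
    fix u
    have "norm (u - \<theta>) * 1 \<le> norm (u - \<theta>) * exp (norm (u - \<theta>) / h)"
      using h0 by (intro mult_left_mono) auto
    then show "norm (u - \<theta>) \<le> 0 + h * (norm (u - \<theta>) / h * exp (norm (u - \<theta>) / h))"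
      using h0 by simp
  qed (use h in auto)
  then show ?thesis by simp
qed

text \<open>The estimate has to hold up to the boundary of \<Theta>. Writing
  \<open>x = a * w\<^sup>2 / h\<^sup>2\<close>, the profile is at most \<open>exp (- x)\<close>
  beyond distance \<open>w\<close>, but at least \<open>exp (- x / 2)\<close> on a ball of fixed
  radius inside \<Theta> and close to the centre, which exists by regularity. The ratio of the
  masses tends to 0 with \<open>h\<close>.\<close>

lemma TN_far:
  assumes reg: "regular_compact \<Theta>" and w: "0 < w" and e: "0 < e"
  obtains h0 where "0 < h0" "\<And>h \<theta>. 0 \<le> h \<Longrightarrow> h \<le> h0 \<Longrightarrow> \<theta> \<in> \<Theta> \<Longrightarrow>
    (\<integral>\<^sup>+ u. indicator {u. norm (u - \<theta>) > w} u \<partial>TN \<Theta> \<theta> (h\<^sup>2 *\<^sub>R V)) \<le> ennreal e"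
proof -
  \<comment> \<open>Chosen so that the upper Gaussian constant at distance \<open>r\<close> is half
    of the lower one at distance \<open>w\<close>.\<close>
  define r where "r = w * sqrt (a / (2 * b))"
  have r: "0 < r" "b * r\<^sup>2 = a * w\<^sup>2 / 2"
    using ab w by (auto simp: r_def power_mult_distrib)
  obtain f where f: "0 < f" "\<And>x. x \<in> \<Theta> \<Longrightarrow> \<exists>x'. ball x' f \<subseteq> ball x r \<inter> \<Theta>"
    using regular_compactD[OF reg r(1)] by blast
  define vol where "vol = enn2real (emeasure lborel \<Theta>)"
  have vol: "emeasure lborel \<Theta> = ennreal vol" "0 \<le> vol"
    using vol_fin by (auto simp: vol_def)
  define B where "B = unit_ball_vol (CARD('d)) * f ^ CARD('d)"
  have B: "0 < B" using f by (simp add: B_def)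
  \<comment> \<open>The polynomial bound \<open>exp (- x / 2) \<le> 2 / x\<close> is enough;
    \<open>h0\<close> is where it makes the ratio of the masses at most \<open>e\<close>.\<close>
  define h0 where "h0 = sqrt (a * w\<^sup>2 * e * B / (2 * (vol + 1)))"
  have h0: "0 < h0" "h0\<^sup>2 = a * w\<^sup>2 * e * B / (2 * (vol + 1))"
    using ab w e B vol by (auto simp: h0_def)
  show thesis
  proof (rule that[OF h0(1)])
    fix h \<theta> assume h: "0 \<le> h" "h \<le> h0" and \<theta>: "\<theta> \<in> \<Theta>"
    show "(\<integral>\<^sup>+ u. indicator {u. norm (u - \<theta>) > w} u \<partial>TN \<Theta> \<theta> (h\<^sup>2 *\<^sub>R V)) \<le> ennreal e"
    proof (cases "h = 0")
      case True
      show ?thesis unfolding True using \<theta> w by (subst nn_integral_TN_0) auto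
    next
      case False
      then have hp: "0 < h" using h by simp
      let ?x = "a * w\<^sup>2 / h\<^sup>2"
      have x: "0 < ?x" using ab w hp by simp
      obtain x' where x': "ball x' f \<subseteq> ball \<theta> r \<inter> \<Theta>" using f(2)[OF \<theta>] by auto
      have low: "ennreal (exp (- ?x / 2) * B) \<le> mass \<theta> h (\<lambda>_. 1)"
        unfolding B_def
      proof (rule mass_ball_ge)
        fix u assume "u \<in> ball x' f"
        then have "u \<in> ball \<theta> r" using x' by blast
        then have "norm (u - \<theta>) \<le> r" by (simp add: dist_norm norm_minus_commute)
        then have "b * (norm ((1 / h) *\<^sub>R (u - \<theta>)))\<^sup>2 \<le> b * (r / h)\<^sup>2"
          using ab hp by (intro mult_left_mono power_mono) (auto simp: divide_right_mono)
        also have "\<dots> = (b * r\<^sup>2) / h\<^sup>2" by (simp add: power_divide)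
        also have "\<dots> = ?x / 2" unfolding r(2) by simp
        finally show "exp (- ?x / 2) \<le> exp (- qform V ((1 / h) *\<^sub>R (u - \<theta>)) / 2)"
          using q_upper[of "(1 / h) *\<^sub>R (u - \<theta>)"] by simp
      qed (use x' f in auto)
      have up: "mass \<theta> h (indicator {u. norm (u - \<theta>) > w}) \<le> ennreal (exp (- ?x) * vol)"
      proof -
        have "mass \<theta> h (indicator {u. norm (u - \<theta>) > w}) \<le> (\<integral>\<^sup>+ u. ennreal (exp (- ?x)) * indicator \<Theta> u \<partial>lborel)"
          unfolding mass_def
        proof (intro nn_integral_mono mult_right_mono)
          fix u
          show "indicator {u. norm (u - \<theta>) > w} u * ennreal (exp (- qform V ((1 / h) *\<^sub>R (u - \<theta>)) / 2)) \<le> ennreal (exp (- ?x))"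
          proof (cases "norm (u - \<theta>) > w")
            case True
            then have "a * (w / h)\<^sup>2 \<le> a * (norm ((1 / h) *\<^sub>R (u - \<theta>)))\<^sup>2"
              using ab hp w by (intro mult_left_mono power_mono) (auto simp: divide_right_mono)
            moreover have "a * (w / h)\<^sup>2 = ?x" by (simp add: power_divide)
            ultimately have "?x \<le> qform V ((1 / h) *\<^sub>R (u - \<theta>)) / 2"
              using q_lower[of "(1 / h) *\<^sub>R (u - \<theta>)"] by linarith
            then show ?thesis using True by (simp add: ennreal_leI)
          qed auto
        qed auto
        also have "\<dots> = ennreal (exp (- ?x) * vol)"
          using vol by (simp add: nn_integral_cmult_indicator ennreal_mult'')
        finally show ?thesis .
      qed
      have "exp (- ?x) * vol \<le> exp (- ?x / 2) * B * e"
      proof -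
        have "exp (- ?x) * vol = exp (- ?x / 2) * (exp (- ?x / 2) * vol)"
          by (simp add: mult_exp_exp mult.assoc[symmetric])
        also have "exp (- ?x / 2) * vol \<le> (2 / ?x) * (vol + 1)"
        proof (intro mult_mono)
          have "?x / 2 \<le> exp (?x / 2)" using exp_ge_add_one_self[of "?x / 2"] by linarith
          then have "inverse (exp (?x / 2)) \<le> inverse (?x / 2)" using x by (intro le_imp_inverse_le) auto
          then show "exp (- ?x / 2) \<le> 2 / ?x" by (simp add: exp_minus mult.commute)
        qed (use vol ab in auto)
        also have "\<dots> = h\<^sup>2 * (2 * (vol + 1)) / (a * w\<^sup>2)" by simp
        also have "\<dots> \<le> h0\<^sup>2 * (2 * (vol + 1)) / (a * w\<^sup>2)"
          using h vol ab by (intro divide_right_mono mult_right_mono power_mono) auto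
        also have "\<dots> = B * e" using vol ab w by (simp add: h0(2))
        finally show ?thesis by (simp add: mult.assoc)
      qed
      then have "mass \<theta> h (indicator {u. norm (u - \<theta>) > w}) \<le> ennreal (exp (- ?x / 2) * B * e)"
        using up by (meson ennreal_leI order_trans)
      also have "\<dots> = ennreal (exp (- ?x / 2) * B) * ennreal e" using e by (simp add: ennreal_mult'')
      also have "\<dots> \<le> mass \<theta> h (\<lambda>_. 1) * ennreal e" by (intro mult_right_mono low) auto
      finally have "mass \<theta> h (indicator {u. norm (u - \<theta>) > w}) / mass \<theta> h (\<lambda>_. 1) \<le> ennreal e"
        using mass_1_pos by (intro divide_le_posI_ennreal) (auto simp: zero_less_iff_neq_zero)
      then show ?thesis by (subst nn_integral_TN[OF hp]) simp_all
    qed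
  qed
qed

text \<open>The bound is uniform over the ball and over all step sizes up to \<open>H\<close>. A
  centre near the boundary of the ball is first moved a little towards \<open>x\<close>; around the
  new point a ball of radius proportional to \<open>h\<close> lies inside the given one and within
  distance \<open>h\<close> of the centre. Its mass and the normalising mass scale alike in
  \<open>h\<close>.\<close>

lemma TN_stay:
  assumes r: "0 < r" and sub: "ball x r \<subseteq> \<Theta>" and H: "0 < H"
  obtains c where "0 < c" "\<And>h \<theta>. 0 \<le> h \<Longrightarrow> h \<le> H \<Longrightarrow> \<theta> \<in> ball x r \<Longrightarrow>
    ennreal c \<le> (\<integral>\<^sup>+ u. indicator (ball x r) u \<partial>TN \<Theta> \<theta> (h\<^sup>2 *\<^sub>R V))"
proof -
  define J0 where "J0 = enn2real (\<integral>\<^sup>+ v. ennreal (exp (- a * (norm (v :: real ^ 'd))\<^sup>2)) \<partial>lborel) + 1"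
  have J0: "(\<integral>\<^sup>+ v. ennreal (exp (- a * (norm (v :: real ^ 'd))\<^sup>2)) \<partial>lborel) \<le> ennreal J0" "0 < J0"
    using nn_integral_gaussian_finite[OF ab(1), where 'd = 'd] by (auto simp: J0_def intro: add_nonneg_pos)
  \<comment> \<open>Ensures for \<open>k = s * h\<close> that \<open>2 * k\<close> is at most
    \<open>h\<close> and at most \<open>r\<close>, so the small ball is close to \<theta> and fits
    into the large one.\<close>
  define s where "s = min 1 (r / H) / 2"
  have s: "0 < s" "s \<le> 1 / 2" using r H by (auto simp: s_def)
  \<comment> \<open>The minimum with 1 covers \<open>h = 0\<close>, where the kernel is a point
    mass.\<close>
  define c where "c = min 1 (exp (- b) * unit_ball_vol (CARD('d)) * s ^ CARD('d) / J0)"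
  have c: "0 < c" using s J0 by (simp add: c_def)
  show thesis
  proof (rule that[OF c])
    fix h \<theta> assume h: "0 \<le> h" "h \<le> H" and \<theta>: "\<theta> \<in> ball x r"
    then have \<theta>': "\<theta> \<in> \<Theta>" using sub by auto
    show "ennreal c \<le> (\<integral>\<^sup>+ u. indicator (ball x r) u \<partial>TN \<Theta> \<theta> (h\<^sup>2 *\<^sub>R V))"
    proof (cases "h = 0")
      case True
      show ?thesis unfolding True using \<theta> \<theta>' by (subst nn_integral_TN_0) (auto simp: c_def intro!: borel_measurable_indicator)
    next
      case False
      then have hp: "0 < h" using h by simp
      define k where "k = s * h"
      have k: "0 < k" "2 * k \<le> h" "2 * k \<le> r"
      proof -
        show "0 < k" "2 * k \<le> h" using s hp by (auto simp: k_def)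
        have "2 * k = min 1 (r / H) * h" by (simp add: k_def s_def)
        also have "\<dots> \<le> (r / H) * h" using hp by (intro mult_right_mono) auto
        also have "\<dots> \<le> (r / H) * H" using h r H by (intro mult_left_mono) auto
        finally show "2 * k \<le> r" using H by simp
      qed
      \<comment> \<open>Moving inwards by the proportion \<open>k / r\<close> leaves a margin
        \<open>k\<close> to the boundary of the ball and moves \<theta> by at most
        \<open>k\<close>.\<close>
      define z where "z = \<theta> - (k / r) *\<^sub>R (\<theta> - x)"
      have z\<theta>: "dist z \<theta> \<le> k"
      proof -
        have "dist z \<theta> = norm ((k / r) *\<^sub>R (\<theta> - x))" by (simp add: z_def dist_norm)
        also have "\<dots> = (k / r) * norm (\<theta> - x)" using k r by (simp only: norm_scaleR) simp
        also have "\<dots> \<le> (k / r) * r"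
          using \<theta> k r by (intro mult_left_mono) (auto simp: dist_norm norm_minus_commute)
        finally show ?thesis using r by simp
      qed
      have zx: "dist z x \<le> r - k"
      proof -
        have "z - x = (1 - k / r) *\<^sub>R (\<theta> - x)" by (simp add: z_def algebra_simps)
        then have "dist z x = \<bar>1 - k / r\<bar> * norm (\<theta> - x)" by (simp only: dist_norm norm_scaleR)
        also have "\<bar>1 - k / r\<bar> = 1 - k / r" using k r by (simp add: field_simps)
        also have "(1 - k / r) * norm (\<theta> - x) \<le> (1 - k / r) * r"
          using \<theta> k r by (intro mult_left_mono) (auto simp: dist_norm norm_minus_commute field_simps)
        also have "(1 - k / r) * r = r - k" using r by (simp add: field_simps)
        finally show ?thesis .
      qed
      have zsub: "ball z k \<subseteq> ball x r"
      proof
        fix y assume "y \<in> ball z k"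
        then show "y \<in> ball x r" using zx dist_triangle[of x y z] by (simp add: dist_commute)
      qed
      have low: "ennreal (exp (- b) * (unit_ball_vol (CARD('d)) * k ^ CARD('d))) \<le> mass \<theta> h (indicator (ball x r))"
      proof (rule mass_ball_ge)
        show "ball z k \<subseteq> \<Theta>" using zsub sub by auto
        fix u assume u: "u \<in> ball z k"
        have "dist \<theta> u \<le> dist z \<theta> + dist z u" by (metis dist_commute dist_triangle)
        then have "norm (u - \<theta>) \<le> h" using u k z\<theta> by (simp add: dist_norm norm_minus_commute)
        then have "b * (norm ((1 / h) *\<^sub>R (u - \<theta>)))\<^sup>2 \<le> b * 1"
          using ab hp by (intro mult_left_mono power_le_one) auto
        then show "exp (- b) \<le> exp (- qform V ((1 / h) *\<^sub>R (u - \<theta>)) / 2)"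
          using q_upper[of "(1 / h) *\<^sub>R (u - \<theta>)"] by simp
      qed (use zsub k in auto)
      have up: "mass \<theta> h (\<lambda>_. 1) \<le> ennreal (h ^ CARD('d)) * ennreal J0"
      proof -
        have "mass \<theta> h (\<lambda>_. 1) \<le> (\<integral>\<^sup>+ u. ennreal (exp (- a * (norm ((1 / h) *\<^sub>R (u - \<theta>)))\<^sup>2)) \<partial>lborel)"
          unfolding mass_def
        proof (intro nn_integral_mono)
          fix u
          have "exp (- qform V ((1 / h) *\<^sub>R (u - \<theta>)) / 2) \<le> exp (- a * (norm ((1 / h) *\<^sub>R (u - \<theta>)))\<^sup>2)"
            using q_lower[of "(1 / h) *\<^sub>R (u - \<theta>)"] by (subst exp_le_cancel_iff) linarith
          then show "1 * ennreal (exp (- qform V ((1 / h) *\<^sub>R (u - \<theta>)) / 2)) * indicator \<Theta> u \<le>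
            ennreal (exp (- a * (norm ((1 / h) *\<^sub>R (u - \<theta>)))\<^sup>2))"
            by (auto simp del: norm_scaleR simp: indicator_def intro!: ennreal_leI)
        qed
        also have "\<dots> = ennreal (h ^ CARD('d)) * (\<integral>\<^sup>+ v. ennreal (exp (- a * (norm (v :: real ^ 'd))\<^sup>2)) \<partial>lborel)"
          using hp by (intro nn_integral_scaled[where H = "\<lambda>v. ennreal (exp (- a * (norm v)\<^sup>2))"]) auto
        also have "\<dots> \<le> ennreal (h ^ CARD('d)) * ennreal J0" by (intro mult_left_mono J0) auto
        finally show ?thesis .
      qed
      have "ennreal c * mass \<theta> h (\<lambda>_. 1) \<le>
        ennreal (exp (- b) * unit_ball_vol (CARD('d)) * s ^ CARD('d) / J0) * (ennreal (h ^ CARD('d)) * ennreal J0)"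
        by (intro mult_mono up ennreal_leI) (auto simp: c_def)
      also have "\<dots> = ennreal (exp (- b) * (unit_ball_vol (CARD('d)) * k ^ CARD('d)))"
        using J0 hp s by (simp add: ennreal_mult''[symmetric] k_def power_mult_distrib field_simps)
      also have "\<dots> \<le> mass \<theta> h (indicator (ball x r))" by (rule low)
      finally have "ennreal c \<le> mass \<theta> h (indicator (ball x r)) / mass \<theta> h (\<lambda>_. 1)"
        by (intro le_divide_ennrealI mass_1_pos mass_1_fin)
      then show ?thesis by (subst nn_integral_TN[OF hp]) (auto intro!: borel_measurable_indicator)
    qed
  qed
qed

end


section \<open>Measurability of the truncated kernels in their centre\<close>

context scaled_kernel begin

lemma mass_meas [measurable]:
  assumes [measurable]: "F \<in> borel_measurable borel"
  shows "(\<lambda>\<theta>. mass \<theta> h F) \<in> borel_measurable borel"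
proof -
  have "(\<lambda>(\<theta>, u). F u * ennreal (\<kappa> ((1 / h) *\<^sub>R (u - \<theta>))) * indicator \<Theta> u) \<in>
    borel_measurable (borel \<Otimes>\<^sub>M lborel)"
    by measurable
  from lborel.borel_measurable_nn_integral[OF this] show ?thesis by (simp add: mass_def)
qed

lemma truncate_kernel:
  assumes c: "0 < c"
  shows "(\<lambda>\<theta>. truncate_to \<Theta> (density lborel (\<lambda>u. ennreal (c * \<kappa> ((1 / h) *\<^sub>R (u - \<theta>))))))
    \<in> restrict_space borel \<Theta> \<rightarrow>\<^sub>M prob_algebra (restrict_space borel \<Theta>)"
proof -
  let ?K = "\<lambda>\<theta>. truncate_to \<Theta> (density lborel (\<lambda>u. ennreal (c * \<kappa> ((1 / h) *\<^sub>R (u - \<theta>)))))"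
  have sets_K: "sets (?K \<theta>) = sets (restrict_space borel \<Theta>)" for \<theta>
    by (simp add: truncate_to_def sets_restrict_space)
  have em: "emeasure (?K \<theta>) A = mass \<theta> h (indicator A) / mass \<theta> h (\<lambda>_. 1)"
    if "A \<in> sets (restrict_space borel \<Theta>)" for A \<theta>
  proof -
    have "A \<in> sets borel" using that by (simp add: sets_restrict_space_iff)
    then have "(\<integral>\<^sup>+ u. indicator A u \<partial>?K \<theta>) = mass \<theta> h (indicator A) / mass \<theta> h (\<lambda>_. 1)"
      by (intro nn_integral_truncate[OF c]) auto
    moreover have "(\<integral>\<^sup>+ u. indicator A u \<partial>?K \<theta>) = emeasure (?K \<theta>) A"
      using that sets_K by (intro nn_integral_indicator) blast
    ultimately show ?thesis by simp
  qed
  have prob: "prob_space (?K \<theta>)" for \<theta>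
  proof
    have "space (?K \<theta>) = \<Theta>" using sets_eq_imp_space_eq[OF sets_K, of \<theta>] by (simp add: space_restrict_space)
    then have "emeasure (?K \<theta>) (space (?K \<theta>)) = mass \<theta> h (indicator \<Theta>) / mass \<theta> h (\<lambda>_. 1)"
      by (subst em) (auto simp: sets_restrict_space_iff)
    also have "mass \<theta> h (indicator \<Theta>) = mass \<theta> h (\<lambda>_. 1)"
      by (intro antisym mass_mono) auto
    finally show "emeasure (?K \<theta>) (space (?K \<theta>)) = 1"
      using mass_1_pos mass_1_fin by (simp add: ennreal_divide_self less_top)
  qed
  show ?thesis
  proof (rule measurable_prob_algebraI[OF prob], rule measurable_subprob_algebra)
    fix A assume A: "A \<in> sets (restrict_space borel \<Theta>)"
    then have "A \<in> sets borel" by (simp add: sets_restrict_space_iff)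
    then have [measurable]: "indicator A \<in> borel_measurable (borel :: (real ^ 'd) measure)" by simp
    have "(\<lambda>\<theta>. mass \<theta> h (indicator A) / mass \<theta> h (\<lambda>_. 1)) \<in> borel_measurable borel" by measurable
    then show "(\<lambda>\<theta>. emeasure (?K \<theta>) A) \<in> borel_measurable (restrict_space borel \<Theta>)"
      unfolding em[OF A] by (rule measurable_restrict_space1)
  qed (use sets_K in \<open>auto intro: prob_space_imp_subprob_space prob\<close>)
qed

end

context gauss_kernel begin

lemma return_kernel: "return (restrict_space borel \<Theta>) \<in> restrict_space borel \<Theta> \<rightarrow>\<^sub>M prob_algebra (restrict_space borel \<Theta>)"
  by (rule measurable_prob_algebraI) (auto intro: prob_space_return)

lemma TN_kernel:
  assumes h: "0 \<le> h"
  shows "(\<lambda>\<theta>. TN \<Theta> \<theta> (h\<^sup>2 *\<^sub>R V)) \<in> restrict_space borel \<Theta> \<rightarrow>\<^sub>M prob_algebra (restrict_space borel \<Theta>)"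
proof (cases "h = 0")
  case True
  then show ?thesis using return_kernel by (simp add: TN_def)
next
  case False
  then have h: "0 < h" using h by simp
  have "mvn_density \<theta> (h\<^sup>2 *\<^sub>R V) u =
    1 / sqrt ((2 * pi) ^ CARD('d) * det (h\<^sup>2 *\<^sub>R V)) * exp (- qform V ((1 / h) *\<^sub>R (u - \<theta>)) / 2)" for \<theta> u
    by (simp add: mvn_density_def qform_scaled h)
  then show ?thesis
    using truncate_kernel[of "1 / sqrt ((2 * pi) ^ CARD('d) * det (h\<^sup>2 *\<^sub>R V))" h] h V_neq_0 det_scaled_pos[OF h]
    by (simp add: TN_def)
qed

end

section \<open>Student steps: reaching a fixed ball and long jumps\<close>

locale student_kernel = gauss_kernel \<Theta> V a b
  for \<Theta> :: "(real ^ 'd) set" and V :: "real ^ 'd ^ 'd" and a b :: real +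
  fixes \<nu> p :: real
  assumes \<nu>: "0 < \<nu>" and p_def: "p = (\<nu> + CARD('d)) / 2"
begin

lemma p: "0 < p" using \<nu> by (simp add: p_def)

definition \<kappa>S :: "real ^ 'd \<Rightarrow> real" where "\<kappa>S v = (1 + qform V v / \<nu>) powr (- p)"

sublocale S: scaled_kernel \<Theta> \<kappa>S
proof
  fix v
  have 1: "1 \<le> 1 + qform V v / \<nu>" using q_nonneg[of v] \<nu> by simp
  show "0 < \<kappa>S v" using 1 by (simp add: \<kappa>S_def)
  show "\<kappa>S v \<le> 1" using powr_mono2'[of "- p" 1 "1 + qform V v / \<nu>"] 1 p by (simp add: \<kappa>S_def)
qed (use cpt_\<Theta> int_\<Theta> in \<open>simp_all add: \<kappa>S_def[abs_def]\<close>)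

definition "cS h = Gamma ((\<nu> + CARD('d)) / 2) / (Gamma (\<nu> / 2) * sqrt ((\<nu> * pi) ^ CARD('d) * det (h\<^sup>2 *\<^sub>R V)))"

lemma cS_pos: "0 < h \<Longrightarrow> 0 < cS h"
  using \<nu> det_scaled_pos[of h] by (auto simp: cS_def intro!: divide_pos_pos mult_pos_pos Gamma_real_pos)

lemma mvt_density_eq: "0 < h \<Longrightarrow> mvt_density \<theta> (h\<^sup>2 *\<^sub>R V) \<nu> u = cS h * \<kappa>S ((1 / h) *\<^sub>R (u - \<theta>))"
  using p_def[symmetric] by (simp add: mvt_density_def cS_def \<kappa>S_def qform_scaled minus_divide_left[symmetric] del: minus_add_distrib)

lemma TS_kernel:
  assumes h: "0 \<le> h"
  shows "(\<lambda>\<theta>. TS \<Theta> \<theta> (h\<^sup>2 *\<^sub>R V) \<nu>) \<in> restrict_space borel \<Theta> \<rightarrow>\<^sub>M prob_algebra (restrict_space borel \<Theta>)"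
proof (cases "h = 0")
  case True
  then show ?thesis using return_kernel by (simp add: TS_def)
next
  case False
  then have h: "0 < h" using h by simp
  show ?thesis
    using S.truncate_kernel[OF cS_pos[OF h], of h] h V_neq_0 by (simp add: TS_def mvt_density_eq)
qed

lemma nn_integral_TS:
  assumes h: "0 < h" and F: "F \<in> borel_measurable borel"
  shows "(\<integral>\<^sup>+ u. F u \<partial>TS \<Theta> \<theta> (h\<^sup>2 *\<^sub>R V) \<nu>) = S.mass \<theta> h F / S.mass \<theta> h (\<lambda>_. 1)"
  using S.nn_integral_truncate[OF cS_pos[OF h] mvt_density_eq[OF h] F] h V_neq_0 by (simp add: TS_def)

text \<open>This is the polynomial price of a jump to the maximiser. On the bounded set \<Theta> the
  rescaled form is at most of order \<open>1 / h\<^sup>2\<close>, so the profile is at least of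
  order \<open>h powr (2 * p)\<close> wherever the step starts. The truncated normalising mass is at
  most the volume of \<Theta>.\<close>

lemma TS_ball:
  assumes r: "0 < r" and sub: "ball x r \<subseteq> \<Theta>"
  obtains c where "0 < c" "\<And>h \<theta>. 0 < (h :: real) \<Longrightarrow> h \<le> 1 \<Longrightarrow> \<theta> \<in> \<Theta> \<Longrightarrow>
    ennreal (c * h powr (2 * p)) \<le> (\<integral>\<^sup>+ u. indicator (ball x r) u \<partial>TS \<Theta> \<theta> (h\<^sup>2 *\<^sub>R V) \<nu>)"
proof -
  define vol where "vol = enn2real (emeasure lborel \<Theta>)"
  have vol: "emeasure lborel \<Theta> = ennreal vol" "0 < vol"
    using vol_fin vol_pos by (auto simp: vol_def enn2real_positive_iff)
  obtain D where D: "\<And>u. u \<in> \<Theta> \<Longrightarrow> norm u \<le> D"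
    using compact_imp_bounded[OF cpt_\<Theta>] by (auto simp: bounded_iff)
  define B where "B = 1 + 2 * b * (2 * D)\<^sup>2 / \<nu>"
  have B: "1 \<le> B" using ab \<nu> by (simp add: B_def)
  define U where "U = unit_ball_vol (CARD('d)) * r ^ CARD('d)"
  have U: "0 < U" using r by (simp add: U_def)
  define c where "c = B powr (- p) * U / vol"
  have c: "0 < c" using B U vol by (simp add: c_def)
  show thesis
  proof (rule that[OF c])
    fix h :: real and \<theta> assume h: "0 < h" "h \<le> 1" and \<theta>: "\<theta> \<in> \<Theta>"
    have low: "ennreal (B powr (- p) * h powr (2 * p) * U) \<le> S.mass \<theta> h (indicator (ball x r))"
      unfolding U_def
    proof (rule S.mass_ball_ge[OF sub])
      fix u assume "u \<in> ball x r"
      then have u: "u \<in> \<Theta>" using sub by auto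
      let ?v = "(1 / h) *\<^sub>R (u - \<theta>)"
      have "norm (u - \<theta>) \<le> 2 * D" using D[OF u] D[OF \<theta>] norm_triangle_ineq4[of u \<theta>] by simp
      then have "(norm ?v)\<^sup>2 \<le> (2 * D / h)\<^sup>2" using h by (intro power_mono) (auto simp: divide_right_mono)
      then have "2 * b * (norm ?v)\<^sup>2 \<le> 2 * b * (2 * D / h)\<^sup>2" using ab by (intro mult_left_mono) auto
      then have "qform V ?v \<le> 2 * b * (2 * D / h)\<^sup>2" using q_upper[of ?v] by linarith
      then have "1 + qform V ?v / \<nu> \<le> 1 + 2 * b * (2 * D / h)\<^sup>2 / \<nu>"
        using \<nu> by (intro add_left_mono divide_right_mono) auto
      also have "\<dots> = 1 + (B - 1) / h\<^sup>2" by (simp add: B_def power_divide)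
      \<comment> \<open>Here \<open>h \<le> 1\<close> enters: the summand 1 is absorbed into
        \<open>1 / h\<^sup>2\<close>.\<close>
      also have "\<dots> \<le> 1 / h\<^sup>2 + (B - 1) / h\<^sup>2" using h by (simp add: power_le_one)
      also have "\<dots> = B / h\<^sup>2" by (simp add: add_divide_distrib[symmetric])
      finally have "(B / h\<^sup>2) powr (- p) \<le> \<kappa>S ?v"
        unfolding \<kappa>S_def using p \<nu> q_nonneg[of ?v]
        by (intro powr_mono2') (auto intro: add_pos_nonneg)
      also have "(B / h\<^sup>2) powr (- p) = B powr (- p) * h powr (2 * p)"
        using B h by (intro powr_divide_square) auto
      finally show "B powr (- p) * h powr (2 * p) \<le> \<kappa>S ?v" .
    qed (use r in auto)
    have up: "S.mass \<theta> h (\<lambda>_. 1) \<le> ennreal vol"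
    proof -
      have "S.mass \<theta> h (\<lambda>_. 1) \<le> (\<integral>\<^sup>+ u. indicator \<Theta> u \<partial>lborel)"
        unfolding S.mass_def using S.\<kappa>_le by (intro nn_integral_mono) (auto simp: indicator_def ennreal_le_1)
      then show ?thesis using vol by simp
    qed
    have "ennreal (c * h powr (2 * p)) * S.mass \<theta> h (\<lambda>_. 1) \<le> ennreal (c * h powr (2 * p)) * ennreal vol"
      by (intro mult_left_mono up) auto
    also have "\<dots> = ennreal (B powr (- p) * h powr (2 * p) * U)"
      using vol by (subst ennreal_mult''[symmetric]) (auto simp: c_def mult_ac)
    also note low
    finally have "ennreal (c * h powr (2 * p)) \<le> S.mass \<theta> h (indicator (ball x r)) / S.mass \<theta> h (\<lambda>_. 1)"
      by (intro le_divide_ennrealI S.mass_1_pos S.mass_1_fin)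
    then show "ennreal (c * h powr (2 * p)) \<le> (\<integral>\<^sup>+ u. indicator (ball x r) u \<partial>TS \<Theta> \<theta> (h\<^sup>2 *\<^sub>R V) \<nu>)"
      by (subst nn_integral_TS[OF h(1)]) (auto intro!: borel_measurable_indicator)
  qed
qed

text \<open>Beyond distance \<open>e\<close> the profile is of order \<open>h powr (2 * p)\<close>,
  while the normalising mass around an interior centre is at least of order
  \<open>h ^ CARD('d)\<close>. The quotient leaves the exponent \<nu>, so a heavy-tailed step is
  still likely to be short when \<open>h\<close> is small.\<close>

lemma TS_far:
  assumes e: "0 < e"
  obtains c where "0 < c" "\<And>h \<theta>. 0 < h \<Longrightarrow> ball \<theta> h \<subseteq> \<Theta> \<Longrightarrow>
    (\<integral>\<^sup>+ u. indicator {u. norm (u - \<theta>) > e} u \<partial>TS \<Theta> \<theta> (h\<^sup>2 *\<^sub>R V) \<nu>) \<le> ennreal (c * h powr \<nu>)"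
proof -
  define vol where "vol = enn2real (emeasure lborel \<Theta>)"
  have vol: "emeasure lborel \<Theta> = ennreal vol" "0 < vol"
    using vol_fin vol_pos by (auto simp: vol_def enn2real_positive_iff)
  define B where "B = 2 * a * e\<^sup>2 / \<nu>"
  have B: "0 < B" using ab \<nu> e by (simp add: B_def)
  define U where "U = (1 + 2 * b / \<nu>) powr (- p) * unit_ball_vol (CARD('d))"
  have U: "0 < U" unfolding U_def
  proof (intro mult_pos_pos)
    have "0 < 1 + 2 * b / \<nu>" using ab \<nu> by (intro add_pos_pos divide_pos_pos) auto
    then show "0 < (1 + 2 * b / \<nu>) powr (- p)" by simp
  qed simp
  define c where "c = B powr (- p) * vol / U"
  have c: "0 < c" using B U vol by (simp add: c_def)
  show thesis
  proof (rule that[OF c])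
    fix h \<theta> assume h: "0 < h" and near: "ball \<theta> h \<subseteq> \<Theta>"
    have "ennreal ((1 + 2 * b / \<nu>) powr (- p) * (unit_ball_vol (CARD('d)) * h ^ CARD('d))) \<le> S.mass \<theta> h (\<lambda>_. 1)"
    proof (rule S.mass_ball_ge[OF near])
      fix u assume "u \<in> ball \<theta> h"
      then have "norm ((1 / h) *\<^sub>R (u - \<theta>)) \<le> 1" using h by (simp add: dist_norm norm_minus_commute)
      then have "b * (norm ((1 / h) *\<^sub>R (u - \<theta>)))\<^sup>2 \<le> b * 1"
        using ab by (intro mult_left_mono power_le_one) auto
      then have "qform V ((1 / h) *\<^sub>R (u - \<theta>)) \<le> 2 * b"
        using q_upper[of "(1 / h) *\<^sub>R (u - \<theta>)"] by linarith
      then show "(1 + 2 * b / \<nu>) powr (- p) \<le> \<kappa>S ((1 / h) *\<^sub>R (u - \<theta>))"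
        unfolding \<kappa>S_def using p \<nu> q_nonneg
        by (intro powr_mono2' add_left_mono divide_right_mono) (auto intro: add_pos_nonneg)
    qed (use h in auto)
    then have low: "ennreal (U * h ^ CARD('d)) \<le> S.mass \<theta> h (\<lambda>_. 1)"
      by (simp add: U_def mult.assoc)
    have up: "S.mass \<theta> h (indicator {u. norm (u - \<theta>) > e}) \<le> ennreal (B powr (- p) * h powr (2 * p) * vol)"
    proof -
      have "S.mass \<theta> h (indicator {u. norm (u - \<theta>) > e}) \<le>
        (\<integral>\<^sup>+ u. ennreal (B powr (- p) * h powr (2 * p)) * indicator \<Theta> u \<partial>lborel)"
        unfolding S.mass_def
      proof (intro nn_integral_mono mult_right_mono)
        fix u
        let ?v = "(1 / h) *\<^sub>R (u - \<theta>)"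
        show "indicator {u. norm (u - \<theta>) > e} u * ennreal (\<kappa>S ?v) \<le> ennreal (B powr (- p) * h powr (2 * p))"
        proof (cases "norm (u - \<theta>) > e")
          case True
          then have "2 * a * (e / h)\<^sup>2 \<le> 2 * a * (norm ?v)\<^sup>2"
            using ab h e by (intro mult_left_mono power_mono) (auto simp: divide_right_mono)
          then have "2 * a * (e / h)\<^sup>2 \<le> qform V ?v" using q_lower[of ?v] by linarith
          then have "2 * a * (e / h)\<^sup>2 / \<nu> \<le> qform V ?v / \<nu>" using \<nu> by (intro divide_right_mono) auto
          moreover have "B / h\<^sup>2 = 2 * a * (e / h)\<^sup>2 / \<nu>" by (simp add: B_def power_divide mult.commute)
          ultimately have "B / h\<^sup>2 \<le> 1 + qform V ?v / \<nu>" by linarith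
          then have "\<kappa>S ?v \<le> (B / h\<^sup>2) powr (- p)"
            unfolding \<kappa>S_def using p B h by (intro powr_mono2') auto
          also have "(B / h\<^sup>2) powr (- p) = B powr (- p) * h powr (2 * p)"
            using B h by (intro powr_divide_square) auto
          finally show ?thesis using True by (simp add: ennreal_leI)
        qed auto
      qed auto
      also have "\<dots> = ennreal (B powr (- p) * h powr (2 * p) * vol)"
        using vol by (simp add: nn_integral_cmult_indicator ennreal_mult'')
      finally show ?thesis .
    qed
    have "B powr (- p) * h powr (2 * p) * vol = U * h ^ CARD('d) * (c * h powr \<nu>)"
    proof -
      have "h powr (2 * p) = h powr \<nu> * h ^ CARD('d)"
      proof -
        have "2 * p = \<nu> + real CARD('d)" by (simp add: p_def)
        then show ?thesis using h by (simp add: powr_add powr_realpow)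
      qed
      then show ?thesis using U by (simp add: c_def)
    qed
    then have "S.mass \<theta> h (indicator {u. norm (u - \<theta>) > e}) \<le> ennreal (U * h ^ CARD('d)) * ennreal (c * h powr \<nu>)"
      using up U h c by (simp add: ennreal_mult''[symmetric])
    also have "\<dots> \<le> S.mass \<theta> h (\<lambda>_. 1) * ennreal (c * h powr \<nu>)"
      by (intro mult_right_mono low) auto
    finally have "S.mass \<theta> h (indicator {u. norm (u - \<theta>) > e}) / S.mass \<theta> h (\<lambda>_. 1) \<le> ennreal (c * h powr \<nu>)"
      using S.mass_1_pos by (intro divide_le_posI_ennreal) (auto simp: zero_less_iff_neq_zero)
    then show "(\<integral>\<^sup>+ u. indicator {u. norm (u - \<theta>) > e} u \<partial>TS \<Theta> \<theta> (h\<^sup>2 *\<^sub>R V) \<nu>) \<le> ennreal (c * h powr \<nu>)"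
      by (subst nn_integral_TS[OF h]) simp_all
  qed
qed

end

section \<open>Upper bounds away from the maximiser\<close>

locale so_gauss = so_model T \<Theta> L K G \<phi> g C \<theta>h ell + gauss_kernel \<Theta> V a b
  for T :: nat and \<Theta> :: "(real ^ 'd) set" and L :: "'x::polish_space measure"
    and K :: "nat \<Rightarrow> real ^ 'd \<Rightarrow> (real ^ 'd) measure"
    and G :: "nat \<Rightarrow> real ^ 'd \<Rightarrow> 'x \<Rightarrow> 'x \<Rightarrow> real"
    and \<phi> :: "nat \<Rightarrow> 'x \<times> 'x \<Rightarrow> real" and g :: "real \<Rightarrow> real" and C :: real
    and \<theta>h :: "real ^ 'd" and ell :: real and V :: "real ^ 'd ^ 'd" and a b :: real +
  fixes h :: "nat \<Rightarrow> real"
  assumes reg: "regular_compact \<Theta>" and h_nonneg: "\<And>t. 2 \<le> t \<Longrightarrow> 0 \<le> h t"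
begin

definition "TN_at t \<longleftrightarrow> 2 \<le> t \<and> (\<forall>\<theta>\<in>\<Theta>. K t \<theta> = TN \<Theta> \<theta> ((h t)\<^sup>2 *\<^sub>R V))"

text \<open>A truncated exponential barrier. Its logarithm is Lipschitz with constant
  \<open>lam\<close>, so a step with \<open>lam * h\<close> small hardly changes its mean. It is 1
  from distance \<open>2 * \<epsilon>\<close> on, which dominates the indicator of the far region,
  and at most \<open>exp (- lam * \<epsilon>)\<close> within \<epsilon>.\<close>

definition W :: "real \<Rightarrow> real \<Rightarrow> real ^ 'd \<Rightarrow> ennreal" where
  "W lam \<epsilon> \<theta> = ennreal (exp (- lam * max 0 (2 * \<epsilon> - norm (\<theta> - \<theta>h))))"

lemma W_meas [measurable]: "W lam \<epsilon> \<in> borel_measurable borel"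
  unfolding W_def[abs_def] by measurable

lemma W_le_1: "0 \<le> lam \<Longrightarrow> W lam \<epsilon> \<theta> \<le> 1"
  by (simp add: W_def ennreal_le_1)

lemma W_far: "2 * \<epsilon> \<le> norm (\<theta> - \<theta>h) \<Longrightarrow> W lam \<epsilon> \<theta> = 1"
  by (simp add: W_def)

lemma W_near:
  assumes "0 \<le> lam" "norm (\<theta> - \<theta>h) \<le> \<epsilon>" shows "W lam \<epsilon> \<theta> \<le> ennreal (exp (- lam * \<epsilon>))"
proof -
  have "\<epsilon> \<le> max 0 (2 * \<epsilon> - norm (\<theta> - \<theta>h))" using assms(2) by simp
  from mult_left_mono[OF this assms(1)] show ?thesis by (simp add: W_def ennreal_leI)
qed

lemma W_lip:
  assumes "0 \<le> lam" shows "W lam \<epsilon> \<theta>' \<le> W lam \<epsilon> \<theta> * ennreal (exp (lam * norm (\<theta>' - \<theta>)))"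
proof -
  have "norm (\<theta>' - \<theta>h) \<le> norm (\<theta>' - \<theta>) + norm (\<theta> - \<theta>h)"
    using norm_triangle_ineq[of "\<theta>' - \<theta>" "\<theta> - \<theta>h"] by simp
  then have "max 0 (2 * \<epsilon> - norm (\<theta> - \<theta>h)) \<le> max 0 (2 * \<epsilon> - norm (\<theta>' - \<theta>h)) + norm (\<theta>' - \<theta>)"
    by (auto simp: max_def)
  from mult_left_mono[OF this assms]
  have "exp (- lam * max 0 (2 * \<epsilon> - norm (\<theta>' - \<theta>h))) \<le>
    exp (- lam * max 0 (2 * \<epsilon> - norm (\<theta> - \<theta>h))) * exp (lam * norm (\<theta>' - \<theta>))"
    by (simp add: mult_exp_exp algebra_simps)
  then show ?thesis by (simp add: W_def ennreal_mult''[symmetric] ennreal_leI)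
qed

text \<open>Beyond \<open>2 * \<epsilon>\<close> the weight has its maximal value 1, so only the
  jump penalty counts, and \<open>TN_far\<close> bounds it even at the boundary of \<Theta>. Closer
  in, the ball of radius \<open>3 * \<epsilon>\<close> leaves room around the centre, and the
  exponential moment of a Gaussian step applies to the Lipschitz bound.\<close>

lemma W_supersolution:
  assumes \<epsilon>: "0 < \<epsilon>" "ball \<theta>h (3 * \<epsilon>) \<subseteq> \<Theta>" and R: "0 \<le> R" and w: "0 < w" and z: "0 < z"
  obtains \<eta> where "0 < \<eta>" "\<eta> \<le> 1" "\<And>t lam \<theta>. TN_at t \<Longrightarrow> h t \<le> \<eta> \<Longrightarrow> 0 \<le> lam \<Longrightarrow> lam * h t \<le> \<eta> \<Longrightarrow> \<theta> \<in> \<Theta> \<Longrightarrow>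
    (\<integral>\<^sup>+ \<theta>'. W lam \<epsilon> \<theta>' * (1 + ennreal R * indicator {\<theta>'. norm (\<theta>' - \<theta>) > w} \<theta>') \<partial>K t \<theta>) \<le> ennreal (1 + z) * W lam \<epsilon> \<theta>"
proof -
  \<comment> \<open>A jump probability of at most \<open>y\<close> keeps the penalty
    \<open>R * y\<close> below \<open>z\<close>; adding 1 to \<open>R\<close> avoids division by
    0.\<close>
  define y where "y = z / (R + 1)"
  have y: "0 < y" "R * y \<le> z" using z R by (auto simp: y_def field_simps)
  obtain h0 where h0: "0 < h0" "\<And>h \<theta>. 0 \<le> h \<Longrightarrow> h \<le> h0 \<Longrightarrow> \<theta> \<in> \<Theta> \<Longrightarrow>
    (\<integral>\<^sup>+ u. indicator {u. norm (u - \<theta>) > w} u \<partial>TN \<Theta> \<theta> (h\<^sup>2 *\<^sub>R V)) \<le> ennreal y"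
    using TN_far[OF reg w y(1)] by blast
  define m where "m = (1 + R / w) * J"
  have m: "0 \<le> m" using R w J_nonneg by (simp add: m_def)
  \<comment> \<open>The bounds serve in turn the exponential moment, the long jumps, the room around
    the centre, and the size \<open>\<eta> * m\<close> of its error.\<close>
  define \<eta> where "\<eta> = min (min 1 h0) (min \<epsilon> (z / (m + 1)))"
  have \<eta>: "0 < \<eta>" "\<eta> \<le> 1" "\<eta> \<le> h0" "\<eta> \<le> \<epsilon>" "\<eta> * m \<le> z"
  proof -
    show "0 < \<eta>" "\<eta> \<le> 1" "\<eta> \<le> h0" "\<eta> \<le> \<epsilon>" using h0 \<epsilon> z m by (auto simp: \<eta>_def)
    have "\<eta> * m \<le> z / (m + 1) * m" using m by (intro mult_right_mono) (simp_all add: \<eta>_def)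
    also have "\<dots> \<le> z" using m z by (simp add: field_simps)
    finally show "\<eta> * m \<le> z" .
  qed
  show thesis
  proof (rule that[OF \<eta>(1,2)])
    fix t lam \<theta> assume t: "TN_at t" "h t \<le> \<eta>" and lam: "0 \<le> lam" "lam * h t \<le> \<eta>" and \<theta>: "\<theta> \<in> \<Theta>"
    have t2: "2 \<le> t" and K_eq: "K t \<theta> = TN \<Theta> \<theta> ((h t)\<^sup>2 *\<^sub>R V)" using t(1) \<theta> by (auto simp: TN_at_def)
    have ht: "0 \<le> h t" by (rule h_nonneg[OF t2])
    interpret prob_space "K t \<theta>" using t2 \<theta> by (intro prob_K) auto
    let ?I = "indicator {\<theta>'. norm (\<theta>' - \<theta>) > w} :: real ^ 'd \<Rightarrow> ennreal"
    have mI: "?I \<in> borel_measurable (K t \<theta>)" using t2 \<theta> by (intro meas_KI) auto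
    have mW: "W lam \<epsilon> \<in> borel_measurable (K t \<theta>)" using t2 \<theta> by (intro meas_KI) auto
    show "(\<integral>\<^sup>+ \<theta>'. W lam \<epsilon> \<theta>' * (1 + ennreal R * ?I \<theta>') \<partial>K t \<theta>) \<le> ennreal (1 + z) * W lam \<epsilon> \<theta>"
    proof (cases "norm (\<theta> - \<theta>h) < 2 * \<epsilon>")
      case False
      have "(\<integral>\<^sup>+ \<theta>'. W lam \<epsilon> \<theta>' * (1 + ennreal R * ?I \<theta>') \<partial>K t \<theta>) \<le> (\<integral>\<^sup>+ \<theta>'. 1 + ennreal R * ?I \<theta>' \<partial>K t \<theta>)"
      proof (intro nn_integral_mono)
        fix \<theta>'
        show "W lam \<epsilon> \<theta>' * (1 + ennreal R * ?I \<theta>') \<le> 1 + ennreal R * ?I \<theta>'"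
          using mult_right_mono[OF W_le_1[OF lam(1), of \<epsilon> \<theta>'], of "1 + ennreal R * ?I \<theta>'"] by simp
      qed
      also have "\<dots> = 1 + ennreal R * (\<integral>\<^sup>+ \<theta>'. ?I \<theta>' \<partial>K t \<theta>)"
        using mI by (subst nn_integral_add) (simp_all add: nn_integral_cmult emeasure_space_1)
      also have "\<dots> \<le> 1 + ennreal R * ennreal y"
        unfolding K_eq using t \<eta> \<theta> ht by (intro add_left_mono mult_left_mono h0) auto
      also have "\<dots> = ennreal (1 + R * y)" using R y by (simp add: ennreal_mult)
      also have "\<dots> \<le> ennreal (1 + z)" using y by (intro ennreal_leI) simp
      finally show ?thesis using False by (simp add: W_far)
    next
      case True
      have near: "ball \<theta> \<eta> \<subseteq> \<Theta>"
      proof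
        fix u assume "u \<in> ball \<theta> \<eta>"
        then have "norm (\<theta> - u) < \<epsilon>" using \<eta> by (simp add: dist_norm)
        then have "norm (\<theta>h - u) < 3 * \<epsilon>"
          using True norm_triangle_ineq[of "\<theta>h - \<theta>" "\<theta> - u"] by (simp add: norm_minus_commute)
        then show "u \<in> \<Theta>" using \<epsilon>(2) by (auto simp: dist_norm)
      qed
      let ?E = "\<lambda>u. ennreal (exp (lam * norm (u - \<theta>)) * (1 + R * indicator {u. norm (u - \<theta>) > w} u))"
      have "(\<integral>\<^sup>+ \<theta>'. W lam \<epsilon> \<theta>' * (1 + ennreal R * ?I \<theta>') \<partial>K t \<theta>) \<le> (\<integral>\<^sup>+ \<theta>'. W lam \<epsilon> \<theta> * ?E \<theta>' \<partial>K t \<theta>)"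
      proof (intro nn_integral_mono)
        fix \<theta>'
        have "W lam \<epsilon> \<theta>' * (1 + ennreal R * ?I \<theta>') \<le> W lam \<epsilon> \<theta> * ennreal (exp (lam * norm (\<theta>' - \<theta>))) * (1 + ennreal R * ?I \<theta>')"
          by (intro mult_right_mono W_lip lam) auto
        also have "\<dots> = W lam \<epsilon> \<theta> * ?E \<theta>'"
          using R by (auto simp: mult.assoc indicator_def ennreal_mult'')
        finally show "W lam \<epsilon> \<theta>' * (1 + ennreal R * ?I \<theta>') \<le> W lam \<epsilon> \<theta> * ?E \<theta>'" .
      qed
      also have "\<dots> = W lam \<epsilon> \<theta> * (\<integral>\<^sup>+ \<theta>'. ?E \<theta>' \<partial>K t \<theta>)"
        using t2 \<theta> by (intro nn_integral_cmult meas_KI) auto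
      also have "\<dots> \<le> W lam \<epsilon> \<theta> * ennreal (1 + \<eta> * (1 + R / w) * J)"
        unfolding K_eq by (intro mult_left_mono TN_exp_moment ht t \<eta> lam R w near) auto
      also have "\<dots> \<le> W lam \<epsilon> \<theta> * ennreal (1 + z)"
        using \<eta>(5) by (intro mult_left_mono ennreal_leI) (simp_all add: m_def mult.assoc)
      finally show ?thesis by (simp add: mult.commute)
    qed
  qed
qed

lemma g_small:
  assumes "0 < c" obtains d where "0 < d" "\<And>x. 0 \<le> x \<Longrightarrow> x \<le> d \<Longrightarrow> g x \<le> c"
proof -
  from g_cont assms obtain d where d: "0 < d" "\<And>x. 0 \<le> x \<Longrightarrow> dist x 0 < d \<Longrightarrow> dist (g x) (g 0) < c"
    unfolding continuous_on_iff by (metis atLeast_iff order_refl)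
  show thesis
  proof (rule that[of "d / 2"])
    fix x assume "0 \<le> x" "x \<le> d / 2"
    with d have "dist (g x) (g 0) < c" by auto
    then show "g x \<le> c" using g_0 by (simp add: dist_real_def)
  qed (use d in simp)
qed

text \<open>Every parameter away from \<theta>h has its own tilt, likelihood bound and radius.
  Compactness reduces them to finitely many, which yields one gap \<open>q < ell\<close> and one
  radius \<open>w0\<close> for the whole far region. The covering balls have half the radius, so
  that a \<open>w0\<close>-neighbourhood of a covered point is still governed by its centre.\<close>

lemma far_cover:
  assumes \<epsilon>: "0 < \<epsilon>"
  obtains w0 q where "0 < w0" "0 < q" "q < ell"
    "\<And>\<theta>. \<theta> \<in> \<Theta> \<Longrightarrow> \<epsilon> \<le> norm (\<theta> - \<theta>h) \<Longrightarrow> \<exists>\<theta>i\<in>\<Theta>. \<exists>c. (\<forall>x. tilted_lik L G \<phi> T \<theta>i c x \<le> ennreal q) \<and>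
      (\<forall>\<theta>'\<in>\<Theta>. norm (\<theta>' - \<theta>) \<le> w0 \<longrightarrow> g (norm (\<theta>i - \<theta>')) \<le> c)"
proof -
  let ?F = "\<Theta> - ball \<theta>h \<epsilon>"
  have "\<exists>c q d. 0 < d \<and> q < ell \<and> (\<forall>x. tilted_lik L G \<phi> T \<theta> c x \<le> ennreal q) \<and> (\<forall>x. 0 \<le> x \<longrightarrow> x \<le> d \<longrightarrow> g x \<le> c)"
    if "\<theta> \<in> ?F" for \<theta>
  proof -
    have "\<theta> \<in> \<Theta>" "\<theta> \<noteq> \<theta>h" using that \<epsilon> by auto
    from lik_less[OF this] obtain c q where c: "0 < c" "q < ell" "\<forall>x. tilted_lik L G \<phi> T \<theta> c x \<le> ennreal q" by blast
    obtain d where "0 < d" "\<And>x. 0 \<le> x \<Longrightarrow> x \<le> d \<Longrightarrow> g x \<le> c" using g_small[OF c(1)] by blast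
    with c show ?thesis by blast
  qed
  then obtain c q d where cqd: "\<And>\<theta>. \<theta> \<in> ?F \<Longrightarrow> 0 < d \<theta>" "\<And>\<theta>. \<theta> \<in> ?F \<Longrightarrow> q \<theta> < ell"
    "\<And>\<theta> x. \<theta> \<in> ?F \<Longrightarrow> tilted_lik L G \<phi> T \<theta> (c \<theta>) x \<le> ennreal (q \<theta>)"
    "\<And>\<theta> x. \<theta> \<in> ?F \<Longrightarrow> 0 \<le> x \<Longrightarrow> x \<le> d \<theta> \<Longrightarrow> g x \<le> c \<theta>"
    by metis
  have cF: "compact ?F" using compact_diff[OF cpt_\<Theta> open_ball] .
  have "?F \<subseteq> (\<Union>\<theta>\<in>?F. ball \<theta> (d \<theta> / 2))" using cqd(1) by force
  then obtain S where S: "S \<subseteq> ?F" "finite S" "?F \<subseteq> (\<Union>\<theta>\<in>S. ball \<theta> (d \<theta> / 2))"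
    using compactE_image[OF cF, of ?F "\<lambda>\<theta>. ball \<theta> (d \<theta> / 2)"] by blast
  \<comment> \<open>The inserted 1, and likewise \<open>ell / 2\<close> below, cover the case of an
    empty family; \<open>ell / 2\<close> also makes the bound positive.\<close>
  define w0 where "w0 = Min (insert 1 ((\<lambda>\<theta>. d \<theta> / 2) ` S))"
  define q0 where "q0 = Max (insert (ell / 2) (q ` S))"
  show thesis
  proof (rule that[of w0 q0])
    show "0 < w0" using S cqd(1) by (auto simp: w0_def)
    show "q0 < ell" using S cqd(2) ell(1) by (auto simp: q0_def)
    have "ell / 2 \<le> q0" unfolding q0_def using S by (intro Max_ge) auto
    then show "0 < q0" using ell(1) by linarith
    fix \<theta> assume "\<theta> \<in> \<Theta>" "\<epsilon> \<le> norm (\<theta> - \<theta>h)"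
    then have "\<theta> \<in> ?F" by (simp add: dist_norm norm_minus_commute)
    then obtain \<theta>i where i: "\<theta>i \<in> S" "dist \<theta>i \<theta> < d \<theta>i / 2" using S(3) by auto
    have w0: "w0 \<le> d \<theta>i / 2" unfolding w0_def using i(1) S(2) by (intro Min_le) auto
    have q0: "q \<theta>i \<le> q0" unfolding q0_def using i(1) S(2) by (intro Max_ge) auto
    have iF: "\<theta>i \<in> ?F" using i S by auto
    show "\<exists>\<theta>i\<in>\<Theta>. \<exists>c. (\<forall>x. tilted_lik L G \<phi> T \<theta>i c x \<le> ennreal q0) \<and>
      (\<forall>\<theta>'\<in>\<Theta>. norm (\<theta>' - \<theta>) \<le> w0 \<longrightarrow> g (norm (\<theta>i - \<theta>')) \<le> c)"
    proof (intro bexI exI conjI ballI allI impI)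
      fix x show "tilted_lik L G \<phi> T \<theta>i (c \<theta>i) x \<le> ennreal q0"
        using cqd(3)[OF iF] q0 by (meson ennreal_leI order_trans)
    next
      fix \<theta>' assume "norm (\<theta>' - \<theta>) \<le> w0"
      then have "norm (\<theta>i - \<theta>') \<le> d \<theta>i"
        using i(2) w0 norm_triangle_ineq[of "\<theta>i - \<theta>" "\<theta> - \<theta>'"] by (simp add: dist_norm norm_minus_commute)
      then show "g (norm (\<theta>i - \<theta>')) \<le> c \<theta>i" by (intro cqd(4) iF) auto
    qed (use iF in auto)
  qed
qed

text \<open>Away from \<theta>h a block gains the likelihood gap, of which a part is spent on exits
  and on the growth of the weight under the noise. Within \<epsilon> of \<theta>h there is nothing
  to gain, but the weight is at most \<open>exp (- lam * \<epsilon>)\<close>, so the crude bound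
  yields the additive error.\<close>

lemma upper_block_W:
  assumes \<epsilon>: "0 < \<epsilon>" "ball \<theta>h (3 * \<epsilon>) \<subseteq> \<Theta>"
  obtains \<rho> D \<eta> where "0 < \<rho>" "\<rho> < 1" "1 \<le> D" "\<rho> * ell \<le> D" "C ^ T \<le> D" "0 < \<eta>" "\<eta> \<le> 1"
    "\<And>k lam \<theta> x. 0 \<le> lam \<Longrightarrow> (\<And>s. s \<in> {1..T} \<Longrightarrow> TN_at (k * T + s) \<and> h (k * T + s) \<le> \<eta> \<and> lam * h (k * T + s) \<le> \<eta>) \<Longrightarrow>
      \<theta> \<in> \<Theta> \<Longrightarrow> run (k * T) T (\<lambda>z. W lam \<epsilon> (fst z)) (\<theta>, x) \<le> ennreal (\<rho> * ell) * W lam \<epsilon> \<theta> + ennreal (D * exp (- lam * \<epsilon>))"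
    "\<And>t n lam \<theta> x. 0 \<le> lam \<Longrightarrow> n \<le> T \<Longrightarrow> (\<And>s. s \<in> {1..n} \<Longrightarrow> TN_at (t + s) \<and> h (t + s) \<le> \<eta> \<and> lam * h (t + s) \<le> \<eta>) \<Longrightarrow>
      \<theta> \<in> \<Theta> \<Longrightarrow> run t n (\<lambda>z. W lam \<epsilon> (fst z)) (\<theta>, x) \<le> ennreal D * W lam \<epsilon> \<theta>"
proof -
  obtain w0 q where wq: "0 < w0" "0 < q" "q < ell"
    "\<And>\<theta>. \<theta> \<in> \<Theta> \<Longrightarrow> \<epsilon> \<le> norm (\<theta> - \<theta>h) \<Longrightarrow> \<exists>\<theta>i\<in>\<Theta>. \<exists>c. (\<forall>x. tilted_lik L G \<phi> T \<theta>i c x \<le> ennreal q) \<and>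
      (\<forall>\<theta>'\<in>\<Theta>. norm (\<theta>' - \<theta>) \<le> w0 \<longrightarrow> g (norm (\<theta>i - \<theta>')) \<le> c)"
    using far_cover[OF \<epsilon>(1)] by blast
  \<comment> \<open>Halfway between \<open>q / ell\<close> and 1. The remaining gap between
    \<open>q\<close> and \<open>\<rho> * ell\<close> pays for exits and noise.\<close>
  define \<rho> where "\<rho> = (q / ell + 1) / 2"
  have \<rho>: "0 < \<rho>" "\<rho> < 1" "q < \<rho> * ell" using wq ell(1) by (auto simp: \<rho>_def field_simps)
  \<comment> \<open>Half of that gap goes to exits, which cost at most \<open>C ^ T * e\<close>; the
    penalty is accordingly \<open>R = 1 / e\<close>.\<close>
  define e where "e = (\<rho> * ell - q) / (2 * C ^ T)"
  have e: "0 < e" using \<rho> C by (simp add: e_def)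
  define m where "m = q + C ^ T * e"
  have "m = q + (\<rho> * ell - q) / 2" using C by (simp add: m_def e_def)
  moreover have "0 < q + (X - q) / 2 \<and> q + (X - q) / 2 < X" if "q < X" for X
    using wq(2) that by (simp add: field_simps)
  ultimately have m: "0 < m" "m < \<rho> * ell" using \<rho>(3) by auto
  \<comment> \<open>The other half pays for the growth of the weight over \<open>T\<close> steps:
    \<open>(1 + z) ^ T * m\<close> is exactly \<open>\<rho> * ell\<close>.\<close>
  define z where "z = root T (\<rho> * ell / m) - 1"
  have "1 < \<rho> * ell / m" using m by simp
  then have z: "0 < z" "(1 + z) ^ T = \<rho> * ell / m"
    using T real_root_gt_1_iff[of T "\<rho> * ell / m"] by (auto simp: z_def real_root_pow_pos2)
  define w where "w = w0 / T"
  have w: "0 < w" "real T * w = w0" using wq T by (auto simp: w_def)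
  have R: "0 \<le> 1 / e" using e by simp
  obtain \<eta> where \<eta>: "0 < \<eta>" "\<eta> \<le> 1" "\<And>t lam \<theta>. TN_at t \<Longrightarrow> h t \<le> \<eta> \<Longrightarrow> 0 \<le> lam \<Longrightarrow> lam * h t \<le> \<eta> \<Longrightarrow> \<theta> \<in> \<Theta> \<Longrightarrow>
    (\<integral>\<^sup>+ \<theta>'. W lam \<epsilon> \<theta>' * (1 + ennreal (1 / e) * indicator {\<theta>'. norm (\<theta>' - \<theta>) > w} \<theta>') \<partial>K t \<theta>) \<le> ennreal (1 + z) * W lam \<epsilon> \<theta>"
    using W_supersolution[OF \<epsilon> R w(1) z(1)] by blast
  \<comment> \<open>One constant that bounds the crude growth over at most \<open>T\<close> steps as
    well as the likelihood.\<close>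
  define D where "D = max ((C * (1 + z)) ^ T) ell"
  have Cz: "1 \<le> C * (1 + z)" using C z mult_mono[of 1 C 1 "1 + z"] by simp
  have pD: "(C * (1 + z)) ^ n \<le> D" if "n \<le> T" for n
    using power_increasing[OF that Cz] by (simp add: D_def)
  have crude: "run t n (\<lambda>z. W lam \<epsilon> (fst z)) (\<theta>, x) \<le> ennreal D * W lam \<epsilon> \<theta>"
    if lam: "0 \<le> lam" and n: "n \<le> T"
      and tn: "\<And>s. s \<in> {1..n} \<Longrightarrow> TN_at (t + s) \<and> h (t + s) \<le> \<eta> \<and> lam * h (t + s) \<le> \<eta>" and \<theta>: "\<theta> \<in> \<Theta>" for t n lam \<theta> x
  proof -
    have "run t n (\<lambda>z. W lam \<epsilon> (fst z)) (\<theta>, x) \<le> (ennreal C * ennreal (1 + z)) ^ n * W lam \<epsilon> \<theta>"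
    proof (rule run_crude[OF W_meas _ \<theta>])
      fix i \<theta>' assume i: "i \<in> {1..n}" and \<theta>': "\<theta>' \<in> \<Theta>"
      have "(\<integral>\<^sup>+ u. W lam \<epsilon> u \<partial>K (t + i) \<theta>') \<le>
        (\<integral>\<^sup>+ u. W lam \<epsilon> u * (1 + ennreal (1 / e) * indicator {u. norm (u - \<theta>') > w} u) \<partial>K (t + i) \<theta>')"
        by (intro nn_integral_mono) (simp add: distrib_left)
      also have "\<dots> \<le> ennreal (1 + z) * W lam \<epsilon> \<theta>'" using tn[OF i] lam \<theta>' by (intro \<eta>) auto
      finally show "(\<integral>\<^sup>+ u. W lam \<epsilon> u \<partial>K (t + i) \<theta>') \<le> ennreal (1 + z) * W lam \<epsilon> \<theta>'" .
    qed
    also have "(ennreal C * ennreal (1 + z)) ^ n = ennreal ((C * (1 + z)) ^ n)"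
      using C z Cz by (subst ennreal_mult[symmetric]) (auto simp: ennreal_power simp del: ennreal_plus)
    also have "\<dots> * W lam \<epsilon> \<theta> \<le> ennreal D * W lam \<epsilon> \<theta>"
      by (intro mult_right_mono ennreal_leI pD n) auto
    finally show ?thesis .
  qed
  show thesis
  proof (rule that[OF \<rho>(1,2) _ _ _ \<eta>(1,2)])
    show "1 \<le> D" using pD[of 0] by simp
    have "\<rho> * ell \<le> ell" using \<rho> ell(1) mult_right_mono[of \<rho> 1 ell] by simp
    then show "\<rho> * ell \<le> D" by (simp add: D_def)
    have "C ^ T \<le> (C * (1 + z)) ^ T" using C z mult_left_mono[of 1 "1 + z" C] by (intro power_mono) auto
    then show "C ^ T \<le> D" using pD[of T] by simp
    show "run t n (\<lambda>z. W lam \<epsilon> (fst z)) (\<theta>, x) \<le> ennreal D * W lam \<epsilon> \<theta>"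
      if "0 \<le> lam" "n \<le> T" "\<And>s. s \<in> {1..n} \<Longrightarrow> TN_at (t + s) \<and> h (t + s) \<le> \<eta> \<and> lam * h (t + s) \<le> \<eta>" "\<theta> \<in> \<Theta>" for t n lam \<theta> x
      by (rule crude[OF that])
    fix k lam \<theta> x assume lam: "0 \<le> lam" and \<theta>: "\<theta> \<in> \<Theta>"
      and tn: "\<And>s. s \<in> {1..T} \<Longrightarrow> TN_at (k * T + s) \<and> h (k * T + s) \<le> \<eta> \<and> lam * h (k * T + s) \<le> \<eta>"
    show "run (k * T) T (\<lambda>z. W lam \<epsilon> (fst z)) (\<theta>, x) \<le> ennreal (\<rho> * ell) * W lam \<epsilon> \<theta> + ennreal (D * exp (- lam * \<epsilon>))"
    proof (cases "\<epsilon> \<le> norm (\<theta> - \<theta>h)")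
      case False
      have "run (k * T) T (\<lambda>z. W lam \<epsilon> (fst z)) (\<theta>, x) \<le> ennreal D * W lam \<epsilon> \<theta>"
        by (intro crude lam \<theta> tn) auto
      also have "\<dots> \<le> ennreal D * ennreal (exp (- lam * \<epsilon>))"
        using False by (intro mult_left_mono W_near lam) auto
      also have "\<dots> = ennreal (D * exp (- lam * \<epsilon>))" by (simp add: ennreal_mult'')
      also have "\<dots> \<le> ennreal (\<rho> * ell) * W lam \<epsilon> \<theta> + \<dots>" by simp
      finally show ?thesis .
    next
      case True
      obtain \<theta>i c where i: "\<theta>i \<in> \<Theta>" "\<And>x. tilted_lik L G \<phi> T \<theta>i c x \<le> ennreal q"
        "\<And>\<theta>'. \<theta>' \<in> \<Theta> \<Longrightarrow> norm (\<theta>' - \<theta>) \<le> w0 \<Longrightarrow> g (norm (\<theta>i - \<theta>')) \<le> c"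
        using wq(4)[OF \<theta> True] by blast
      have "run (k * T) T (\<lambda>z. W lam \<epsilon> (fst z)) (\<theta>, x) \<le>
        ennreal (1 + z) ^ T * W lam \<epsilon> \<theta> * (tilted_lik L G \<phi> T \<theta>i c x + ennreal C ^ T * ennreal e)"
      proof (rule upper_block[OF refl \<theta> i(1) W_meas, where w = w and R = "ennreal (1 / e)"])
        show "1 \<le> ennreal (1 / e) * ennreal e" using e by (simp add: ennreal_mult[symmetric])
        fix s \<theta>' assume s: "s \<in> {1..T}" and \<theta>': "\<theta>' \<in> \<Theta>"
        show "(\<integral>\<^sup>+ u. W lam \<epsilon> u * (1 + ennreal (1 / e) * indicator {u. norm (u - \<theta>') > w} u) \<partial>K (k * T + s) \<theta>')
          \<le> ennreal (1 + z) * W lam \<epsilon> \<theta>'"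
          using tn[OF s] lam \<theta>' by (intro \<eta>) auto
        fix y y' assume d: "norm (\<theta>' - \<theta>) \<le> real T * w"
        have "G s \<theta>' y y' \<le> G s \<theta>i y y' * exp (g (norm (\<theta>i - \<theta>')) * \<phi> s (y, y'))"
          by (rule G_cmp[OF s i(1) \<theta>'])
        also have "\<dots> \<le> G s \<theta>i y y' * exp (c * \<phi> s (y, y'))"
          using i(3)[OF \<theta>'] d w G_nonneg[OF s i(1)] \<phi>_nonneg[OF s]
          by (intro mult_left_mono iffD2[OF exp_le_cancel_iff] mult_right_mono) auto
        finally show "G s \<theta>' y y' \<le> G s \<theta>i y y' * exp (c * \<phi> s (y, y'))" .
      qed (use w in simp)
      also have "\<dots> \<le> ennreal (1 + z) ^ T * W lam \<epsilon> \<theta> * (ennreal q + ennreal C ^ T * ennreal e)"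
        by (intro mult_left_mono add_right_mono i) auto
      also have "ennreal q + ennreal C ^ T * ennreal e = ennreal m"
        using C e wq by (simp add: m_def ennreal_power ennreal_mult)
      also have "ennreal (1 + z) ^ T * W lam \<epsilon> \<theta> * ennreal m = ennreal ((1 + z) ^ T * m) * W lam \<epsilon> \<theta>"
      proof -
        have "ennreal ((1 + z) ^ T * m) = ennreal (1 + z) ^ T * ennreal m"
          using z(1) m(1) by (simp add: ennreal_mult ennreal_power[symmetric] del: ennreal_plus)
        then show ?thesis by (simp add: mult_ac)
      qed
      also have "(1 + z) ^ T * m = \<rho> * ell" using m z by simp
      also have "ennreal (\<rho> * ell) * W lam \<epsilon> \<theta> \<le> ennreal (\<rho> * ell) * W lam \<epsilon> \<theta> + ennreal (D * exp (- lam * \<epsilon>))" by simp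
      finally show ?thesis .
    qed
  qed
qed

lemma run_const_le:
  assumes "\<theta> \<in> \<Theta>" "n \<le> T"
  shows "run t n (\<lambda>_. 1) (\<theta>, x) \<le> ennreal (C ^ T)"
proof -
  have "run t n (\<lambda>z. (\<lambda>_. 1) (fst z)) (\<theta>, x) \<le> (ennreal C * 1) ^ n * 1"
    using assms(1) prob_K by (intro run_crude) (auto simp: prob_space.emeasure_space_1)
  also have "\<dots> \<le> ennreal (C ^ T)"
    using C assms(2) by (simp add: ennreal_power ennreal_leI power_increasing)
  finally show ?thesis by simp
qed

text \<open>An additive error made in one block is carried as a constant through the other blocks,
  each of which enlarges it by at most \<open>C ^ T \<le> D\<close>. Since \<open>q \<le> D\<close>
  too, the \<open>N\<close> errors sum up to at most \<open>N * D ^ N * e\<close>.\<close>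

lemma upper_blocks_W:
  assumes D: "1 \<le> D" "C ^ T \<le> D" and q: "0 \<le> q" "q \<le> D" and e: "0 \<le> e"
    and blk: "\<And>j \<theta> x. j \<in> {k..<k + N} \<Longrightarrow> \<theta> \<in> \<Theta> \<Longrightarrow>
      run (j * T) T (\<lambda>z. W lam \<epsilon> (fst z)) (\<theta>, x) \<le> ennreal q * W lam \<epsilon> \<theta> + ennreal (D * e)"
    and \<theta>: "\<theta> \<in> \<Theta>"
  shows "run (k * T) (N * T) (\<lambda>z. W lam \<epsilon> (fst z)) (\<theta>, x) \<le> ennreal (q ^ N) * W lam \<epsilon> \<theta> + ennreal (N * D ^ N * e)"
  using blk \<theta>
proof (induction N arbitrary: k \<theta> x)
  case (Suc N)
  have DN: "0 \<le> N * D ^ N * e" using D e by simp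
  have "run (k * T) (Suc N * T) (\<lambda>z. W lam \<epsilon> (fst z)) (\<theta>, x) =
    run (k * T) T (run (Suc k * T) (N * T) (\<lambda>z. W lam \<epsilon> (fst z))) (\<theta>, x)"
    using chain_add[of stp "k * T" T "N * T"] by (simp add: add.commute)
  also have "\<dots> \<le> run (k * T) T (\<lambda>z. ennreal (q ^ N) * W lam \<epsilon> (fst z) + ennreal (N * D ^ N * e) * 1) (\<theta>, x)"
    using Suc.prems Suc.IH[of "Suc k"] by (intro run_mono) auto
  also have "\<dots> = ennreal (q ^ N) * run (k * T) T (\<lambda>z. W lam \<epsilon> (fst z)) (\<theta>, x) +
    ennreal (N * D ^ N * e) * run (k * T) T (\<lambda>_. 1) (\<theta>, x)"
    by (intro run_lin Suc.prems fst_meas W_meas) simp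
  also have "\<dots> \<le> ennreal (q ^ N) * (ennreal q * W lam \<epsilon> \<theta> + ennreal (D * e)) + ennreal (N * D ^ N * e) * ennreal (C ^ T)"
    using Suc.prems by (intro add_mono mult_left_mono run_const_le) auto
  also have "\<dots> = ennreal (q ^ Suc N) * W lam \<epsilon> \<theta> + ennreal (q ^ N * (D * e) + N * D ^ N * e * C ^ T)"
  proof -
    have 1: "ennreal (q ^ N) * ennreal q = ennreal (q ^ Suc N)"
      using q by (simp add: ennreal_mult[symmetric] mult.commute)
    have 2: "ennreal (q ^ N) * ennreal (D * e) = ennreal (q ^ N * (D * e))"
      using q D e by (intro ennreal_mult[symmetric]) auto
    have 3: "ennreal (N * D ^ N * e) * ennreal (C ^ T) = ennreal (N * D ^ N * e * C ^ T)"
      using DN C by (intro ennreal_mult[symmetric]) auto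
    have 4: "ennreal (q ^ N * (D * e) + N * D ^ N * e * C ^ T) = ennreal (q ^ N * (D * e)) + ennreal (N * D ^ N * e * C ^ T)"
      using q D e DN C by (intro ennreal_plus) auto
    show ?thesis unfolding 4 3 distrib_left 2 add.assoc by (simp only: mult.assoc[symmetric] 1)
  qed
  also have "\<dots> \<le> ennreal (q ^ Suc N) * W lam \<epsilon> \<theta> + ennreal (Suc N * D ^ Suc N * e)"
  proof (intro add_left_mono ennreal_leI)
    have "q ^ N * (D * e) \<le> D ^ N * (D * e)" using q D e by (intro mult_right_mono power_mono) auto
    moreover have "N * D ^ N * e * C ^ T \<le> N * D ^ N * e * D" using DN D by (intro mult_left_mono) auto
    ultimately show "q ^ N * (D * e) + N * D ^ N * e * C ^ T \<le> Suc N * D ^ Suc N * e"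
      by (simp add: algebra_simps)
  qed
  finally show ?case .
qed simp

end

section \<open>Mass near the maximiser\<close>

context so_gauss begin

text \<open>The initial law enters as a kernel \<open>K 1\<close> that ignores its argument, so the starting point is immaterial.\<close>

definition U :: "nat \<Rightarrow> (real ^ 'd \<Rightarrow> ennreal) \<Rightarrow> ennreal" where
  "U n F = run 0 n (\<lambda>z. F (fst z)) (\<theta>h, undefined)"

abbreviation mass1 :: "nat \<Rightarrow> ennreal" where "mass1 n \<equiv> U n (\<lambda>_. 1)"

lemma U_mono: "(\<And>\<theta>. \<theta> \<in> \<Theta> \<Longrightarrow> F \<theta> \<le> H \<theta>) \<Longrightarrow> U n F \<le> U n H"
  unfolding U_def by (intro run_mono \<theta>h_mem) auto

lemma U_lin:
  assumes "F \<in> borel_measurable borel" "H \<in> borel_measurable borel"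
  shows "U n (\<lambda>\<theta>. c * F \<theta> + d * H \<theta>) = c * U n F + d * U n H"
  unfolding U_def by (intro run_lin \<theta>h_mem fst_meas assms)

lemma U_cmult:
  assumes "F \<in> borel_measurable borel"
  shows "U n (\<lambda>\<theta>. c * F \<theta>) = c * U n F"
  using U_lin[OF assms assms, of n c 0] by simp

text \<open>The bound on the last \<open>n\<close> steps holds for every state, so it can be
  inserted into the first \<open>m\<close> steps by monotonicity and linearity.\<close>

lemma U_le:
  assumes le: "\<And>\<theta> x. \<theta> \<in> \<Theta> \<Longrightarrow> run m n (\<lambda>z. F (fst z)) (\<theta>, x) \<le> c * H \<theta> + d" and H: "H \<in> borel_measurable borel"
  shows "U (m + n) F \<le> c * U m H + d * mass1 m"
proof -
  have "U (m + n) F \<le> U m (\<lambda>\<theta>. c * H \<theta> + d * 1)"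
    unfolding U_def chain_add add_0 by (intro run_mono \<theta>h_mem) (simp add: le)
  also have "\<dots> = c * U m H + d * mass1 m" by (intro U_lin H) simp
  finally show ?thesis .
qed

lemma U_ge:
  assumes le: "\<And>\<theta> x. \<theta> \<in> \<Theta> \<Longrightarrow> c * H \<theta> \<le> run m n (\<lambda>z. F (fst z)) (\<theta>, x)" and H: "H \<in> borel_measurable borel"
  shows "c * U m H \<le> U (m + n) F"
proof -
  have "c * U m H = U m (\<lambda>\<theta>. c * H \<theta>)" by (rule U_cmult[OF H, symmetric])
  also have "\<dots> \<le> U (m + n) F"
    unfolding U_def chain_add add_0 by (intro run_mono \<theta>h_mem) (simp add: le)
  finally show ?thesis .
qed

lemma mass1_le:
  assumes "n \<le> T" shows "mass1 (m + n) \<le> ennreal (C ^ T) * mass1 m"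
  using U_le[where c = "ennreal (C ^ T)" and d = 0 and H = "\<lambda>_. 1" and F = "\<lambda>_. 1" and m = m and n = n]
    run_const_le assms by simp

lemma mass1_blocks_le: "mass1 (n * T) \<le> ennreal ((C ^ T) ^ n)"
proof (induction n)
  case (Suc n)
  have "mass1 (Suc n * T) \<le> ennreal (C ^ T) * mass1 (n * T)"
    using mass1_le[of T "n * T"] by (simp add: add.commute)
  also have "\<dots> \<le> ennreal (C ^ T) * ennreal ((C ^ T) ^ n)" by (intro mult_left_mono Suc.IH) auto
  finally show ?case using C by (simp add: ennreal_mult)
qed (simp add: U_def)

lemma mass1_fin: "mass1 t < top"
proof -
  have "mass1 (t div T * T + t mod T) \<le> ennreal (C ^ T) * mass1 (t div T * T)"
    using T by (intro mass1_le) (simp add: less_imp_le)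
  also have "\<dots> \<le> ennreal (C ^ T) * ennreal ((C ^ T) ^ (t div T))" by (intro mult_left_mono mass1_blocks_le) auto
  also have "\<dots> < top" by (simp add: ennreal_mult_less_top)
  finally show ?thesis by simp
qed

text \<open>Used from right to left: lower bounds are available at ends of blocks, and this carries
  them back to any time inside the block, since the total mass cannot grow by more than
  \<open>C ^ T\<close> until its end.\<close>

lemma mass1_next_block:
  assumes "r \<le> T" shows "mass1 (Suc n * T) \<le> ennreal (C ^ T) * mass1 (n * T + r)"
  using mass1_le[of "T - r" "n * T + r"] assms by (simp add: add.commute)

text \<open>The lower comparison with the constant function 1 and a radius \<open>D\<close> that
  covers all of \<Theta>. The tilt is then large, but even a large negative tilt leaves a positive
  likelihood.\<close>

lemma mass1_pos: "0 < mass1 t"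
proof -
  obtain D where D: "\<And>\<theta>. \<theta> \<in> \<Theta> \<Longrightarrow> norm (\<theta> - \<theta>h) \<le> D"
  proof -
    obtain B where "\<And>u. u \<in> \<Theta> \<Longrightarrow> norm u \<le> B"
      using compact_imp_bounded[OF cpt_\<Theta>] by (auto simp: bounded_iff)
    then have "norm (\<theta> - \<theta>h) \<le> B + norm \<theta>h" if "\<theta> \<in> \<Theta>" for \<theta>
      using norm_triangle_ineq4[of \<theta> \<theta>h] that by force
    then show ?thesis by (rule that)
  qed
  have D0: "0 \<le> D" using D[OF \<theta>h_mem] by simp
  then have "0 \<le> g D" using g_mono g_0 strict_mono_on_leD[OF g_mono, of 0 D] by simp
  then obtain q where q: "0 < q" "\<And>x. ennreal q \<le> tilted_lik L G \<phi> T \<theta>h (- g D) x"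
    using lik_pos by blast
  have blk: "0 < mass1 (n * T)" for n
  proof -
    have "ennreal q ^ n * 1 \<le> run (0 * T) (n * T) (\<lambda>z. 1) (\<theta>h, undefined)"
    proof (rule lower_blocks[where u = "\<lambda>_ _. 1" and r = D])
      fix t \<theta> assume "t \<in> {0 * T + 1..(0 + n) * T}" "\<theta> \<in> \<Theta>"
      then have "prob_space (K t \<theta>)" by (intro prob_K) auto
      then show "1 \<le> (\<integral>\<^sup>+ \<theta>'. 1 \<partial>K t \<theta>)" by (simp add: prob_space.emeasure_space_1)
    qed (use q D D0 \<theta>h_mem in auto)
    moreover have "0 < ennreal q ^ n" using q by (simp add: ennreal_power)
    ultimately show ?thesis by (simp add: U_def)
  qed
  have "0 < ennreal (C ^ T) * mass1 (t div T * T + t mod T)"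
    using T by (intro less_le_trans[OF blk mass1_next_block]) (simp add: less_imp_le)
  then show ?thesis by (simp add: ennreal_zero_less_mult_iff)
qed

text \<open>A tent of slope \<open>1 / r\<close> around \<theta>h, lowered by \<open>s\<close> and
  cut off at 0. The lowering is a budget that is used up as time advances.\<close>

definition bump :: "real \<Rightarrow> real \<Rightarrow> real ^ 'd \<Rightarrow> ennreal" where
  "bump r s \<theta> = ennreal (max 0 (1 - norm (\<theta> - \<theta>h) / r - s))"

lemma bump_meas [measurable]: "bump r s \<in> borel_measurable borel"
  unfolding bump_def[abs_def] by measurable

text \<open>The tent is Lipschitz with constant \<open>1 / r\<close> and the mean displacement of a
  Gaussian step is at most \<open>h t * J\<close>, so lowering the tent by \<open>e\<close>
  compensates for one step. Where the lowered tent is positive, the parameter is within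
  \<open>r\<close> of \<theta>h, which leaves room for the ball of radius
  \<open>h t\<close>.\<close>

lemma bump_subsolution:
  assumes r: "0 < r" "ball \<theta>h (2 * r) \<subseteq> \<Theta>" and t: "TN_at t" "h t \<le> r" "h t * J \<le> r * e" and e: "0 \<le> e" and \<theta>: "\<theta> \<in> \<Theta>"
    and s: "0 \<le> s"
  shows "bump r (s + e) \<theta> \<le> (\<integral>\<^sup>+ \<theta>'. bump r s \<theta>' \<partial>K t \<theta>)"
proof (cases "1 - norm (\<theta> - \<theta>h) / r - s \<le> e")
  case True
  then show ?thesis by (simp add: bump_def)
next
  case False
  define \<alpha> where "\<alpha> = 1 - norm (\<theta> - \<theta>h) / r - s"
  have \<alpha>: "e < \<alpha>" using False by (simp add: \<alpha>_def)
  have t2: "2 \<le> t" and K_eq: "K t \<theta> = TN \<Theta> \<theta> ((h t)\<^sup>2 *\<^sub>R V)" using t(1) \<theta> by (auto simp: TN_at_def)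
  interpret prob_space "K t \<theta>" using t2 \<theta> by (intro prob_K) auto
  have "norm (\<theta> - \<theta>h) / r < 1" using \<alpha> e s by (simp add: \<alpha>_def)
  then have nr: "norm (\<theta> - \<theta>h) < r" using r by simp
  have near: "ball \<theta> (h t) \<subseteq> \<Theta>"
  proof
    fix u assume "u \<in> ball \<theta> (h t)"
    then have "norm (\<theta> - u) < r" using t by (simp add: dist_norm)
    then have "norm (\<theta>h - u) < 2 * r"
      using nr norm_triangle_ineq[of "\<theta>h - \<theta>" "\<theta> - u"] by (simp add: norm_minus_commute)
    then show "u \<in> \<Theta>" using r(2) by (auto simp: dist_norm)
  qed
  have m1: "bump r s \<in> borel_measurable (K t \<theta>)" using t2 \<theta> by (intro meas_KI) auto
  have m2: "(\<lambda>\<theta>'. ennreal (norm (\<theta>' - \<theta>))) \<in> borel_measurable (K t \<theta>)" using t2 \<theta> by (intro meas_KI) auto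
  have "ennreal (\<alpha> - e) + ennreal e = ennreal \<alpha>" using \<alpha> e by (simp flip: ennreal_plus)
  also have "\<dots> = (\<integral>\<^sup>+ \<theta>'. ennreal \<alpha> \<partial>K t \<theta>)" by (simp add: emeasure_space_1)
  also have "\<dots> \<le> (\<integral>\<^sup>+ \<theta>'. bump r s \<theta>' + ennreal (1 / r) * ennreal (norm (\<theta>' - \<theta>)) \<partial>K t \<theta>)"
  proof (intro nn_integral_mono)
    fix \<theta>'
    have "norm (\<theta>' - \<theta>h) \<le> norm (\<theta> - \<theta>h) + norm (\<theta>' - \<theta>)"
      using norm_triangle_ineq[of "\<theta> - \<theta>h" "\<theta>' - \<theta>"] by simp
    then have "norm (\<theta>' - \<theta>h) / r \<le> norm (\<theta> - \<theta>h) / r + norm (\<theta>' - \<theta>) / r"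
      using r by (simp add: add_divide_distrib[symmetric] divide_right_mono)
    then have "\<alpha> \<le> max 0 (1 - norm (\<theta>' - \<theta>h) / r - s) + 1 / r * norm (\<theta>' - \<theta>)" by (simp add: \<alpha>_def)
    then have "ennreal \<alpha> \<le> ennreal (max 0 (1 - norm (\<theta>' - \<theta>h) / r - s) + 1 / r * norm (\<theta>' - \<theta>))" by (rule ennreal_leI)
    also have "\<dots> = bump r s \<theta>' + ennreal (1 / r) * ennreal (norm (\<theta>' - \<theta>))"
      using r by (subst ennreal_mult[symmetric]) (auto simp: bump_def intro!: ennreal_plus)
    finally show "ennreal \<alpha> \<le> bump r s \<theta>' + ennreal (1 / r) * ennreal (norm (\<theta>' - \<theta>))" .
  qed
  also have "\<dots> = (\<integral>\<^sup>+ \<theta>'. bump r s \<theta>' \<partial>K t \<theta>) + ennreal (1 / r) * (\<integral>\<^sup>+ \<theta>'. ennreal (norm (\<theta>' - \<theta>)) \<partial>K t \<theta>)"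
    using m1 m2 by (subst nn_integral_add) (simp_all add: nn_integral_cmult)
  also have "\<dots> \<le> (\<integral>\<^sup>+ \<theta>'. bump r s \<theta>' \<partial>K t \<theta>) + ennreal (1 / r) * ennreal (h t * J)"
    unfolding K_eq by (intro add_left_mono mult_left_mono TN_mean_step near \<theta> h_nonneg t2) auto
  also have "ennreal (1 / r) * ennreal (h t * J) \<le> ennreal e"
    using r t(3) by (subst ennreal_mult'[symmetric]) (auto intro!: ennreal_leI simp: field_simps)
  finally have "ennreal (\<alpha> - e) + ennreal e \<le> (\<integral>\<^sup>+ \<theta>'. bump r s \<theta>' \<partial>K t \<theta>) + ennreal e"
    by (meson add_left_mono order_trans)
  then have "ennreal (\<alpha> - e) \<le> (\<integral>\<^sup>+ \<theta>'. bump r s \<theta>' \<partial>K t \<theta>)"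
    by (simp add: add.commute[of _ "ennreal e"])
  then show ?thesis using \<alpha> by (simp add: bump_def \<alpha>_def algebra_simps)
qed

text \<open>The first transition of the window is arbitrary, so that it may be a heavy-tailed one.\<close>

lemma lower_window:
  assumes r: "0 < r" "ball \<theta>h (2 * r) \<subseteq> \<Theta>" and q: "\<And>x. q \<le> tilted_lik L G \<phi> T \<theta>h (- g r) x"
    and N: "1 \<le> N" and e: "0 \<le> (e :: real)" "e * real (N * T) \<le> 1 / 4"
    and tn: "\<And>t. t \<in> {k * T + 2..(k + N) * T} \<Longrightarrow> TN_at t \<and> h t \<le> r \<and> h t * J \<le> r * e"
    and \<theta>: "\<theta> \<in> \<Theta>"
  shows "q ^ N * (ennreal (1 / 2) * (\<integral>\<^sup>+ \<theta>'. indicator (ball \<theta>h (r / 4)) \<theta>' \<partial>K (k * T + 1) \<theta>)) \<le>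
    run (k * T) (N * T) (\<lambda>_. 1) (\<theta>, x)"
proof -
  define b where "b = (k + N) * T"
  \<comment> \<open>The tent has full height at the end of the window and is lower by
    \<open>e\<close> for each step to go. At the starting time \<open>u\<close> is by definition the
    image of the next tent, so no property of the first kernel enters.\<close>
  define u where "u = (\<lambda>t \<theta>. if t = k * T then (\<integral>\<^sup>+ \<theta>'. bump r ((real b - real (k * T + 1)) * e) \<theta>' \<partial>K (k * T + 1) \<theta>)
    else bump r ((real b - real t) * e) \<theta>)"
  have kb: "k * T + 1 \<le> b"
  proof -
    have "1 * 1 \<le> N * T" using N T by (intro mult_mono) auto
    then show ?thesis by (simp add: b_def add_mult_distrib)
  qed
  have "q ^ N * u (k * T) \<theta> \<le> run (k * T) (N * T) (\<lambda>z. u ((k + N) * T) (fst z)) (\<theta>, x)"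
  proof (rule lower_blocks[OF _ _ q _ _ \<theta>])
    fix t assume "t \<in> {k * T + 1..(k + N) * T}"
    then have "u t = bump r ((real b - real t) * e)" by (auto simp: u_def)
    then show "u t \<in> borel_measurable borel" by simp
  next
    fix t \<theta> assume t: "t \<in> {k * T + 1..(k + N) * T}" and "u t \<theta> \<noteq> 0"
    then have "0 < 1 - norm (\<theta> - \<theta>h) / r - (real b - real t) * e"
      by (auto simp: u_def bump_def max_def split: if_splits)
    moreover have "0 \<le> (real b - real t) * e" using t e unfolding b_def by (intro mult_nonneg_nonneg) (auto simp del: of_nat_mult of_nat_add)
    ultimately have "norm (\<theta> - \<theta>h) / r < 1" by linarith
    then show "norm (\<theta> - \<theta>h) \<le> r" using r by simp
  next
    fix t \<theta> assume t: "t \<in> {k * T + 1..(k + N) * T}" and \<theta>: "\<theta> \<in> \<Theta>"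
    show "u (t - 1) \<theta> \<le> (\<integral>\<^sup>+ \<theta>'. u t \<theta>' \<partial>K t \<theta>)"
    proof (cases "t = k * T + 1")
      case True
      then show ?thesis by (simp add: u_def)
    next
      case False
      then have t': "t \<in> {k * T + 2..(k + N) * T}" "t \<noteq> k * T" "t - 1 \<noteq> k * T" "real (t - 1) = real t - 1" using t by auto
      have "u (t - 1) \<theta> = bump r ((real b - real t) * e + e) \<theta>" using t' by (simp add: u_def algebra_simps)
      also have "\<dots> \<le> (\<integral>\<^sup>+ \<theta>'. bump r ((real b - real t) * e) \<theta>' \<partial>K t \<theta>)"
        using tn[OF t'(1)] t e unfolding b_def
        by (intro bump_subsolution r \<theta> mult_nonneg_nonneg) (auto simp del: of_nat_mult of_nat_add)
      finally show ?thesis using t'(2) by (simp add: u_def)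
    qed
  qed (use r in auto)
  also have "\<dots> \<le> run (k * T) (N * T) (\<lambda>_. 1) (\<theta>, x)"
    using kb unfolding b_def by (intro run_mono \<theta>) (auto simp: u_def bump_def b_def ennreal_le_1 r less_imp_le)
  finally have main: "q ^ N * u (k * T) \<theta> \<le> run (k * T) (N * T) (\<lambda>_. 1) (\<theta>, x)" .
  have "ennreal (1 / 2) * (\<integral>\<^sup>+ \<theta>'. indicator (ball \<theta>h (r / 4)) \<theta>' \<partial>K (k * T + 1) \<theta>) =
    (\<integral>\<^sup>+ \<theta>'. ennreal (1 / 2) * indicator (ball \<theta>h (r / 4)) \<theta>' \<partial>K (k * T + 1) \<theta>)"
    by (intro nn_integral_cmult[symmetric] meas_KI \<theta>) (auto intro!: borel_measurable_indicator)
  also have "\<dots> \<le> (\<integral>\<^sup>+ \<theta>'. bump r ((real b - (1 + real k * real T)) * e) \<theta>' \<partial>K (k * T + 1) \<theta>)"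
  proof (intro nn_integral_mono)
    fix \<theta>'
    show "ennreal (1 / 2) * indicator (ball \<theta>h (r / 4)) \<theta>' \<le> bump r ((real b - (1 + real k * real T)) * e) \<theta>'"
    proof (cases "\<theta>' \<in> ball \<theta>h (r / 4)")
      case True
      have "norm (\<theta>' - \<theta>h) / r \<le> 1 / 4" using True r by (simp add: dist_norm norm_minus_commute)
      moreover have "(real b - (1 + real k * real T)) * e \<le> 1 / 4"
      proof -
        have "(real b - (1 + real k * real T)) * e \<le> (N * T) * e" using e by (intro mult_right_mono) (auto simp: b_def algebra_simps)
        then show ?thesis using e(2) by (simp add: mult.commute)
      qed
      \<comment> \<open>Within \<open>r / 4\<close> of \<theta>h the slope costs at most 1/4, and so
        does the whole budget of the window.\<close>
      ultimately have "1 / 2 \<le> max 0 (1 - norm (\<theta>' - \<theta>h) / r - (real b - (1 + real k * real T)) * e)" by linarith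
      from ennreal_leI[OF this] show ?thesis using True by (simp add: bump_def)
    qed simp
  qed
  also have "\<dots> = u (k * T) \<theta>" by (simp add: u_def)
  finally have "q ^ N * (ennreal (1 / 2) * (\<integral>\<^sup>+ \<theta>'. indicator (ball \<theta>h (r / 4)) \<theta>' \<partial>K (k * T + 1) \<theta>)) \<le> q ^ N * u (k * T) \<theta>"
    by (intro mult_left_mono) auto
  with main show ?thesis by (rule order_trans[rotated])
qed

text \<open>A slight negative tilt keeps the likelihood at \<theta>h above \<open>\<sigma>\<close>,
  and \<open>g\<close> is small near 0, so a small radius needs no more than this tilt.\<close>

lemma near_radius:
  assumes "\<sigma> < ell" "0 < e"
  obtains r where "0 < r" "r \<le> e" "ball \<theta>h (2 * r) \<subseteq> \<Theta>" "\<And>x. ennreal \<sigma> \<le> tilted_lik L G \<phi> T \<theta>h (- g r) x"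
proof -
  obtain c where c: "0 < c" "\<And>x. ennreal \<sigma> \<le> tilted_lik L G \<phi> T \<theta>h (- c) x" using lik_hat[OF assms(1)] by blast
  obtain d where d: "0 < d" "\<And>x. 0 \<le> x \<Longrightarrow> x \<le> d \<Longrightarrow> g x \<le> c" using g_small[OF c(1)] by blast
  obtain R where R: "0 < R" "ball \<theta>h R \<subseteq> \<Theta>" using \<theta>h by (auto simp: mem_interior)
  define r where "r = min (min d e) (R / 2)"
  have r: "0 < r" "r \<le> d" "r \<le> e" "2 * r \<le> R" using d R assms by (auto simp: r_def)
  have mono: "tilted_lik L G \<phi> T \<theta>h (- c) x \<le> tilted_lik L G \<phi> T \<theta>h (- g r) x" for x
  proof -
    \<comment> \<open>The tilted likelihood is monotone in the tilt since \<open>\<phi>\<close> is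
      nonnegative; the terminal functions vary to let the induction through.\<close>
    have "chain (frozen_step L G \<phi> \<theta>h (- c)) 0 n F y \<le> chain (frozen_step L G \<phi> \<theta>h (- g r)) 0 n H y"
      if "n \<le> T" "\<And>y. F y \<le> H y" for n F H y
      using that
    proof (induction n arbitrary: F H)
      case (Suc n)
      show ?case unfolding chain.simps
      proof (rule Suc.IH)
        fix y
        have s: "0 + Suc n \<in> {1..T}" using Suc.prems by auto
        show "frozen_step L G \<phi> \<theta>h (- c) (0 + Suc n) F y \<le> frozen_step L G \<phi> \<theta>h (- g r) (0 + Suc n) H y"
          unfolding frozen_step_def using d(2)[of r] r G_nonneg[OF s \<theta>h_mem] \<phi>_nonneg[OF s]
          by (intro nn_integral_mono mult_mono ennreal_leI mult_left_mono iffD2[OF exp_le_cancel_iff] mult_right_mono Suc.prems) auto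
      qed (use Suc.prems in auto)
    qed simp
    then show ?thesis unfolding tilted_lik_def by simp
  qed
  show thesis
  proof (rule that[OF r(1,3)])
    show "ball \<theta>h (2 * r) \<subseteq> \<Theta>" using R r(4) subset_ball[of "2 * r" R \<theta>h] by auto
    show "ennreal \<sigma> \<le> tilted_lik L G \<phi> T \<theta>h (- g r) x" for x using c(2) mono order_trans by blast
  qed
qed

end

section \<open>Fast kernels\<close>

text \<open>The common form of all comparisons: \<open>A\<close> is the far mass, \<open>B\<close>
  the total mass at the same time, \<open>B'\<close> the total mass at the end of its block, and
  \<open>Z\<close> the reference mass at the start of the window. \<open>Z\<close> drops out without
  being divided by.\<close>

lemma ennreal_ratio_bound:
  fixes A Z B B' :: ennreal
  assumes "A \<le> ennreal X * Z" "ennreal Y * Z \<le> B'" "B' \<le> ennreal D * B" "X * D \<le> e * Y" "0 < D" "0 \<le> e" "0 \<le> Y"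
  shows "A \<le> ennreal e * B"
proof -
  have "X \<le> e / D * Y" using assms(4,5) by (simp add: field_simps)
  then have "A \<le> ennreal (e / D * Y) * Z"
    using assms(1) by (meson ennreal_leI mult_right_mono order_trans zero_le)
  also have "\<dots> = ennreal (e / D) * (ennreal Y * Z)"
    using assms(5-7) by (simp add: ennreal_mult mult.assoc del: times_divide_eq_left)
  also have "\<dots> \<le> ennreal (e / D) * (ennreal D * B)"
    using assms(2,3) by (intro mult_left_mono) (auto intro: order_trans)
  also have "\<dots> = ennreal e * B"
    using assms(5,6) by (simp add: mult.assoc[symmetric] ennreal_mult[symmetric])
  finally show ?thesis .
qed

text \<open>An initial segment of \<open>n div Q\<close> blocks, on which only the crude ratio
  \<open>E\<close> per block is known, is outweighed by the gain \<beta> in the remaining blocks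
  once \<open>Q\<close> is large. Then \<open>M\<close> is chosen so large that the exponential
  decay beats the accumulated errors.\<close>

lemma fast_rate:
  fixes E F \<beta> \<epsilon> A :: real
  assumes E: "1 \<le> E" and F: "1 \<le> F" and \<beta>: "0 < \<beta>" "\<beta> < 1" and \<epsilon>: "0 < \<epsilon>"
  obtains Q M where "1 \<le> (Q :: nat)" "0 \<le> M"
    "(\<lambda>n. A * E ^ (n div Q) * (\<beta> ^ (n - n div Q) + real (n - n div Q) * F ^ (n - n div Q) * exp (- (M * real n) * \<epsilon>))) \<longlonglongrightarrow> 0"
proof -
  have "(\<lambda>n. E * \<beta> ^ n) \<longlonglongrightarrow> E * 0" using \<beta> by (intro tendsto_mult_left LIMSEQ_power_zero) simp
  then have "eventually (\<lambda>n. E * \<beta> ^ n < 1 / 2) sequentially" by (rule order_tendstoD) simp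
  then obtain q where q: "E * \<beta> ^ q \<le> 1 / 2" by (auto simp: eventually_sequentially intro: less_imp_le)
  \<comment> \<open>Solves \<open>exp (- M * \<epsilon>) * E * F = 1 / 2\<close>, so the error term
    is at most \<open>n\<close> times a geometric sequence.\<close>
  define M where "M = ln (2 * E * F) / \<epsilon>"
  have EF: "1 \<le> E * F" using mult_mono[OF E F] E by simp
  have M: "0 \<le> M" using EF \<epsilon> by (simp add: M_def mult.assoc)
  have eM: "exp (- (M * \<epsilon>)) * (E * F) = 1 / 2"
    using EF E F \<epsilon> by (simp add: M_def exp_minus mult.assoc) (simp add: field_simps)
  \<comment> \<open>With one more than \<open>q\<close>, each block of the initial segment is
    matched by at least \<open>q\<close> blocks of the window.\<close>
  let ?Q = "Suc q"
  show thesis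
  proof (rule that[of ?Q M])
    have "(\<lambda>n. \<bar>A\<bar> * ((1 / 2) ^ (n div ?Q) + real n * (1 / 2) ^ n)) \<longlonglongrightarrow> \<bar>A\<bar> * (0 + 0)"
    proof (intro tendsto_mult_left tendsto_add)
      have "filterlim (\<lambda>n::nat. n div ?Q) at_top at_top"
        by (rule filterlim_at_top[THEN iffD2]) (auto simp: eventually_at_top_linorder intro!: exI[of _ "Z * ?Q" for Z] simp: less_eq_div_iff_mult_less_eq)
      moreover have "(\<lambda>n. (1 / 2 :: real) ^ n) \<longlonglongrightarrow> 0" by (rule LIMSEQ_power_zero) simp
      ultimately show "(\<lambda>n. (1 / 2 :: real) ^ (n div ?Q)) \<longlonglongrightarrow> 0"
        by (rule filterlim_compose[rotated])
      show "(\<lambda>n. real n * (1 / 2) ^ n) \<longlonglongrightarrow> 0" by real_asymp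
    qed
    then have lim: "(\<lambda>n. \<bar>A\<bar> * ((1 / 2) ^ (n div ?Q) + real n * (1 / 2) ^ n)) \<longlonglongrightarrow> 0" by simp
    show "(\<lambda>n. A * E ^ (n div ?Q) * (\<beta> ^ (n - n div ?Q) + real (n - n div ?Q) * F ^ (n - n div ?Q) * exp (- (M * real n) * \<epsilon>))) \<longlonglongrightarrow> 0"
    proof (rule Lim_null_comparison[OF always_eventually lim], rule allI)
      fix n
      let ?k = "n div ?Q"
      have kn: "?k \<le> n" by simp
      have "?k * ?Q \<le> n" by (rule div_times_less_eq_dividend)
      then have N: "q * ?k \<le> n - ?k" by (simp add: algebra_simps)
      have "E ^ ?k * \<beta> ^ (n - ?k) \<le> E ^ ?k * \<beta> ^ (q * ?k)"
        using E \<beta> N by (intro mult_left_mono power_decreasing) auto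
      also have "\<dots> = (E * \<beta> ^ q) ^ ?k" by (simp add: power_mult_distrib power_mult)
      also have "\<dots> \<le> (1 / 2) ^ ?k" using q E \<beta> by (intro power_mono) auto
      finally have 1: "E ^ ?k * \<beta> ^ (n - ?k) \<le> (1 / 2) ^ ?k" .
      have "E ^ ?k * (real (n - ?k) * F ^ (n - ?k) * exp (- (M * real n) * \<epsilon>)) \<le>
        E ^ n * (real n * F ^ n * exp (- (M * real n) * \<epsilon>))"
        using E F kn by (intro mult_mono power_increasing) auto
      also have "\<dots> = real n * (exp (- (M * \<epsilon>)) * (E * F)) ^ n"
        by (simp add: power_mult_distrib exp_of_nat_mult[symmetric] mult_ac)
      finally have 2: "E ^ ?k * (real (n - ?k) * F ^ (n - ?k) * exp (- (M * real n) * \<epsilon>)) \<le> real n * (1 / 2) ^ n"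
        unfolding eM .
      define X where "X = \<beta> ^ (n - ?k) + real (n - ?k) * F ^ (n - ?k) * exp (- (M * real n) * \<epsilon>)"
      have "0 \<le> X" using F \<beta> by (simp add: X_def)
      then have "norm (A * E ^ ?k * X) = \<bar>A\<bar> * (E ^ ?k * X)" using E by (simp add: abs_mult)
      then have "norm (A * E ^ ?k * (\<beta> ^ (n - ?k) + real (n - ?k) * F ^ (n - ?k) * exp (- (M * real n) * \<epsilon>))) =
        \<bar>A\<bar> * (E ^ ?k * \<beta> ^ (n - ?k) + E ^ ?k * (real (n - ?k) * F ^ (n - ?k) * exp (- (M * real n) * \<epsilon>)))"
        by (simp add: X_def distrib_left)
      also have "\<dots> \<le> \<bar>A\<bar> * ((1 / 2) ^ ?k + real n * (1 / 2) ^ n)"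
        using 1 2 by (intro mult_left_mono add_mono) auto
      finally show "norm (A * E ^ ?k * (\<beta> ^ (n - ?k) + real (n - ?k) * F ^ (n - ?k) * exp (- (M * real n) * \<epsilon>))) \<le>
        \<bar>A\<bar> * ((1 / 2) ^ ?k + real n * (1 / 2) ^ n)" .
    qed
  qed (use M in auto)
qed

section \<open>Concentration of the filter under the fast kernels\<close>

context so_gauss begin

definition far :: "real \<Rightarrow> real ^ 'd \<Rightarrow> ennreal" where
  "far \<epsilon> = indicator {\<theta>. 2 * \<epsilon> \<le> norm (\<theta> - \<theta>h)}"

lemma far_meas [measurable]: "far \<epsilon> \<in> borel_measurable borel"
  unfolding far_def by measurable

lemma far_le_W: "far \<epsilon> \<theta> \<le> W lam \<epsilon> \<theta>"
  by (auto simp: far_def indicator_def W_far)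

text \<open>Stated for the unnormalised masses: the filter probability of being at distance at least
  \<open>2 * \<epsilon>\<close> from \<theta>h tends to 0. The restriction on \<epsilon> leaves the
  margin inside \<Theta> that the weight \<open>W\<close> needs.\<close>

definition concentrates :: bool where
  "concentrates \<longleftrightarrow> (\<forall>\<epsilon> e. 0 < \<epsilon> \<longrightarrow> ball \<theta>h (3 * \<epsilon>) \<subseteq> \<Theta> \<longrightarrow> 0 < e \<longrightarrow>
    (\<forall>\<^sub>F t in sequentially. U t (far \<epsilon>) \<le> ennreal e * mass1 t))"

lemma ball_meas [measurable]: "indicator (ball x r) \<in> borel_measurable (borel :: (real ^ 'd) measure)"
  by (intro borel_measurable_indicator) simp

text \<open>Up to block \<open>k = n div Q\<close> the noise may be large and only crude ratios are
  available: the mass in a small ball loses at most a fixed factor per block against the total mass.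
  From then on \<open>h\<close> at time s is o(1/n), because s is at least a fixed fraction of n. So
  the sharp comparisons hold on the whole remaining window, with \<open>lam\<close> proportional to
  \<open>n\<close>.\<close>

theorem fast_concentrates:
  assumes TN: "\<And>t. 2 \<le> t \<Longrightarrow> TN_at t" and h_lim: "(\<lambda>t. real t * h t) \<longlonglongrightarrow> 0"
    and K1: "\<And>r. 0 < r \<Longrightarrow> \<exists>c>0. \<forall>\<theta>\<in>\<Theta>. ennreal c \<le> (\<integral>\<^sup>+ \<theta>'. indicator (ball \<theta>h r) \<theta>' \<partial>K 1 \<theta>)"
  shows concentrates
  unfolding concentrates_def
proof (intro allI impI)
  fix \<epsilon> e :: real assume \<epsilon>: "0 < \<epsilon>" "ball \<theta>h (3 * \<epsilon>) \<subseteq> \<Theta>" and e: "0 < e"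
  obtain \<rho> D \<eta> where uw: "0 < \<rho>" "\<rho> < 1" "1 \<le> D" "\<rho> * ell \<le> D" "C ^ T \<le> D" "0 < \<eta>" "\<eta> \<le> 1"
    and uw1: "\<And>k lam \<theta> x. 0 \<le> lam \<Longrightarrow> (\<And>s. s \<in> {1..T} \<Longrightarrow> TN_at (k * T + s) \<and> h (k * T + s) \<le> \<eta> \<and> lam * h (k * T + s) \<le> \<eta>) \<Longrightarrow>
      \<theta> \<in> \<Theta> \<Longrightarrow> run (k * T) T (\<lambda>z. W lam \<epsilon> (fst z)) (\<theta>, x) \<le> ennreal (\<rho> * ell) * W lam \<epsilon> \<theta> + ennreal (D * exp (- lam * \<epsilon>))"
    and uw2: "\<And>t n lam \<theta> x. 0 \<le> lam \<Longrightarrow> n \<le> T \<Longrightarrow> (\<And>s. s \<in> {1..n} \<Longrightarrow> TN_at (t + s) \<and> h (t + s) \<le> \<eta> \<and> lam * h (t + s) \<le> \<eta>) \<Longrightarrow>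
      \<theta> \<in> \<Theta> \<Longrightarrow> run t n (\<lambda>z. W lam \<epsilon> (fst z)) (\<theta>, x) \<le> ennreal D * W lam \<epsilon> \<theta>"
    using upper_block_W[OF \<epsilon>] by metis
  \<comment> \<open>Strictly between the factor \<open>\<rho> * ell\<close> of the upper bound and
    \<open>ell\<close>; the quotient of the two factors is the gain \<beta> per block.\<close>
  define \<sigma> where "\<sigma> = (\<rho> + 1) / 2 * ell"
  have \<sigma>: "0 < \<sigma>" "\<rho> * ell < \<sigma>" "\<sigma> < ell" using uw ell(1) mult_strict_right_mono[OF uw(2) ell(1)] by (auto simp: \<sigma>_def field_simps intro: add_pos_pos)
  obtain r where r: "0 < r" "r \<le> 1" "ball \<theta>h (2 * r) \<subseteq> \<Theta>" "\<And>x. ennreal \<sigma> \<le> tilted_lik L G \<phi> T \<theta>h (- g r) x"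
    using near_radius[OF \<sigma>(3), of 1] by auto
  have r4: "0 < r / 4" "ball \<theta>h (r / 4) \<subseteq> \<Theta>" using r subset_ball[of "r / 4" "2 * r" \<theta>h] by auto
  obtain H where H: "0 < H" "\<And>t. 2 \<le> t \<Longrightarrow> h t \<le> H"
  proof -
    obtain B where B: "0 < B" "\<And>t. norm (real t * h t) \<le> B"
      using convergent_imp_Bseq[OF convergentI[OF h_lim]] by (auto simp: Bseq_def)
    have "h t \<le> B" if "2 \<le> t" for t
    proof -
      have "1 * h t \<le> real t * h t" using that h_nonneg[OF that] by (intro mult_right_mono) auto
      then show ?thesis using B(2)[of t] by simp
    qed
    with B(1) show ?thesis by (rule that)
  qed
  obtain c1 where c1: "0 < c1" "\<And>h \<theta>. 0 \<le> h \<Longrightarrow> h \<le> H \<Longrightarrow> \<theta> \<in> ball \<theta>h (r / 4) \<Longrightarrow>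
    ennreal c1 \<le> (\<integral>\<^sup>+ u. indicator (ball \<theta>h (r / 4)) u \<partial>TN \<Theta> \<theta> (h\<^sup>2 *\<^sub>R V))"
    using TN_stay[OF r4 H(1)] by blast
  obtain c2 where c2: "0 < c2" "\<And>\<theta>. \<theta> \<in> \<Theta> \<Longrightarrow> ennreal c2 \<le> (\<integral>\<^sup>+ \<theta>'. indicator (ball \<theta>h (r / 4)) \<theta>' \<partial>K 1 \<theta>)"
    using K1[OF r4(1)] by blast
  define c where "c = min 1 (min c1 c2)"
  have c: "0 < c" "c \<le> 1" using c1 c2 by (auto simp: c_def)
  have stay: "ennreal c * indicator (ball \<theta>h (r / 4)) \<theta> \<le> (\<integral>\<^sup>+ u. indicator (ball \<theta>h (r / 4)) u \<partial>K t \<theta>)"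
    if t: "1 \<le> t" and \<theta>: "\<theta> \<in> \<Theta>" for t \<theta>
  proof (cases "\<theta> \<in> ball \<theta>h (r / 4)")
    case True
    have "ennreal c \<le> (\<integral>\<^sup>+ u. indicator (ball \<theta>h (r / 4)) u \<partial>K t \<theta>)"
    proof (cases "t = 1")
      case True
      have "ennreal c \<le> ennreal c2" by (intro ennreal_leI) (simp add: c_def)
      then show ?thesis unfolding True using c2(2)[OF \<theta>] by (rule order_trans)
    next
      case False
      then have t2: "2 \<le> t" using t by simp
      have "ennreal c \<le> ennreal c1" by (intro ennreal_leI) (simp add: c_def)
      also have "\<dots> \<le> (\<integral>\<^sup>+ u. indicator (ball \<theta>h (r / 4)) u \<partial>TN \<Theta> \<theta> ((h t)\<^sup>2 *\<^sub>R V))"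
        by (intro c1 h_nonneg H t2 True)
      finally show ?thesis using TN[OF t2] \<theta> by (simp add: TN_at_def)
    qed
    then show ?thesis using True by simp
  qed simp
  \<comment> \<open>The parameter is forced to stay in the ball at every step, at the price
    \<open>c\<close> each, whatever the step size. The power of \<open>c\<close> counts the steps
    still to come.\<close>
  have lowk: "ennreal ((\<sigma> * c ^ T) ^ k) \<le> U (k * T) (indicator (ball \<theta>h (r / 4)))" for k
  proof -
    let ?u = "\<lambda>t \<theta>. ennreal (c ^ (k * T - t)) * indicator (ball \<theta>h (r / 4)) \<theta>"
    have "ennreal \<sigma> ^ k * ?u (0 * T) \<theta>h \<le> run (0 * T) (k * T) (\<lambda>z. ?u ((0 + k) * T) (fst z)) (\<theta>h, undefined)"
    proof (rule lower_blocks[OF _ _ r(4) _ _ \<theta>h_mem])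
      fix t \<theta> assume t: "t \<in> {0 * T + 1..(0 + k) * T}" and \<theta>: "\<theta> \<in> \<Theta>"
      have "Suc (k * T - t) = k * T - (t - 1)" using t by auto
      then have "?u (t - 1) \<theta> = ennreal (c ^ (k * T - t)) * (ennreal c * indicator (ball \<theta>h (r / 4)) \<theta>)"
        using c by (simp add: ennreal_mult[symmetric] mult.assoc[symmetric] power_Suc2[symmetric] del: power_Suc)
      also have "\<dots> \<le> ennreal (c ^ (k * T - t)) * (\<integral>\<^sup>+ u. indicator (ball \<theta>h (r / 4)) u \<partial>K t \<theta>)"
        using t by (intro mult_left_mono stay \<theta>) auto
      also have "\<dots> = (\<integral>\<^sup>+ \<theta>'. ?u t \<theta>' \<partial>K t \<theta>)"
        using t by (intro nn_integral_cmult[symmetric] meas_KI ball_meas \<theta>) auto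
      finally show "?u (t - 1) \<theta> \<le> (\<integral>\<^sup>+ \<theta>'. ?u t \<theta>' \<partial>K t \<theta>)" .
    next
      fix t \<theta> assume "?u t \<theta> \<noteq> 0"
      then show "norm (\<theta> - \<theta>h) \<le> r" using r by (auto simp: indicator_def dist_norm norm_minus_commute split: if_splits)
    qed (use r in auto)
    moreover have "ennreal \<sigma> ^ k * ?u 0 \<theta>h = ennreal ((\<sigma> * c ^ T) ^ k)"
      using \<sigma> c r by (simp add: ennreal_power ennreal_mult[symmetric] power_mult_distrib power_mult[symmetric] mult.commute)
    ultimately show ?thesis by (simp add: U_def)
  qed
  \<comment> \<open>The crude upper factor \<open>D\<close> of a block divided by the lower factor
    \<open>\<sigma> * c ^ T\<close> for staying in the ball.\<close>
  define E where "E = max 1 (D / (\<sigma> * c ^ T))"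
  define F where "F = max 1 (D / \<sigma>)"
  define \<beta> where "\<beta> = \<rho> * ell / \<sigma>"
  \<comment> \<open>Collects two factors \<open>D\<close>, for the incomplete block and for the
    passage to the end of the block, the factor \<open>1 / 2 * c\<close> of the first step of the
    lower bound, and the extra power of \<open>\<sigma>\<close> in it.\<close>
  define A where "A = 2 * D * D / (c * \<sigma>)"
  have \<beta>: "0 < \<beta>" "\<beta> < 1" using uw \<sigma> ell(1) by (auto simp: \<beta>_def)
  obtain Q M where QM: "1 \<le> (Q :: nat)" "0 \<le> M"
    "(\<lambda>n. A * E ^ (n div Q) * (\<beta> ^ (n - n div Q) + real (n - n div Q) * F ^ (n - n div Q) * exp (- (M * real n) * \<epsilon>))) \<longlonglongrightarrow> 0"
    by (rule fast_rate[of E F \<beta> \<epsilon> A]) (auto simp: E_def F_def \<beta> \<epsilon>)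
  from order_tendstoD(2)[OF QM(3) e] obtain n1 where n1: "\<And>n. n1 \<le> n \<Longrightarrow>
    A * E ^ (n div Q) * (\<beta> ^ (n - n div Q) + real (n - n div Q) * F ^ (n - n div Q) * exp (- (M * real n) * \<epsilon>)) < e"
    by (auto simp: eventually_sequentially)
  \<comment> \<open>A bound on \<open>s * h s\<close> that gives all smallness conditions at once:
    \<open>h\<close> below \<eta> and \<open>r\<close>, \<open>lam * h\<close> below \<eta>, and the
    total lowering of the tent below 1/4. The factor \<open>3 * Q\<close> accounts for the window
    starting at block \<open>n div Q\<close>.\<close>
  define \<zeta> where "\<zeta> = min \<eta> r / (3 * Q * (1 + M + 4 * J * T))"
  have den: "1 \<le> 1 + M + 4 * J * T" using QM J_nonneg by simp
  have \<zeta>: "0 < \<zeta>" using uw r QM den by (simp add: \<zeta>_def)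
  have \<zeta>3: "3 * Q * \<zeta> * (1 + M + 4 * J * T) = min \<eta> r" using QM den by (simp add: \<zeta>_def)
  from order_tendstoD(2)[OF h_lim \<zeta>] obtain s0 where s0: "\<And>s. s0 \<le> s \<Longrightarrow> real s * h s < \<zeta>"
    by (auto simp: eventually_sequentially)
  define n0 where "n0 = max n1 (Q * (s0 + 2))"
  have main: "U t (far \<epsilon>) \<le> ennreal e * mass1 t" if n: "n0 \<le> n" and j: "j < T" and t_eq: "t = n * T + j" for n j t
  proof -
    define k where "k = n div Q"
    define N where "N = n - k"
    define lam where "lam = M * real n"
    have lam: "0 \<le> lam" using QM by (simp add: lam_def)
    have kN: "n = k + N" by (simp add: N_def k_def)
    have k2: "s0 + 2 \<le> k" using n QM by (simp add: k_def n0_def less_eq_div_iff_mult_less_eq mult.commute)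
    have nk: "real (n + 1) \<le> 3 * Q * k"
    proof -
      have "n < Q * (k + 1)" unfolding k_def using QM by (simp add: dividend_less_times_div)
      then have "n + 1 \<le> Q * (k + 1)" by simp
      also have "\<dots> \<le> Q * (3 * k)" using k2 by (intro mult_left_mono) auto
      finally have "n + 1 \<le> 3 * Q * k" by simp
      then show ?thesis using of_nat_mono by fastforce
    qed
    have small: "h s \<le> \<eta> \<and> lam * h s \<le> \<eta> \<and> h s \<le> r \<and> real (n + 1) * (4 * J * T) * h s \<le> r" "2 \<le> s" if s: "k * T + 1 \<le> s" for s
    proof -
      have "k * 1 \<le> k * T" using T by (intro mult_left_mono) auto
      then have ks: "k \<le> s" using s unfolding mult_1_right by linarith
      show s2: "2 \<le> s" using ks k2 by simp
      have hs: "0 \<le> h s" by (rule h_nonneg[OF s2])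
      have "real (n + 1) * h s \<le> 3 * Q * (k * h s)"
        using mult_right_mono[OF nk hs] by (simp add: mult.assoc)
      also have "\<dots> \<le> 3 * Q * (s * h s)" using ks hs by (intro mult_left_mono mult_right_mono) auto
      also have "\<dots> \<le> 3 * Q * \<zeta>" using s0[of s] ks k2 by (intro mult_left_mono) auto
      finally have nh: "real (n + 1) * h s \<le> 3 * Q * \<zeta>" .
      have all: "real (n + 1) * h s * (1 + M + 4 * J * T) \<le> min \<eta> r"
        unfolding \<zeta>3[symmetric] using den by (intro mult_right_mono nh) simp
      have p1: "0 \<le> real (n + 1) * h s" "0 \<le> real (n + 1) * h s * M" "0 \<le> real (n + 1) * h s * (4 * J * T)"
        using hs QM J_nonneg by auto
      have sum: "real (n + 1) * h s + real (n + 1) * h s * M + real (n + 1) * h s * (4 * J * T) \<le> min \<eta> r"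
        using all by (simp add: distrib_left)
      have a1: "h s \<le> real (n + 1) * h s" using hs by (simp add: distrib_right)
      have a2: "lam * h s \<le> real (n + 1) * h s * M"
        using hs QM by (simp add: lam_def algebra_simps)
      show "h s \<le> \<eta> \<and> lam * h s \<le> \<eta> \<and> h s \<le> r \<and> real (n + 1) * (4 * J * T) * h s \<le> r"
        using sum p1 a1 a2 by (simp add: mult_ac)
    qed
    define Z where "Z = U (k * T) (indicator (ball \<theta>h (r / 4)))"
    have Zk: "ennreal ((\<sigma> * c ^ T) ^ k) \<le> Z" unfolding Z_def by (rule lowk)
    have mk: "mass1 (k * T) \<le> ennreal ((D / (\<sigma> * c ^ T)) ^ k) * Z"
    proof -
      have "mass1 (k * T) \<le> ennreal (D ^ k)"
        using mass1_blocks_le[of k] power_mono[OF uw(5), of k] C by (meson ennreal_leI order_trans zero_le_power zero_le_one)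
      also have "\<dots> = ennreal ((D / (\<sigma> * c ^ T)) ^ k) * ennreal ((\<sigma> * c ^ T) ^ k)"
        using \<sigma> c uw by (subst ennreal_mult[symmetric]) (auto simp: power_mult_distrib[symmetric])
      also have "\<dots> \<le> ennreal ((D / (\<sigma> * c ^ T)) ^ k) * Z" by (intro mult_left_mono Zk) auto
      finally show ?thesis .
    qed
    have mkE: "mass1 (k * T) \<le> ennreal (E ^ k) * Z"
    proof -
      have "(D / (\<sigma> * c ^ T)) ^ k \<le> E ^ k" using uw \<sigma> c by (intro power_mono) (auto simp: E_def)
      then show ?thesis using mk by (meson ennreal_leI mult_right_mono order_trans zero_le)
    qed
    \<comment> \<open>Three stages backwards from \<open>t\<close>: the incomplete block costs
      \<open>D\<close>, the \<open>N\<close> blocks of the window give the sharp factor plus error,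
      and before them the total mass is compared with \<open>Z\<close>.\<close>
    have up: "U t (far \<epsilon>) \<le> ennreal (D * ((\<rho> * ell) ^ N + N * D ^ N * exp (- lam * \<epsilon>)) * E ^ k) * Z"
    proof -
      have "U t (far \<epsilon>) \<le> U (n * T + j) (W lam \<epsilon>)" unfolding t_eq by (intro U_mono far_le_W)
      also have "\<dots> \<le> ennreal D * U (n * T) (W lam \<epsilon>) + 0 * mass1 (n * T)"
      proof (intro U_le W_meas)
        fix \<theta> x assume \<theta>: "\<theta> \<in> \<Theta>"
        have "run (n * T) j (\<lambda>z. W lam \<epsilon> (fst z)) (\<theta>, x) \<le> ennreal D * W lam \<epsilon> \<theta>"
        proof (rule uw2[OF lam _ _ \<theta>])
          fix s assume "s \<in> {1..j}"
          then have "k * T + 1 \<le> n * T + s" using kN by (auto simp: add_mult_distrib)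
          from small[OF this] TN show "TN_at (n * T + s) \<and> h (n * T + s) \<le> \<eta> \<and> lam * h (n * T + s) \<le> \<eta>" by blast
        qed (use j in simp)
        then show "run (n * T) j (\<lambda>z. W lam \<epsilon> (fst z)) (\<theta>, x) \<le> ennreal D * W lam \<epsilon> \<theta> + 0" by simp
      qed
      also have "U (n * T) (W lam \<epsilon>) \<le> ennreal ((\<rho> * ell) ^ N) * U (k * T) (W lam \<epsilon>) + ennreal (N * D ^ N * exp (- lam * \<epsilon>)) * mass1 (k * T)"
        unfolding kN add_mult_distrib
      proof (intro U_le W_meas upper_blocks_W)
        fix i \<theta> x assume i: "i \<in> {k..<k + N}" and \<theta>: "\<theta> \<in> \<Theta>"
        show "run (i * T) T (\<lambda>z. W lam \<epsilon> (fst z)) (\<theta>, x) \<le> ennreal (\<rho> * ell) * W lam \<epsilon> \<theta> + ennreal (D * exp (- lam * \<epsilon>))"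
        proof (rule uw1[OF lam _ \<theta>])
          fix s assume "s \<in> {1..T}"
          moreover have "k * T \<le> i * T" using i by simp
          ultimately have "k * T + 1 \<le> i * T + s" unfolding atLeastAtMost_iff by linarith
          from small[OF this] TN show "TN_at (i * T + s) \<and> h (i * T + s) \<le> \<eta> \<and> lam * h (i * T + s) \<le> \<eta>" by blast
        qed
      qed (use uw ell(1) in auto)
      also have "U (k * T) (W lam \<epsilon>) \<le> mass1 (k * T)" by (intro U_mono W_le_1 lam)
      also have "ennreal ((\<rho> * ell) ^ N) * mass1 (k * T) + ennreal (N * D ^ N * exp (- lam * \<epsilon>)) * mass1 (k * T) =
        ennreal ((\<rho> * ell) ^ N + N * D ^ N * exp (- lam * \<epsilon>)) * mass1 (k * T)"
        using uw ell(1) by (subst ennreal_plus) (auto simp: distrib_right)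
      also have "\<dots> \<le> ennreal ((\<rho> * ell) ^ N + N * D ^ N * exp (- lam * \<epsilon>)) * (ennreal (E ^ k) * Z)"
        by (intro mult_left_mono mkE) auto
      finally have "U t (far \<epsilon>) \<le> ennreal D * (ennreal ((\<rho> * ell) ^ N + N * D ^ N * exp (- lam * \<epsilon>)) * (ennreal (E ^ k) * Z))"
        by (simp add: mult_left_mono add_right_mono)
      also have "\<dots> = ennreal (D * ((\<rho> * ell) ^ N + N * D ^ N * exp (- lam * \<epsilon>)) * E ^ k) * Z"
      proof -
        have nn: "0 \<le> (\<rho> * ell) ^ N + N * D ^ N * exp (- lam * \<epsilon>)" "0 \<le> E ^ k" "0 \<le> D"
          using uw ell(1) by (auto simp: E_def)
        show ?thesis unfolding mult.assoc[symmetric] using nn by (simp only: ennreal_mult mult_nonneg_nonneg)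
      qed
      finally show ?thesis .
    qed
    \<comment> \<open>One block more than in the upper bound, because lower bounds live at ends of
      blocks and \<open>t\<close> lies inside block \<open>n\<close>.\<close>
    have low: "ennreal (\<sigma> ^ Suc N * (1 / 2 * c)) * Z \<le> mass1 (Suc n * T)"
    proof -
      have "ennreal (\<sigma> ^ Suc N * (1 / 2 * c)) * U (k * T) (indicator (ball \<theta>h (r / 4))) \<le> U (k * T + Suc N * T) (\<lambda>_. 1)"
      proof (rule U_ge[OF _ ball_meas])
        fix \<theta> x assume \<theta>: "\<theta> \<in> \<Theta>"
        have "ennreal (\<sigma> ^ Suc N * (1 / 2 * c)) * indicator (ball \<theta>h (r / 4)) \<theta> =
          ennreal \<sigma> ^ Suc N * (ennreal (1 / 2) * (ennreal c * indicator (ball \<theta>h (r / 4)) \<theta>))"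
          using \<sigma> c by (simp only: ennreal_power less_imp_le ennreal_mult zero_le_power mult.assoc)
        also have "\<dots> \<le> ennreal \<sigma> ^ Suc N * (ennreal (1 / 2) * (\<integral>\<^sup>+ \<theta>'. indicator (ball \<theta>h (r / 4)) \<theta>' \<partial>K (k * T + 1) \<theta>))"
          by (intro mult_left_mono stay \<theta>) auto
        also have "\<dots> \<le> run (k * T) (Suc N * T) (\<lambda>_. 1) (\<theta>, x)"
        proof (rule lower_window[OF r(1,3,4) _ _ _ _ \<theta>, where e = "1 / (4 * real (Suc N * T))"])
          fix s assume "s \<in> {k * T + 2..(k + Suc N) * T}"
          then have s: "k * T + 1 \<le> s" by simp
          note sm = small[OF s]
          have "h s * J * (4 * real (Suc N * T)) \<le> real (n + 1) * (4 * J * T) * h s"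
          proof -
            have "h s * J * (4 * T) * real (Suc N) \<le> h s * J * (4 * T) * real (n + 1)"
              using J_nonneg h_nonneg[OF sm(2)] kN by (intro mult_left_mono mult_nonneg_nonneg) auto
            then show ?thesis by (simp only: of_nat_mult mult_ac)
          qed
          also have "\<dots> \<le> r" using sm by simp
          finally have le: "h s * J * (4 * real (Suc N * T)) \<le> r" .
          have pos: "0 < 4 * real (Suc N * T)" using T by (simp del: mult_Suc)
          have "h s * J \<le> r * (1 / (4 * real (Suc N * T)))"
            using le unfolding pos_le_divide_eq[OF pos, symmetric] by simp
          then show "TN_at s \<and> h s \<le> r \<and> h s * J \<le> r * (1 / (4 * real (Suc N * T)))" using sm TN by simp
        next
          show "1 / (4 * real (Suc N * T)) * real (Suc N * T) \<le> 1 / 4" using T by (simp del: mult_Suc)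
        qed auto
        finally show "ennreal (\<sigma> ^ Suc N * (1 / 2 * c)) * indicator (ball \<theta>h (r / 4)) \<theta> \<le> run (k * T) (Suc N * T) (\<lambda>z. 1) (\<theta>, x)" .
      qed
      also have "k * T + Suc N * T = Suc n * T" using kN by (simp add: add_mult_distrib)
      finally show ?thesis by (simp add: Z_def)
    qed
    show ?thesis
    proof (rule ennreal_ratio_bound[OF up low])
      show "mass1 (Suc n * T) \<le> ennreal D * mass1 t"
        using mass1_next_block[of j n] j uw(5) unfolding t_eq
        by (meson ennreal_leI less_imp_le mult_right_mono order_trans zero_le)
      have "D * ((\<rho> * ell) ^ N + N * D ^ N * exp (- lam * \<epsilon>)) * E ^ k * D =
        (\<sigma> ^ Suc N * (1 / 2 * c)) * (A * E ^ k * (\<beta> ^ N + N * (D / \<sigma>) ^ N * exp (- lam * \<epsilon>)))"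
        using \<sigma> c by (simp add: A_def \<beta>_def power_divide field_simps)
      also have "\<dots> \<le> (\<sigma> ^ Suc N * (1 / 2 * c)) * (A * E ^ k * (\<beta> ^ N + N * F ^ N * exp (- lam * \<epsilon>)))"
        using \<sigma> c uw \<beta> by (intro mult_left_mono add_left_mono mult_right_mono power_mono) (auto simp: F_def E_def A_def)
      also have "\<dots> \<le> (\<sigma> ^ Suc N * (1 / 2 * c)) * e"
        using n1[of n] n \<sigma> c unfolding k_def[symmetric] N_def[symmetric] lam_def[symmetric]
        by (intro mult_left_mono) (auto simp: n0_def)
      finally show "D * ((\<rho> * ell) ^ N + N * D ^ N * exp (- lam * \<epsilon>)) * E ^ k * D \<le> e * (\<sigma> ^ Suc N * (1 / 2 * c))"
        by (simp add: mult.commute)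
    qed (use uw e \<sigma> c in auto)
  qed
  show "\<forall>\<^sub>F t in sequentially. U t (far \<epsilon>) \<le> ennreal e * mass1 t"
    unfolding eventually_sequentially
  proof (intro exI allI impI)
    fix t assume "n0 * T \<le> t"
    then have "n0 \<le> t div T" using T by (simp add: less_eq_div_iff_mult_less_eq)
    then show "U t (far \<epsilon>) \<le> ennreal e * mass1 t" using T by (intro main[of "t div T" "t mod T"]) auto
  qed
qed

end

section \<open>Slow kernels\<close>

text \<open>Here \<open>y\<close> is the logarithm of the time at which a window starts. The first
  factor is the polynomial price of the heavy-tailed jump, the second the gain over about
  \<open>y\<^sup>2 / T\<close> blocks.\<close>

lemma slow_rate_1:
  fixes \<kappa> b T :: real assumes "0 < b" "0 < T" "0 < \<kappa>"
  shows "((\<lambda>y. exp (\<kappa> * y) * exp (- b * (y\<^sup>2 / T - 1))) \<longlongrightarrow> 0) at_top"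
  using assms by real_asymp

text \<open>The accumulated error over \<open>N\<close> blocks, with \<open>N\<close> of order
  \<open>y\<^sup>2\<close>, grows like the exponential of \<open>y\<^sup>2\<close>. It is beaten by
  \<open>exp (- lam * \<epsilon>)\<close>, which decays doubly exponentially in \<open>y\<close> as
  \<open>lam = exp (\<alpha> / 2 * y)\<close>.\<close>

lemma slow_rate_2:
  fixes \<kappa> f \<Delta> \<epsilon> \<alpha> :: real assumes "0 < \<epsilon>" "0 < \<alpha>" "0 < \<kappa>" "0 < f" "0 < \<Delta>"
  shows "((\<lambda>y. exp (\<kappa> * y) * (\<Delta> * (y\<^sup>2 + 1) * exp (f * (\<Delta> * (y\<^sup>2 + 1))) * exp (- exp (\<alpha> / 2 * y) * \<epsilon>))) \<longlongrightarrow> 0) at_top"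
proof -
  have 2: "((\<lambda>y. \<Delta> * (y\<^sup>2 + 1) * exp (- exp (\<alpha> / 2 * y) * \<epsilon> / 2)) \<longlongrightarrow> 0) at_top"
    using assms by real_asymp
  \<comment> \<open>Half of the doubly exponential decay is used against the exponential factors,
    the other half against the polynomial one.\<close>
  have 3: "((\<lambda>y. exp (\<kappa> * y + (f * (\<Delta> * (y\<^sup>2 + 1))) - exp (\<alpha> / 2 * y) * \<epsilon> / 2)) \<longlongrightarrow> 0) at_top"
  proof (rule filterlim_compose[OF exp_at_bot])
    have a: "((\<lambda>y. y * exp (- (\<alpha> / 2 * y))) \<longlongrightarrow> 0) at_top" using assms by real_asymp
    have b: "((\<lambda>y. (y\<^sup>2 + 1) * exp (- (\<alpha> / 2 * y))) \<longlongrightarrow> 0) at_top" using assms by real_asymp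
    have c: "filterlim (\<lambda>y. exp (\<alpha> / 2 * y)) at_top at_top" using assms by real_asymp
    \<comment> \<open>The exponent is written as \<open>exp (\<alpha> / 2 * y)\<close> times a
      bracket that tends to \<open>- \<epsilon> / 2\<close>.\<close>
    have "((\<lambda>y. \<kappa> * (y * exp (- (\<alpha> / 2 * y))) + f * \<Delta> * ((y\<^sup>2 + 1) * exp (- (\<alpha> / 2 * y))) - \<epsilon> / 2) \<longlongrightarrow>
      \<kappa> * 0 + f * \<Delta> * 0 - \<epsilon> / 2) at_top"
      by (intro tendsto_intros a b)
    from filterlim_tendsto_neg_mult_at_bot[OF this _ c]
    have "filterlim (\<lambda>y. (\<kappa> * (y * exp (- (\<alpha> / 2 * y))) + f * \<Delta> * ((y\<^sup>2 + 1) * exp (- (\<alpha> / 2 * y))) - \<epsilon> / 2) *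
      exp (\<alpha> / 2 * y)) at_bot at_top" using assms by simp
    also have "(\<lambda>y. (\<kappa> * (y * exp (- (\<alpha> / 2 * y))) + f * \<Delta> * ((y\<^sup>2 + 1) * exp (- (\<alpha> / 2 * y))) - \<epsilon> / 2) *
      exp (\<alpha> / 2 * y)) = (\<lambda>y. \<kappa> * y + (f * (\<Delta> * (y\<^sup>2 + 1))) - exp (\<alpha> / 2 * y) * \<epsilon> / 2)"
      by (rule ext) (simp add: exp_minus field_simps)
    finally show "filterlim (\<lambda>y. \<kappa> * y + (f * (\<Delta> * (y\<^sup>2 + 1))) - exp (\<alpha> / 2 * y) * \<epsilon> / 2) at_bot at_top" .
  qed
  have gen: "exp a * (D * exp P * exp (- E)) = exp (a + P - E / 2) * (D * exp (- (E / 2)))" for a D P E :: real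
  proof -
    have "exp (- E) = exp (- (E / 2)) * exp (- (E / 2))" by (simp add: mult_exp_exp)
    moreover have "exp (a + P - E / 2) = exp a * exp P * exp (- (E / 2))" by (simp add: mult_exp_exp)
    ultimately show ?thesis by (simp only: mult_ac)
  qed
  have "(\<lambda>y. exp (\<kappa> * y) * (\<Delta> * (y\<^sup>2 + 1) * exp (f * (\<Delta> * (y\<^sup>2 + 1))) * exp (- exp (\<alpha> / 2 * y) * \<epsilon>))) =
    (\<lambda>y. exp (\<kappa> * y + (f * (\<Delta> * (y\<^sup>2 + 1))) - exp (\<alpha> / 2 * y) * \<epsilon> / 2) * (\<Delta> * (y\<^sup>2 + 1) * exp (- (exp (\<alpha> / 2 * y) * \<epsilon> / 2))))"
    unfolding mult_minus_left gen ..
  with tendsto_mult[OF 3 2] show ?thesis by simp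
qed

text \<open>With \<open>c * exp (- \<alpha> * y)\<close> as a bound for \<open>h\<close> in the
  window, these are the smallness of \<open>h\<close>, of \<open>lam * h\<close>, and of
  \<open>h\<close> times the window length.\<close>

lemma slow_step_rate:
  fixes c \<alpha> \<Delta> :: real assumes "0 < \<alpha>"
  shows "((\<lambda>y. c * exp (- \<alpha> * y)) \<longlongrightarrow> 0) at_top"
    "((\<lambda>y. exp (\<alpha> / 2 * y) * (c * exp (- \<alpha> * y))) \<longlongrightarrow> 0) at_top"
    "((\<lambda>y. c * exp (- \<alpha> * y) * (\<Delta> * (y\<^sup>2 + 1))) \<longlongrightarrow> 0) at_top"
  using assms by real_asymp+


lemma ennreal_sum_mult:
  "0 \<le> x \<Longrightarrow> 0 \<le> y \<Longrightarrow> 0 \<le> D \<Longrightarrow>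
    ennreal x * (ennreal D * Z) + ennreal y * (ennreal D * Z) = ennreal ((x + y) * D) * Z"
  by (simp add: ennreal_mult distrib_right mult.assoc)

lemma ennreal_half: "ennreal (1 / 2) + ennreal (1 / 2) = 1"
  by (subst ennreal_plus[symmetric]) auto

lemma ennreal_add_right_cancel_leD: "a + ennreal x \<le> b + ennreal x \<Longrightarrow> a \<le> b"
  using ennreal_add_left_cancel_le[of "ennreal x" a b] by (simp add: add.commute)

lemma ennreal_power_half:
  assumes "0 \<le> s" "0 \<le> x"
  shows "ennreal s ^ n * (ennreal (1 / 2) * ennreal x) = ennreal (s ^ n * (1 / 2 * x))"
proof -
  have "ennreal (1 / 2) * ennreal x = ennreal (1 / 2 * x)" using assms by (intro ennreal_mult[symmetric]) auto
  moreover have "ennreal s ^ n = ennreal (s ^ n)" using assms by (simp add: ennreal_power)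
  moreover have "ennreal (s ^ n) * ennreal (1 / 2 * x) = ennreal (s ^ n * (1 / 2 * x))"
    using assms by (intro ennreal_mult[symmetric]) auto
  ultimately show ?thesis by metis
qed

lemma exp_ln_mult_power: "0 < (x :: real) \<Longrightarrow> exp (real n * ln x) = x ^ n"
  by (simp add: exp_of_nat_mult)

section \<open>Concentration of the filter under the slow kernels\<close>

context so_gauss begin

text \<open>A window runs from one heavy-tailed step to the next, and all its other steps are
  Gaussian. Ends of windows are treated on their own: from anywhere the heavy-tailed step reaches a
  ball at \<theta>h with polynomially small probability, and the many blocks that follow outweigh
  this. Times inside a window use the concentration at the end of the previous one, and that a
  heavy-tailed step with small scale is mostly short.\<close>

theorem slow_concentrates:
  fixes \<alpha> \<nu> :: real and \<Delta> :: nat and \<tau> kk :: "nat \<Rightarrow> nat"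
  assumes \<alpha>: "0 < \<alpha>" and \<nu>: "0 < \<nu>" and \<Delta>: "1 \<le> \<Delta>"
    and kk: "\<And>p. 1 \<le> p \<Longrightarrow> 1 \<le> kk p \<and> \<tau> p = kk p * T + 1"
    and step: "\<And>p. 1 \<le> p \<Longrightarrow> \<tau> (Suc p) = \<tau> p + \<Delta> * nat \<lceil>(ln (real (\<tau> p)))\<^sup>2\<rceil>"
    and TN: "\<And>t. 2 \<le> t \<Longrightarrow> t \<notin> \<tau> ` {1..} \<Longrightarrow> TN_at t"
    and TS: "\<And>p \<theta>. 1 \<le> p \<Longrightarrow> \<theta> \<in> \<Theta> \<Longrightarrow> K (\<tau> p) \<theta> = TS \<Theta> \<theta> ((h (\<tau> p))\<^sup>2 *\<^sub>R V) \<nu>"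
    and h_upper: "h \<in> O(\<lambda>t. real t powr (- \<alpha>))"
    and h_lower: "0 < c1" "\<forall>\<^sub>F p in sequentially. c1 \<le> real (\<tau> p) powr \<alpha> * h (\<tau> p)"
  shows concentrates
proof -
  interpret ST: student_kernel \<Theta> V a b \<nu> "(\<nu> + CARD('d)) / 2"
    by unfold_locales (simp_all add: \<nu>)
  define y where "y p = ln (real (\<tau> p))" for p
  define N where "N p = kk (Suc p) - kk p" for p
  have \<tau>2: "2 \<le> \<tau> p" if "1 \<le> p" for p
  proof -
    have "1 * 1 \<le> kk p * T" using kk[OF that] T by (intro mult_mono) auto
    then show ?thesis using kk[OF that] by simp
  qed
  have ypos: "0 < y p" if "1 \<le> p" for p using \<tau>2[OF that] by (simp add: y_def)
  have \<tau>_step: "\<tau> p < \<tau> (Suc p)" if "1 \<le> p" for p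
  proof -
    have "0 < nat \<lceil>(y p)\<^sup>2\<rceil>" using ypos[OF that] by simp
    then show ?thesis using step[OF that] \<Delta> by (simp add: y_def)
  qed
  have \<tau>_mono: "\<tau> p < \<tau> p'" if "1 \<le> p" "p < p'" for p p'
    using that(2,1)
  proof (induction p')
    case (Suc p')
    then show ?case using \<tau>_step[of p'] by (cases "p = p'") auto
  qed simp
  have \<tau>_ge: "p \<le> \<tau> p" if "1 \<le> p" for p
    using that by (induction p rule: nat_induct_at_least) (use \<tau>2[of 1] \<tau>_step in \<open>auto simp: Suc_le_eq intro: le_less_trans\<close>)
  have y_lim: "filterlim y at_top sequentially"
  proof (rule filterlim_at_top_mono[where f = "\<lambda>p. ln (real p)"])
    show "filterlim (\<lambda>p. ln (real p)) at_top sequentially" by real_asymp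
    show "\<forall>\<^sub>F p in sequentially. ln (real p) \<le> y p"
      using eventually_ge_at_top[of 1]
    proof eventually_elim
      case (elim p)
      then show ?case using \<tau>_ge[OF elim] \<tau>2[OF elim] by (simp add: y_def)
    qed
  qed
  have kk_le: "kk p < kk (Suc p)" if "1 \<le> p" for p
    using \<tau>_step[OF that] kk[OF that] kk[of "Suc p"] T by simp
  have kkN: "kk (Suc p) = kk p + N p" "1 \<le> N p" if "1 \<le> p" for p
    using kk_le[OF that] by (auto simp: N_def)
  have NT: "N p * T = \<Delta> * nat \<lceil>(y p)\<^sup>2\<rceil>" if "1 \<le> p" for p
    using step[OF that] kk[OF that] kk[of "Suc p"] kkN[OF that] by (simp add: y_def add_mult_distrib)
  have N_lower: "(y p)\<^sup>2 / T - 1 \<le> real (N p - 1)" if "1 \<le> p" for p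
  proof -
    have "1 * (y p)\<^sup>2 \<le> real \<Delta> * real (nat \<lceil>(y p)\<^sup>2\<rceil>)" using \<Delta> by (intro mult_mono real_nat_ceiling_ge) auto
    also have "\<dots> = real (N p) * T" using NT[OF that] by (metis of_nat_mult)
    finally have "(y p)\<^sup>2 / T \<le> real (N p)" using T by (simp add: field_simps)
    then show ?thesis using kkN(2)[OF that] by simp
  qed
  \<comment> \<open>The ceiling costs the summand 1; the window length is thus of order
    \<open>(y p)\<^sup>2\<close> from above as well.\<close>
  have NT_upper: "real (N p * T) \<le> \<Delta> * ((y p)\<^sup>2 + 1)" if p: "1 \<le> p" for p
  proof -
    have "real (N p * T) = \<Delta> * real (nat \<lceil>(y p)\<^sup>2\<rceil>)" using NT[OF p] by (metis of_nat_mult)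
    also have "\<dots> \<le> \<Delta> * ((y p)\<^sup>2 + 1)" by (intro mult_left_mono) (auto simp: of_nat_nat intro: less_imp_le ceiling_correct[THEN conjunct1] order_trans[OF of_int_ceiling_le_add_one])
    finally show ?thesis .
  qed
  obtain c0 where c0: "0 < c0" "\<forall>\<^sub>F t in sequentially. norm (h t) \<le> c0 * norm (real t powr (- \<alpha>))"
    using landau_o.bigE[OF h_upper] by auto
  then obtain t0 where t0: "\<And>t. t0 \<le> t \<Longrightarrow> norm (h t) \<le> c0 * norm (real t powr (- \<alpha>))"
    by (auto simp: eventually_sequentially)
  \<comment> \<open>The power \<alpha>/2 of the starting time: \<open>lam * h\<close> still tends to
    0, and \<open>lam\<close> exceeds every power of the logarithm, in particular the number of
    blocks.\<close>
  define lam where "lam p = exp (\<alpha> / 2 * y p)" for p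
  have lam: "0 \<le> lam p" for p by (simp add: lam_def)
  have h_win: "0 \<le> h t" "h t \<le> c0 * exp (- \<alpha> * y p)" if "1 \<le> p" "t0 \<le> p" "\<tau> p \<le> t" for t p
  proof -
    have t2: "2 \<le> t" and pt: "p \<le> t" using \<tau>2[OF that(1)] \<tau>_ge[OF that(1)] that(3) by auto
    show "0 \<le> h t" by (rule h_nonneg[OF t2])
    have "h t \<le> c0 * real t powr (- \<alpha>)" using t0[of t] that(2) pt by simp
    also have "\<dots> \<le> c0 * real (\<tau> p) powr (- \<alpha>)"
      using c0 \<alpha> \<tau>2[OF that(1)] that(3) by (intro mult_left_mono powr_mono2') auto
    also have "real (\<tau> p) powr (- \<alpha>) = exp (- \<alpha> * y p)" using \<tau>2[OF that(1)] by (simp add: powr_def y_def)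
    finally show "h t \<le> c0 * exp (- \<alpha> * y p)" .
  qed
  have win_ok: "\<forall>\<^sub>F p in sequentially. 1 \<le> p \<and> (\<forall>t\<ge>\<tau> p. 0 \<le> h t \<and> h t \<le> \<kappa> \<and> lam p * h t \<le> \<kappa> \<and> h t * real (N p * T) \<le> \<kappa>)"
    if \<kappa>: "0 < \<kappa>" for \<kappa>
  proof -
    note r = slow_step_rate[OF \<alpha>, of c0]
    have e1: "\<forall>\<^sub>F p in sequentially. c0 * exp (- \<alpha> * y p) < \<kappa>"
      using order_tendstoD(2)[OF filterlim_compose[OF r(1) y_lim] \<kappa>] .
    have e2: "\<forall>\<^sub>F p in sequentially. exp (\<alpha> / 2 * y p) * (c0 * exp (- \<alpha> * y p)) < \<kappa>"
      using order_tendstoD(2)[OF filterlim_compose[OF r(2) y_lim] \<kappa>] .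
    have e3: "\<forall>\<^sub>F p in sequentially. c0 * exp (- \<alpha> * y p) * (\<Delta> * ((y p)\<^sup>2 + 1)) < \<kappa>"
      using order_tendstoD(2)[OF filterlim_compose[OF r(3) y_lim] \<kappa>] .
    show ?thesis
      using e1 e2 e3 eventually_ge_at_top[of "max 1 t0"]
    proof eventually_elim
      case (elim p)
      then have p: "1 \<le> p" "t0 \<le> p" by auto
      show ?case
      proof (intro conjI allI impI p(1))
        fix t assume t: "\<tau> p \<le> t"
        note hw = h_win[OF p t]
        show "0 \<le> h t" by fact
        show "h t \<le> \<kappa>" using hw elim by linarith
        have "lam p * h t \<le> lam p * (c0 * exp (- \<alpha> * y p))" by (intro mult_left_mono hw lam)
        then show "lam p * h t \<le> \<kappa>" using elim(2) unfolding lam_def by linarith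
        have "h t * real (N p * T) \<le> c0 * exp (- \<alpha> * y p) * (\<Delta> * ((y p)\<^sup>2 + 1))"
          using hw NT_upper[OF p(1)] c0 by (intro mult_mono) auto
        then show "h t * real (N p * T) \<le> \<kappa>" using elim by linarith
      qed
    qed
  qed
  have TNw: "TN_at t" if "1 \<le> p" "\<tau> p < t" "t < \<tau> (Suc p)" for p t
  proof (rule TN)
    show "2 \<le> t" using \<tau>2[OF that(1)] that(2) by simp
    show "t \<notin> \<tau> ` {1..}"
    proof
      assume "t \<in> \<tau> ` {1..}"
      then obtain q where q: "1 \<le> q" "t = \<tau> q" by auto
      show False
      proof (cases "q \<le> p")
        case True
        then show False using \<tau>_mono[OF q(1), of p] q that(2) by (cases "q = p") auto
      next
        case False
        then show False using \<tau>_mono[of "Suc p" q] q that(3) by (cases "q = Suc p") auto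
      qed
    qed
  qed
  have TNk: "TN_at t" if p: "1 \<le> p" and t: "kk p * T + 2 \<le> t" "t \<le> kk (Suc p) * T" for p t
    using kk[OF p] kk[of "Suc p"] t by (intro TNw[OF p]) auto

  \<comment> \<open>The gain is counted from block \<open>kk p + 1\<close> on, since block
    \<open>kk p\<close> begins with the heavy-tailed step at \<open>kk p * T + 1\<close>. The last
    clause treats Gaussian stretches of at most \<open>T\<close> steps anywhere in the
    window.\<close>
  have W_step: "\<exists>\<rho> D. 0 < \<rho> \<and> \<rho> < 1 \<and> 1 \<le> D \<and> \<rho> * ell \<le> D \<and> C ^ T \<le> D \<and>
    (\<forall>\<^sub>F p in sequentially. 1 \<le> p \<and>
      (\<forall>j. Suc j \<le> N p \<longrightarrow> U ((kk p + 1 + j) * T) (W (lam p) \<epsilon>) \<le>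
        ennreal ((\<rho> * ell) ^ j) * U ((kk p + 1) * T) (W (lam p) \<epsilon>) +
        ennreal (j * D ^ j * exp (- lam p * \<epsilon>)) * mass1 ((kk p + 1) * T)) \<and>
      (\<forall>t n \<theta> x. n \<le> T \<longrightarrow> kk p * T + 1 \<le> t \<longrightarrow> t + n \<le> kk (Suc p) * T \<longrightarrow> \<theta> \<in> \<Theta> \<longrightarrow>
        run t n (\<lambda>z. W (lam p) \<epsilon> (fst z)) (\<theta>, x) \<le> ennreal D * W (lam p) \<epsilon> \<theta>))"
    if \<epsilon>: "0 < \<epsilon>" "ball \<theta>h (3 * \<epsilon>) \<subseteq> \<Theta>" for \<epsilon>
  proof -
    obtain \<rho> D \<eta> where uw: "0 < \<rho>" "\<rho> < 1" "1 \<le> D" "\<rho> * ell \<le> D" "C ^ T \<le> D" "0 < \<eta>" "\<eta> \<le> 1"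
      and uw1: "\<And>k lam \<theta> x. 0 \<le> lam \<Longrightarrow> (\<And>s. s \<in> {1..T} \<Longrightarrow> TN_at (k * T + s) \<and> h (k * T + s) \<le> \<eta> \<and> lam * h (k * T + s) \<le> \<eta>) \<Longrightarrow>
        \<theta> \<in> \<Theta> \<Longrightarrow> run (k * T) T (\<lambda>z. W lam \<epsilon> (fst z)) (\<theta>, x) \<le> ennreal (\<rho> * ell) * W lam \<epsilon> \<theta> + ennreal (D * exp (- lam * \<epsilon>))"
      and uw2: "\<And>t n lam \<theta> x. 0 \<le> lam \<Longrightarrow> n \<le> T \<Longrightarrow> (\<And>s. s \<in> {1..n} \<Longrightarrow> TN_at (t + s) \<and> h (t + s) \<le> \<eta> \<and> lam * h (t + s) \<le> \<eta>) \<Longrightarrow>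
        \<theta> \<in> \<Theta> \<Longrightarrow> run t n (\<lambda>z. W lam \<epsilon> (fst z)) (\<theta>, x) \<le> ennreal D * W lam \<epsilon> \<theta>"
      using upper_block_W[OF \<epsilon>] by metis
    have "\<forall>\<^sub>F p in sequentially. 1 \<le> p \<and>
      (\<forall>j. Suc j \<le> N p \<longrightarrow> U ((kk p + 1 + j) * T) (W (lam p) \<epsilon>) \<le>
        ennreal ((\<rho> * ell) ^ j) * U ((kk p + 1) * T) (W (lam p) \<epsilon>) +
        ennreal (j * D ^ j * exp (- lam p * \<epsilon>)) * mass1 ((kk p + 1) * T)) \<and>
      (\<forall>t n \<theta> x. n \<le> T \<longrightarrow> kk p * T + 1 \<le> t \<longrightarrow> t + n \<le> kk (Suc p) * T \<longrightarrow> \<theta> \<in> \<Theta> \<longrightarrow>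
        run t n (\<lambda>z. W (lam p) \<epsilon> (fst z)) (\<theta>, x) \<le> ennreal D * W (lam p) \<epsilon> \<theta>)"
      using win_ok[OF uw(6)]
    proof eventually_elim
      case (elim p)
      then have p: "1 \<le> p" and hs: "\<And>t. \<tau> p \<le> t \<Longrightarrow> h t \<le> \<eta> \<and> lam p * h t \<le> \<eta>" by auto
      have ok: "TN_at s \<and> h s \<le> \<eta> \<and> lam p * h s \<le> \<eta>" if "kk p * T + 2 \<le> s" "s \<le> kk (Suc p) * T" for s
        using TNk[OF p that] hs[of s] kk[OF p] that by auto
      show ?case
      proof (intro conjI allI impI p)
        fix j assume j: "Suc j \<le> N p"
        have "U ((kk p + 1) * T + j * T) (W (lam p) \<epsilon>) \<le>
          ennreal ((\<rho> * ell) ^ j) * U ((kk p + 1) * T) (W (lam p) \<epsilon>) +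
          ennreal (j * D ^ j * exp (- lam p * \<epsilon>)) * mass1 ((kk p + 1) * T)"
        proof (intro U_le W_meas upper_blocks_W)
          fix i \<theta> x assume i: "i \<in> {kk p + 1..<kk p + 1 + j}" and \<theta>: "\<theta> \<in> \<Theta>"
          show "run (i * T) T (\<lambda>z. W (lam p) \<epsilon> (fst z)) (\<theta>, x) \<le>
            ennreal (\<rho> * ell) * W (lam p) \<epsilon> \<theta> + ennreal (D * exp (- lam p * \<epsilon>))"
          proof (rule uw1[OF lam _ \<theta>])
            fix s assume s: "s \<in> {1..T}"
            have "(kk p + 1) * T \<le> i * T" "(i + 1) * T \<le> kk (Suc p) * T"
              using i j kkN(1)[OF p] by (intro mult_right_mono; simp)+
            then have "kk p * T + 2 \<le> i * T + s" "i * T + s \<le> kk (Suc p) * T"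
              using s T by (simp_all add: add_mult_distrib)
            then show "TN_at (i * T + s) \<and> h (i * T + s) \<le> \<eta> \<and> lam p * h (i * T + s) \<le> \<eta>" by (rule ok)
          qed
        qed (use uw ell(1) in auto)
        then show "U ((kk p + 1 + j) * T) (W (lam p) \<epsilon>) \<le>
          ennreal ((\<rho> * ell) ^ j) * U ((kk p + 1) * T) (W (lam p) \<epsilon>) +
          ennreal (j * D ^ j * exp (- lam p * \<epsilon>)) * mass1 ((kk p + 1) * T)"
          by (simp only: add_mult_distrib)
      next
        fix t n \<theta> x assume "n \<le> T" "kk p * T + 1 \<le> t" "t + n \<le> kk (Suc p) * T" "\<theta> \<in> \<Theta>"
        then show "run t n (\<lambda>z. W (lam p) \<epsilon> (fst z)) (\<theta>, x) \<le> ennreal D * W (lam p) \<epsilon> \<theta>"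
          by (intro uw2 lam ok) auto
      qed
    qed
    with uw show ?thesis by blast
  qed
  have low_win: "\<forall>\<^sub>F p in sequentially. 1 \<le> p \<and> (\<forall>n \<theta> x. 1 \<le> n \<longrightarrow> n \<le> N p \<longrightarrow> \<theta> \<in> \<Theta> \<longrightarrow>
      ennreal \<sigma> ^ n * (ennreal (1 / 2) * (\<integral>\<^sup>+ \<theta>'. indicator (ball \<theta>h (r / 4)) \<theta>' \<partial>K (\<tau> p) \<theta>)) \<le>
      run (kk p * T) (n * T) (\<lambda>_. 1) (\<theta>, x))"
    if r: "0 < r" "ball \<theta>h (2 * r) \<subseteq> \<Theta>" "\<And>x. ennreal \<sigma> \<le> tilted_lik L G \<phi> T \<theta>h (- g r) x" for \<sigma> r
  proof -
    \<comment> \<open>One bound that yields both \<open>h t \<le> r\<close> and, through the factor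
      \<open>4 * J\<close>, a total lowering of the tent by at most 1/4.\<close>
    define \<kappa> where "\<kappa> = r / (1 + 4 * J)"
    have \<kappa>: "0 < \<kappa>" "\<kappa> \<le> r" "\<kappa> * (4 * J) \<le> r"
      using r J_nonneg by (auto simp: \<kappa>_def field_simps)
    show ?thesis
      using win_ok[OF \<kappa>(1)]
    proof eventually_elim
      case (elim p)
      then have p: "1 \<le> p" and hs: "\<And>t. \<tau> p \<le> t \<Longrightarrow> h t \<le> \<kappa> \<and> h t * real (N p * T) \<le> \<kappa>" by auto
      have NT0: "0 < real (N p * T)" using kkN(2)[OF p] T by simp
      show ?case
      proof (intro conjI allI impI p)
        fix n \<theta> x assume n: "1 \<le> n" "n \<le> N p" and \<theta>: "\<theta> \<in> \<Theta>"
        show "ennreal \<sigma> ^ n * (ennreal (1 / 2) * (\<integral>\<^sup>+ \<theta>'. indicator (ball \<theta>h (r / 4)) \<theta>' \<partial>K (\<tau> p) \<theta>)) \<le>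
          run (kk p * T) (n * T) (\<lambda>_. 1) (\<theta>, x)"
          unfolding kk[OF p, THEN conjunct2]
        proof (rule lower_window[OF r n(1) _ _ _ \<theta>, where e = "1 / (4 * real (N p * T))"])
          have "n * T \<le> N p * T" using n(2) by simp
          then have "real (n * T) \<le> real (N p * T)" by (rule of_nat_mono)
          then show "1 / (4 * real (N p * T)) * real (n * T) \<le> 1 / 4"
            using NT0 by (simp add: field_simps del: of_nat_mult)
          fix t assume t: "t \<in> {kk p * T + 2..(kk p + n) * T}"
          have "(kk p + n) * T \<le> kk (Suc p) * T" using n(2) kkN(1)[OF p] by simp
          then have "t \<le> kk (Suc p) * T" using t by (meson atLeastAtMost_iff order_trans)
          then have t': "kk p * T + 2 \<le> t" "t \<le> kk (Suc p) * T" "\<tau> p \<le> t" using t kk[OF p] by auto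
          have "h t * real (N p * T) * (4 * J) \<le> \<kappa> * (4 * J)"
            using hs[OF t'(3)] J_nonneg by (intro mult_right_mono) auto
          then have "h t * J * (4 * real (N p * T)) \<le> r" using \<kappa>(3) by (simp only: mult_ac)
          then have "h t * J \<le> r * (1 / (4 * real (N p * T)))"
            using NT0 by (simp add: field_simps del: of_nat_mult)
          then show "TN_at t \<and> h t \<le> r \<and> h t * J \<le> r * (1 / (4 * real (N p * T)))"
            using TNk[OF p t'(1,2)] hs[OF t'(3)] \<kappa>(2) by auto
        qed (use NT0 in auto)
      qed
    qed
  qed
  have \<tau>_powr: "real (\<tau> p) powr \<alpha> = exp (\<alpha> * y p)" if "1 \<le> p" for p
    using \<tau>2[OF that] by (simp add: powr_def y_def)
  have hp: "\<forall>\<^sub>F p in sequentially. 1 \<le> p \<and> c1 * exp (- \<alpha> * y p) \<le> h (\<tau> p) \<and> 0 < h (\<tau> p)"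
    using h_lower(2) eventually_ge_at_top[of 1]
  proof eventually_elim
    case (elim p)
    have "c1 * exp (- \<alpha> * y p) \<le> h (\<tau> p)" using elim by (simp add: \<tau>_powr exp_minus field_simps)
    moreover have "0 < c1 * exp (- \<alpha> * y p)" using h_lower(1) by simp
    ultimately show ?case using elim by auto
  qed
  have rate2: "\<forall>\<^sub>F p in sequentially. 1 \<le> p \<and> exp (\<kappa> * y p) * (real (N p) * F ^ (N p) * exp (- lam p * \<epsilon>)) < e"
    if \<epsilon>: "0 < \<epsilon>" and \<kappa>: "0 < \<kappa>" and F: "1 < F" and e: "0 < e" for \<epsilon> \<kappa> F e
  proof -
    have "0 < ln F" using F by simp
    from order_tendstoD(2)[OF filterlim_compose[OF slow_rate_2[of \<epsilon> \<alpha> \<kappa> "ln F" "real \<Delta>"] y_lim] e]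
    have "\<forall>\<^sub>F p in sequentially. exp (\<kappa> * y p) * (\<Delta> * ((y p)\<^sup>2 + 1) * exp (ln F * (\<Delta> * ((y p)\<^sup>2 + 1))) * exp (- exp (\<alpha> / 2 * y p) * \<epsilon>)) < e"
      using \<epsilon> \<kappa> F \<alpha> \<Delta> by simp
    then show ?thesis
      using eventually_ge_at_top[of 1]
    proof eventually_elim
      case (elim p)
      have "1 * real (N p) \<le> real T * real (N p)" using T by (intro mult_right_mono) auto
      then have NB: "real (N p) \<le> \<Delta> * ((y p)\<^sup>2 + 1)" using NT_upper[OF elim(2)] by (simp add: mult.commute)
      have "F ^ (N p) = exp (ln F * real (N p))" using F by (simp add: exp_ln_mult_power[of F, symmetric] mult.commute)
      also have "\<dots> \<le> exp (ln F * (\<Delta> * ((y p)\<^sup>2 + 1)))" using F NB by (intro iffD2[OF exp_le_cancel_iff] mult_left_mono) auto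
      finally have "exp (\<kappa> * y p) * (real (N p) * F ^ (N p) * exp (- lam p * \<epsilon>)) \<le>
        exp (\<kappa> * y p) * (\<Delta> * ((y p)\<^sup>2 + 1) * exp (ln F * (\<Delta> * ((y p)\<^sup>2 + 1))) * exp (- exp (\<alpha> / 2 * y p) * \<epsilon>))"
        using NB F unfolding lam_def by (intro mult_left_mono mult_right_mono mult_mono) auto
      from le_less_trans[OF this elim(1)] show ?case using elim(2) by blast
    qed
  qed
  have mass1_step: "mass1 ((k + 1) * T) \<le> ennreal D * mass1 (k * T)" if "C ^ T \<le> D" for k D
  proof -
    have "mass1 ((k + 1) * T) \<le> ennreal (C ^ T) * mass1 (k * T)"
      using mass1_le[of T "k * T"] by (simp add: add.commute)
    also have "\<dots> \<le> ennreal D * mass1 (k * T)" by (intro mult_right_mono ennreal_leI that) auto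
    finally show ?thesis .
  qed

  have ends: "\<forall>\<^sub>F p in sequentially. U (kk p * T) (far \<epsilon>) \<le> ennreal e * mass1 (kk p * T)"
    if \<epsilon>: "0 < \<epsilon>" "ball \<theta>h (3 * \<epsilon>) \<subseteq> \<Theta>" and e: "0 < e" for \<epsilon> e
  proof -
    obtain \<rho> D where uw: "0 < \<rho>" "\<rho> < 1" "1 \<le> D" "\<rho> * ell \<le> D" "C ^ T \<le> D" and
      evW: "\<forall>\<^sub>F p in sequentially. 1 \<le> p \<and>
      (\<forall>j. Suc j \<le> N p \<longrightarrow> U ((kk p + 1 + j) * T) (W (lam p) \<epsilon>) \<le>
        ennreal ((\<rho> * ell) ^ j) * U ((kk p + 1) * T) (W (lam p) \<epsilon>) +
        ennreal (j * D ^ j * exp (- lam p * \<epsilon>)) * mass1 ((kk p + 1) * T)) \<and>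
      (\<forall>t n \<theta> x. n \<le> T \<longrightarrow> kk p * T + 1 \<le> t \<longrightarrow> t + n \<le> kk (Suc p) * T \<longrightarrow> \<theta> \<in> \<Theta> \<longrightarrow>
        run t n (\<lambda>z. W (lam p) \<epsilon> (fst z)) (\<theta>, x) \<le> ennreal D * W (lam p) \<epsilon> \<theta>)"
      using W_step[OF \<epsilon>] by blast
    define \<sigma> where "\<sigma> = (\<rho> + 1) / 2 * ell"
    have \<sigma>: "0 < \<sigma>" "\<rho> * ell < \<sigma>" "\<sigma> < ell"
      using uw ell(1) mult_strict_right_mono[OF uw(2) ell(1)] by (auto simp: \<sigma>_def field_simps intro: add_pos_pos)
    obtain r where r: "0 < r" "r \<le> 1" "ball \<theta>h (2 * r) \<subseteq> \<Theta>" "\<And>x. ennreal \<sigma> \<le> tilted_lik L G \<phi> T \<theta>h (- g r) x"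
      using near_radius[OF \<sigma>(3), of 1] by auto
    have r4: "0 < r / 4" "ball \<theta>h (r / 4) \<subseteq> \<Theta>" using r subset_ball[of "r / 4" "2 * r" \<theta>h] by auto
    \<comment> \<open>Equal to \<nu> plus the dimension: the exponent of \<open>h\<close> in the
      price of a heavy-tailed jump to a fixed ball.\<close>
    define d where "d = 2 * ((\<nu> + CARD('d)) / 2)"
    have d: "0 < d" using \<nu> by (simp add: d_def)
    obtain c2 where c2: "0 < c2" "\<And>h \<theta>. 0 < h \<Longrightarrow> h \<le> 1 \<Longrightarrow> \<theta> \<in> \<Theta> \<Longrightarrow>
      ennreal (c2 * h powr d) \<le> (\<integral>\<^sup>+ u. indicator (ball \<theta>h (r / 4)) u \<partial>TS \<Theta> \<theta> (h\<^sup>2 *\<^sub>R V) \<nu>)"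
      unfolding d_def using ST.TS_ball[OF r4] by blast
    define \<beta> where "\<beta> = \<rho> * ell / \<sigma>"
    have \<beta>: "0 < \<beta>" "\<beta> < 1" using uw \<sigma> ell(1) by (auto simp: \<beta>_def)
    define F where "F = max 2 (D / \<sigma>)"
    define A where "A = 2 * D * D / (\<sigma> * c2 * c1 powr d)"
    have A: "0 < A" using uw \<sigma> c2 h_lower by (simp add: A_def)
    \<comment> \<open>As \<open>h\<close> is at least of order \<tau>^(-\<alpha>) at the
      heavy-tailed steps, the price of the jump is \<tau>^(-\<kappa>).\<close>
    define \<kappa> where "\<kappa> = \<alpha> * d"
    have \<kappa>: "0 < \<kappa>" using \<alpha> d by (simp add: \<kappa>_def)
    have eA: "0 < e / (2 * A)" using e A by simp
    have ev1: "\<forall>\<^sub>F p in sequentially. exp (\<kappa> * y p) * exp (- (- ln \<beta>) * ((y p)\<^sup>2 / T - 1)) < e / (2 * A)"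
      using \<beta> T \<kappa> by (intro order_tendstoD(2)[OF filterlim_compose[OF slow_rate_1 y_lim] eA]) auto
    have ev2: "\<forall>\<^sub>F p in sequentially. 1 \<le> p \<and> exp (\<kappa> * y p) * (real (N p) * F ^ (N p) * exp (- lam p * \<epsilon>)) < e / (2 * A)"
      by (rule rate2[OF \<epsilon>(1) \<kappa> _ eA]) (simp add: F_def)
    have "\<forall>\<^sub>F p in sequentially. U (kk (Suc p) * T) (far \<epsilon>) \<le> ennreal e * mass1 (kk (Suc p) * T)"
      using evW low_win[OF r(1,3,4)] ev1 ev2 hp win_ok[of 1, OF zero_less_one]
    proof eventually_elim
      case (elim p)
      then have p: "1 \<le> p" by auto
      \<comment> \<open>The first block of the window contributes no gain, only the factor
        \<open>D\<close> in \<open>Z1\<close>.\<close>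
      define M where "M = N p - 1"
      have M: "N p = Suc M" "kk (Suc p) = kk p + 1 + M" using kkN[OF p] by (auto simp: M_def)
      define Z where "Z = mass1 (kk p * T)"
      have Z1: "mass1 ((kk p + 1) * T) \<le> ennreal D * Z" unfolding Z_def by (rule mass1_step[OF uw(5)])
      have up: "U (kk (Suc p) * T) (far \<epsilon>) \<le> ennreal (((\<rho> * ell) ^ M + M * D ^ M * exp (- lam p * \<epsilon>)) * D) * Z"
      proof -
        have "U (kk (Suc p) * T) (far \<epsilon>) \<le> U ((kk p + 1 + M) * T) (W (lam p) \<epsilon>)" unfolding M by (intro U_mono far_le_W)
        also have "\<dots> \<le> ennreal ((\<rho> * ell) ^ M) * U ((kk p + 1) * T) (W (lam p) \<epsilon>) +
          ennreal (M * D ^ M * exp (- lam p * \<epsilon>)) * mass1 ((kk p + 1) * T)"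
          using elim(1) M(1) by simp
        also have "\<dots> \<le> ennreal ((\<rho> * ell) ^ M) * (ennreal D * Z) + ennreal (M * D ^ M * exp (- lam p * \<epsilon>)) * (ennreal D * Z)"
        proof (intro add_mono mult_left_mono Z1)
          have "U ((kk p + 1) * T) (W (lam p) \<epsilon>) \<le> mass1 ((kk p + 1) * T)" by (intro U_mono W_le_1 lam)
          then show "U ((kk p + 1) * T) (W (lam p) \<epsilon>) \<le> ennreal D * Z" using Z1 by (rule order_trans)
        qed auto
        also have "\<dots> = ennreal (((\<rho> * ell) ^ M + M * D ^ M * exp (- lam p * \<epsilon>)) * D) * Z"
        proof -
          have nn: "0 \<le> (\<rho> * ell) ^ M" "0 \<le> M * D ^ M * exp (- lam p * \<epsilon>)" "0 \<le> D" using uw ell(1) by auto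
          show ?thesis by (rule ennreal_sum_mult[OF nn])
        qed
        finally show ?thesis .
      qed
      have low: "ennreal (\<sigma> ^ N p * (1 / 2 * (c2 * h (\<tau> p) powr d))) * Z \<le> mass1 (kk (Suc p) * T)"
      proof -
        have "ennreal (\<sigma> ^ N p * (1 / 2 * (c2 * h (\<tau> p) powr d))) * U (kk p * T) (\<lambda>_. 1) \<le> U (kk p * T + N p * T) (\<lambda>_. 1)"
        proof (rule U_ge)
          fix \<theta> x assume \<theta>: "\<theta> \<in> \<Theta>"
          have hb: "0 < h (\<tau> p)" "h (\<tau> p) \<le> 1" using elim by auto
          have "ennreal (c2 * h (\<tau> p) powr d) \<le> (\<integral>\<^sup>+ u. indicator (ball \<theta>h (r / 4)) u \<partial>K (\<tau> p) \<theta>)"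
            unfolding TS[OF p \<theta>] by (rule c2(2)[OF hb \<theta>])
          then have "ennreal \<sigma> ^ N p * (ennreal (1 / 2) * ennreal (c2 * h (\<tau> p) powr d)) \<le>
            ennreal \<sigma> ^ N p * (ennreal (1 / 2) * (\<integral>\<^sup>+ u. indicator (ball \<theta>h (r / 4)) u \<partial>K (\<tau> p) \<theta>))"
            by (intro mult_left_mono) auto
          also have "\<dots> \<le> run (kk p * T) (N p * T) (\<lambda>_. 1) (\<theta>, x)"
            using elim(2) kkN(2)[OF p] \<theta> by simp
          also have "ennreal \<sigma> ^ N p * (ennreal (1 / 2) * ennreal (c2 * h (\<tau> p) powr d)) =
            ennreal (\<sigma> ^ N p * (1 / 2 * (c2 * h (\<tau> p) powr d)))"
            using \<sigma> c2 by (intro ennreal_power_half) auto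
          finally show "ennreal (\<sigma> ^ N p * (1 / 2 * (c2 * h (\<tau> p) powr d))) * 1 \<le> run (kk p * T) (N p * T) (\<lambda>z. 1) (\<theta>, x)"
            by simp
        qed simp
        then show ?thesis using kkN(1)[OF p] by (simp add: Z_def add_mult_distrib)
      qed
      have hd: "c1 powr d * exp (- \<kappa> * y p) \<le> h (\<tau> p) powr d"
      proof -
        have "(c1 * exp (- \<alpha> * y p)) powr d \<le> h (\<tau> p) powr d"
          using elim h_lower d by (intro powr_mono2) auto
        moreover have "(c1 * exp (- \<alpha> * y p)) powr d = c1 powr d * exp (- \<kappa> * y p)"
          using h_lower by (simp add: powr_mult exp_powr_real \<kappa>_def mult_ac)
        ultimately show ?thesis by simp
      qed
      show ?case
      proof (rule ennreal_ratio_bound[OF up low])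
        show "mass1 (kk (Suc p) * T) \<le> ennreal 1 * mass1 (kk (Suc p) * T)" by simp
        have b1: "\<beta> ^ M \<le> exp (- (- ln \<beta>) * ((y p)\<^sup>2 / T - 1))"
        proof -
          have "\<beta> ^ M = exp (ln \<beta> * real M)" using \<beta> by (simp add: exp_ln_mult_power[of \<beta>, symmetric] mult.commute)
          also have "\<dots> \<le> exp (ln \<beta> * ((y p)\<^sup>2 / T - 1))"
            using N_lower[OF p] \<beta> unfolding M_def by (intro iffD2[OF exp_le_cancel_iff] mult_left_mono_neg) (auto simp: less_imp_le)
          finally show ?thesis by simp
        qed
        have b2: "M * (D / \<sigma>) ^ M \<le> real (N p) * F ^ N p"
        proof (intro mult_mono)
          have "(D / \<sigma>) ^ M \<le> F ^ M" using uw \<sigma> by (intro power_mono) (auto simp: F_def)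
          also have "\<dots> \<le> F ^ N p" by (intro power_increasing) (auto simp: M F_def)
          finally show "(D / \<sigma>) ^ M \<le> F ^ N p" .
        qed (use uw \<sigma> M in auto)
        have s1: "A * (exp (\<kappa> * y p) * \<beta> ^ M) \<le> e / 2"
        proof -
          have "exp (\<kappa> * y p) * \<beta> ^ M \<le> e / (2 * A)" using b1 elim(3) by (smt (verit) mult_left_mono exp_ge_zero)
          then show ?thesis using A by (simp add: field_simps)
        qed
        have s2: "A * (exp (\<kappa> * y p) * (M * (D / \<sigma>) ^ M * exp (- lam p * \<epsilon>))) \<le> e / 2"
        proof -
          have "exp (\<kappa> * y p) * (M * (D / \<sigma>) ^ M * exp (- lam p * \<epsilon>)) \<le> exp (\<kappa> * y p) * (real (N p) * F ^ N p * exp (- lam p * \<epsilon>))"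
            by (intro mult_left_mono mult_right_mono b2) auto
          also have "\<dots> \<le> e / (2 * A)" using elim(4) by simp
          finally show ?thesis using A by (simp add: field_simps)
        qed
        define q where "q = \<sigma> ^ N p * (1 / 2 * (c2 * (c1 powr d * exp (- \<kappa> * y p))))"
        have q: "0 < q" using \<sigma> c2 h_lower by (simp add: q_def)
        have "((\<rho> * ell) ^ M + M * D ^ M * exp (- lam p * \<epsilon>)) * D * D =
          q * (A * (exp (\<kappa> * y p) * \<beta> ^ M) + A * (exp (\<kappa> * y p) * (M * (D / \<sigma>) ^ M * exp (- lam p * \<epsilon>))))"
        proof -
          have "exp (- \<kappa> * y p) * exp (\<kappa> * y p) = 1" by (simp add: mult_exp_exp)
          then have "q * A * exp (\<kappa> * y p) = \<sigma> ^ M * D * D"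
            using \<sigma> c2 h_lower by (simp add: q_def A_def M field_simps)
          then have "q * (A * (exp (\<kappa> * y p) * \<beta> ^ M) + A * (exp (\<kappa> * y p) * (M * (D / \<sigma>) ^ M * exp (- lam p * \<epsilon>)))) =
            \<sigma> ^ M * D * D * (\<beta> ^ M + M * (D / \<sigma>) ^ M * exp (- lam p * \<epsilon>))"
            by (simp add: distrib_left mult.assoc[symmetric])
          also have "\<dots> = ((\<sigma> * \<beta>) ^ M + M * (\<sigma> * (D / \<sigma>)) ^ M * exp (- lam p * \<epsilon>)) * D * D"
            by (simp only: power_mult_distrib) (simp add: algebra_simps)
          finally show ?thesis using \<sigma> by (simp add: \<beta>_def)
        qed
        also have "\<dots> \<le> q * e" using s1 s2 q by (intro mult_left_mono) auto
        also have "\<dots> \<le> e * (\<sigma> ^ N p * (1 / 2 * (c2 * h (\<tau> p) powr d)))"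
          unfolding q_def mult.commute[of _ e] using hd \<sigma> c2 e by (intro mult_left_mono) auto
        finally have main: "((\<rho> * ell) ^ M + M * D ^ M * exp (- lam p * \<epsilon>)) * D * D \<le> e * (\<sigma> ^ N p * (1 / 2 * (c2 * h (\<tau> p) powr d)))" .
        have "((\<rho> * ell) ^ M + M * D ^ M * exp (- lam p * \<epsilon>)) * D * 1 \<le> ((\<rho> * ell) ^ M + M * D ^ M * exp (- lam p * \<epsilon>)) * D * D"
          using uw ell(1) by (intro mult_left_mono mult_nonneg_nonneg add_nonneg_nonneg) auto
        with main show "((\<rho> * ell) ^ M + M * D ^ M * exp (- lam p * \<epsilon>)) * D * 1 \<le> e * (\<sigma> ^ N p * (1 / 2 * (c2 * h (\<tau> p) powr d)))"
          by linarith
      qed (use e \<sigma> c2 in auto)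
    qed
    \<comment> \<open>Window \<open>p\<close> gives the claim at its end, which is the index
      \<open>Suc p\<close>.\<close>
    then show ?thesis by (subst (asm) eventually_sequentially_Suc)
  qed
  show concentrates
    unfolding concentrates_def
  proof (intro allI impI)
    fix \<epsilon> e :: real assume \<epsilon>: "0 < \<epsilon>" "ball \<theta>h (3 * \<epsilon>) \<subseteq> \<Theta>" and e: "0 < e"
    obtain \<rho> D where uw: "0 < \<rho>" "\<rho> < 1" "1 \<le> D" "\<rho> * ell \<le> D" "C ^ T \<le> D" and
      evW: "\<forall>\<^sub>F p in sequentially. 1 \<le> p \<and>
      (\<forall>j. Suc j \<le> N p \<longrightarrow> U ((kk p + 1 + j) * T) (W (lam p) \<epsilon>) \<le>
        ennreal ((\<rho> * ell) ^ j) * U ((kk p + 1) * T) (W (lam p) \<epsilon>) +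
        ennreal (j * D ^ j * exp (- lam p * \<epsilon>)) * mass1 ((kk p + 1) * T)) \<and>
      (\<forall>t n \<theta> x. n \<le> T \<longrightarrow> kk p * T + 1 \<le> t \<longrightarrow> t + n \<le> kk (Suc p) * T \<longrightarrow> \<theta> \<in> \<Theta> \<longrightarrow>
        run t n (\<lambda>z. W (lam p) \<epsilon> (fst z)) (\<theta>, x) \<le> ennreal D * W (lam p) \<epsilon> \<theta>)"
      using W_step[OF \<epsilon>] by blast
    define \<sigma> where "\<sigma> = (\<rho> + 1) / 2 * ell"
    have \<sigma>: "0 < \<sigma>" "\<rho> * ell < \<sigma>" "\<sigma> < ell"
      using uw ell(1) mult_strict_right_mono[OF uw(2) ell(1)] by (auto simp: \<sigma>_def field_simps intro: add_pos_pos)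
    obtain r where r: "0 < r" "r \<le> \<epsilon>" "ball \<theta>h (2 * r) \<subseteq> \<Theta>" "\<And>x. ennreal \<sigma> \<le> tilted_lik L G \<phi> T \<theta>h (- g r) x"
      using near_radius[OF \<sigma>(3) \<epsilon>(1)] by auto
    \<comment> \<open>Below, the lower bound has \<open>m\<close> blocks against \<open>i\<close>
      gaining blocks in the upper bound, with \<open>m = i + 2\<close>, or \<open>m = 1\<close> and
      \<open>i = 0\<close>. In both cases
      \<open>s0 * \<sigma> ^ i \<le> \<sigma> ^ m\<close>.\<close>
    define s0 where "s0 = min \<sigma> (\<sigma> ^ 2)"
    have s0: "0 < s0" using \<sigma> by (simp add: s0_def)
    \<comment> \<open>The 8 is from the factor 1/8 of the lower bound; \<open>D ^ 4\<close> collects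
      \<open>D ^ 3\<close> from the upper bound and \<open>D\<close> from passing to the end of the
      block. The bracket that remains is at most \<open>4 * \<delta>\<close>, which explains
      \<delta> below.\<close>
    define A where "A = 8 * D ^ 4 / s0"
    have A: "0 < A" using uw s0 by (simp add: A_def)
    define F where "F = max 2 (D / \<sigma>)"
    define \<delta> where "\<delta> = e / (4 * A)"
    have \<delta>: "0 < \<delta>" using e A by (simp add: \<delta>_def)
    have e2: "0 < \<epsilon> / 2" and r8: "0 < r / 8" using \<epsilon> r by auto
    obtain c3 where c3: "0 < c3" "\<And>h \<theta>. 0 < h \<Longrightarrow> ball \<theta> h \<subseteq> \<Theta> \<Longrightarrow>
      (\<integral>\<^sup>+ u. indicator {u. norm (u - \<theta>) > \<epsilon> / 2} u \<partial>TS \<Theta> \<theta> (h\<^sup>2 *\<^sub>R V) \<nu>) \<le> ennreal (c3 * h powr \<nu>)"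
      using ST.TS_far[OF e2] by blast
    obtain c4 where c4: "0 < c4" "\<And>h \<theta>. 0 < h \<Longrightarrow> ball \<theta> h \<subseteq> \<Theta> \<Longrightarrow>
      (\<integral>\<^sup>+ u. indicator {u. norm (u - \<theta>) > r / 8} u \<partial>TS \<Theta> \<theta> (h\<^sup>2 *\<^sub>R V) \<nu>) \<le> ennreal (c4 * h powr \<nu>)"
      using ST.TS_far[OF r8] by blast
    \<comment> \<open>The last two bounds make long jumps of the heavy-tailed step unlikely: beyond
      \<open>\<epsilon> / 2\<close> with probability at most \<delta>, beyond \<open>r / 8\<close>
      at most 1/2.\<close>
    define \<eta> where "\<eta> = min (min \<epsilon> r) (min ((\<delta> / c3) powr (1 / \<nu>)) ((1 / (2 * c4)) powr (1 / \<nu>)))"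
    have \<eta>: "0 < \<eta>" using \<epsilon> r c3 c4 \<delta> by (simp add: \<eta>_def)
    have \<eta>_powr: "c3 * x powr \<nu> \<le> \<delta>" "c4 * x powr \<nu> \<le> 1 / 2" if "0 \<le> x" "x \<le> \<eta>" for x
    proof -
      have "x powr \<nu> \<le> ((\<delta> / c3) powr (1 / \<nu>)) powr \<nu>" using that \<nu> by (intro powr_mono2) (auto simp: \<eta>_def)
      then show "c3 * x powr \<nu> \<le> \<delta>" using c3 \<delta> \<nu> by (simp add: powr_powr field_simps)
      have "x powr \<nu> \<le> ((1 / (2 * c4)) powr (1 / \<nu>)) powr \<nu>" using that \<nu> by (intro powr_mono2) (auto simp: \<eta>_def)
      then show "c4 * x powr \<nu> \<le> 1 / 2" using c4 \<nu> by (simp add: powr_powr field_simps)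
    qed
    \<comment> \<open>The concentration at ends of windows is applied at two scales:
      \<open>\<epsilon> / 4\<close> makes distances of at least \<open>\<epsilon> / 2\<close> rare,
      and \<open>r / 16\<close> puts half of the mass within \<open>r / 8\<close>.\<close>
    have ball_sub: "ball \<theta>h (3 * (\<epsilon> / 4)) \<subseteq> \<Theta>" "ball \<theta>h (3 * (r / 16)) \<subseteq> \<Theta>"
      using \<epsilon> r subset_ball[of "3 * (\<epsilon> / 4)" "3 * \<epsilon>" \<theta>h] subset_ball[of "3 * (r / 16)" "2 * r" \<theta>h] by auto
    have e4: "0 < \<epsilon> / 4" and r16: "0 < r / 16" and half: "0 < (1 / 2 :: real)" using \<epsilon> r by auto
    \<comment> \<open>The exponent 1 is only a convenient choice: the factor
      \<open>exp (y p)\<close> is at least 1 and is dropped later.\<close>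
    have ev2: "\<forall>\<^sub>F p in sequentially. 1 \<le> p \<and> exp (1 * y p) * (real (N p) * F ^ (N p) * exp (- lam p * \<epsilon>)) < \<delta>"
      by (rule rate2[OF \<epsilon>(1) zero_less_one _ \<delta>]) (simp add: F_def)
    have "\<forall>\<^sub>F p in sequentially. 1 \<le> p \<and> (\<forall>n j. kk p \<le> n \<longrightarrow> n < kk (Suc p) \<longrightarrow> 1 \<le> j \<longrightarrow> j \<le> T \<longrightarrow>
      U (n * T + j) (far \<epsilon>) \<le> ennreal e * mass1 (n * T + j))"
      using evW low_win[OF r(1,3,4)] ends[OF e4 ball_sub(1) \<delta>] ends[OF r16 ball_sub(2) half] ev2 hp win_ok[OF \<eta>]
    proof eventually_elim
      case (elim p)
      then have p: "1 \<le> p" by auto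
      have h\<tau>: "0 < h (\<tau> p)" "h (\<tau> p) \<le> \<eta>" using elim by auto
      have tp: "1 \<le> \<tau> p" using \<tau>2[OF p] by simp
      define Z where "Z = mass1 (kk p * T)"
      define small where "small = real (N p) * F ^ N p * exp (- lam p * \<epsilon>)"
      have small: "0 \<le> small" "small \<le> \<delta>" "exp (- lam p * \<epsilon>) \<le> \<delta>"
      proof -
        show sm0: "0 \<le> small" by (simp add: small_def F_def)
        have "1 * small \<le> exp (1 * y p) * small" using ypos[OF p] sm0 by (intro mult_right_mono) auto
        then show le: "small \<le> \<delta>" using elim(5) by (simp add: small_def)
        have "1 * 1 * exp (- lam p * \<epsilon>) \<le> small"
          unfolding small_def using kkN(2)[OF p] by (intro mult_right_mono mult_mono one_le_power) (auto simp: F_def)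
        then show "exp (- lam p * \<epsilon>) \<le> \<delta>" using le by simp
      qed
      \<comment> \<open>Starting within \<open>\<epsilon> / 2\<close> and jumping at most
        \<open>\<epsilon> / 2\<close> ends within \<epsilon>, where the weight is at most \<delta>.
        A longer jump adds another \<delta>, and a start farther away is left to the previous
        window.\<close>
      have TSW: "(\<integral>\<^sup>+ \<theta>'. W (lam p) \<epsilon> \<theta>' \<partial>K (\<tau> p) \<theta>) \<le> ennreal (2 * \<delta>) + far (\<epsilon> / 4) \<theta>" if \<theta>: "\<theta> \<in> \<Theta>" for \<theta>
      proof -
        interpret prob_space "K (\<tau> p) \<theta>" by (rule prob_K[OF tp \<theta>])
        show ?thesis
        proof (cases "2 * (\<epsilon> / 4) \<le> norm (\<theta> - \<theta>h)")
          case True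
          have "(\<integral>\<^sup>+ \<theta>'. W (lam p) \<epsilon> \<theta>' \<partial>K (\<tau> p) \<theta>) \<le> (\<integral>\<^sup>+ \<theta>'. 1 \<partial>K (\<tau> p) \<theta>)"
            by (intro nn_integral_mono W_le_1 lam)
          also have "\<dots> = far (\<epsilon> / 4) \<theta>" using True by (simp add: emeasure_space_1 far_def)
          also have "\<dots> \<le> ennreal (2 * \<delta>) + far (\<epsilon> / 4) \<theta>" by simp
          finally show ?thesis .
        next
          case False
          have near: "ball \<theta> (h (\<tau> p)) \<subseteq> \<Theta>"
          proof
            fix u assume "u \<in> ball \<theta> (h (\<tau> p))"
            then have "norm (\<theta> - u) < \<epsilon>" using h\<tau> by (simp add: dist_norm \<eta>_def)
            then have "norm (\<theta>h - u) < 3 * \<epsilon>"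
              using False norm_triangle_ineq[of "\<theta>h - \<theta>" "\<theta> - u"] \<epsilon>(1) by (simp add: norm_minus_commute)
            then show "u \<in> \<Theta>" using \<epsilon>(2) by (auto simp: dist_norm)
          qed
          let ?I = "indicator {u. norm (u - \<theta>) > \<epsilon> / 2} :: real ^ 'd \<Rightarrow> ennreal"
          have mI: "?I \<in> borel_measurable (K (\<tau> p) \<theta>)" by (intro meas_KI tp \<theta>) measurable
          have "(\<integral>\<^sup>+ \<theta>'. W (lam p) \<epsilon> \<theta>' \<partial>K (\<tau> p) \<theta>) \<le> (\<integral>\<^sup>+ \<theta>'. ennreal \<delta> + ?I \<theta>' \<partial>K (\<tau> p) \<theta>)"
          proof (intro nn_integral_mono)
            fix \<theta>'
            show "W (lam p) \<epsilon> \<theta>' \<le> ennreal \<delta> + ?I \<theta>'"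
            proof (cases "norm (\<theta>' - \<theta>) > \<epsilon> / 2")
              case True
              then show ?thesis using W_le_1[OF lam, of p \<epsilon> \<theta>'] by (simp add: add_increasing)
            next
              case F2: False
              have "norm (\<theta>' - \<theta>h) \<le> \<epsilon>"
                using False F2 norm_triangle_ineq[of "\<theta>' - \<theta>" "\<theta> - \<theta>h"] by simp
              then have "W (lam p) \<epsilon> \<theta>' \<le> ennreal (exp (- lam p * \<epsilon>))" by (intro W_near lam)
              also have "\<dots> \<le> ennreal \<delta>" by (intro ennreal_leI small)
              finally show ?thesis using F2 by simp
            qed
          qed
          also have "\<dots> = ennreal \<delta> + (\<integral>\<^sup>+ \<theta>'. ?I \<theta>' \<partial>K (\<tau> p) \<theta>)"
            using mI by (subst nn_integral_add) (simp_all add: emeasure_space_1)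
          also have "(\<integral>\<^sup>+ \<theta>'. ?I \<theta>' \<partial>K (\<tau> p) \<theta>) \<le> ennreal \<delta>"
          proof -
            have "(\<integral>\<^sup>+ \<theta>'. ?I \<theta>' \<partial>K (\<tau> p) \<theta>) \<le> ennreal (c3 * h (\<tau> p) powr \<nu>)"
              unfolding TS[OF p \<theta>] by (rule c3(2)[OF h\<tau>(1) near])
            also have "\<dots> \<le> ennreal \<delta>" using h\<tau> by (intro ennreal_leI \<eta>_powr) auto
            finally show ?thesis .
          qed
          also have "ennreal \<delta> + ennreal \<delta> = ennreal (2 * \<delta>)" using \<delta> by (simp flip: ennreal_plus)
          finally show ?thesis using False by (simp add: far_def add_left_mono)
        qed
      qed
      \<comment> \<open>The heavy-tailed step costs one factor \<open>D\<close>, the Gaussian steps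
        after it another. \<open>2 * \<delta>\<close> comes from the step and \<delta> from the far
        mass at the end of the previous window.\<close>
      have first: "U (kk p * T + j) (W (lam p) \<epsilon>) \<le> ennreal (D\<^sup>2 * (3 * \<delta>)) * Z" if j: "1 \<le> j" "j \<le> T" for j
      proof -
        obtain i where i: "j = Suc i" using j(1) by (cases j) auto
        have jN: "kk p * T + 1 + i \<le> kk (Suc p) * T"
        proof -
          have "1 * T \<le> N p * T" using kkN(2)[OF p] by (intro mult_right_mono) auto
          then have "Suc i \<le> N p * T" using i j(2) by linarith
          then show ?thesis using kkN(1)[OF p] by (simp add: add_mult_distrib)
        qed
        have "U (kk p * T + j) (W (lam p) \<epsilon>) \<le> ennreal (D\<^sup>2) * U (kk p * T) (far (\<epsilon> / 4)) + ennreal (D\<^sup>2 * (2 * \<delta>)) * mass1 (kk p * T)"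
        proof (rule U_le[OF _ far_meas])
          fix \<theta> x assume \<theta>: "\<theta> \<in> \<Theta>"
          have "run (kk p * T) j (\<lambda>z. W (lam p) \<epsilon> (fst z)) (\<theta>, x) =
            stp (\<tau> p) (run (kk p * T + 1) i (\<lambda>z. W (lam p) \<epsilon> (fst z))) (\<theta>, x)"
            unfolding i chain_Suc_left using kk[OF p] by simp
          also have "\<dots> \<le> stp (\<tau> p) (\<lambda>z. ennreal D * W (lam p) \<epsilon> (fst z)) (\<theta>, x)"
            using elim(1) jN i j(2) by (intro stp_mono tp \<theta>) simp
          also have "\<dots> = ennreal D * stp (\<tau> p) (\<lambda>z. W (lam p) \<epsilon> (fst z)) (\<theta>, x)"
            by (intro stp_cmult tp \<theta> fst_meas W_meas)
          also have "\<dots> \<le> ennreal D * (ennreal C * (\<integral>\<^sup>+ \<theta>'. W (lam p) \<epsilon> \<theta>' \<partial>K (\<tau> p) \<theta>))"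
            by (intro mult_left_mono stp_fst_le tp \<theta> W_meas) auto
          also have "\<dots> \<le> ennreal D * (ennreal D * (ennreal (2 * \<delta>) + far (\<epsilon> / 4) \<theta>))"
          proof (intro mult_left_mono mult_mono TSW \<theta> ennreal_leI)
            have "C ^ 1 \<le> C ^ T" using C T by (intro power_increasing) auto
            then show "C \<le> D" using uw(5) by simp
          qed auto
          also have "\<dots> = ennreal (D\<^sup>2) * far (\<epsilon> / 4) \<theta> + ennreal (D\<^sup>2 * (2 * \<delta>))"
          proof -
            have D2: "ennreal (D\<^sup>2) = ennreal D * ennreal D" using uw by (simp add: power2_eq_square ennreal_mult)
            have "ennreal (D\<^sup>2 * (2 * \<delta>)) = ennreal (D\<^sup>2) * ennreal (2 * \<delta>)" using \<delta> by (intro ennreal_mult) auto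
            then show ?thesis unfolding D2 by (simp only: distrib_left mult.assoc add.commute)
          qed
          finally show "run (kk p * T) j (\<lambda>z. W (lam p) \<epsilon> (fst z)) (\<theta>, x) \<le> ennreal (D\<^sup>2) * far (\<epsilon> / 4) \<theta> + ennreal (D\<^sup>2 * (2 * \<delta>))" .
        qed
        also have "\<dots> \<le> ennreal (D\<^sup>2) * (ennreal \<delta> * Z) + ennreal (D\<^sup>2 * (2 * \<delta>)) * Z"
          using elim(3) unfolding Z_def by (intro add_mono mult_left_mono) auto
        also have "\<dots> = ennreal (D\<^sup>2 * (3 * \<delta>)) * Z"
        proof -
          have "ennreal (D\<^sup>2 * (3 * \<delta>)) = ennreal (D\<^sup>2 * \<delta>) + ennreal (D\<^sup>2 * (2 * \<delta>))"
            using \<delta> by (subst ennreal_plus[symmetric]) (auto simp: algebra_simps)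
          moreover have "ennreal (D\<^sup>2 * \<delta>) = ennreal (D\<^sup>2) * ennreal \<delta>" using \<delta> by (intro ennreal_mult) auto
          ultimately show ?thesis by (simp only: distrib_right mult.assoc)
        qed
        finally show ?thesis .
      qed
      \<comment> \<open>\<open>far (r / 16)\<close> is the complement of the ball of radius
        \<open>r / 8\<close> and carries at most half of the mass, which is finite and can be
        cancelled.\<close>
      have Zball: "ennreal (1 / 2) * Z \<le> U (kk p * T) (indicator (ball \<theta>h (r / 8)))"
      proof -
        let ?B = "indicator (ball \<theta>h (r / 8)) :: real ^ 'd \<Rightarrow> ennreal"
        have "Z = U (kk p * T) (\<lambda>\<theta>. 1 * ?B \<theta> + 1 * far (r / 16) \<theta>)"
          unfolding Z_def by (intro arg_cong[where f = "U (kk p * T)"] ext) (auto simp: far_def indicator_def dist_norm norm_minus_commute)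
        also have "\<dots> = U (kk p * T) ?B + U (kk p * T) (far (r / 16))"
          by (subst U_lin[OF ball_meas far_meas]) simp
        also have "\<dots> \<le> U (kk p * T) ?B + ennreal (1 / 2) * Z"
          using elim(4) unfolding Z_def by (intro add_left_mono) auto
        finally have "ennreal (1 / 2) * Z + ennreal (1 / 2) * Z \<le> U (kk p * T) ?B + ennreal (1 / 2) * Z"
          unfolding distrib_right[symmetric] ennreal_half by simp
        moreover have "ennreal (1 / 2) * Z \<noteq> top" using mass1_fin[of "kk p * T"] by (simp add: Z_def ennreal_mult_eq_top_iff)
        ultimately show ?thesis by (simp add: add.commute[of _ "ennreal (1 / 2) * Z"])
      qed
      \<comment> \<open>The 1/8 is a product of three halves: the height of the tent, a heavy-tailed
        step that stays near, and the mass that was in the ball before it.\<close>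
      have low: "ennreal (\<sigma> ^ n * (1 / 8)) * Z \<le> mass1 ((kk p + n) * T)" if n: "1 \<le> n" "n \<le> N p" for n
      proof -
        have "ennreal (\<sigma> ^ n * (1 / 4)) * U (kk p * T) (indicator (ball \<theta>h (r / 8))) \<le> U (kk p * T + n * T) (\<lambda>_. 1)"
        proof (rule U_ge[OF _ ball_meas])
          fix \<theta> x assume \<theta>: "\<theta> \<in> \<Theta>"
          have "ennreal (1 / 2) * indicator (ball \<theta>h (r / 8)) \<theta> \<le> (\<integral>\<^sup>+ u. indicator (ball \<theta>h (r / 4)) u \<partial>K (\<tau> p) \<theta>)"
          proof (cases "\<theta> \<in> ball \<theta>h (r / 8)")
            case True
            interpret prob_space "K (\<tau> p) \<theta>" by (rule prob_K[OF tp \<theta>])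
            have near: "ball \<theta> (h (\<tau> p)) \<subseteq> \<Theta>"
            proof
              fix u assume "u \<in> ball \<theta> (h (\<tau> p))"
              then have "dist \<theta> u < r" using h\<tau> by (simp add: \<eta>_def)
              then have "dist \<theta>h u < 2 * r" using True r(1) dist_triangle[of \<theta>h u \<theta>] by simp
              then show "u \<in> \<Theta>" using r(3) by auto
            qed
            let ?I = "indicator {u. norm (u - \<theta>) > r / 8} :: real ^ 'd \<Rightarrow> ennreal"
            let ?B = "indicator (ball \<theta>h (r / 4)) :: real ^ 'd \<Rightarrow> ennreal"
            have mI: "?I \<in> borel_measurable (K (\<tau> p) \<theta>)" by (intro meas_KI tp \<theta>) measurable
            have mB: "?B \<in> borel_measurable (K (\<tau> p) \<theta>)" by (intro meas_KI tp \<theta> ball_meas)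
            have "ennreal (1 / 2) + ennreal (1 / 2) = (\<integral>\<^sup>+ u. 1 \<partial>K (\<tau> p) \<theta>)" unfolding ennreal_half by (simp add: emeasure_space_1)
            also have "\<dots> \<le> (\<integral>\<^sup>+ u. ?B u + ?I u \<partial>K (\<tau> p) \<theta>)"
            proof (intro nn_integral_mono)
              fix u
              show "1 \<le> ?B u + ?I u"
              proof (cases "norm (u - \<theta>) > r / 8")
                case False
                then have "dist \<theta>h u < r / 4" using True dist_triangle[of \<theta>h u \<theta>] by (simp add: dist_norm norm_minus_commute)
                then show ?thesis by simp
              qed simp
            qed
            also have "\<dots> = (\<integral>\<^sup>+ u. ?B u \<partial>K (\<tau> p) \<theta>) + (\<integral>\<^sup>+ u. ?I u \<partial>K (\<tau> p) \<theta>)"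
              by (intro nn_integral_add mB mI)
            also have "\<dots> \<le> (\<integral>\<^sup>+ u. ?B u \<partial>K (\<tau> p) \<theta>) + ennreal (1 / 2)"
            proof (intro add_left_mono)
              have "(\<integral>\<^sup>+ u. ?I u \<partial>K (\<tau> p) \<theta>) \<le> ennreal (c4 * h (\<tau> p) powr \<nu>)"
                unfolding TS[OF p \<theta>] by (rule c4(2)[OF h\<tau>(1) near])
              also have "\<dots> \<le> ennreal (1 / 2)" using h\<tau> by (intro ennreal_leI \<eta>_powr) auto
              finally show "(\<integral>\<^sup>+ u. ?I u \<partial>K (\<tau> p) \<theta>) \<le> ennreal (1 / 2)" .
            qed
            finally have "ennreal (1 / 2) \<le> (\<integral>\<^sup>+ u. ?B u \<partial>K (\<tau> p) \<theta>)" by (rule ennreal_add_right_cancel_leD)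
            then show ?thesis using True by simp
          qed simp
          then have "ennreal \<sigma> ^ n * (ennreal (1 / 2) * (ennreal (1 / 2) * indicator (ball \<theta>h (r / 8)) \<theta>)) \<le>
            ennreal \<sigma> ^ n * (ennreal (1 / 2) * (\<integral>\<^sup>+ u. indicator (ball \<theta>h (r / 4)) u \<partial>K (\<tau> p) \<theta>))"
            by (intro mult_left_mono) auto
          also have "\<dots> \<le> run (kk p * T) (n * T) (\<lambda>_. 1) (\<theta>, x)" using elim(2) n \<theta> by simp
          finally have "ennreal \<sigma> ^ n * (ennreal (1 / 2) * ennreal (1 / 2)) * indicator (ball \<theta>h (r / 8)) \<theta> \<le> run (kk p * T) (n * T) (\<lambda>_. 1) (\<theta>, x)"
            by (simp only: mult.assoc)
          moreover have "ennreal \<sigma> ^ n * (ennreal (1 / 2) * ennreal (1 / 2)) = ennreal (\<sigma> ^ n * (1 / 2 * (1 / 2)))"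
            using \<sigma> by (intro ennreal_power_half) auto
          ultimately show "ennreal (\<sigma> ^ n * (1 / 4)) * indicator (ball \<theta>h (r / 8)) \<theta> \<le> run (kk p * T) (n * T) (\<lambda>z. 1) (\<theta>, x)"
            by simp
        qed
        then have "ennreal (\<sigma> ^ n * (1 / 4)) * (ennreal (1 / 2) * Z) \<le> mass1 ((kk p + n) * T)"
          using Zball by (simp only: add_mult_distrib) (meson mult_left_mono order_trans zero_le)
        moreover have "ennreal (\<sigma> ^ n * (1 / 8)) = ennreal (\<sigma> ^ n * (1 / 4)) * ennreal (1 / 2)"
          using \<sigma> by (subst ennreal_mult[symmetric]) auto
        ultimately show ?thesis by (simp only: mult.assoc)
      qed
      show ?case
      proof (intro conjI allI impI p)
        fix n j assume n: "kk p \<le> n" "n < kk (Suc p)" and j: "1 \<le> j" "j \<le> T"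
        \<comment> \<open>The number of full Gaussian blocks before block \<open>n\<close>.
          Truncated subtraction makes it 0 for \<open>n = kk p\<close>, where only the first block
          is involved.\<close>
        define i where "i = n - kk p - 1"
        have iN: "i \<le> N p" using n kkN[OF p] by (simp add: i_def)
        have up: "U (n * T + j) (far \<epsilon>) \<le> ennreal (((\<rho> * ell) ^ i * (3 * \<delta>) + i * D ^ i * exp (- lam p * \<epsilon>)) * D ^ 3) * Z"
        proof (cases "n = kk p")
          case True
          have "U (n * T + j) (far \<epsilon>) \<le> U (kk p * T + j) (W (lam p) \<epsilon>)" unfolding True by (intro U_mono far_le_W)
          also have "\<dots> \<le> ennreal (D\<^sup>2 * (3 * \<delta>)) * Z" by (rule first[OF j])
          also have "\<dots> \<le> ennreal (((\<rho> * ell) ^ i * (3 * \<delta>) + i * D ^ i * exp (- lam p * \<epsilon>)) * D ^ 3) * Z"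
          proof (intro mult_right_mono ennreal_leI)
            have "D\<^sup>2 \<le> D ^ 3" using uw(3) by (intro power_increasing) auto
            then have "D\<^sup>2 * (3 * \<delta>) \<le> D ^ 3 * (3 * \<delta>)" using \<delta> by (intro mult_right_mono) auto
            then show "D\<^sup>2 * (3 * \<delta>) \<le> ((\<rho> * ell) ^ i * (3 * \<delta>) + i * D ^ i * exp (- lam p * \<epsilon>)) * D ^ 3"
              using True by (simp add: i_def mult.commute)
          qed auto
          finally show ?thesis .
        next
          case False
          then have ni: "n = kk p + 1 + i" using n by (simp add: i_def)
          have "U (n * T + j) (far \<epsilon>) \<le> U (n * T + j) (W (lam p) \<epsilon>)" by (intro U_mono far_le_W)
          also have "\<dots> \<le> ennreal D * U (n * T) (W (lam p) \<epsilon>) + 0 * mass1 (n * T)"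
          proof (intro U_le W_meas)
            fix \<theta> x assume \<theta>: "\<theta> \<in> \<Theta>"
            have "kk p * T + 1 \<le> n * T" unfolding ni using T by (simp add: add_mult_distrib)
            moreover have "n * T + j \<le> kk (Suc p) * T"
            proof -
              have "(n + 1) * T \<le> kk (Suc p) * T" using n(2) by (intro mult_right_mono) auto
              then show ?thesis using j(2) by simp
            qed
            ultimately show "run (n * T) j (\<lambda>z. W (lam p) \<epsilon> (fst z)) (\<theta>, x) \<le> ennreal D * W (lam p) \<epsilon> \<theta> + 0"
              using elim(1) j(2) \<theta> by simp
          qed
          also have "\<dots> \<le> ennreal D * (ennreal ((\<rho> * ell) ^ i) * U ((kk p + 1) * T) (W (lam p) \<epsilon>) +
            ennreal (i * D ^ i * exp (- lam p * \<epsilon>)) * mass1 ((kk p + 1) * T))"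
            using elim(1) n(2) kkN(1)[OF p] unfolding ni by (simp add: mult_left_mono)
          also have "\<dots> \<le> ennreal D * (ennreal ((\<rho> * ell) ^ i) * (ennreal (D\<^sup>2 * (3 * \<delta>)) * Z) +
            ennreal (i * D ^ i * exp (- lam p * \<epsilon>)) * (ennreal (D\<^sup>2) * Z))"
          proof (intro add_mono mult_left_mono)
            show "U ((kk p + 1) * T) (W (lam p) \<epsilon>) \<le> ennreal (D\<^sup>2 * (3 * \<delta>)) * Z"
              using first[of T] T by (simp add: add.commute)
            have "D * 1 \<le> D * D" using uw(3) by (intro mult_left_mono) auto
            then have "C ^ T \<le> D\<^sup>2" using uw(5) by (simp add: power2_eq_square)
            then show "mass1 ((kk p + 1) * T) \<le> ennreal (D\<^sup>2) * Z" unfolding Z_def by (rule mass1_step)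
          qed auto
          also have "\<dots> = ennreal (((\<rho> * ell) ^ i * (3 * \<delta>) + i * D ^ i * exp (- lam p * \<epsilon>)) * D ^ 3) * Z"
          proof -
            define X where "X = (\<rho> * ell) ^ i"
            define Y where "Y = i * D ^ i * exp (- lam p * \<epsilon>)"
            have nn: "0 \<le> X" "0 \<le> Y" "0 \<le> D" "0 \<le> 3 * \<delta>" "0 \<le> D\<^sup>2" using uw ell(1) \<delta> by (auto simp: X_def Y_def)
            have "ennreal X * (ennreal (D\<^sup>2 * (3 * \<delta>)) * Z) + ennreal Y * (ennreal (D\<^sup>2) * Z) =
              ennreal (X * (3 * \<delta>)) * (ennreal (D\<^sup>2) * Z) + ennreal Y * (ennreal (D\<^sup>2) * Z)"
              unfolding ennreal_mult[OF nn(1,4)] ennreal_mult[OF nn(5,4)] by (simp only: mult_ac)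
            also have "\<dots> = ennreal ((X * (3 * \<delta>) + Y) * D\<^sup>2) * Z"
              using nn by (intro ennreal_sum_mult) auto
            finally have "ennreal D * (ennreal X * (ennreal (D\<^sup>2 * (3 * \<delta>)) * Z) + ennreal Y * (ennreal (D\<^sup>2) * Z)) =
              ennreal (D * ((X * (3 * \<delta>) + Y) * D\<^sup>2)) * Z"
              using nn by (subst ennreal_mult) (auto simp: mult.assoc)
            also have "D * ((X * (3 * \<delta>) + Y) * D\<^sup>2) = (X * (3 * \<delta>) + Y) * D ^ 3"
              by (simp add: power2_eq_square power3_eq_cube)
            finally show ?thesis unfolding X_def Y_def .
          qed
          finally show ?thesis .
        qed
        define m where "m = n + 1 - kk p"
        have m: "1 \<le> m" "m \<le> N p" "kk p + m = n + 1" "m = 1 \<and> i = 0 \<or> m = i + 2" using n kkN[OF p] by (auto simp: m_def i_def)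
        have sm: "s0 * \<sigma> ^ i \<le> \<sigma> ^ m"
          using m(4)
        proof
          assume "m = i + 2"
          then have "\<sigma> ^ m = \<sigma>\<^sup>2 * \<sigma> ^ i" by (simp add: power_add power2_eq_square mult_ac)
          moreover have "s0 * \<sigma> ^ i \<le> \<sigma>\<^sup>2 * \<sigma> ^ i" using \<sigma> by (intro mult_right_mono) (auto simp: s0_def)
          ultimately show ?thesis by simp
        qed (simp add: s0_def)
        show "U (n * T + j) (far \<epsilon>) \<le> ennreal e * mass1 (n * T + j)"
        proof (rule ennreal_ratio_bound[OF up low[OF m(1,2)]])
          show "mass1 ((kk p + m) * T) \<le> ennreal D * mass1 (n * T + j)"
            unfolding m(3) using mass1_next_block[OF j(2), of n] uw(5)
            by (simp, meson ennreal_leI mult_right_mono order_trans zero_le)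
          define \<beta> where "\<beta> = \<rho> * ell / \<sigma>"
          have \<beta>: "0 \<le> \<beta>" "\<beta> \<le> 1" using uw \<sigma> ell(1) by (auto simp: \<beta>_def)
          have "\<beta> ^ i \<le> 1" by (intro power_le_one \<beta>)
          moreover have "i * (D / \<sigma>) ^ i * exp (- lam p * \<epsilon>) \<le> small"
            unfolding small_def
          proof (intro mult_right_mono mult_mono)
            have "(D / \<sigma>) ^ i \<le> F ^ i" using uw \<sigma> by (intro power_mono) (auto simp: F_def)
            also have "\<dots> \<le> F ^ N p" by (intro power_increasing iN) (auto simp: F_def)
            finally show "(D / \<sigma>) ^ i \<le> F ^ N p" .
          qed (use iN uw \<sigma> in auto)
          ultimately have "\<beta> ^ i * (3 * \<delta>) + i * (D / \<sigma>) ^ i * exp (- lam p * \<epsilon>) \<le> 1 * (3 * \<delta>) + \<delta>"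
            using small(2) \<delta> by (intro add_mono mult_right_mono) auto
          then have b: "\<beta> ^ i * (3 * \<delta>) + i * (D / \<sigma>) ^ i * exp (- lam p * \<epsilon>) \<le> e / A"
            using A by (simp add: \<delta>_def)
          have "((\<rho> * ell) ^ i * (3 * \<delta>) + i * D ^ i * exp (- lam p * \<epsilon>)) * D ^ 3 * D =
            \<sigma> ^ i * D ^ 4 * (\<beta> ^ i * (3 * \<delta>) + i * (D / \<sigma>) ^ i * exp (- lam p * \<epsilon>))"
          proof -
            have 1: "(\<rho> * ell) ^ i = \<sigma> ^ i * \<beta> ^ i" and 2: "D ^ i = \<sigma> ^ i * (D / \<sigma>) ^ i"
              using \<sigma> by (simp_all add: \<beta>_def power_mult_distrib[symmetric])
            have 3: "D ^ 4 = D ^ 3 * D" by (simp add: eval_nat_numeral)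
            show ?thesis unfolding 1 2 3 by (simp only: distrib_left distrib_right mult_ac)
          qed
          also have "\<dots> \<le> \<sigma> ^ i * D ^ 4 * (e / A)" using \<sigma> uw by (intro mult_left_mono b) auto
          also have "\<dots> = e * (s0 * \<sigma> ^ i * (1 / 8))" using s0 uw by (simp add: A_def)
          also have "\<dots> \<le> e * (\<sigma> ^ m * (1 / 8))" using sm e by (intro mult_left_mono mult_right_mono) auto
          finally show "((\<rho> * ell) ^ i * (3 * \<delta>) + i * D ^ i * exp (- lam p * \<epsilon>)) * D ^ 3 * D \<le> e * (\<sigma> ^ m * (1 / 8))" .
        qed (use uw e \<sigma> in auto)
      qed
    qed
    then obtain q where q: "\<And>p n j. q \<le> p \<Longrightarrow> kk p \<le> n \<Longrightarrow> n < kk (Suc p) \<Longrightarrow> 1 \<le> j \<Longrightarrow> j \<le> T \<Longrightarrow>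
      U (n * T + j) (far \<epsilon>) \<le> ennreal e * mass1 (n * T + j)"
      unfolding eventually_sequentially by blast
    define p0 where "p0 = max 1 q"
    have p0: "\<And>p n j. p0 \<le> p \<Longrightarrow> kk p \<le> n \<Longrightarrow> n < kk (Suc p) \<Longrightarrow> 1 \<le> j \<Longrightarrow> j \<le> T \<Longrightarrow>
      U (n * T + j) (far \<epsilon>) \<le> ennreal e * mass1 (n * T + j)" "1 \<le> p0"
      using q by (auto simp: p0_def)
    show "\<forall>\<^sub>F t in sequentially. U t (far \<epsilon>) \<le> ennreal e * mass1 t"
      unfolding eventually_sequentially
    proof (intro exI allI impI)
      fix t assume t: "\<tau> p0 \<le> t"
      \<comment> \<open>The window containing \<open>t\<close>. Minimality gives
        \<open>\<tau> q \<le> t\<close>, and the bound \<open>p0\<close> keeps the search among the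
        windows for which the estimate is known.\<close>
      define q where "q = (LEAST q. t < \<tau> (Suc q) \<and> p0 \<le> q)"
      have "t < \<tau> (Suc (max p0 t)) \<and> p0 \<le> max p0 t" using \<tau>_ge[of "Suc (max p0 t)"] by simp
      then have q: "t < \<tau> (Suc q)" "p0 \<le> q" unfolding q_def by (metis (mono_tags, lifting) LeastI)+
      have q': "\<tau> q \<le> t"
      proof (cases "q = p0")
        case False
        then obtain q' where q': "q = Suc q'" "p0 \<le> q'" using q(2) by (cases q) auto
        have "\<not> (t < \<tau> (Suc q') \<and> p0 \<le> q')" using not_less_Least[of q' "\<lambda>q. t < \<tau> (Suc q) \<and> p0 \<le> q"] q' unfolding q_def by simp
        then show ?thesis using q' by simp
      qed (use t in simp)
      have q1: "1 \<le> q" using q(2) p0(2) by simp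
      \<comment> \<open>Positions in a block run from 1 to \<open>T\<close>, so that the time
        \<open>n * T + T\<close> is still the end of block \<open>n\<close>; this fits windows that
        start at a multiple of \<open>T\<close> plus 1.\<close>
      define n where "n = (t - 1) div T"
      define j where "j = (t - 1) mod T + 1"
      have t1: "t = n * T + j" using q' \<tau>2[OF q1] by (simp add: n_def j_def)
      have n1: "kk q \<le> n" using q' kk[OF q1] T by (simp add: n_def less_eq_div_iff_mult_less_eq)
      have "t - 1 < kk (Suc q) * T" using q(1) kk[of "Suc q"] q' \<tau>2[OF q1] by simp
      then have n2: "n < kk (Suc q)" using T by (simp add: n_def div_less_iff_less_mult)
      have j1: "1 \<le> j" "j \<le> T" using T by (auto simp: j_def Suc_le_eq)
      show "U t (far \<epsilon>) \<le> ennreal e * mass1 t"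
        unfolding t1 by (rule p0(1)[OF q(2) n1 n2 j1])
    qed
  qed
qed

end

section \<open>Periodic state-space models\<close>

text \<open>The operators to be compared agree only on a class \<open>M\<close> of functions, the
  measurable ones, and at points of a set \<open>X\<close>, the underlying space. The class must be
  preserved by the second family.\<close>

lemma chain_cong_on:
  assumes step: "\<And>s H H' z. s \<in> {a + 1..a + n} \<Longrightarrow> H' \<in> M \<Longrightarrow> (\<And>z. z \<in> X \<Longrightarrow> H z = H' z) \<Longrightarrow> z \<in> X \<Longrightarrow> A s H z = B s H' z"
    and M: "\<And>s H. s \<in> {a + 1..a + n} \<Longrightarrow> H \<in> M \<Longrightarrow> B s H \<in> M"
    and H: "H' \<in> M" "\<And>z. z \<in> X \<Longrightarrow> H z = H' z" and z: "z \<in> X"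
  shows "chain A a n H z = chain B a n H' z"
  using step M H
proof (induction n arbitrary: H H')
  case (Suc n)
  have s: "a + Suc n \<in> {a + 1..a + Suc n}" by simp
  show ?case unfolding chain.simps
  proof (rule Suc.IH)
    show "B (a + Suc n) H' \<in> M" by (rule Suc.prems(2)[OF s Suc.prems(3)])
    show "A (a + Suc n) H z = B (a + Suc n) H' z" if "z \<in> X" for z
      by (rule Suc.prems(1)[OF s Suc.prems(3,4) that])
  qed (use Suc.prems(1,2) in auto)
qed (use z in auto)

text \<open>The kernel of time 1 never enters the law, which starts from \<open>I\<close>. So it can
  be redefined to be the constant initial law, as the backward evaluation requires.\<close>

lemma markov_law_cong:
  "(\<And>s. 2 \<le> s \<Longrightarrow> P s = P' s) \<Longrightarrow> markov_law S I P n = markov_law S I P' n"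
proof (induction n)
  case (Suc n)
  have "(if n = 0 then I else P (Suc n) z) = (if n = 0 then I else P' (Suc n) z)" for z
    using Suc.prems[of "Suc n"] by (cases n) auto
  then show ?case using Suc by simp
qed simp

text \<open>A finite bound rules out that exactly one of the two numbers is 0, so densities at
  different parameters have the same zeros and the multiplicative form holds without
  exceptions.\<close>

lemma log_dist_le_exp:
  assumes "0 \<le> a" "0 \<le> b" "log_dist a b \<le> ereal c" shows "b \<le> a * exp c"
proof -
  consider "a = 0" "b = 0" | "a = 0 \<or> b = 0" "\<not> (a = 0 \<and> b = 0)" | "0 < a" "0 < b"
    using assms by fastforce
  then show ?thesis
  proof cases
    case 3
    then have "ln b \<le> ln a + c" using assms(3) by (simp add: log_dist_def)
    then have "exp (ln b) \<le> exp (ln a + c)" by simp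
    then show ?thesis using 3 by (simp add: exp_add)
  qed (use assms(3) in \<open>auto simp: log_dist_def\<close>)
qed

lemma log_dist_nonneg: "0 \<le> log_dist a b"
  by (simp add: log_dist_def zero_ereal_def[symmetric])

lemma density_kernel:
  assumes L: "sigma_finite_measure L" "sets L = sets N"
    and d: "case_prod d \<in> borel_measurable (Z \<Otimes>\<^sub>M N)"
    and p: "\<And>z. z \<in> space Z \<Longrightarrow> prob_space (density L (\<lambda>x. ennreal (d z x)))"
  shows "(\<lambda>z. density L (\<lambda>x. ennreal (d z x))) \<in> Z \<rightarrow>\<^sub>M prob_algebra N"
proof (rule measurable_prob_algebraI[OF p], assumption, rule measurable_subprob_algebra)
  interpret sigma_finite_measure L by (rule L)
  have dL: "case_prod d \<in> borel_measurable (Z \<Otimes>\<^sub>M L)"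
    using d L(2) by (simp cong: measurable_cong_sets sets_pair_measure_cong)
  fix A assume "A \<in> sets N"
  then have A[measurable]: "A \<in> sets L" using L(2) by simp
  note [measurable] = dL
  have "case_prod (\<lambda>z x. ennreal (d z x) * indicator A x) \<in> borel_measurable (Z \<Otimes>\<^sub>M L)"
    by measurable
  from borel_measurable_nn_integral[OF this]
  have "(\<lambda>z. \<integral>\<^sup>+ x. ennreal (d z x) * indicator A x \<partial>L) \<in> borel_measurable Z" by simp
  moreover have "emeasure (density L (\<lambda>x. ennreal (d z x))) A = (\<integral>\<^sup>+ x. ennreal (d z x) * indicator A x \<partial>L)"
    if "z \<in> space Z" for z
  proof (rule emeasure_density[OF _ A])
    show "(\<lambda>x. ennreal (d z x)) \<in> borel_measurable L"
      using measurable_compose[OF measurable_Pair1'[OF that] dL] by simp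
  qed
  ultimately show "(\<lambda>z. emeasure (density L (\<lambda>x. ennreal (d z x))) A) \<in> borel_measurable Z"
    by (simp cong: measurable_cong)
next
  fix z assume "z \<in> space Z"
  then show "subprob_space (density L (\<lambda>x. ennreal (d z x)))" by (intro prob_space_imp_subprob_space p)
qed (use L(2) in simp)

locale periodic_ssm =
  fixes T :: nat and \<Theta> :: "(real ^ 'd) set" and L :: "'x::polish_space measure" and \<mu> :: "'y measure"
    and p :: "real ^ 'd \<Rightarrow> 'x \<Rightarrow> real" and m :: "nat \<Rightarrow> real ^ 'd \<Rightarrow> 'x \<Rightarrow> 'x \<Rightarrow> real"
    and f :: "nat \<Rightarrow> real ^ 'd \<Rightarrow> 'x \<Rightarrow> 'y \<Rightarrow> real" and yt :: "nat \<Rightarrow> 'y"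
  assumes T2: "2 \<le> T" and model: "state_space_model T \<Theta> L \<mu> p m f"
    and yt: "\<And>s. s \<in> {1..T} \<Longrightarrow> yt s \<in> space \<mu>"
begin

abbreviation "P\<Theta> \<equiv> restrict_space borel \<Theta> :: (real ^ 'd) measure"

text \<open>At position 1 of a block the old state is ignored: the state is redrawn from the initial
  law. With this convention all positions have the same type.\<close>

definition dens :: "nat \<Rightarrow> real ^ 'd \<Rightarrow> 'x \<Rightarrow> 'x \<Rightarrow> real" where
  "dens s \<theta> x x' = (if s = 1 then p \<theta> x' else m s \<theta> x x')"

definition G :: "nat \<Rightarrow> real ^ 'd \<Rightarrow> 'x \<Rightarrow> 'x \<Rightarrow> real" where
  "G s \<theta> x x' = f s \<theta> x' (yt s) * dens s \<theta> x x'"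

lemma sets_L: "sets L = sets borel" and sf_L: "sigma_finite_measure L"
  using model by (auto simp: state_space_model_def)

lemma space_P\<Theta> [simp]: "space P\<Theta> = \<Theta>"
  by (simp add: space_restrict_space)

lemma dens_meas:
  assumes "s \<in> {1..T}"
  shows "(\<lambda>(\<theta>, x, x'). dens s \<theta> x x') \<in> borel_measurable (P\<Theta> \<Otimes>\<^sub>M borel \<Otimes>\<^sub>M borel)"
proof (cases "s = 1")
  case True
  have p: "(\<lambda>(\<theta>, x). p \<theta> x) \<in> borel_measurable (P\<Theta> \<Otimes>\<^sub>M borel)"
    using model by (auto simp: state_space_model_def)
  have "(\<lambda>z. (fst z, snd (snd z))) \<in> P\<Theta> \<Otimes>\<^sub>M borel \<Otimes>\<^sub>M borel \<rightarrow>\<^sub>M P\<Theta> \<Otimes>\<^sub>M (borel :: 'x measure)"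
    by measurable
  from measurable_compose[OF this p] show ?thesis using True by (simp add: dens_def split_beta')
next
  case False
  then have "s \<in> {2..T}" using assms by auto
  then have "(\<lambda>(\<theta>, x', x). m s \<theta> x' x) \<in> borel_measurable (P\<Theta> \<Otimes>\<^sub>M borel \<Otimes>\<^sub>M borel)"
    using model by (auto simp: state_space_model_def)
  then show ?thesis using False by (simp add: dens_def)
qed

lemma obs_meas:
  assumes "s \<in> {1..T}"
  shows "(\<lambda>(\<theta>, x). f s \<theta> x (yt s)) \<in> borel_measurable (P\<Theta> \<Otimes>\<^sub>M borel)"
proof -
  have f: "(\<lambda>(\<theta>, x, y). f s \<theta> x y) \<in> borel_measurable (P\<Theta> \<Otimes>\<^sub>M borel \<Otimes>\<^sub>M \<mu>)"
    using model assms by (auto simp: state_space_model_def)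
  note [measurable] = measurable_const[OF yt[OF assms]]
  have "(\<lambda>z. (fst z, snd z, yt s)) \<in> P\<Theta> \<Otimes>\<^sub>M borel \<rightarrow>\<^sub>M P\<Theta> \<Otimes>\<^sub>M (borel :: 'x measure) \<Otimes>\<^sub>M \<mu>"
    by measurable
  from measurable_compose[OF this f] show ?thesis by (simp add: split_beta')
qed

lemma dens_nonneg: "s \<in> {1..T} \<Longrightarrow> \<theta> \<in> \<Theta> \<Longrightarrow> 0 \<le> dens s \<theta> x x'"
  using model by (auto simp: dens_def state_space_model_def)

lemma obs_nonneg: "s \<in> {1..T} \<Longrightarrow> \<theta> \<in> \<Theta> \<Longrightarrow> 0 \<le> f s \<theta> x (yt s)"
  using model yt by (auto simp: state_space_model_def)

lemma dens_prob: "s \<in> {1..T} \<Longrightarrow> \<theta> \<in> \<Theta> \<Longrightarrow> prob_space (density L (\<lambda>x'. ennreal (dens s \<theta> x x')))"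
  using model by (cases "s = 1") (auto simp: dens_def state_space_model_def init_law_def trans_kernel_def)

lemma G_meas:
  assumes "s \<in> {1..T}"
  shows "(\<lambda>(\<theta>, x, x'). G s \<theta> x x') \<in> borel_measurable (P\<Theta> \<Otimes>\<^sub>M borel \<Otimes>\<^sub>M borel)"
proof -
  have "(\<lambda>z. (fst z, snd (snd z))) \<in> P\<Theta> \<Otimes>\<^sub>M borel \<Otimes>\<^sub>M borel \<rightarrow>\<^sub>M P\<Theta> \<Otimes>\<^sub>M (borel :: 'x measure)"
    by measurable
  from measurable_compose[OF this obs_meas[OF assms]]
  have [measurable]: "(\<lambda>z. f s (fst z) (snd (snd z)) (yt s)) \<in> borel_measurable (P\<Theta> \<Otimes>\<^sub>M borel \<Otimes>\<^sub>M borel)"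
    by simp
  have [measurable]: "(\<lambda>z. dens s (fst z) (fst (snd z)) (snd (snd z))) \<in> borel_measurable (P\<Theta> \<Otimes>\<^sub>M borel \<Otimes>\<^sub>M borel)"
    using dens_meas[OF assms] by (simp add: split_beta')
  show ?thesis unfolding G_def split_beta' by measurable
qed

lemma G_nonneg: "s \<in> {1..T} \<Longrightarrow> \<theta> \<in> \<Theta> \<Longrightarrow> 0 \<le> G s \<theta> x x'"
  by (simp add: G_def dens_nonneg obs_nonneg)

lemma meas_L: "borel_measurable L = borel_measurable borel"
  by (rule measurable_cong_sets) (simp_all add: sets_L)

lemma dens_meas1:
  assumes "s \<in> {1..T}" "\<theta> \<in> \<Theta>" shows "dens s \<theta> x \<in> borel_measurable borel"
proof -
  have "\<theta> \<in> space P\<Theta>" using assms by simp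
  from measurable_compose[OF measurable_Pair1'[OF this] dens_meas[OF assms(1)]]
  have "(\<lambda>(x, x'). dens s \<theta> x x') \<in> borel_measurable (borel \<Otimes>\<^sub>M borel)" by (simp add: split_beta')
  from measurable_compose[OF measurable_Pair1'[of x borel borel] this] show ?thesis by simp
qed

lemma obs_meas1:
  assumes "s \<in> {1..T}" "\<theta> \<in> \<Theta>" shows "(\<lambda>x. f s \<theta> x (yt s)) \<in> borel_measurable borel"
proof -
  have "\<theta> \<in> space P\<Theta>" using assms by simp
  from measurable_compose[OF measurable_Pair1'[OF this] obs_meas[OF assms(1)]] show ?thesis by simp
qed

lemma nn_integral_dens:
  assumes "s \<in> {1..T}" "\<theta> \<in> \<Theta>" "H \<in> borel_measurable borel"
  shows "(\<integral>\<^sup>+ x'. H x' \<partial>density L (\<lambda>x'. ennreal (dens s \<theta> x x'))) = (\<integral>\<^sup>+ x'. ennreal (dens s \<theta> x x') * H x' \<partial>L)"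
  using dens_meas1[OF assms(1,2)] assms(3) by (intro nn_integral_density) (simp_all add: meas_L)

lemma G_bound:
  assumes s: "s \<in> {1..T}" and \<theta>: "\<theta> \<in> \<Theta>" and C: "\<And>x. f s \<theta> x (yt s) \<le> C" "0 \<le> C"
  shows "(\<integral>\<^sup>+ x'. ennreal (G s \<theta> x x') \<partial>L) \<le> ennreal C"
proof -
  interpret prob_space "density L (\<lambda>x'. ennreal (dens s \<theta> x x'))" by (rule dens_prob[OF s \<theta>])
  have "(\<integral>\<^sup>+ x'. ennreal (G s \<theta> x x') \<partial>L) \<le> (\<integral>\<^sup>+ x'. ennreal (dens s \<theta> x x') * ennreal C \<partial>L)"
  proof (intro nn_integral_mono)
    fix x'
    have "G s \<theta> x x' \<le> dens s \<theta> x x' * C"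
      unfolding G_def mult.commute[of "f s \<theta> x' (yt s)"] by (intro mult_left_mono C dens_nonneg s \<theta>)
    then show "ennreal (G s \<theta> x x') \<le> ennreal (dens s \<theta> x x') * ennreal C"
      using C(2) by (simp add: ennreal_mult''[symmetric] ennreal_leI)
  qed
  also have "\<dots> = (\<integral>\<^sup>+ x'. ennreal C \<partial>density L (\<lambda>x'. ennreal (dens s \<theta> x x')))"
    by (rule nn_integral_dens[OF s \<theta>, symmetric]) simp
  also have "\<dots> = ennreal C" using emeasure_space_1 by simp
  finally show ?thesis .
qed

definition path_weight :: "(nat \<Rightarrow> 'x \<times> 'x \<Rightarrow> real) \<Rightarrow> (nat \<Rightarrow> 'x) \<Rightarrow> real" where
  "path_weight \<phi> x = (\<Sum>s\<in>{1..T}. \<phi> s (if s = 1 then x s else x (s - 1), x s))"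

abbreviation "law \<theta> \<equiv> markov_law borel (init_law L p \<theta>) (\<lambda>s. trans_kernel L m s \<theta>) T"

lemma kern_prob:
  assumes "s \<in> {1..T}" "\<theta> \<in> \<Theta>"
  shows "(\<lambda>x. density L (\<lambda>x'. ennreal (dens s \<theta> x x'))) \<in> borel \<rightarrow>\<^sub>M prob_algebra borel"
proof (rule density_kernel[OF sf_L sets_L])
  have "\<theta> \<in> space P\<Theta>" using assms by simp
  from measurable_compose[OF measurable_Pair1'[OF this] dens_meas[OF assms(1)]]
  show "case_prod (dens s \<theta>) \<in> borel_measurable (borel \<Otimes>\<^sub>M borel)" by (simp add: split_beta')
qed (rule dens_prob[OF assms])

lemma init_prob:
  assumes "\<theta> \<in> \<Theta>" shows "init_law L p \<theta> \<in> space (prob_algebra borel)"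
  using model assms sets_L by (auto simp: state_space_model_def space_prob_algebra init_law_def)

lemma law_prob:
  assumes \<theta>: "\<theta> \<in> \<Theta>" shows "law \<theta> \<in> space (prob_algebra (\<Pi>\<^sub>M i\<in>{1..T}. borel))"
proof (rule markov_law_prob[OF init_prob[OF \<theta>]])
  fix s assume "s \<in> {2..T}"
  then show "trans_kernel L m s \<theta> \<in> borel \<rightarrow>\<^sub>M prob_algebra borel"
    using kern_prob[of s \<theta>] \<theta> by (simp add: dens_def trans_kernel_def[abs_def])
qed

text \<open>Identifies the backward recursion with an integral over paths, where limits in the tilt
  are accessible. The point \<open>x0\<close> is arbitrary, since neither the density nor
  \<open>\<phi>\<close> at position 1 depends on the previous state.\<close>

lemma tilted_lik_eq:
  assumes \<theta>: "\<theta> \<in> \<Theta>"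
    and \<phi>: "\<And>s. s \<in> {1..T} \<Longrightarrow> \<phi> s \<in> borel_measurable (borel \<Otimes>\<^sub>M borel)" and \<phi>1: "\<And>x x'. \<phi> 1 (x, x') = \<phi> 1 (x', x')"
  shows "tilted_lik L G \<phi> T \<theta> c x0 =
    (\<integral>\<^sup>+ x. ennreal (exp (c * path_weight \<phi> x)) * obs_weight (\<lambda>s. f s \<theta>) yt T x \<partial>law \<theta>)"
proof -
  note One_nat_def [simp del]
  \<comment> \<open>Observation and tilt form the weight and the transition density stays in the
    kernel; in \<open>frozen_step\<close> all three are merged into a density with respect to
    \<open>L\<close>.\<close>
  define q where "q s x x' = ennreal (f s \<theta> x' (yt s) * exp (c * \<phi> s (x, x')))" for s x x'
  define P where "P s x = density L (\<lambda>x'. ennreal (dens s \<theta> x x'))" for s x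
  have P1: "P 1 = (\<lambda>_. init_law L p \<theta>)" by (rule ext) (simp add: P_def dens_def init_law_def)
  have mq: "case_prod (q s) \<in> borel_measurable (borel \<Otimes>\<^sub>M borel)" if s: "s \<in> {1..T}" for s
  proof -
    note [measurable] = \<phi>[OF s] obs_meas1[OF s \<theta>]
    show ?thesis unfolding q_def by measurable
  qed
  have "(\<integral>\<^sup>+ x. ennreal (exp (c * path_weight \<phi> x)) * obs_weight (\<lambda>s. f s \<theta>) yt T x \<partial>law \<theta>) =
    (\<integral>\<^sup>+ x. (\<Prod>s\<in>{1..T}. q s (if s = 1 then x s else x (s - 1)) (x s)) * 1 \<partial>markov_law borel (init_law L p \<theta>) P T)"
  proof -
    have "law \<theta> = markov_law borel (init_law L p \<theta>) P T"
      by (rule markov_law_cong) (auto simp: P_def[abs_def] dens_def trans_kernel_def[abs_def] One_nat_def)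
    moreover have "ennreal (exp (c * path_weight \<phi> x)) * obs_weight (\<lambda>s. f s \<theta>) yt T x =
      (\<Prod>s\<in>{1..T}. q s (if s = 1 then x s else x (s - 1)) (x s)) * 1" for x
    proof -
      have "exp (c * path_weight \<phi> x) = (\<Prod>s\<in>{1..T}. exp (c * \<phi> s (if s = 1 then x s else x (s - 1), x s)))"
        by (simp add: path_weight_def sum_distrib_left exp_sum)
      then have "ennreal (exp (c * path_weight \<phi> x)) = (\<Prod>s\<in>{1..T}. ennreal (exp (c * \<phi> s (if s = 1 then x s else x (s - 1), x s))))"
        by (simp only: prod_ennreal exp_ge_zero)
      then show ?thesis
        unfolding obs_weight_def q_def mult_1_right using \<theta>
        by (simp only: prod.distrib[symmetric]) (intro prod.cong refl, simp add: obs_nonneg ennreal_mult mult.commute)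
    qed
    ultimately show ?thesis by simp
  qed
  also have "\<dots> = chain (\<lambda>s H z. \<integral>\<^sup>+ u. q s z u * H u \<partial>P s z) 0 T (\<lambda>_. 1) x0"
  proof (rule nn_integral_markov_law[where P = P and q = q and F = "\<lambda>_. 1", OF P1 init_prob[OF \<theta>]])
    show "P s \<in> borel \<rightarrow>\<^sub>M prob_algebra borel" if "s \<in> {1..T}" for s
      unfolding P_def[abs_def] by (rule kern_prob[OF that \<theta>])
    show "q 1 u w = q 1 v w" for u v w using \<phi>1[of u w] \<phi>1[of v w] by (simp add: q_def)
  qed (use mq T2 in auto)
  also have "\<dots> = chain (frozen_step L G \<phi> \<theta> c) 0 T (\<lambda>_. 1) x0"
  proof (rule chain_cong_on[where M = "borel_measurable borel" and X = UNIV])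
    fix s and H H' :: "'x \<Rightarrow> ennreal" and z
    assume s': "s \<in> {0 + 1..0 + T}" and H': "H' \<in> borel_measurable borel" and "\<And>z. z \<in> UNIV \<Longrightarrow> H z = H' z"
    then have HH: "H = H'" by auto
    have s: "s \<in> {1..T}" using s' by simp
    have mqs: "q s z \<in> borel_measurable borel"
      using measurable_compose[OF measurable_Pair1'[of z borel borel] mq[OF s]] by simp
    have "(\<integral>\<^sup>+ u. q s z u * H u \<partial>P s z) = (\<integral>\<^sup>+ u. ennreal (dens s \<theta> z u) * (q s z u * H' u) \<partial>L)"
      unfolding P_def HH using mqs H' by (intro nn_integral_dens[OF s \<theta>]) simp
    also have "\<dots> = frozen_step L G \<phi> \<theta> c s H' z"
      unfolding frozen_step_def
    proof (intro nn_integral_cong)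
      fix u
      have "ennreal (dens s \<theta> z u) * q s z u = ennreal (G s \<theta> z u * exp (c * \<phi> s (z, u)))"
        unfolding q_def G_def using dens_nonneg[OF s \<theta>] obs_nonneg[OF s \<theta>]
        by (subst ennreal_mult[symmetric]) (auto simp: mult_ac)
      then show "ennreal (dens s \<theta> z u) * (q s z u * H' u) = ennreal (G s \<theta> z u * exp (c * \<phi> s (z, u))) * H' u"
        by (simp only: mult.assoc[symmetric])
    qed
    finally show "(\<integral>\<^sup>+ u. q s z u * H u \<partial>P s z) = frozen_step L G \<phi> \<theta> c s H' z" .
  next
    fix s and H :: "'x \<Rightarrow> ennreal" assume s': "s \<in> {0 + 1..0 + T}" and [measurable]: "H \<in> borel_measurable borel"
    have s: "s \<in> {1..T}" using s' by simp
    interpret sigma_finite_measure L by (rule sf_L)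
    have "\<theta> \<in> space P\<Theta>" using \<theta> by simp
    from measurable_compose[OF measurable_Pair1'[OF this] G_meas[OF s]]
    have [measurable]: "(\<lambda>(x, x'). G s \<theta> x x') \<in> borel_measurable (borel \<Otimes>\<^sub>M borel)" by (simp add: split_beta')
    note [measurable] = \<phi>[OF s]
    have "(\<lambda>(x, x'). ennreal (G s \<theta> x x' * exp (c * \<phi> s (x, x'))) * H x') \<in> borel_measurable (borel \<Otimes>\<^sub>M borel)"
      by measurable
    then have "(\<lambda>(x, x'). ennreal (G s \<theta> x x' * exp (c * \<phi> s (x, x'))) * H x') \<in> borel_measurable (borel \<Otimes>\<^sub>M L)"
      using sets_L by (simp cong: measurable_cong_sets sets_pair_measure_cong)
    from borel_measurable_nn_integral[OF this] show "frozen_step L G \<phi> \<theta> c s H \<in> borel_measurable borel"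
      unfolding frozen_step_def by simp
  qed auto
  finally show ?thesis by (simp add: tilted_lik_def)
qed

lemma periodic_kernel_eq: "periodic_kernel T L p m t \<theta> x = density L (\<lambda>x'. ennreal (dens (phase T t) \<theta> x x'))"
  by (simp add: periodic_kernel_def dens_def init_law_def trans_kernel_def)

lemma phase_in: "phase T t \<in> {1..T}"
  using T2 phase_mem by simp

section \<open>The self-organizing model as a backward chain\<close>

context
  fixes K :: "nat \<Rightarrow> real ^ 'd \<Rightarrow> (real ^ 'd) measure" and \<pi>1 :: "(real ^ 'd) measure"
  assumes \<pi>1: "\<pi>1 \<in> space (prob_algebra P\<Theta>)"
    and K: "\<And>t. 2 \<le> t \<Longrightarrow> K t \<in> P\<Theta> \<rightarrow>\<^sub>M prob_algebra P\<Theta>"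
begin

definition K1 :: "nat \<Rightarrow> real ^ 'd \<Rightarrow> (real ^ 'd) measure" where
  "K1 t = (if t = 1 then (\<lambda>_. \<pi>1) else K t)"

lemma K1: "1 \<le> t \<Longrightarrow> K1 t \<in> P\<Theta> \<rightarrow>\<^sub>M prob_algebra P\<Theta>"
  using \<pi>1 K[of t] by (auto simp: K1_def)

abbreviation "S \<equiv> so_space \<Theta> :: ((real ^ 'd) \<times> 'x) measure"
abbreviation "so_I \<equiv> so_init \<Theta> \<pi>1 (init_law L p)"
abbreviation "so_law t \<equiv> markov_law S so_I (so_kernel \<Theta> K (periodic_kernel T L p m)) t"
abbreviation "so_weight t \<equiv> obs_weight (\<lambda>s (\<theta>, x). cloned T f s \<theta> x) (cloned T yt) t"

definition Pk :: "nat \<Rightarrow> (real ^ 'd) \<times> 'x \<Rightarrow> ((real ^ 'd) \<times> 'x) measure" where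
  "Pk t = so_kernel \<Theta> K1 (periodic_kernel T L p m) t"

lemma Pk_eq: "Pk t z = K1 t (fst z) \<bind>
    (\<lambda>\<theta>'. distr (density L (\<lambda>x'. ennreal (dens (phase T t) \<theta>' (snd z) x'))) S (\<lambda>x'. (\<theta>', x')))"
  by (simp add: Pk_def so_kernel_def split_beta' periodic_kernel_eq)

text \<open>Time 1 has phase 1, so the periodic kernel is the initial law there; with the prior as
  parameter kernel this makes the first step a constant kernel.\<close>

lemma Pk_1: "Pk 1 = (\<lambda>_. so_I)"
  by (rule ext) (simp add: Pk_def so_kernel_def so_init_def split_beta' K1_def periodic_kernel_def phase_def)

lemma space_S: "space S = \<Theta> \<times> UNIV"
  by (simp add: so_space_def space_pair_measure)

lemma inner_kernel:
  "(\<lambda>w. distr (density L (\<lambda>x'. ennreal (dens (phase T t) (snd w) (snd (fst w)) x'))) S (\<lambda>x'. (snd w, x')))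
    \<in> S \<Otimes>\<^sub>M P\<Theta> \<rightarrow>\<^sub>M prob_algebra S"
proof (rule measurable_distr_prob_space2[where M = borel])
  let ?s = "phase T t"
  show "(\<lambda>w. density L (\<lambda>x'. ennreal (dens ?s (snd w) (snd (fst w)) x'))) \<in> S \<Otimes>\<^sub>M P\<Theta> \<rightarrow>\<^sub>M prob_algebra borel"
  proof (rule density_kernel[OF sf_L sets_L])
    have "(\<lambda>v. (snd (fst v), snd (fst (fst v)), snd v)) \<in> (S \<Otimes>\<^sub>M P\<Theta>) \<Otimes>\<^sub>M borel \<rightarrow>\<^sub>M P\<Theta> \<Otimes>\<^sub>M (borel :: 'x measure) \<Otimes>\<^sub>M (borel :: 'x measure)"
      unfolding so_space_def by measurable
    from measurable_compose[OF this dens_meas[OF phase_in]]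
    show "(\<lambda>(w, x'). dens ?s (snd w) (snd (fst w)) x') \<in> borel_measurable ((S \<Otimes>\<^sub>M P\<Theta>) \<Otimes>\<^sub>M borel)"
      by (simp add: split_beta')
  next
    fix w assume "w \<in> space (S \<Otimes>\<^sub>M P\<Theta>)"
    then show "prob_space (density L (\<lambda>x'. ennreal (dens ?s (snd w) (snd (fst w)) x')))"
      by (intro dens_prob phase_in) (auto simp: space_pair_measure)
  qed
  show "(\<lambda>(w, x'). (snd w, x')) \<in> (S \<Otimes>\<^sub>M P\<Theta>) \<Otimes>\<^sub>M borel \<rightarrow>\<^sub>M S"
    unfolding so_space_def by measurable
qed

lemma Pk_meas: assumes "1 \<le> t" shows "Pk t \<in> S \<rightarrow>\<^sub>M prob_algebra S"
proof -
  have "(\<lambda>z. K1 t (fst z)) \<in> S \<rightarrow>\<^sub>M prob_algebra P\<Theta>"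
    unfolding so_space_def by (rule measurable_compose[OF measurable_fst K1[OF assms]])
  moreover have "(\<lambda>(z, \<theta>'). distr (density L (\<lambda>x'. ennreal (dens (phase T t) \<theta>' (snd z) x'))) S (\<lambda>x'. (\<theta>', x')))
    \<in> S \<Otimes>\<^sub>M P\<Theta> \<rightarrow>\<^sub>M prob_algebra S"
    using inner_kernel[of t] by (simp add: split_beta')
  ultimately have "(\<lambda>z. K1 t (fst z) \<bind> (\<lambda>\<theta>'. distr (density L (\<lambda>x'. ennreal (dens (phase T t) \<theta>' (snd z) x'))) S (\<lambda>x'. (\<theta>', x'))))
    \<in> S \<rightarrow>\<^sub>M prob_algebra S"
    by (rule measurable_bind_prob_space2)
  then show ?thesis by (simp add: Pk_eq[symmetric])
qed

lemma nn_integral_Pk: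
  assumes t: "1 \<le> t" and z: "z \<in> space S" and H: "H \<in> borel_measurable S"
  shows "(\<integral>\<^sup>+ u. H u \<partial>Pk t z) =
    (\<integral>\<^sup>+ \<theta>'. \<integral>\<^sup>+ x'. ennreal (dens (phase T t) \<theta>' (snd z) x') * H (\<theta>', x') \<partial>L \<partial>K1 t (fst z))"
proof -
  have \<theta>: "fst z \<in> \<Theta>" using z by (auto simp: space_S)
  then have "K1 t (fst z) \<in> space (prob_algebra P\<Theta>)" using measurable_space[OF K1[OF t], of "fst z"] by simp
  then have sK: "sets (K1 t (fst z)) = sets P\<Theta>" by (simp add: space_prob_algebra)
  have "(\<lambda>\<theta>'. distr (density L (\<lambda>x'. ennreal (dens (phase T t) \<theta>' (snd z) x'))) S (\<lambda>x'. (\<theta>', x'))) \<in> P\<Theta> \<rightarrow>\<^sub>M subprob_algebra S"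
    using measurable_prob_algebraD[OF measurable_compose[OF measurable_Pair1'[OF z] inner_kernel[of t]]] by simp
  then have k: "(\<lambda>\<theta>'. distr (density L (\<lambda>x'. ennreal (dens (phase T t) \<theta>' (snd z) x'))) S (\<lambda>x'. (\<theta>', x'))) \<in> K1 t (fst z) \<rightarrow>\<^sub>M subprob_algebra S"
    using sK by (simp cong: measurable_cong_sets)
  show ?thesis
    unfolding Pk_eq nn_integral_bind[OF H k]
  proof (intro nn_integral_cong)
    fix \<theta>' assume "\<theta>' \<in> space (K1 t (fst z))"
    then have \<theta>': "\<theta>' \<in> \<Theta>" using sets_eq_imp_space_eq[OF sK] by simp
    have pr: "(\<lambda>x'. (\<theta>', x')) \<in> borel \<rightarrow>\<^sub>M S"
      unfolding so_space_def using \<theta>' by (intro measurable_Pair1') simp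
    have "(\<integral>\<^sup>+ u. H u \<partial>distr (density L (\<lambda>x'. ennreal (dens (phase T t) \<theta>' (snd z) x'))) S (\<lambda>x'. (\<theta>', x'))) =
      (\<integral>\<^sup>+ x'. H (\<theta>', x') \<partial>density L (\<lambda>x'. ennreal (dens (phase T t) \<theta>' (snd z) x')))"
      using pr H sets_L by (intro nn_integral_distr) (simp_all cong: measurable_cong_sets)
    also have "\<dots> = (\<integral>\<^sup>+ x'. ennreal (dens (phase T t) \<theta>' (snd z) x') * H (\<theta>', x') \<partial>L)"
      by (intro nn_integral_dens phase_in \<theta>' measurable_compose[OF pr H])
    finally show "(\<integral>\<^sup>+ u. H u \<partial>distr (density L (\<lambda>x'. ennreal (dens (phase T t) \<theta>' (snd z) x'))) S (\<lambda>x'. (\<theta>', x'))) = \<dots>" .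
  qed
qed

lemma so_law_Pk: "so_law t = markov_law S so_I Pk t"
  by (rule markov_law_cong) (simp add: Pk_def so_kernel_def K1_def)

lemma so_I_prob:
  assumes "\<theta>0 \<in> \<Theta>" shows "so_I \<in> space (prob_algebra S)"
  using measurable_space[OF Pk_meas[of 1], of "(\<theta>0, undefined)"] assms by (simp add: Pk_1 space_S del: One_nat_def)

lemma so_law_prob:
  assumes "\<theta>0 \<in> \<Theta>" shows "so_law t \<in> space (prob_algebra (\<Pi>\<^sub>M i\<in>{1..t}. S))"
  unfolding so_law_Pk by (intro markov_law_prob so_I_prob[OF assms] Pk_meas) auto

text \<open>The general backward evaluation for the chain of pairs, whose weight depends on the
  arrival point only. Writing out the kernel of the pair by \<open>nn_integral_Pk\<close> merges
  transition and observation density into \<open>G\<close>.\<close>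

lemma so_functional:
  assumes t: "1 \<le> t" and F: "F \<in> borel_measurable S" and \<theta>0: "\<theta>0 \<in> \<Theta>"
  shows "(\<integral>\<^sup>+ z. so_weight t z * F (z t) \<partial>so_law t) =
    chain (\<lambda>t F (\<theta>, x). \<integral>\<^sup>+ \<theta>'. \<integral>\<^sup>+ x'. ennreal (G (phase T t) \<theta>' x x') * F (\<theta>', x') \<partial>L \<partial>K1 t \<theta>) 0 t F (\<theta>0, x0)"
proof -
  define q where "q s z u = ennreal (f (phase T s) (fst u) (snd u) (yt (phase T s)))"
    for s :: nat and z u :: "(real ^ 'd) \<times> 'x"
  have mq: "q s z \<in> borel_measurable S" for s z
  proof -
    have "q s z = (\<lambda>u. ennreal (f (phase T s) (fst u) (snd u) (yt (phase T s))))" by (rule ext) (simp add: q_def)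
    then show ?thesis using obs_meas[OF phase_in[of s]] by (simp add: so_space_def split_beta')
  qed
  have mq2: "case_prod (q s) \<in> borel_measurable (S \<Otimes>\<^sub>M S)" for s
  proof -
    have "(\<lambda>w. q s undefined (snd w)) \<in> borel_measurable (S \<Otimes>\<^sub>M S)"
      by (rule measurable_compose[OF measurable_snd mq])
    then show ?thesis by (simp add: q_def split_beta')
  qed
  have z0: "(\<theta>0, x0) \<in> space S" using \<theta>0 by (simp add: space_S)
  have "(\<integral>\<^sup>+ z. so_weight t z * F (z t) \<partial>so_law t) =
    (\<integral>\<^sup>+ z. (\<Prod>s\<in>{1..t}. q s (if s = 1 then z s else z (s - 1)) (z s)) * F (z t) \<partial>markov_law S so_I Pk t)"
    unfolding so_law_Pk by (simp add: obs_weight_def q_def cloned_def split_beta')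
  also have "\<dots> = chain (\<lambda>s H z. \<integral>\<^sup>+ u. q s z u * H u \<partial>Pk s z) 0 t F (\<theta>0, x0)"
    by (rule nn_integral_markov_law[where P = Pk and q = q, OF Pk_1 so_I_prob[OF \<theta>0]])
      (use mq2 Pk_meas F t z0 in \<open>auto simp: q_def\<close>)
  also have "\<dots> = chain (\<lambda>t F (\<theta>, x). \<integral>\<^sup>+ \<theta>'. \<integral>\<^sup>+ x'. ennreal (G (phase T t) \<theta>' x x') * F (\<theta>', x') \<partial>L \<partial>K1 t \<theta>) 0 t F (\<theta>0, x0)"
    (is "chain ?A 0 t F _ = chain ?B 0 t F _")
  proof -
    \<comment> \<open>The operators agree only at points of the space and for measurable functions,
      hence \<open>chain_cong_on\<close>; measurability of the second form is inherited from the
      first.\<close>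
    have eq: "?A s H z = ?B s H' z"
      if s: "1 \<le> s" and H': "H' \<in> borel_measurable S" and HH: "\<And>z. z \<in> space S \<Longrightarrow> H z = H' z" and z: "z \<in> space S" for s H H' z
    proof -
      have "Pk s z \<in> space (prob_algebra S)" using measurable_space[OF Pk_meas[OF s] z] .
      then have "sets (Pk s z) = sets S" by (simp add: space_prob_algebra)
      then have "?A s H z = ?A s H' z"
        using HH by (intro nn_integral_cong) (auto dest: sets_eq_imp_space_eq)
      also have "\<dots> = (\<integral>\<^sup>+ \<theta>'. \<integral>\<^sup>+ x'. ennreal (dens (phase T s) \<theta>' (snd z) x') * (q s z (\<theta>', x') * H' (\<theta>', x')) \<partial>L \<partial>K1 s (fst z))"
        by (intro nn_integral_Pk s z borel_measurable_times_ennreal mq H')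
      also have "\<dots> = (\<integral>\<^sup>+ \<theta>'. \<integral>\<^sup>+ x'. ennreal (G (phase T s) \<theta>' (snd z) x') * H' (\<theta>', x') \<partial>L \<partial>K1 s (fst z))"
      proof (intro nn_integral_cong)
        fix \<theta>' x' assume "\<theta>' \<in> space (K1 s (fst z))"
        moreover have "K1 s (fst z) \<in> space (prob_algebra P\<Theta>)"
          using measurable_space[OF K1[OF s], of "fst z"] z by (simp add: space_S mem_Times_iff)
        ultimately have \<theta>': "\<theta>' \<in> \<Theta>" by (auto simp: space_prob_algebra dest: sets_eq_imp_space_eq)
        have "ennreal (dens (phase T s) \<theta>' (snd z) x') * q s z (\<theta>', x') = ennreal (G (phase T s) \<theta>' (snd z) x')"
          using obs_nonneg[OF phase_in \<theta>'] dens_nonneg[OF phase_in \<theta>']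
          by (simp add: q_def G_def ennreal_mult mult.commute)
        then show "ennreal (dens (phase T s) \<theta>' (snd z) x') * (q s z (\<theta>', x') * H' (\<theta>', x')) =
          ennreal (G (phase T s) \<theta>' (snd z) x') * H' (\<theta>', x')"
          by (simp only: mult.assoc[symmetric])
      qed
      finally show ?thesis by (simp add: split_beta')
    qed
    show ?thesis
    proof (rule chain_cong_on[where M = "borel_measurable S" and X = "space S", OF eq _ F _ z0])
      fix s and H :: "(real ^ 'd) \<times> 'x \<Rightarrow> ennreal"
      assume s: "s \<in> {0 + 1..0 + t}" and H: "H \<in> borel_measurable S"
      have "?A s H \<in> borel_measurable S"
        using s mq2 H Pk_meas[of s]
        by (intro nn_integral_measurable_subprob_algebra2[where N = S] measurable_prob_algebraD) (auto simp: split_beta')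
      moreover have "?A s H z = ?B s H z" if "z \<in> space S" for z using s by (intro eq H that) auto
      ultimately show "?B s H \<in> borel_measurable S" by (simp cong: measurable_cong)
    qed auto
  qed
  finally show ?thesis .
qed

abbreviation "so_filter t \<equiv> param_filter \<Theta> \<pi>1 K (init_law L p) (periodic_kernel T L p m) (cloned T f) (cloned T yt) t"

lemma sets_so_filter: "sets (so_filter t) = sets P\<Theta>"
  by (simp add: param_filter_def)

lemma nn_integral_so_filter:
  assumes t: "1 \<le> t" and F: "F \<in> borel_measurable borel" and \<theta>0: "\<theta>0 \<in> \<Theta>"
  shows "(\<integral>\<^sup>+ \<theta>. F \<theta> \<partial>so_filter t) =
    (\<integral>\<^sup>+ z. so_weight t z * F (fst (z t)) \<partial>so_law t) / (\<integral>\<^sup>+ z. so_weight t z \<partial>so_law t)"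
proof -
  let ?c = "\<integral>\<^sup>+ z. so_weight t z \<partial>so_law t"
  let ?w = "\<lambda>z. so_weight t z / ?c"
  have sl: "sets (so_law t) = sets (\<Pi>\<^sub>M i\<in>{1..t}. S)" using so_law_prob[OF \<theta>0, of t] by (simp add: space_prob_algebra)
  have mw: "so_weight t \<in> borel_measurable (\<Pi>\<^sub>M i\<in>{1..t}. S)"
    unfolding obs_weight_def
  proof (intro borel_measurable_prod_ennreal)
    fix s assume s: "s \<in> {1..t}"
    have "(\<lambda>u. ennreal (f (phase T s) (fst u) (snd u) (yt (phase T s)))) \<in> borel_measurable S"
      using obs_meas[OF phase_in[of s]] by (simp add: so_space_def split_beta')
    from measurable_compose[OF measurable_component_singleton[OF s] this]
    show "(\<lambda>z. ennreal ((case z s of (\<theta>, x) \<Rightarrow> cloned T f s \<theta> x) (cloned T yt s))) \<in> borel_measurable (\<Pi>\<^sub>M i\<in>{1..t}. S)"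
      by (simp add: cloned_def split_beta')
  qed
  have mp: "(\<lambda>z. fst (z t)) \<in> (\<Pi>\<^sub>M i\<in>{1..t}. S) \<rightarrow>\<^sub>M P\<Theta>"
  proof (rule measurable_compose[where N = S])
    show "(\<lambda>z. z t) \<in> (\<Pi>\<^sub>M i\<in>{1..t}. S) \<rightarrow>\<^sub>M S" using t by (intro measurable_component_singleton) simp
    show "fst \<in> S \<rightarrow>\<^sub>M P\<Theta>" unfolding so_space_def by (rule measurable_fst)
  qed
  have mF: "F \<in> borel_measurable P\<Theta>" using F by (rule measurable_restrict_space1)
  have mw': "so_weight t \<in> borel_measurable (so_law t)" using mw sl by (simp cong: measurable_cong_sets)
  have mFz: "(\<lambda>z. F (fst (z t))) \<in> borel_measurable (so_law t)"
    using measurable_compose[OF mp mF] sl by (simp cong: measurable_cong_sets)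
  have "(\<integral>\<^sup>+ \<theta>. F \<theta> \<partial>so_filter t) = (\<integral>\<^sup>+ z. F (fst (z t)) \<partial>density (so_law t) ?w)"
    unfolding param_filter_def ssm_posterior_def ssm_likelihood_def
    using mp sl mF by (intro nn_integral_distr) (simp_all cong: measurable_cong_sets)
  also have "\<dots> = (\<integral>\<^sup>+ z. ?w z * F (fst (z t)) \<partial>so_law t)"
    using mw' mFz by (intro nn_integral_density) auto
  also have "\<dots> = (\<integral>\<^sup>+ z. so_weight t z * F (fst (z t)) / ?c \<partial>so_law t)"
    by (intro nn_integral_cong) (simp add: divide_ennreal_def mult_ac)
  also have "\<dots> = (\<integral>\<^sup>+ z. so_weight t z * F (fst (z t)) \<partial>so_law t) / ?c"
    using mw' mFz by (intro nn_integral_divide) auto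
  finally show ?thesis .
qed

end

end

section \<open>From concentration to the mean; limits of the tilted likelihood\<close>

lemma measurable_sets_restrictI:
  assumes "sets M = sets (restrict_space N A)" "F \<in> N \<rightarrow>\<^sub>M N'"
  shows "F \<in> M \<rightarrow>\<^sub>M N'"
  unfolding measurable_cong_sets[OF assms(1) refl] by (rule measurable_restrict_space1[OF assms(2)])

text \<open>The mean error is at most the mean distance, which is at most \<epsilon> within the ball
  and at most the bound \<open>D\<close> outside, where the probability is at most
  \<open>e\<close>.\<close>

lemma mean_close:
  fixes \<theta>h :: "real ^ 'd"
  assumes M: "prob_space M" and sets: "sets M = sets (restrict_space borel \<Theta>)"
    and D: "\<And>\<theta>. \<theta> \<in> \<Theta> \<Longrightarrow> norm (\<theta> - \<theta>h) \<le> D"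
    and e: "(\<integral>\<^sup>+ \<theta>. indicator {\<theta>. \<epsilon> \<le> norm (\<theta> - \<theta>h)} \<theta> \<partial>M) \<le> ennreal e" "0 \<le> e" "0 \<le> \<epsilon>" "0 \<le> D"
  shows "norm ((\<integral>\<theta>. \<theta> \<partial>M) - \<theta>h) \<le> \<epsilon> + D * e"
proof -
  interpret prob_space M by fact
  have space: "space M = \<Theta>" using sets_eq_imp_space_eq[OF sets] by (simp add: space_restrict_space)
  note meas = measurable_sets_restrictI[OF sets]
  let ?I = "indicator {\<theta>. \<epsilon> \<le> norm (\<theta> - \<theta>h)} :: real ^ 'd \<Rightarrow> real"
  have int1: "integrable M (\<lambda>\<theta>. \<theta> - \<theta>h)"
    by (rule integrable_const_bound[where B = D]) (auto intro!: AE_I2 meas simp: space D)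
  have int0: "integrable M (\<lambda>\<theta>. \<theta>)"
    using Bochner_Integration.integrable_add[OF int1, of "\<lambda>_. \<theta>h"] by simp
  have int2: "integrable M ?I"
    by (rule integrable_const_bound[where B = 1]) (auto intro!: AE_I2 meas)
  have I: "(\<integral>\<theta>. ?I \<theta> \<partial>M) \<le> e"
  proof -
    have "ennreal (\<integral>\<theta>. ?I \<theta> \<partial>M) = (\<integral>\<^sup>+ \<theta>. ennreal (?I \<theta>) \<partial>M)"
      by (rule nn_integral_eq_integral[symmetric, OF int2]) simp
    also have "\<dots> \<le> ennreal e" using e(1) by (simp add: ennreal_indicator)
    finally show ?thesis using e(2) by simp
  qed
  have "norm ((\<integral>\<theta>. \<theta> \<partial>M) - \<theta>h) = norm (\<integral>\<theta>. \<theta> - \<theta>h \<partial>M)"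
    using int0 by (subst Bochner_Integration.integral_diff) (auto simp: prob_space)
  also have "\<dots> \<le> (\<integral>\<theta>. norm (\<theta> - \<theta>h) \<partial>M)" by (rule integral_norm_bound)
  also have "\<dots> \<le> (\<integral>\<theta>. \<epsilon> + D * ?I \<theta> \<partial>M)"
  proof (rule integral_mono)
    show "integrable M (\<lambda>\<theta>. norm (\<theta> - \<theta>h))" using int1 by simp
    show "integrable M (\<lambda>\<theta>. \<epsilon> + D * ?I \<theta>)" using int2 by simp
    fix \<theta> assume "\<theta> \<in> space M"
    then show "norm (\<theta> - \<theta>h) \<le> \<epsilon> + D * ?I \<theta>" using D[of \<theta>] e by (auto simp: space indicator_def)
  qed
  also have "\<dots> = \<epsilon> + D * (\<integral>\<theta>. ?I \<theta> \<partial>M)" using int2 by (simp add: prob_space)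
  also have "\<dots> \<le> \<epsilon> + D * e" using I e(4) by (intro add_left_mono mult_left_mono)
  finally show ?thesis .
qed

context periodic_ssm begin

lemma tilted_meas:
  assumes \<theta>: "\<theta> \<in> \<Theta>" and \<phi>: "\<And>s. s \<in> {1..T} \<Longrightarrow> \<phi> s \<in> borel_measurable (borel \<Otimes>\<^sub>M borel)"
  shows "path_weight \<phi> \<in> borel_measurable (law \<theta>)" "obs_weight (\<lambda>s. f s \<theta>) yt T \<in> borel_measurable (law \<theta>)"
proof -
  have sl: "sets (law \<theta>) = sets (\<Pi>\<^sub>M i\<in>{1..T}. borel)" using law_prob[OF \<theta>] by (simp add: space_prob_algebra)
  have mc: "(\<lambda>z. z i) \<in> (\<Pi>\<^sub>M i\<in>{1..T}. (borel :: 'x measure)) \<rightarrow>\<^sub>M borel" if "i \<in> {1..T}" for i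
    using that by (rule measurable_component_singleton)
  have "path_weight \<phi> \<in> borel_measurable (\<Pi>\<^sub>M i\<in>{1..T}. borel)"
    unfolding path_weight_def[abs_def]
  proof (intro borel_measurable_sum)
    fix s assume s: "s \<in> {1..T}"
    have "(\<lambda>x. (if s = 1 then x s else x (s - 1), x s)) \<in> (\<Pi>\<^sub>M i\<in>{1..T}. (borel :: 'x measure)) \<rightarrow>\<^sub>M borel \<Otimes>\<^sub>M borel"
    proof (cases "s = 1")
      case True
      then show ?thesis using mc[OF s] by (simp add: measurable_Pair)
    next
      case False
      then have "s - 1 \<in> {1..T}" using s by auto
      from measurable_Pair[OF mc[OF this] mc[OF s]] show ?thesis using False by simp
    qed
    from measurable_compose[OF this \<phi>[OF s]]
    show "(\<lambda>x. \<phi> s (if s = 1 then x s else x (s - 1), x s)) \<in> borel_measurable (\<Pi>\<^sub>M i\<in>{1..T}. borel)" .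
  qed
  then show "path_weight \<phi> \<in> borel_measurable (law \<theta>)" using sl by (simp cong: measurable_cong_sets)
  have "obs_weight (\<lambda>s. f s \<theta>) yt T \<in> borel_measurable (\<Pi>\<^sub>M i\<in>{1..T}. borel)"
    unfolding obs_weight_def[abs_def]
    by (intro borel_measurable_prod_ennreal measurable_compose[OF _ measurable_ennreal] measurable_compose[OF mc obs_meas1] \<theta>)
  then show "obs_weight (\<lambda>s. f s \<theta>) yt T \<in> borel_measurable (law \<theta>)" using sl by (simp cong: measurable_cong_sets)
qed

definition tilt :: "(nat \<Rightarrow> 'x \<times> 'x \<Rightarrow> real) \<Rightarrow> real ^ 'd \<Rightarrow> real \<Rightarrow> ennreal" where
  "tilt \<phi> \<theta> c = (\<integral>\<^sup>+ x. ennreal (exp (c * path_weight \<phi> x)) * obs_weight (\<lambda>s. f s \<theta>) yt T x \<partial>law \<theta>)"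

lemma path_weight_nonneg: "(\<And>s z. s \<in> {1..T} \<Longrightarrow> 0 \<le> \<phi> s z) \<Longrightarrow> 0 \<le> path_weight \<phi> x"
  unfolding path_weight_def by (intro sum_nonneg) auto

lemma likelihood_eq_tilt: "likelihood T L p m f yt \<theta> = tilt \<phi> \<theta> 0"
  by (simp add: likelihood_def ssm_likelihood_def tilt_def)

lemma tilt_mono:
  assumes "\<And>s z. s \<in> {1..T} \<Longrightarrow> 0 \<le> \<phi> s z" "c \<le> d"
  shows "tilt \<phi> \<theta> c \<le> tilt \<phi> \<theta> d"
  unfolding tilt_def using path_weight_nonneg[of \<phi>] assms
  by (intro nn_integral_mono mult_right_mono ennreal_leI iffD2[OF exp_le_cancel_iff]) auto

text \<open>Dominated convergence with the integrand at the exponent \<delta> as majorant. As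
  \<open>\<phi>\<close> is nonnegative, tilts of either sign are covered.\<close>

lemma tilt_limit:
  assumes \<theta>: "\<theta> \<in> \<Theta>" and \<phi>: "\<And>s. s \<in> {1..T} \<Longrightarrow> \<phi> s \<in> borel_measurable (borel \<Otimes>\<^sub>M borel)"
    and nn: "\<And>s z. s \<in> {1..T} \<Longrightarrow> 0 \<le> \<phi> s z" and fin: "tilt \<phi> \<theta> \<delta> < \<infinity>"
    and c: "c \<longlonglongrightarrow> 0" "\<And>n. c n \<le> \<delta>"
  shows "(\<lambda>n. tilt \<phi> \<theta> (c n)) \<longlonglongrightarrow> tilt \<phi> \<theta> 0"
  unfolding tilt_def
proof (rule nn_integral_dominated_convergence[where w = "\<lambda>x. ennreal (exp (\<delta> * path_weight \<phi> x)) * obs_weight (\<lambda>s. f s \<theta>) yt T x"])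
  show "(\<lambda>x. ennreal (exp (d * path_weight \<phi> x)) * obs_weight (\<lambda>s. f s \<theta>) yt T x) \<in> borel_measurable (law \<theta>)" for d
    using tilted_meas[OF \<theta> \<phi>] by simp
  then show "(\<lambda>x. ennreal (exp (d * path_weight \<phi> x)) * obs_weight (\<lambda>s. f s \<theta>) yt T x) \<in> borel_measurable (law \<theta>)"
     "(\<lambda>x. ennreal (exp (0 * path_weight \<phi> x)) * obs_weight (\<lambda>s. f s \<theta>) yt T x) \<in> borel_measurable (law \<theta>)" for d
    by this+
  show "AE x in law \<theta>. ennreal (exp (c j * path_weight \<phi> x)) * obs_weight (\<lambda>s. f s \<theta>) yt T x \<le>
      ennreal (exp (\<delta> * path_weight \<phi> x)) * obs_weight (\<lambda>s. f s \<theta>) yt T x" for j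
    using c(2) path_weight_nonneg[of \<phi>, OF nn]
    by (intro AE_I2 mult_right_mono ennreal_leI iffD2[OF exp_le_cancel_iff]) auto
  show "(\<integral>\<^sup>+ x. ennreal (exp (\<delta> * path_weight \<phi> x)) * obs_weight (\<lambda>s. f s \<theta>) yt T x \<partial>law \<theta>) < \<infinity>"
    using fin by (simp add: tilt_def)
  show "AE x in law \<theta>. (\<lambda>i. ennreal (exp (c i * path_weight \<phi> x)) * obs_weight (\<lambda>s. f s \<theta>) yt T x)
      \<longlonglongrightarrow> ennreal (exp (0 * path_weight \<phi> x)) * obs_weight (\<lambda>s. f s \<theta>) yt T x"
  proof (rule AE_I2)
    fix x
    have w: "obs_weight (\<lambda>s. f s \<theta>) yt T x = ennreal (\<Prod>s\<in>{1..T}. f s \<theta> (x s) (yt s))"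
      unfolding obs_weight_def using \<theta> by (intro prod_ennreal obs_nonneg)
    have "(\<lambda>i. ennreal (exp (c i * path_weight \<phi> x) * (\<Prod>s\<in>{1..T}. f s \<theta> (x s) (yt s))))
      \<longlonglongrightarrow> ennreal (exp (0 * path_weight \<phi> x) * (\<Prod>s\<in>{1..T}. f s \<theta> (x s) (yt s)))"
      by (intro tendsto_intros c(1))
    then show "(\<lambda>i. ennreal (exp (c i * path_weight \<phi> x)) * obs_weight (\<lambda>s. f s \<theta>) yt T x)
      \<longlonglongrightarrow> ennreal (exp (0 * path_weight \<phi> x)) * obs_weight (\<lambda>s. f s \<theta>) yt T x"
      unfolding w by (simp add: ennreal_mult')
  qed
qed

text \<open>The exponential factor never vanishes, so the tilted integrand vanishes almost
  everywhere only if the untilted one does.\<close>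

lemma tilt_pos:
  assumes \<theta>: "\<theta> \<in> \<Theta>" and \<phi>: "\<And>s. s \<in> {1..T} \<Longrightarrow> \<phi> s \<in> borel_measurable (borel \<Otimes>\<^sub>M borel)"
    and pos: "0 < tilt \<phi> \<theta> 0"
  shows "0 < tilt \<phi> \<theta> c"
proof (rule ccontr)
  note meas = tilted_meas[OF \<theta> \<phi>]
  assume "\<not> 0 < tilt \<phi> \<theta> c"
  then have "AE x in law \<theta>. ennreal (exp (c * path_weight \<phi> x)) * obs_weight (\<lambda>s. f s \<theta>) yt T x = 0"
    unfolding tilt_def using meas by (subst (asm) not_gr_zero, subst (asm) nn_integral_0_iff_AE) auto
  then have "AE x in law \<theta>. ennreal (exp (0 * path_weight \<phi> x)) * obs_weight (\<lambda>s. f s \<theta>) yt T x = 0"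
    by eventually_elim (simp add: ennreal_eq_0_iff not_le)
  then have "tilt \<phi> \<theta> 0 = 0" unfolding tilt_def using meas by (subst nn_integral_0_iff_AE) auto
  with pos show False by simp
qed

end

text \<open>Around an interior point a smaller ball lies inside \<Theta>, has positive volume, and
  the density is positive on it.\<close>

lemma positive_density_on_ball:
  fixes \<Theta> :: "(real ^ 'd) set"
  assumes pd: "positive_density_on \<Theta> \<pi>" and \<Theta>: "\<Theta> \<in> sets borel" and x: "x \<in> interior \<Theta>" and r: "0 < r"
  shows "0 < (\<integral>\<^sup>+ \<theta>. indicator (ball x r) \<theta> \<partial>\<pi>)"
proof (rule ccontr)
  let ?R = "restrict_space lborel \<Theta>"
  obtain q where q: "q \<in> borel_measurable (restrict_space borel \<Theta>)" "\<And>\<theta>. \<theta> \<in> \<Theta> \<Longrightarrow> 0 < (q \<theta> :: real)"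
    "\<pi> = density ?R (\<lambda>\<theta>. ennreal (q \<theta>))"
    using pd by (auto simp: positive_density_on_def)
  have sR: "sets ?R = sets (restrict_space borel \<Theta>)" by (simp add: sets_restrict_space)
  have mq: "q \<in> borel_measurable ?R" using q(1) sR by (simp cong: measurable_cong_sets)
  have mi: "(indicator (ball x r) :: _ \<Rightarrow> ennreal) \<in> borel_measurable ?R"
    by (rule measurable_restrict_space1, rule borel_measurable_indicator) simp
  assume "\<not> 0 < (\<integral>\<^sup>+ \<theta>. indicator (ball x r) \<theta> \<partial>\<pi>)"
  then have "(\<integral>\<^sup>+ \<theta>. ennreal (q \<theta>) * indicator (ball x r) \<theta> \<partial>?R) = 0"
    unfolding q(3) using mq mi by (subst (asm) nn_integral_density) auto
  then have "AE \<theta> in ?R. ennreal (q \<theta>) * indicator (ball x r) \<theta> = 0"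
    using mq mi by (subst (asm) nn_integral_0_iff_AE) auto
  then have ae: "AE \<theta> in lborel. \<theta> \<in> \<Theta> \<longrightarrow> ennreal (q \<theta>) * indicator (ball x r) \<theta> = 0"
    using \<Theta> by (subst (asm) AE_restrict_space_iff) auto
  obtain r' where r': "0 < r'" "ball x r' \<subseteq> \<Theta>" using x by (auto simp: mem_interior)
  define s where "s = min r r'"
  have s: "0 < s" "ball x s \<subseteq> \<Theta>" "ball x s \<subseteq> ball x r" using r r' by (auto simp: s_def)
  have "AE \<theta> in lborel. \<theta> \<notin> ball x s"
    using ae
  proof eventually_elim
    case (elim \<theta>)
    show ?case
    proof
      assume "\<theta> \<in> ball x s"
      then have "\<theta> \<in> \<Theta>" "\<theta> \<in> ball x r" using s by auto
      then show False using elim q(2)[of \<theta>] by (simp add: ennreal_eq_0_iff)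
    qed
  qed
  then have "emeasure lborel (ball x s) = 0"
    using emeasure_eq_0_AE[of "\<lambda>\<theta>. \<theta> \<in> ball x s" lborel] by (simp del: mem_ball)
  moreover have "0 < emeasure lborel (ball x s)" using s(1) by (simp add: emeasure_ball)
  ultimately show False by simp
qed

lemma ennreal_ge_real: "0 < (v :: ennreal) \<Longrightarrow> \<exists>c>0. ennreal c \<le> v"
  by (cases v) (auto intro: exI[of _ 1])


theorem theorem3:
  fixes T :: nat
    and \<Theta> :: "(real ^ 'd) set"
    and L :: "'x::polish_space measure"
    and \<mu> :: "'y measure"
    and p :: "real ^ 'd \<Rightarrow> 'x \<Rightarrow> real"
    and m :: "nat \<Rightarrow> real ^ 'd \<Rightarrow> 'x \<Rightarrow> 'x \<Rightarrow> real"
    and f :: "nat \<Rightarrow> real ^ 'd \<Rightarrow> 'x \<Rightarrow> 'y \<Rightarrow> real"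
    and yt :: "nat \<Rightarrow> 'y"
    and \<theta>hat :: "real ^ 'd"
    and \<pi>1 :: "(real ^ 'd) measure"
    and V :: "real ^ 'd ^ 'd"
    and h :: "nat \<Rightarrow> real"
    and K :: "nat \<Rightarrow> real ^ 'd \<Rightarrow> (real ^ 'd) measure"
  assumes "T \<ge> 2"
    and "regular_compact \<Theta>"
    and "state_space_model T \<Theta> L \<mu> p m f"
    and "\<forall>s\<in>{1..T}. yt s \<in> space \<mu>"
    and "mle_smooth T \<Theta> L p m f yt"
    and "{\<theta>. is_arg_max (likelihood T L p m f yt) (\<lambda>\<theta>. \<theta> \<in> \<Theta>) \<theta>} = {\<theta>hat}"
    and "\<theta>hat \<in> interior \<Theta>"
    and "prob_space \<pi>1" and "positive_density_on \<Theta> \<pi>1"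
    and "spd_matrix V"
    and "\<forall>t\<ge>2. h t \<ge> 0"
    and "fast_kernels \<Theta> V h K \<or> slow_kernels T \<Theta> V h K"
  shows "(\<lambda>t. \<integral>\<theta>. \<theta> \<partial>param_filter \<Theta> \<pi>1 K (init_law L p) (periodic_kernel T L p m)
                     (cloned T f) (cloned T yt) t)
           \<longlonglongrightarrow> \<theta>hat"
proof -
  note T2 = assms(1) and reg = assms(2) and model = assms(3) and int = assms(7) and spd = assms(10)
  have cpt: "compact \<Theta>" using reg by (simp add: regular_compact_def)
  have b\<Theta>: "\<Theta> \<in> sets borel" using cpt by (rule borel_compact)
  have h_nonneg: "0 \<le> h t" if "2 \<le> t" for t using assms(11) that by simp
  have hat: "\<theta>hat \<in> \<Theta>" using int interior_subset by auto
  interpret P: periodic_ssm T \<Theta> L \<mu> p m f yt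
    by unfold_locales (use assms(1,3,4) in auto)
  let ?lik = "likelihood T L p m f yt"
  from assms(5) obtain g :: "real \<Rightarrow> real" and \<phi> :: "nat \<Rightarrow> 'x \<times> 'x \<Rightarrow> real" where
    sm: "continuous_on {0..} g" "strict_mono_on {0..} g" "g 0 = 0"
      "\<forall>s\<in>{1..T}. \<phi> s \<in> borel_measurable (borel \<Otimes>\<^sub>M borel)"
      "\<forall>x' x. \<phi> 1 (x', x) = \<phi> 1 (x, x)"
      "\<forall>x x'. \<forall>\<theta>\<in>\<Theta>. \<forall>\<theta>'\<in>\<Theta>. \<forall>s\<in>{2..T}.
        log_dist (f s \<theta> x (yt s) * m s \<theta> x' x) (f s \<theta>' x (yt s) * m s \<theta>' x' x)
          \<le> ereal (g (norm (\<theta> - \<theta>')) * \<phi> s (x', x))"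
      "\<forall>x. \<forall>\<theta>\<in>\<Theta>. \<forall>\<theta>'\<in>\<Theta>.
        log_dist (f 1 \<theta> x (yt 1) * p \<theta> x) (f 1 \<theta>' x (yt 1) * p \<theta>' x)
          \<le> ereal (g (norm (\<theta> - \<theta>')) * \<phi> 1 (x, x))"
      "\<exists>\<delta>>0. \<forall>\<theta>\<in>\<Theta>. P.tilt \<phi> \<theta> \<delta> < \<infinity>"
    unfolding mle_smooth_def P.path_weight_def[symmetric] P.tilt_def[symmetric] by (elim conjE exE) (rule that, (assumption | intro exI conjI)+)
  note g = sm(1-3)
  have \<phi>: "\<phi> s \<in> borel_measurable (borel \<Otimes>\<^sub>M borel)" if "s \<in> {1..T}" for s using sm(4) that by blast
  have \<phi>1: "\<phi> 1 (x', x) = \<phi> 1 (x, x)" for x' x using sm(5) by blast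
  obtain \<delta> where \<delta>: "0 < \<delta>" and fin: "\<And>\<theta>. \<theta> \<in> \<Theta> \<Longrightarrow> P.tilt \<phi> \<theta> \<delta> < \<infinity>" using sm(8) by blast
  have lik_pos: "0 < ?lik \<theta>" if "\<theta> \<in> \<Theta>" for \<theta> using assms(5) that by (auto simp: mle_smooth_def)
  have log_cmp: "log_dist (P.G s \<theta> x x') (P.G s \<theta>' x x') \<le> ereal (g (norm (\<theta> - \<theta>')) * \<phi> s (x, x'))"
    if "\<theta> \<in> \<Theta>" "\<theta>' \<in> \<Theta>" "s \<in> {1..T}" for \<theta> \<theta>' s x x'
  proof (cases "s = 1")
    case True
    then show ?thesis using sm(7)[rule_format, OF that(1,2), of x'] \<phi>1[of x x'] by (simp add: P.G_def P.dens_def)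
  next
    case False
    then show ?thesis using sm(6)[rule_format, OF that(1,2), of s x' x] that(3) by (simp add: P.G_def P.dens_def)
  qed
  obtain R0 where R0: "0 < R0" "ball \<theta>hat R0 \<subseteq> \<Theta>" using int by (auto simp: mem_interior)
  \<comment> \<open>The nonnegativity follows from the smoothness bound: a distance of logarithms is
    nonnegative, and \<open>g\<close> is positive at the distance \<open>R0 / 2\<close>, which is
    realised by two points of \<Theta> because \<theta>hat is interior.\<close>
  have \<phi>_nonneg: "0 \<le> \<phi> s z" if s: "s \<in> {1..T}" for s z
  proof -
    define \<theta> where "\<theta> = \<theta>hat + (R0 / 2) *\<^sub>R axis undefined 1"
    have d: "norm (\<theta>hat - \<theta>) = R0 / 2" using R0 by (simp add: \<theta>_def norm_axis_1)
    then have \<theta>: "\<theta> \<in> \<Theta>" using R0 by (auto simp: dist_norm)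
    have "0 \<le> ereal (g (norm (\<theta>hat - \<theta>)) * \<phi> s z)"
      using order_trans[OF log_dist_nonneg log_cmp[OF hat \<theta> s, of "fst z" "snd z"]] by simp
    moreover have "0 < g (norm (\<theta>hat - \<theta>))"
      unfolding d using strict_mono_onD[OF g(2), of 0 "R0 / 2"] R0 g(3) by simp
    ultimately show ?thesis by (simp add: zero_le_mult_iff)
  qed
  obtain C where C: "1 \<le> C" "\<And>s \<theta> x. s \<in> {1..T} \<Longrightarrow> \<theta> \<in> \<Theta> \<Longrightarrow> f s \<theta> x (yt s) \<le> C"
  proof -
    have "\<forall>s\<in>{1..T}. \<exists>B. \<forall>\<theta>\<in>\<Theta>. \<forall>x. f s \<theta> x (yt s) \<le> B"
      using assms(5) unfolding mle_smooth_def bdd_above_def by fastforce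
    then obtain B where B: "\<And>s \<theta> x. s \<in> {1..T} \<Longrightarrow> \<theta> \<in> \<Theta> \<Longrightarrow> f s \<theta> x (yt s) \<le> B s" by metis
    show ?thesis
    proof (rule that[of "1 + (\<Sum>s\<in>{1..T}. \<bar>B s\<bar>)"])
      show "1 \<le> 1 + (\<Sum>s\<in>{1..T}. \<bar>B s\<bar>)" by (simp add: sum_nonneg)
      fix s \<theta> x assume s: "s \<in> {1..T}" and "\<theta> \<in> \<Theta>"
      then have "f s \<theta> x (yt s) \<le> \<bar>B s\<bar>" using B[of s \<theta> x] by simp
      also have "\<dots> \<le> (\<Sum>s\<in>{1..T}. \<bar>B s\<bar>)" using s by (intro member_le_sum) auto
      finally show "f s \<theta> x (yt s) \<le> 1 + (\<Sum>s\<in>{1..T}. \<bar>B s\<bar>)" by simp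
    qed
  qed
  have lik_tilt: "?lik \<theta> = P.tilt \<phi> \<theta> 0" for \<theta> by (rule P.likelihood_eq_tilt)
  have tl: "tilted_lik L P.G \<phi> T \<theta> c x = P.tilt \<phi> \<theta> c" if "\<theta> \<in> \<Theta>" for \<theta> c x
    unfolding P.tilt_def by (rule P.tilted_lik_eq[where \<phi> = \<phi>, OF that \<phi> \<phi>1])
  have lik_fin: "P.tilt \<phi> \<theta> 0 < \<infinity>" if "\<theta> \<in> \<Theta>" for \<theta>
    using P.tilt_mono[where \<phi> = \<phi> and c = 0 and d = \<delta> and \<theta> = \<theta>, OF \<phi>_nonneg] fin[OF that] \<delta> by (auto intro: le_less_trans)
  define ell where "ell = enn2real (?lik \<theta>hat)"
  have ell: "ennreal ell = ?lik \<theta>hat" "0 < ell"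
    using lik_fin[OF hat] lik_pos[OF hat] by (auto simp: ell_def lik_tilt enn2real_positive_iff)
  \<comment> \<open>A sequence of positive tilts not exceeding \<delta> and tending to 0, so that
    dominated convergence applies to it and to its negative.\<close>
  have lim0: "(\<lambda>n. \<delta> / real (Suc n)) \<longlonglongrightarrow> 0" by real_asymp
  have lim0': "(\<lambda>n. - (\<delta> / real (Suc n))) \<longlonglongrightarrow> 0" using tendsto_minus[OF lim0] by simp
  have \<delta>n: "0 < \<delta> / real (Suc n)" "\<delta> / real (Suc n) \<le> \<delta>" for n
    using \<delta> by (auto simp: field_simps)
  have lik_less: "\<exists>c>0. \<exists>q<ell. \<forall>x. tilted_lik L P.G \<phi> T \<theta> c x \<le> ennreal q"
    if \<theta>: "\<theta> \<in> \<Theta>" and ne: "\<theta> \<noteq> \<theta>hat" for \<theta>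
  proof -
    have "is_arg_max ?lik (\<lambda>\<theta>. \<theta> \<in> \<Theta>) \<theta>hat" "\<not> is_arg_max ?lik (\<lambda>\<theta>. \<theta> \<in> \<Theta>) \<theta>" using assms(6) ne by auto
    then have "P.tilt \<phi> \<theta> 0 < ennreal ell"
      unfolding ell lik_tilt[symmetric] is_arg_max_def using \<theta> by (meson le_less_trans not_less less_le_trans)
    \<comment> \<open>A level strictly between the two likelihoods leaves room for a small tilt and
      serves as the bound \<open>q\<close>.\<close>
    then obtain r where r: "P.tilt \<phi> \<theta> 0 < r" "r < ennreal ell" using dense by blast
    then obtain q where q: "r = ennreal q" "0 \<le> q" by (cases r) auto
    have "eventually (\<lambda>n. P.tilt \<phi> \<theta> (\<delta> / real (Suc n)) < r) sequentially"
      by (intro order_tendstoD(2)[OF _ r(1)] P.tilt_limit[where \<phi> = \<phi>, OF \<theta> \<phi> \<phi>_nonneg fin[OF \<theta>]] lim0 \<delta>n)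
    then obtain n where "P.tilt \<phi> \<theta> (\<delta> / real (Suc n)) < r" by (auto simp: eventually_sequentially)
    then show ?thesis using \<delta>n(1)[of n] r(2) q by (intro exI[of _ "\<delta> / real (Suc n)"] conjI exI[of _ q]) (auto simp: tl[OF \<theta>] ennreal_less_iff)
  qed
  have lik_hat: "\<exists>c>0. \<forall>x. ennreal a \<le> tilted_lik L P.G \<phi> T \<theta>hat (- c) x" if a: "a < ell" for a
  proof -
    have "ennreal a < P.tilt \<phi> \<theta>hat 0" using a ell unfolding lik_tilt[symmetric] ell(1)[symmetric] by (intro ennreal_lessI)
    moreover have "(\<lambda>n. P.tilt \<phi> \<theta>hat (- (\<delta> / real (Suc n)))) \<longlonglongrightarrow> P.tilt \<phi> \<theta>hat 0"
    proof (rule P.tilt_limit[where \<phi> = \<phi>, OF hat \<phi> \<phi>_nonneg fin[OF hat] lim0'])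
      show "- (\<delta> / real (Suc n)) \<le> \<delta>" for n using \<delta>n(1)[of n] \<delta> by linarith
    qed
    ultimately have "eventually (\<lambda>n. ennreal a < P.tilt \<phi> \<theta>hat (- (\<delta> / real (Suc n)))) sequentially"
      by (rule order_tendstoD(1)[rotated])
    then obtain n where "ennreal a < P.tilt \<phi> \<theta>hat (- (\<delta> / real (Suc n)))" by (auto simp: eventually_sequentially)
    then show ?thesis using \<delta>n(1)[of n] by (intro exI[of _ "\<delta> / real (Suc n)"]) (simp add: tl[OF hat] less_imp_le)
  qed
  have lik_pos_tilt: "\<exists>q>0. \<forall>x. ennreal q \<le> tilted_lik L P.G \<phi> T \<theta>hat (- c) x" for c
  proof -
    have "0 < P.tilt \<phi> \<theta>hat (- c)"
      by (rule P.tilt_pos[where \<phi> = \<phi>, OF hat \<phi>]) (use lik_pos[OF hat] in \<open>simp_all add: lik_tilt\<close>)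
    from ennreal_ge_real[OF this] show ?thesis by (simp add: tl[OF hat])
  qed
  obtain a b where ab: "0 < a" "0 < b" "\<And>v. a * (norm v)\<^sup>2 \<le> qform V v" "\<And>v. qform V v \<le> b * (norm v)\<^sup>2"
    using qform_bounds[OF spd] by blast
  \<comment> \<open>The constants are halved, because \<open>gauss_kernel\<close> bounds half of the
    quadratic form, the exponent of the Gaussian density.\<close>
  interpret GK: gauss_kernel \<Theta> V "a / 2" "b / 2"
    by unfold_locales (use cpt int spd ab in auto)
  have \<pi>1: "\<pi>1 \<in> space (prob_algebra (restrict_space borel \<Theta>))"
    using assms(8,9) by (auto simp: space_prob_algebra positive_density_on_def sets_restrict_space)
  have kern: "K t \<in> restrict_space borel \<Theta> \<rightarrow>\<^sub>M prob_algebra (restrict_space borel \<Theta>)" if t: "2 \<le> t" for t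
  proof -
    have TN: "K t \<in> restrict_space borel \<Theta> \<rightarrow>\<^sub>M prob_algebra (restrict_space borel \<Theta>)"
      if "\<forall>\<theta>\<in>\<Theta>. K t \<theta> = TN \<Theta> \<theta> ((h t)\<^sup>2 *\<^sub>R V)"
      using GK.TN_kernel[OF h_nonneg[OF t]] that
      by (subst measurable_cong[where g = "\<lambda>\<theta>. TN \<Theta> \<theta> ((h t)\<^sup>2 *\<^sub>R V)"]) auto
    have TS: "K t \<in> restrict_space borel \<Theta> \<rightarrow>\<^sub>M prob_algebra (restrict_space borel \<Theta>)"
      if "\<forall>\<theta>\<in>\<Theta>. K t \<theta> = TS \<Theta> \<theta> ((h t)\<^sup>2 *\<^sub>R V) \<nu>" "0 < \<nu>" for \<nu>
    proof -
      interpret ST: student_kernel \<Theta> V "a / 2" "b / 2" \<nu> "(\<nu> + CARD('d)) / 2"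
        by unfold_locales (use that in auto)
      show ?thesis
        using ST.TS_kernel[OF h_nonneg[OF t]] that(1)
        by (subst measurable_cong[where g = "\<lambda>\<theta>. TS \<Theta> \<theta> ((h t)\<^sup>2 *\<^sub>R V) \<nu>"]) auto
    qed
    from assms(12) show ?thesis
    proof
      assume "fast_kernels \<Theta> V h K"
      then show ?thesis using t by (intro TN) (auto simp: fast_kernels_def)
    next
      assume "slow_kernels T \<Theta> V h K"
      then obtain \<nu> \<tau> where "0 < \<nu>" "\<forall>t\<ge>2. \<forall>\<theta>\<in>\<Theta>. K t \<theta> =
        (if t \<in> \<tau> ` {1::nat..} then TS \<Theta> \<theta> ((h t)\<^sup>2 *\<^sub>R V) \<nu> else TN \<Theta> \<theta> ((h t)\<^sup>2 *\<^sub>R V))"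
        unfolding slow_kernels_def by blast
      then show ?thesis using t TN TS[of \<nu>] by (cases "t \<in> \<tau> ` {1..}") auto
    qed
  qed
  let ?K = "P.K1 K \<pi>1"
  have K_eq: "?K 1 = (\<lambda>_. \<pi>1)" "\<And>t. 2 \<le> t \<Longrightarrow> ?K t = K t" by (auto simp: P.K1_def[OF \<pi>1 kern])
  interpret so_gauss T \<Theta> L ?K P.G \<phi> g C \<theta>hat ell V "a / 2" "b / 2" h
  proof unfold_locales
    show "P.G s \<theta>' x x' \<le> P.G s \<theta> x x' * exp (g (norm (\<theta> - \<theta>')) * \<phi> s (x, x'))"
      if "s \<in> {1..T}" "\<theta> \<in> \<Theta>" "\<theta>' \<in> \<Theta>" for s \<theta> \<theta>' x x'
      using that by (intro log_dist_le_exp P.G_nonneg log_cmp)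
    show "(\<integral>\<^sup>+ x'. ennreal (P.G s \<theta> x x') \<partial>L) \<le> ennreal C" if "s \<in> {1..T}" "\<theta> \<in> \<Theta>" for s \<theta> x
      using C that by (intro P.G_bound) auto
    show "?K t \<in> restrict_space borel \<Theta> \<rightarrow>\<^sub>M prob_algebra (restrict_space borel \<Theta>)" if "1 \<le> t" for t
      by (rule P.K1[OF \<pi>1 kern that])
    show "tilted_lik L P.G \<phi> T \<theta>hat 0 x = ennreal ell" for x by (simp add: tl[OF hat] ell lik_tilt)
    show "\<exists>q>0. \<forall>x. ennreal q \<le> tilted_lik L P.G \<phi> T \<theta>hat (- c) x" for c by (rule lik_pos_tilt)
    show "1 \<le> T" using T2 by simp
  qed ((rule P.sets_L sigma_finite_measure.sigma_finite_countable[OF P.sf_L] P.G_meas P.G_nonneg C(1) \<phi> \<phi>_nonneg g cpt int ell(2) lik_less lik_hat reg h_nonneg; assumption)+)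
  have conc: concentrates
    using assms(12)
  proof
    assume fast: "fast_kernels \<Theta> V h K"
    show concentrates
    proof (rule fast_concentrates)
      show "TN_at t" if "2 \<le> t" for t using fast that K_eq(2)[OF that] by (simp add: TN_at_def fast_kernels_def)
      have "((\<lambda>t. h t / (1 / real t)) \<longlongrightarrow> 0) sequentially"
        using fast unfolding fast_kernels_def by (intro smalloD_tendsto) auto
      then show "(\<lambda>t. real t * h t) \<longlonglongrightarrow> 0" by (simp add: mult.commute)
      show "\<exists>c>0. \<forall>\<theta>\<in>\<Theta>. ennreal c \<le> (\<integral>\<^sup>+ \<theta>'. indicator (ball \<theta>hat r) \<theta>' \<partial>?K 1 \<theta>)" if "0 < r" for r
        unfolding K_eq(1) using ennreal_ge_real[OF positive_density_on_ball[OF assms(9) b\<Theta> int that]] by auto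
    qed
  next
    assume "slow_kernels T \<Theta> V h K"
    then obtain \<alpha> \<nu> :: real and \<Delta> :: nat and \<tau> :: "nat \<Rightarrow> nat" where sk: "\<alpha> > 0" "\<nu> > 0" "\<Delta> \<ge> 1"
      "\<forall>p\<ge>2. \<tau> p = \<tau> (p - 1) + \<Delta> * nat \<lceil>(ln (real (\<tau> (p - 1))))\<^sup>2\<rceil>"
      "\<forall>p\<ge>1. \<tau> p \<in> {k * T + 1 | k. k \<ge> 1}"
      "h \<in> O(\<lambda>t. real t powr (- \<alpha>))"
      "liminf (\<lambda>p. ereal (real (\<tau> p) powr \<alpha> * h (\<tau> p))) > 0"
      "\<forall>t\<ge>2. \<forall>\<theta>\<in>\<Theta>. K t \<theta> =
        (if t \<in> \<tau> ` {1..} then TS \<Theta> \<theta> ((h t)\<^sup>2 *\<^sub>R V) \<nu> else TN \<Theta> \<theta> ((h t)\<^sup>2 *\<^sub>R V))"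
      unfolding slow_kernels_def by blast
    have "\<forall>p\<ge>1. \<exists>k\<ge>1. \<tau> p = k * T + 1" using sk(5) by auto
    then obtain kk where kk: "\<And>p. 1 \<le> p \<Longrightarrow> 1 \<le> kk p \<and> \<tau> p = kk p * T + 1" by metis
    have \<tau>2: "2 \<le> \<tau> p" if "1 \<le> p" for p
    proof -
      have "1 * 1 \<le> kk p * T" using kk[OF that] T2 by (intro mult_mono) auto
      then show ?thesis using kk[OF that] by simp
    qed
    \<comment> \<open>A constant strictly below the lower limit turns it into an eventual lower
      bound for the step sizes at the heavy-tailed times.\<close>
    obtain c1 where c1: "0 < ereal c1" "ereal c1 < liminf (\<lambda>p. ereal (real (\<tau> p) powr \<alpha> * h (\<tau> p)))"
      using ereal_dense2[OF sk(7)] by blast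
    show concentrates
    proof (rule slow_concentrates[OF sk(1-3) kk _ _ _ sk(6), where ?c1.0 = c1])
      show "\<tau> (Suc p) = \<tau> p + \<Delta> * nat \<lceil>(ln (real (\<tau> p)))\<^sup>2\<rceil>" if "1 \<le> p" for p
        using sk(4)[rule_format, of "Suc p"] that by simp
      show "TN_at t" if "2 \<le> t" "t \<notin> \<tau> ` {1..}" for t
        using sk(8) that K_eq(2)[OF that(1)] by (simp add: TN_at_def)
      show "?K (\<tau> p) \<theta> = TS \<Theta> \<theta> ((h (\<tau> p))\<^sup>2 *\<^sub>R V) \<nu>" if "1 \<le> p" "\<theta> \<in> \<Theta>" for p \<theta>
        using sk(8) that \<tau>2[OF that(1)] K_eq(2)[OF \<tau>2[OF that(1)]] by auto
      show "\<forall>\<^sub>F p in sequentially. c1 \<le> real (\<tau> p) powr \<alpha> * h (\<tau> p)"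
        using less_LiminfD[OF c1(2)] by eventually_elim simp
    qed (use c1 in auto)
  qed
  let ?\<mu> = "\<lambda>t. param_filter \<Theta> \<pi>1 K (init_law L p) (periodic_kernel T L p m) (cloned T f) (cloned T yt) t"
  have stp_eq: "stp = (\<lambda>t F (\<theta>, x). \<integral>\<^sup>+ \<theta>'. \<integral>\<^sup>+ x'. ennreal (P.G (phase T t) \<theta>' x x') * F (\<theta>', x') \<partial>L \<partial>?K t \<theta>)"
    by (intro ext) (simp add: stp_def)
  \<comment> \<open>Both numerator and denominator of the filter are values of the backward chain,
    the latter for the function 1, so the filter is the normalised functional
    \<open>U\<close>.\<close>
  have U_eq: "(\<integral>\<^sup>+ \<theta>. F \<theta> \<partial>?\<mu> t) = U t F / mass1 t" if t: "1 \<le> t" and F: "F \<in> borel_measurable borel" for t F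
  proof -
    have "(\<integral>\<^sup>+ z. P.so_weight t z * F (fst (z t)) \<partial>P.so_law K \<pi>1 t) = U t F" if "F \<in> borel_measurable borel" for F
      unfolding U_def stp_eq by (rule P.so_functional[OF \<pi>1 kern t fst_meas[OF that] hat])
    from this[OF F] this[of "\<lambda>_. 1"] show ?thesis
      by (subst P.nn_integral_so_filter[OF \<pi>1 kern t F hat]) simp_all
  qed
  have prob: "prob_space (?\<mu> t)" if "1 \<le> t" for t
  proof
    have "emeasure (?\<mu> t) (space (?\<mu> t)) = (\<integral>\<^sup>+ \<theta>. 1 \<partial>?\<mu> t)" by simp
    also have "\<dots> = mass1 t / mass1 t" by (rule U_eq[OF that]) simp
    also have "\<dots> = 1" using mass1_pos[of t] mass1_fin[of t] by (simp add: ennreal_divide_self)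
    finally show "emeasure (?\<mu> t) (space (?\<mu> t)) = 1" .
  qed
  obtain D where D: "0 \<le> D" "\<And>\<theta>. \<theta> \<in> \<Theta> \<Longrightarrow> norm (\<theta> - \<theta>hat) \<le> D"
  proof -
    obtain B where "\<And>u. u \<in> \<Theta> \<Longrightarrow> norm u \<le> B"
      using compact_imp_bounded[OF cpt] by (auto simp: bounded_iff)
    then have *: "norm (\<theta> - \<theta>hat) \<le> B + norm \<theta>hat" if "\<theta> \<in> \<Theta>" for \<theta>
      using norm_triangle_ineq4[of \<theta> \<theta>hat] that by force
    from *[OF hat] show ?thesis by (intro that[OF _ *]) auto
  qed
  show ?thesis
  proof (rule tendstoI)
    fix r :: real assume r: "0 < r"
    \<comment> \<open>The error of the mean is at most \<open>2 * \<epsilon>\<close> plus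
      \<open>D * e\<close>, each at most \<open>r / 4\<close>; the second bound on \<epsilon> makes
      the ball of radius \<open>3 * \<epsilon>\<close> fit into \<Theta>.\<close>
    define \<epsilon> where "\<epsilon> = min (r / 8) (R0 / 3)"
    define e where "e = r / (4 * (D + 1))"
    have \<epsilon>: "0 < \<epsilon>" "2 * \<epsilon> \<le> r / 4" "3 * \<epsilon> \<le> R0" and e: "0 < e" using r R0 D by (auto simp: \<epsilon>_def e_def)
    have "ball \<theta>hat (3 * \<epsilon>) \<subseteq> \<Theta>" using R0 \<epsilon> subset_ball[of "3 * \<epsilon>" R0 \<theta>hat] by auto
    then have "\<forall>\<^sub>F t in sequentially. U t (far \<epsilon>) \<le> ennreal e * mass1 t"
      using conc \<epsilon> e unfolding concentrates_def by blast
    then show "\<forall>\<^sub>F t in sequentially. dist (\<integral>\<theta>. \<theta> \<partial>?\<mu> t) \<theta>hat < r"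
      using eventually_ge_at_top[of 1]
    proof eventually_elim
      case (elim t)
      have "(\<integral>\<^sup>+ \<theta>. far \<epsilon> \<theta> \<partial>?\<mu> t) \<le> ennreal e"
        unfolding U_eq[OF elim(2) far_meas] using elim(1) mass1_pos[of t]
        by (intro divide_le_posI_ennreal) (simp_all add: mult.commute)
      then have "norm ((\<integral>\<theta>. \<theta> \<partial>?\<mu> t) - \<theta>hat) \<le> 2 * \<epsilon> + D * e"
        using D e \<epsilon> by (intro mean_close[OF prob[OF elim(2)] P.sets_so_filter[OF \<pi>1 kern]]) (auto simp: far_def)
      also have "D * e \<le> r / 4" using D r by (simp add: e_def field_simps)
      finally show ?case using \<epsilon>(2) r by (simp add: dist_norm)
    qed
  qed
qed

end
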